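(* Let $\epsilon\in(0,1)$, $d_{S'},d_{T'}\ge0$, let $L$ be a positive integer, and let $\alpha \ge 2 + 3\epsilon$ be polynomially bounded. For a directed graph $G=(V,E)$ undergoing edge insertions and deletions starting from the empty graph, one can deterministically maintain an $(\alpha, d_{S'}, d_{T'}, L)$-decomposition of its derived graph $G' = (V',E')$, handling any sequence of $t$ updates in total time $O(t L/\epsilon)$ (amortized update time $O(L/\epsilon)$), with space $O(|V'| + |E'|)$ at each time-step.
   Context: Derived graph: for each $v\in V$ create nodes $s_v,t_v$; $S'=\{s_v:v\in V\}$, $T'=\{t_v:v\in V\}$, $V'=S'\cup T'$, and $E'=\{(s_u,t_v):(u,v)\in E\}$; inserting/deleting $(u,v)$ in $G$ inserts/deletes $(s_u,t_v)$ in $G'$. For $s\in S'$, $T\subseteq T'$: $D_s(T)=|\{t\in T:(s,t)\in E'\}|$; for $t\in T'$, $S\subseteq S'$: $D_t(S)=|\{s\in S:(s,t)\in E'\}|$. Families $S'=S_1\supseteq\cdots\supseteq S_L$, $T'=T_1\supseteq\cdots\supseteq T_L$ form an $(\alpha,d_{S'},d_{T'},L)$-decomposition of $G'$ iff for every $i\in\{1,\dots,L-1\}$: $S_{i+1}\supseteq\{s\in S_i:D_s(T_i)>\alpha d_{S'}\}$, $S_{i+1}\cap\{s\in S_i:D_s(T_i)<d_{S'}\}=\emptyset$, $T_{i+1}\supseteq\{t\in T_i:D_t(S_i)>\alpha d_{T'}\}$, $T_{i+1}\cap\{t\in T_i:D_t(S_i)<d_{T'}\}=\emptyset$. *)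

theory Defs
  imports Complex_Main "HOL-Computational_Algebra.Polynomial"
begin

section \<open>Derived graphs and decompositions\<close>

datatype 'v node = Src 'v | Tgt 'v

definition derived_edges :: "('v \<times> 'v) set \<Rightarrow> ('v node \<times> 'v node) set" where
  "derived_edges E = {(Src u, Tgt v) | u v. (u, v) \<in> E}"

definition deg_out :: "('a \<times> 'a) set \<Rightarrow> 'a \<Rightarrow> 'a set \<Rightarrow> nat" where
  "deg_out E s T = card {t \<in> T. (s, t) \<in> E}"

definition deg_in :: "('a \<times> 'a) set \<Rightarrow> 'a \<Rightarrow> 'a set \<Rightarrow> nat" where
  "deg_in E t S = card {s \<in> S. (s, t) \<in> E}"

text \<open>Only the indices \<open>1, \<dots>, L\<close> of the families \<open>S\<close> and \<open>T\<close> are relevant.\<close>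

definition decomposition ::
  "real \<Rightarrow> real \<Rightarrow> real \<Rightarrow> nat \<Rightarrow> 'a set \<Rightarrow> 'a set \<Rightarrow> ('a \<times> 'a) set
    \<Rightarrow> (nat \<Rightarrow> 'a set) \<Rightarrow> (nat \<Rightarrow> 'a set) \<Rightarrow> bool" where
  "decomposition \<alpha> dS dT L S' T' E' S T \<longleftrightarrow>
     S 1 = S' \<and> T 1 = T' \<and>
     (\<forall>i. 1 \<le> i \<and> i \<le> L - 1 \<longrightarrow>
        S (i + 1) \<subseteq> S i \<and> T (i + 1) \<subseteq> T i \<and>
        {s \<in> S i. real (deg_out E' s (T i)) > \<alpha> * dS} \<subseteq> S (i + 1) \<and>
        S (i + 1) \<inter> {s \<in> S i. real (deg_out E' s (T i)) < dS} = {} \<and>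
        {t \<in> T i. real (deg_in E' t (S i)) > \<alpha> * dT} \<subseteq> T (i + 1) \<and>
        T (i + 1) \<inter> {t \<in> T i. real (deg_in E' t (S i)) < dT} = {})"


section \<open>Edge updates\<close>

datatype update = Ins nat nat | Del nat nat

fun apply_update :: "update \<Rightarrow> (nat \<times> nat) set \<Rightarrow> (nat \<times> nat) set" where
  "apply_update (Ins u v) E = insert (u, v) E"
| "apply_update (Del u v) E = E - {(u, v)}"

definition edges_after :: "update list \<Rightarrow> (nat \<times> nat) set" where
  "edges_after us = fold apply_update us {}"

fun legal_update :: "nat \<Rightarrow> (nat \<times> nat) set \<Rightarrow> update \<Rightarrow> bool" where
  "legal_update n E (Ins u v) \<longleftrightarrow> u < n \<and> v < n \<and> (u, v) \<notin> E"
| "legal_update n E (Del u v) \<longleftrightarrow> u < n \<and> v < n \<and> (u, v) \<in> E"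

definition legal_updates :: "nat \<Rightarrow> update list \<Rightarrow> bool" where
  "legal_updates n us \<longleftrightarrow>
     (\<forall>k < length us. legal_update n (edges_after (take k us)) (us ! k))"


section \<open>A deterministic word RAM\<close>

text \<open>
  The machine is a structured unit-cost RAM. Registers and memory cells hold natural numbers.
  The real parameters of the problem are read-only constants: they occur only in comparisons
  and cannot be stored, so that all memory consists of words.
\<close>

datatype param = Epsilon | Alpha | DS | DT

datatype aexp =
    Const nat
  | Reg string
  | Load aexp
  | Plus aexp aexp
  | Minus aexp aexp
  | Times aexp aexp
  | Div aexp aexp
  | Mod aexp aexp

datatype rexp =
    Param param
  | OfNat aexp
  | RPlus rexp rexp
  | RMinus rexp rexp
  | RTimes rexp rexp

datatype bexp =
    Less aexp aexp
  | RLess rexp rexp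
  | Neg bexp
  | And bexp bexp

datatype com =
    Skip
  | Assign string aexp
  | Store aexp aexp
  | Seq com com
  | Cond bexp com com
  | While bexp com

record state =
  regs :: "string \<Rightarrow> nat"
  mem :: "nat \<Rightarrow> nat"

primrec aval :: "aexp \<Rightarrow> state \<Rightarrow> nat" where
  "aval (Const k) s = k"
| "aval (Reg x) s = regs s x"
| "aval (Load a) s = mem s (aval a s)"
| "aval (Plus a b) s = aval a s + aval b s"
| "aval (Minus a b) s = aval a s - aval b s"
| "aval (Times a b) s = aval a s * aval b s"
| "aval (Div a b) s = aval a s div aval b s"
| "aval (Mod a b) s = aval a s mod aval b s"

primrec rval :: "(param \<Rightarrow> real) \<Rightarrow> rexp \<Rightarrow> state \<Rightarrow> real" where
  "rval \<pi> (Param p) s = \<pi> p"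
| "rval \<pi> (OfNat a) s = real (aval a s)"
| "rval \<pi> (RPlus a b) s = rval \<pi> a s + rval \<pi> b s"
| "rval \<pi> (RMinus a b) s = rval \<pi> a s - rval \<pi> b s"
| "rval \<pi> (RTimes a b) s = rval \<pi> a s * rval \<pi> b s"

primrec bval :: "(param \<Rightarrow> real) \<Rightarrow> bexp \<Rightarrow> state \<Rightarrow> bool" where
  "bval \<pi> (Less a b) s \<longleftrightarrow> aval a s < aval b s"
| "bval \<pi> (RLess a b) s \<longleftrightarrow> rval \<pi> a s < rval \<pi> b s"
| "bval \<pi> (Neg b) s \<longleftrightarrow> \<not> bval \<pi> b s"
| "bval \<pi> (And a b) s \<longleftrightarrow> bval \<pi> a s \<and> bval \<pi> b s"

definition set_reg :: "string \<Rightarrow> nat \<Rightarrow> state \<Rightarrow> state" where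
  "set_reg x k s = s\<lparr>regs := (regs s)(x := k)\<rparr>"

definition set_mem :: "nat \<Rightarrow> nat \<Rightarrow> state \<Rightarrow> state" where
  "set_mem a k s = s\<lparr>mem := (mem s)(a := k)\<rparr>"

text \<open>
  \<open>exec \<pi> c s tr\<close>: started in \<open>s\<close>, the program \<open>c\<close> terminates, and \<open>tr\<close> lists the states
  after each elementary step (assignment, store or test). The trace is nonempty, its last
  element is the final state and its length is the running time. Charging one unit per step
  is correct up to a constant factor, since a fixed program contains expressions of bounded
  size only.
\<close>

inductive exec :: "(param \<Rightarrow> real) \<Rightarrow> com \<Rightarrow> state \<Rightarrow> state list \<Rightarrow> bool" for \<pi> where
  Skip: "exec \<pi> Skip s [s]"
| Assign: "exec \<pi> (Assign x a) s [set_reg x (aval a s) s]"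
| Store: "exec \<pi> (Store a b) s [set_mem (aval a s) (aval b s) s]"
| Seq: "exec \<pi> c1 s tr1 \<Longrightarrow> exec \<pi> c2 (last tr1) tr2 \<Longrightarrow> exec \<pi> (Seq c1 c2) s (tr1 @ tr2)"
| CondTrue: "bval \<pi> b s \<Longrightarrow> exec \<pi> c1 s tr \<Longrightarrow> exec \<pi> (Cond b c1 c2) s (s # tr)"
| CondFalse: "\<not> bval \<pi> b s \<Longrightarrow> exec \<pi> c2 s tr \<Longrightarrow> exec \<pi> (Cond b c1 c2) s (s # tr)"
| WhileFalse: "\<not> bval \<pi> b s \<Longrightarrow> exec \<pi> (While b c) s [s]"
| WhileTrue: "bval \<pi> b s \<Longrightarrow> exec \<pi> c s tr1 \<Longrightarrow> exec \<pi> (While b c) (last tr1) tr2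
    \<Longrightarrow> exec \<pi> (While b c) s (s # tr1 @ tr2)"

inductive_cases SkipE: "exec \<pi> Skip s tr"
inductive_cases AssignE: "exec \<pi> (Assign x a) s tr"
inductive_cases StoreE: "exec \<pi> (Store a b) s tr"
inductive_cases SeqE: "exec \<pi> (Seq c1 c2) s tr"
inductive_cases CondE: "exec \<pi> (Cond b c1 c2) s tr"
inductive_cases WhileE: "exec \<pi> (While b c) s tr"

lemma exec_deterministic: "exec \<pi> c s tr \<Longrightarrow> exec \<pi> c s tr' \<Longrightarrow> tr' = tr"
proof (induction arbitrary: tr' rule: exec.induct)
  case (Skip s)
  then show ?case by (rule SkipE)
next
  case (Assign x a s)
  then show ?case by (rule AssignE)
next
  case (Store a b s)
  then show ?case by (rule StoreE)
next
  case (Seq c1 s tr1 c2 tr2)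
  from Seq.prems obtain u1 u2
    where "tr' = u1 @ u2" "exec \<pi> c1 s u1" "exec \<pi> c2 (last u1) u2" by (rule SeqE)
  with Seq.IH show ?case by metis
next
  case (CondTrue b s c1 tr c2)
  from CondTrue.prems obtain u where "tr' = s # u" "exec \<pi> c1 s u"
    by (rule CondE) (use CondTrue.hyps in simp_all)
  with CondTrue.IH show ?case by metis
next
  case (CondFalse b s c2 tr c1)
  from CondFalse.prems obtain u where "tr' = s # u" "exec \<pi> c2 s u"
    by (rule CondE) (use CondFalse.hyps in simp_all)
  with CondFalse.IH show ?case by metis
next
  case (WhileFalse b s c)
  from WhileFalse.prems show ?case
    by (rule WhileE) (use WhileFalse.hyps in simp_all)
next
  case (WhileTrue b s c tr1 tr2)
  from WhileTrue.prems obtain u1 u2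
    where "tr' = s # u1 @ u2" "exec \<pi> c s u1" "exec \<pi> (While b c) (last u1) u2"
    by (rule WhileE) (use WhileTrue.hyps in simp_all)
  with WhileTrue.IH show ?case by metis
qed

text \<open>
  Space is measured by the extent of the used memory, so a sparsely filled address range is
  charged in full. Memory is initially zero; a cell beyond the extent carries no information.
  The finitely many registers of a program are not counted.
\<close>

definition fits_space :: "nat \<Rightarrow> state \<Rightarrow> bool" where
  "fits_space N s \<longleftrightarrow> (\<forall>a \<ge> N. mem s a = 0)"

definition fits_words :: "nat \<Rightarrow> state \<Rightarrow> bool" where
  "fits_words W s \<longleftrightarrow> (\<forall>x. regs s x \<le> W) \<and> (\<forall>a. mem s a \<le> W)"


section \<open>Dynamic algorithms for decompositions\<close>

text \<open>
  An algorithm consists of two update programs, which find the endpoints of the updated edge in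
  the registers \<open>u\<close> and \<open>v\<close>, and two membership tests. The latter are expressions, hence free of
  side effects and of constant cost; with a node \<open>x\<close> and an index \<open>i\<close> in the registers of these
  names they decide \<open>s\<^sub>x \<in> S\<^sub>i\<close> and \<open>t\<^sub>x \<in> T\<^sub>i\<close>.
\<close>

record dyn_alg =
  on_insert :: com
  on_delete :: com
  test_S :: bexp
  test_T :: bexp

definition init_state :: "nat \<Rightarrow> nat \<Rightarrow> state" where
  "init_state n L =
     \<lparr>regs = (\<lambda>_. 0)(''n'' := n, ''L'' := L), mem = (\<lambda>_. 0)\<rparr>"

fun exec_update :: "dyn_alg \<Rightarrow> (param \<Rightarrow> real) \<Rightarrow> update \<Rightarrow> state \<Rightarrow> state list \<Rightarrow> bool" where
  "exec_update A \<pi> (Ins u v) s tr \<longleftrightarrow>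
     exec \<pi> (on_insert A) (set_reg ''u'' u (set_reg ''v'' v s)) tr"
| "exec_update A \<pi> (Del u v) s tr \<longleftrightarrow>
     exec \<pi> (on_delete A) (set_reg ''u'' u (set_reg ''v'' v s)) tr"

inductive exec_updates ::
  "dyn_alg \<Rightarrow> (param \<Rightarrow> real) \<Rightarrow> state \<Rightarrow> update list \<Rightarrow> state list list \<Rightarrow> bool" for A \<pi> where
  Nil: "exec_updates A \<pi> s [] []"
| Cons: "exec_update A \<pi> x s tr \<Longrightarrow> exec_updates A \<pi> (last tr) us trs
    \<Longrightarrow> exec_updates A \<pi> s (x # us) (tr # trs)"

definition state_after :: "state \<Rightarrow> state list list \<Rightarrow> nat \<Rightarrow> state" where
  "state_after s trs k = (if k = 0 then s else last (trs ! (k - 1)))"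

definition total_time :: "state list list \<Rightarrow> nat" where
  "total_time trs = (\<Sum>tr\<leftarrow>trs. length tr)"

definition fam_S :: "dyn_alg \<Rightarrow> (param \<Rightarrow> real) \<Rightarrow> nat \<Rightarrow> state \<Rightarrow> nat \<Rightarrow> nat node set" where
  "fam_S A \<pi> n s i =
     {Src x | x. x < n \<and> bval \<pi> (test_S A) (set_reg ''x'' x (set_reg ''i'' i s))}"

definition fam_T :: "dyn_alg \<Rightarrow> (param \<Rightarrow> real) \<Rightarrow> nat \<Rightarrow> state \<Rightarrow> nat \<Rightarrow> nat node set" where
  "fam_T A \<pi> n s i =
     {Tgt x | x. x < n \<and> bval \<pi> (test_T A) (set_reg ''x'' x (set_reg ''i'' i s))}"

end

theory Submission
 imports Defs
begin

text \<open>
 Give every node a level. Each edge lies, at both endpoints, in the bucket whose key is the smaller of the two levels, so the degree of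
 a node \<open>x\<close> into its own level and into the level below are sums of sizes of the top two buckets of \<open>x\<close>, read in constant time.
 After an update, nodes that violate the decomposition are moved up or down by one level; a move rebuckets only the edges to nodes that are not
 below \<open>x\<close>, and only the neighbours met in this way can become violating. With the level-dependent potential of Bhattacharya, Henzinger,
 Nanongkai and Tsourakakis every move pays for itself, an insertion costs \<open>O(L)\<close> and a deletion \<open>O(L/\<epsilon>)\<close>.

 No dictionary is available to locate a deleted edge in linear space, so deletions are recorded as negative edges that share the buckets
 of the edges they cancel. A bucket is cleaned, with counters indexed by the opposite endpoint, before its edges are scanned. When the number of records
 exceeds \<open>3 m + 2 n\<close>, for \<open>m\<close> current edges, the structure is rebuilt in place; the excess over \<open>m\<close>, to which
 each deletion adds 2, pays for this.
\<close>

text \<open>The time of a move must be proportional to a degree, yet records of deleted edges may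
  clutter the buckets. Hence every half-edge carries a prepaid credit for its own removal, and
  scanning a bucket is charged to its live edges only. A move changes keys by at most one, so a
  half-edge travels to an adjacent bucket in the sorted list of its owner, at both ends of the edge,
  in constant time; only a new record has to search through up to \<open>L\<close> buckets. Two
  buckets per node suffice for the tests because no key at a node exceeds the key of its own level.
  The space bound is required of every intermediate state. All programs are therefore verified
  relative to a bound \<open>M\<close> on identifiers that follows the number \<open>R\<close> of
  records: an update runs with room for one more record, and rebuilding ends in the smaller space of
  the live edges. Emptied buckets are recycled at once, which bounds the number of buckets in terms
  of the records.\<close>

section \<open>Circular doubly linked lists: iteration, removal, insertion, and lists sorted by a
  key\<close>

primrec path :: "(nat \<Rightarrow> nat) \<Rightarrow> (nat \<Rightarrow> nat) \<Rightarrow> nat \<Rightarrow> nat list \<Rightarrow> nat \<Rightarrow> bool" where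
 "path f g a [] z \<longleftrightarrow> f a = z \<and> g z = a"
| "path f g a (x # xs) z \<longleftrightarrow> f a = x \<and> g x = a \<and> path f g x xs z"

lemma path_append:
 "path f g a (xs @ y # ys) z \<longleftrightarrow> path f g a xs y \<and> path f g y ys z" by (induction xs arbitrary: a) auto

lemma path_cong:
 assumes "\<And>i. i \<in> insert a (set xs) \<Longrightarrow> f' i = f i" "\<And>i. i \<in> insert z (set xs) \<Longrightarrow> g' i = g i"
 shows "path f' g' a xs z \<longleftrightarrow> path f g a xs z" using assms by (induction xs arbitrary: a) auto

lemma path_last: "path f g a xs z \<Longrightarrow> g z = last (a # xs)" by (induction xs arbitrary: a) auto

lemma path_first: "path f g a xs z \<Longrightarrow> f a = hd (xs @ [z])" by (cases xs) auto

text \<open>Only the two neighbours of \<open>y\<close> read the changed cells, so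
  \<open>path_cong\<close> carries over the rest on both sides. The ends may coincide, since a
  circle is a path from its head back to itself; the case splits treat the sides on which the
  neighbour of \<open>y\<close> is an end.\<close>

lemma path_remove:
 assumes "path f g a (xs @ y # ys) z" "distinct (xs @ y # ys)" "a \<notin> set (xs @ y # ys)"
  "z \<notin> set (xs @ y # ys)"
 shows "path (f(g y := f y)) (g(f y := g y)) a (xs @ ys) z"
proof -
 from assms(1) have p: "path f g a xs y" "path f g y ys z" by (auto simp: path_append)
 have gy: "g y = last (a # xs)" and fy: "f y = hd (ys @ [z])" using p path_last path_first by blast+
 show ?thesis
 proof (cases ys)
  case Nil
  show ?thesis
  proof (cases xs rule: rev_cases)
   case Nil
   thus ?thesis using \<open>ys = []\<close> p by auto
  next case (snoc xs' x)
   have "path f g a xs' x" using p(1) snoc by (simp add: path_append)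
   hence "path (f(g y := f y)) (g(f y := g y)) a xs' x"
    by (subst path_cong[where f = f and g = g]) (use assms snoc \<open>ys = []\<close> gy fy in auto)
   thus ?thesis using snoc \<open>ys = []\<close> gy fy p by (auto simp: path_append)
  qed
 next case (Cons w ys')
  have gn: "g y \<notin> set ys" using assms(2,3) gy by (cases xs rule: rev_cases) auto
  have r: "path (f(g y := f y)) (g(f y := g y)) w ys' z" by (subst path_cong[where f = f and g = g]) (use assms p Cons gn fy in auto)
  have l: "path (f(g y := f y)) (g(f y := g y)) a xs w"
  proof (cases xs rule: rev_cases)
   case Nil
   thus ?thesis using Cons gy fy by auto
  next case (snoc xs' x)
   have "path f g a xs' x" using p(1) snoc by (simp add: path_append)
   hence "path (f(g y := f y)) (g(f y := g y)) a xs' x" by (subst path_cong[where f = f and g = g]) (use assms snoc Cons gy fy in auto)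
   thus ?thesis using snoc Cons gy fy by (auto simp: path_append)
  qed
  show ?thesis using l r Cons by (simp add: path_append)
 qed
qed

lemma path_insert:
 assumes "path f g a (xs @ ys) z" "p = last (a # xs)" "distinct (xs @ ys)" "a \<notin> set (xs @ ys)"
  "z \<notin> set (xs @ ys)" "h \<notin> set (xs @ ys)" "h \<noteq> a" "h \<noteq> z"
 shows "path (f(p := h, h := f p)) (g(h := p, f p := h)) a (xs @ h # ys) z"
proof (cases ys)
 case Nil
 show ?thesis
 proof (cases xs rule: rev_cases)
  case Nil
  thus ?thesis using \<open>ys = []\<close> assms by auto
 next case (snoc xs' x)
  have "path f g a xs' x" "f x = z" using assms(1) Nil snoc by (simp_all add: path_append)
  moreover have "path (f(p := h, h := f p)) (g(h := p, f p := h)) a xs' x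
    \<longleftrightarrow> path f g a xs' x" by (rule path_cong) (use assms snoc \<open>ys = []\<close> \<open>f x = z\<close> in auto)
  ultimately show ?thesis using assms snoc Nil by (auto simp: path_append)
 qed
next case (Cons w ys')
 have pw: "path f g a xs w" "path f g w ys' z" using assms(1) Cons by (simp_all add: path_append)
 have fp: "f p = w"
 proof (cases xs rule: rev_cases)
  case Nil
  thus ?thesis using assms pw by simp
 next case (snoc xs' x)
  thus ?thesis using assms pw by (auto simp: path_append)
 qed
 have pn: "p \<notin> set ys" using assms(2-4) by (cases xs rule: rev_cases) auto
 have r: "path (f(p := h, h := f p)) (g(h := p, f p := h)) w ys' z" by (subst path_cong[where f = f and g = g]) (use assms pw Cons fp pn in auto)
 have l: "path (f(p := h, h := f p)) (g(h := p, f p := h)) a xs h"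
 proof (cases xs rule: rev_cases)
  case Nil
  thus ?thesis using Cons assms fp by auto
 next case (snoc xs' x)
  have "path f g a xs' x" using pw snoc by (simp add: path_append)
  hence "path (f(p := h, h := f p)) (g(h := p, f p := h)) a xs' x" by (subst path_cong[where f = f and g = g]) (use assms snoc Cons fp in auto)
  thus ?thesis using snoc Cons assms fp by (auto simp: path_append)
 qed
 show ?thesis using l r Cons fp assms by (auto simp: path_append)
qed

text \<open>A loop invariant for walking round a circle with head \<open>a\<close>: \<open>D\<close>
  holds the elements passed and kept, \<open>T\<close> those ahead, \<open>c\<close> is the next
  one, and the walk is over when \<open>c\<close> is the head. Elements removed on the way are in
  neither set, so the same invariant serves loops that delete while they iterate.\<close>

definition iter :: "(nat \<Rightarrow> nat) \<Rightarrow> (nat \<Rightarrow> nat) \<Rightarrow> nat \<Rightarrow> nat set \<Rightarrow> nat set \<Rightarrow> nat \<Rightarrow> bool" where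
 "iter f g a D T c \<longleftrightarrow> (\<exists>ds rs. path f g a (ds @ rs) a \<and> distinct (a # ds @ rs) \<and>
  set ds = D \<and> set rs = T \<and> c = hd (rs @ [a]))"

definition ring :: "(nat \<Rightarrow> nat) \<Rightarrow> (nat \<Rightarrow> nat) \<Rightarrow> nat \<Rightarrow> nat set \<Rightarrow> bool" where
 "ring f g a X \<longleftrightarrow> (\<exists>xs. path f g a xs a \<and> distinct (a # xs) \<and> set xs = X)"

lemma iter_start: "ring f g a X \<Longrightarrow> iter f g a {} X (f a)" unfolding ring_def iter_def by (metis append_Nil empty_set path_first)

lemma iter_cur:
 assumes "iter f g a D T c"
 shows "c \<noteq> a \<longleftrightarrow> T \<noteq> {}"
proof -
 obtain ds rs where "distinct (a # ds @ rs)" "set rs = T" "c = hd (rs @ [a])" using assms unfolding iter_def by blast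
 thus ?thesis by (cases rs) auto
qed

lemma iter_mem: "iter f g a D T c \<Longrightarrow> c \<noteq> a \<Longrightarrow> c \<in> T"
 unfolding iter_def by (auto simp: hd_append split: if_splits)

lemma iter_disj: "iter f g a D T c \<Longrightarrow> D \<inter> T = {}" unfolding iter_def by auto

lemma iter_keep:
 assumes "iter f g a D T c" "c \<noteq> a"
 shows "iter f g a (insert c D) (T - {c}) (f c)"
proof -
 obtain ds rs where p: "path f g a (ds @ rs) a" and d: "distinct (a # ds @ rs)" and D: "set ds = D" and T: "set rs = T" and c: "c = hd (rs @ [a])"
  using assms unfolding iter_def by blast
 from c assms obtain rs' where rs: "rs = c # rs'" by (cases rs) auto
 have "f c = hd (rs' @ [a])" by (rule path_first[of f g c rs' a]) (use p rs in \<open>simp add: path_append\<close>)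
 moreover have "path f g a ((ds @ [c]) @ rs') a" "distinct (a # (ds @ [c]) @ rs')"
  "set (ds @ [c]) = insert c D" "set rs' = T - {c}" using p d D T rs by auto
 ultimately show ?thesis unfolding iter_def by blast
qed

text \<open>Removing \<open>c\<close> writes the successor cell of \<open>g c\<close> and the
  predecessor cell of \<open>f c\<close>, so the successor read before the removal is still the
  right place to continue.\<close>

lemma iter_remove:
 assumes "iter f g a D T c" "c \<noteq> a"
 shows "iter (f(g c := f c)) (g(f c := g c)) a D (T - {c}) (f c)"
proof -
 obtain ds rs where p: "path f g a (ds @ rs) a" and d: "distinct (a # ds @ rs)" and D: "set ds = D" and T: "set rs = T" and c: "c = hd (rs @ [a])"
  using assms unfolding iter_def by blast
 from c assms obtain rs' where rs: "rs = c # rs'" by (cases rs) auto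
 have "f c = hd (rs' @ [a])" by (rule path_first[of f g c rs' a]) (use p rs in \<open>simp add: path_append\<close>)
 moreover have "path (f(g c := f c)) (g(f c := g c)) a (ds @ rs') a" by (rule path_remove) (use p d rs in auto)
 moreover have "distinct (a # ds @ rs')" "set rs' = T - {c}" using d D T rs by auto
 ultimately show ?thesis using D unfolding iter_def by blast
qed

lemma iter_cong:
 assumes "iter f g a D T c" "\<And>i. i \<in> insert a (D \<union> T) \<Longrightarrow> f' i = f i \<and> g' i = g i"
 shows "iter f' g' a D T c"
proof -
 obtain ds rs where *: "path f g a (ds @ rs) a" "distinct (a # ds @ rs)" "set ds = D" "set rs = T"
  "c = hd (rs @ [a])" using assms unfolding iter_def by blast
 have "path f' g' a (ds @ rs) a" by (subst path_cong[where f = f and g = g]) (use assms * in auto)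
 thus ?thesis using * unfolding iter_def by blast
qed

lemma ring_cong:
 assumes "ring f g a X" "\<And>i. i \<in> insert a X \<Longrightarrow> f' i = f i \<and> g' i = g i"
 shows "ring f' g' a X"
proof -
 obtain xs where *: "path f g a xs a" "distinct (a # xs)" "set xs = X" using assms unfolding ring_def by blast
 have "path f' g' a xs a" by (subst path_cong[where f = f and g = g]) (use assms * in auto)
 thus ?thesis using * unfolding ring_def by blast
qed

lemma ring_notin: "ring f g a X \<Longrightarrow> a \<notin> X" unfolding ring_def by auto

lemma ring_remove:
 assumes "ring f g a X" "y \<in> X"
 shows "ring (f(g y := f y)) (g(f y := g y)) a (X - {y})"
proof -
 obtain xs where *: "path f g a xs a" "distinct (a # xs)" "set xs = X" using assms unfolding ring_def by blast
 obtain us vs where xs: "xs = us @ y # vs" using assms * by (metis split_list)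
 have "path (f(g y := f y)) (g(f y := g y)) a (us @ vs) a" by (rule path_remove) (use * xs in auto)
 thus ?thesis using * xs unfolding ring_def by (intro exI[of _ "us @ vs"]) auto
qed

lemma ring_push:
 assumes "ring f g a X" "h \<notin> insert a X"
 shows "ring (f(a := h, h := f a)) (g(h := a, f a := h)) a (insert h X)"
proof -
 obtain xs where *: "path f g a xs a" "distinct (a # xs)" "set xs = X" using assms unfolding ring_def by blast
 have "path (f(a := h, h := f a)) (g(h := a, f a := h)) a ([] @ h # xs) a" by (rule path_insert) (use * assms in auto)
 thus ?thesis using * assms unfolding ring_def by (intro exI[of _ "h # xs"]) auto
qed

lemma ring_empty: "f a = a \<Longrightarrow> g a = a \<Longrightarrow> ring f g a {}" unfolding ring_def by (intro exI[of _ "[]"]) auto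

lemma ring_closed:
 assumes "ring f g a X" "i \<in> insert a X"
 shows "f i \<in> insert a X" "g i \<in> insert a X" "g (f i) = i" "f (g i) = i"
proof -
 obtain xs where *: "path f g a xs a" "distinct (a # xs)" "set xs = X" using assms unfolding ring_def by blast
 have "f i \<in> insert a X \<and> g i \<in> insert a X \<and> g (f i) = i \<and> f (g i) = i"
 proof (cases "i = a")
  case True
  have "g a = last (a # xs)" "f a = hd (xs @ [a])" using * path_last path_first by blast+
  moreover have "f (last (a # xs)) = a" using *(1) by (cases xs rule: rev_cases) (auto simp: path_append)
  moreover have "g (hd (xs @ [a])) = a" using *(1) by (cases xs) auto
  moreover have "last (a # xs) \<in> insert a X" "hd (xs @ [a]) \<in> insert a X" using * by (auto simp: hd_append)
  ultimately show ?thesis using True by auto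
 next case False
  then obtain us vs where xs: "xs = us @ i # vs" using assms * by (metis insertE split_list)
  have p: "path f g a us i" "path f g i vs a" using * xs by (auto simp: path_append)
  have "g i = last (a # us)" "f i = hd (vs @ [a])" using p path_last path_first by blast+
  moreover have "f (last (a # us)) = i" using p(1) by (cases us rule: rev_cases) (auto simp: path_append)
  moreover have "g (hd (vs @ [a])) = i" using p(2) by (cases vs) auto
  moreover have "last (a # us) \<in> insert a X" "hd (vs @ [a]) \<in> insert a X" using * xs by (auto simp: hd_append)
  ultimately show ?thesis by auto
 qed
 thus "f i \<in> insert a X" "g i \<in> insert a X" "g (f i) = i" "f (g i) = i" by auto
qed

lemma ring_empty_iff: "ring f g a X \<Longrightarrow> f a = a \<longleftrightarrow> X = {}" using iter_cur iter_start by blast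

text \<open>The head takes part in the order. Nodes will have key 0 and buckets positive keys, so
  the head is a sentinel below all buckets; strictness gives at most one bucket per key.\<close>

definition oring :: "(nat \<Rightarrow> nat) \<Rightarrow> (nat \<Rightarrow> nat) \<Rightarrow> (nat \<Rightarrow> nat) \<Rightarrow> nat \<Rightarrow> nat set \<Rightarrow> bool" where
 "oring key f g a X \<longleftrightarrow>
  (\<exists>xs. path f g a xs a \<and> sorted_wrt (\<lambda>i j. key i < key j) (a # xs) \<and> set xs = X)"

lemma sorted_wrt_key_distinct: "sorted_wrt (\<lambda>i j. (key i :: nat) < key j) xs \<Longrightarrow> distinct xs" by (induction xs) auto

lemma oring_ring: "oring key f g a X \<Longrightarrow> ring f g a X" unfolding oring_def ring_def using sorted_wrt_key_distinct by blast

lemma oring_min: "oring key f g a X \<Longrightarrow> b \<in> X \<Longrightarrow> key a < key b" unfolding oring_def by auto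

lemma sorted_wrt_key_inj:
 assumes "sorted_wrt (\<lambda>i j. (key i :: nat) < key j) xs" "i \<in> set xs" "j \<in> set xs" "key i = key j"
 shows "i = j" using assms by (induction xs) auto

lemma oring_inj: "oring key f g a X \<Longrightarrow> i \<in> X \<Longrightarrow> j \<in> X \<Longrightarrow> key i = key j \<Longrightarrow> i = j"
 unfolding oring_def using sorted_wrt_key_inj by (metis set_subset_Cons subsetD)

lemma oring_split:
 assumes "oring key f g a X" "i \<in> insert a X"
 obtains us vs where "path f g a us i \<or> (us = [] \<and> i = a)" "path f g i vs a"
  "\<And>j. j \<in> X \<Longrightarrow> key j < key i \<Longrightarrow> j \<in> set us" "\<And>j. j \<in> X \<Longrightarrow> key i < key j \<Longrightarrow> j \<in> set vs"
  "sorted_wrt (\<lambda>i j. key i < key j) (a # us)" "sorted_wrt (\<lambda>i j. key i < key j) (i # vs)"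
  "set us \<union> set vs \<subseteq> X" "\<And>j. j \<in> set us \<Longrightarrow> key j < key i"
proof -
 obtain xs where *: "path f g a xs a" "sorted_wrt (\<lambda>i j. key i < key j) (a # xs)" "set xs = X" using assms unfolding oring_def by blast
 show ?thesis
 proof (cases "i = a")
  case True
  show ?thesis by (rule that[of "[]" xs]) (use * True in auto)
 next case False
  then obtain us vs where xs: "xs = us @ i # vs" using assms * by (metis insertE split_list)
  show ?thesis by (rule that[of us vs]) (use * xs in \<open>auto simp: path_append sorted_wrt_append\<close>)
 qed
qed

lemma oring_down:
 assumes "oring key f g a X" "i \<in> X"
 shows "g i \<in> insert a X" "key (g i) < key i" "j \<in> X \<Longrightarrow> key j < key i \<Longrightarrow> key j \<le> key (g i)"
proof -
 obtain us vs where *: "path f g a us i \<or> (us = [] \<and> i = a)"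
  "\<And>j. j \<in> X \<Longrightarrow> key j < key i \<Longrightarrow> j \<in> set us"
  "sorted_wrt (\<lambda>i j. key i < key j) (a # us)" "set us \<union> set vs \<subseteq> X"
  "\<And>j. j \<in> set us \<Longrightarrow> key j < key i" using oring_split[OF assms(1), of i] assms by (metis insertI2)
 have "i \<noteq> a" using assms oring_min by fastforce
 with * have gi: "g i = last (a # us)" using path_last by blast
 have "last (a # us) \<in> insert a (set us)" by auto
 thus "g i \<in> insert a X" using gi *(4) by auto
 show "key (g i) < key i" using gi * oring_min[OF assms] by (auto split: if_splits)
 show "key j \<le> key (g i)" if "j \<in> X" "key j < key i" using gi *(2)[OF that] *(3) by (cases us rule: rev_cases) (auto simp: sorted_wrt_append)
qed

lemma oring_top:
 assumes "oring key f g a X"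
 shows "g a \<in> insert a X" "j \<in> X \<Longrightarrow> key j \<le> key (g a)"
proof -
 obtain xs where *: "path f g a xs a" "sorted_wrt (\<lambda>i j. key i < key j) (a # xs)" "set xs = X" using assms unfolding oring_def by blast
 have gi: "g a = last (a # xs)" using * path_last by blast
 show "g a \<in> insert a X" using gi * by auto
 show "j \<in> X \<Longrightarrow> key j \<le> key (g a)" using gi *(2,3) by (cases xs rule: rev_cases) (auto simp: sorted_wrt_append)
qed

lemma oring_up:
 assumes "oring key f g a X" "i \<in> insert a X"
 shows "f i \<in> insert a X" "f i \<in> X \<Longrightarrow> key i < key (f i)"
  "j \<in> X \<Longrightarrow> key i < key j \<Longrightarrow> f i \<in> X \<and> key (f i) \<le> key j"
proof -
 obtain us vs where *: "path f g i vs a" "\<And>j. j \<in> X \<Longrightarrow> key i < key j \<Longrightarrow> j \<in> set vs"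
  "sorted_wrt (\<lambda>i j. key i < key j) (i # vs)" "set us \<union> set vs \<subseteq> X" using oring_split[OF assms] by metis
 have na: "a \<notin> X" using assms oring_ring ring_notin by blast
 have fi: "f i = hd (vs @ [a])" using * path_first by blast
 show "f i \<in> insert a X" using fi * by (cases vs) auto
 show "key i < key (f i)" if "f i \<in> X" using fi * that na by (cases vs) auto
 show "f i \<in> X \<and> key (f i) \<le> key j" if "j \<in> X" "key i < key j" using fi *(2)[OF that] *(3,4) by (cases vs) auto
qed

lemma oring_remove:
 assumes "oring key f g a X" "y \<in> X"
 shows "oring key (f(g y := f y)) (g(f y := g y)) a (X - {y})"
proof -
 obtain xs where *: "path f g a xs a" "sorted_wrt (\<lambda>i j. key i < key j) (a # xs)" "set xs = X" using assms unfolding oring_def by blast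
 hence d: "distinct (a # xs)" using sorted_wrt_key_distinct by blast
 obtain us vs where xs: "xs = us @ y # vs" using assms * by (metis split_list)
 have "path (f(g y := f y)) (g(f y := g y)) a (us @ vs) a" by (rule path_remove) (use * d xs in auto)
 thus ?thesis using * d xs unfolding oring_def by (intro exI[of _ "us @ vs"]) (auto simp: sorted_wrt_append)
qed

text \<open>The hypothesis \<open>q\<close> leaves no key between that of \<open>p\<close> and the
  new one, so the place after \<open>p\<close> is the right one. As \<open>h\<close> is new, giving
  it a key affects no comparison among the old elements.\<close>

lemma oring_insert:
 assumes "oring key f g a X" "p \<in> insert a X" "h \<notin> insert a X" "key p < q"
  and q: "\<And>j. j \<in> X \<Longrightarrow> key j \<le> key p \<or> q < key j"
 shows "oring (key(h := q)) (f(p := h, h := f p)) (g(h := p, f p := h)) a (insert h X)"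
proof -
 obtain xs where *: "path f g a xs a" "sorted_wrt (\<lambda>i j. key i < key j) (a # xs)" "set xs = X" using assms unfolding oring_def by blast
 hence d: "distinct (a # xs)" using sorted_wrt_key_distinct by blast
 obtain us vs where xs: "xs = us @ vs" "p = last (a # us)"
 proof (cases "p = a")
  case True
  thus ?thesis using that[of "[]" xs] by simp
 next case False
  then obtain us vs where "xs = us @ p # vs" using assms * by (metis insertE split_list)
  thus ?thesis using that[of "us @ [p]" vs] by simp
 qed
 have "path (f(p := h, h := f p)) (g(h := p, f p := h)) a (us @ h # vs) a" by (rule path_insert) (use * d xs assms in auto)
 moreover have vs: "q < key j" if "j \<in> set vs" for j using q[of j] that * xs by (cases us rule: rev_cases) (auto simp: sorted_wrt_append)
 moreover have us: "key j < q" if "j \<in> set us" for j using assms(4) that * xs by (cases us rule: rev_cases) (auto simp: sorted_wrt_append)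
 moreover have aq: "key a < q" using assms(2,4) * oring_min[OF assms(1)] by fastforce
 moreover have "sorted_wrt (\<lambda>i j. (key(h := q)) i < (key(h := q)) j) (a # us @ h # vs)"
 proof -
  have s: "sorted_wrt (\<lambda>i j. (key(h := q)) i < (key(h := q)) j) zs
    \<longleftrightarrow> sorted_wrt (\<lambda>i j. key i < key j) zs" if "h \<notin> set zs" for zs using that by (induction zs) auto
  have "h \<notin> set us" "h \<notin> set vs" "h \<noteq> a" using assms(3) * xs by auto
  thus ?thesis using * xs us vs aq by (simp add: sorted_wrt_append s[simplified] ball_Un) auto
 qed
 ultimately show ?thesis using * xs unfolding oring_def by (intro exI[of _ "us @ h # vs"]) auto
qed

lemma oring_cong:
 assumes "oring key f g a X"
  "\<And>i. i \<in> insert a X \<Longrightarrow> f' i = f i \<and> g' i = g i \<and> key' i = key i"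
 shows "oring key' f' g' a X"
proof -
 obtain xs where *: "path f g a xs a" "sorted_wrt (\<lambda>i j. key i < key j) (a # xs)" "set xs = X" using assms unfolding oring_def by blast
 have "path f' g' a xs a" by (subst path_cong[where f = f and g = g]) (use assms * in auto)
 moreover have "sorted_wrt (\<lambda>i j. key' i < key' j) (a # xs)" by (rule sorted_wrt_mono_rel[OF _ *(2)]) (use assms(2) *(3) in auto)
 ultimately show ?thesis using * unfolding oring_def by blast
qed

lemma oring_empty: "f a = a \<Longrightarrow> g a = a \<Longrightarrow> oring key f g a {}" unfolding oring_def by (intro exI[of _ "[]"]) auto

section \<open>Memory layout and bounded execution\<close>

text \<open>
 Every object has an identifier, and field \<open>f\<close> of object \<open>i\<close> is the cell \<open>16 * i + code f\<close>.
 The residue modulo 4 tells the kinds apart: the node \<open>s\<^sub>u\<close> is \<open>8 * u + 1\<close> and \<open>t\<^sub>v\<close> is \<open>8 * v + 5\<close>, the two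
 halves of edge record \<open>e\<close> are \<open>8 * e + 2\<close> and \<open>8 * e + 6\<close>, and buckets are \<open>4 * j + 3\<close>; 0 is the null pointer.
 \<open>LEV\<close> holds the level minus 1, so that the zero memory puts every node on level 1.
\<close>

datatype fld = NX | PV | BK | OWN | SG | KEY | CNT | UP | DN | LEV | SLOT | WL | INW | FS

type_synonym heap = "fld \<Rightarrow> nat \<Rightarrow> nat"
type_synonym graph = "nat \<Rightarrow> nat \<Rightarrow> bool"

text \<open>Registers that \<open>clean\<close>, \<open>moveloop\<close>, the addition of a
  half-edge and \<open>shift2\<close> may overwrite; they serve as frames in
  \<open>eqx\<close>.\<close>

abbreviation "cleanrs \<equiv> {''i'', ''j'', ''p'', ''c'', ''b'', ''nf'', ''h''}"
abbreviation "looprs \<equiv> {''i'', ''j'', ''y'', ''top'', ''a'', ''b'', ''c'', ''f'', ''p'', ''nb'', ''nf'', ''h''}"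
abbreviation "halfrs \<equiv> {''a'', ''c'', ''f'', ''nb'', ''nf''}"
abbreviation "shiftrs \<equiv> {''a'', ''b'', ''c'', ''f'', ''p'', ''nb'', ''nf'', ''h''}"

primrec code :: "fld \<Rightarrow> nat" where
 "code NX = 0" | "code PV = 1" | "code BK = 2" | "code OWN = 3" | "code SG = 4" | "code KEY = 5"
| "code CNT = 6" | "code UP = 7" | "code DN = 8" | "code LEV = 9" | "code SLOT = 10"
| "code WL = 11" | "code INW = 12" | "code FS = 13"

definition adr :: "fld \<Rightarrow> nat \<Rightarrow> nat" where "adr f i = 16 * i + code f"

lemma code_less: "code f < 16" by (cases f) auto

lemma code_inject: "code f = code g \<longleftrightarrow> f = g" by (cases f; cases g) auto

lemma adr_inject [simp]: "adr f i = adr g j \<longleftrightarrow> f = g \<and> i = j"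
proof
 assume *: "adr f i = adr g j"
 have "adr f i div 16 = i" "adr f i mod 16 = code f" "adr g j div 16 = j" "adr g j mod 16 = code g"
  unfolding adr_def using code_less[of f] code_less[of g] by simp_all
 with * show "f = g \<and> i = j" using code_inject by metis
qed simp

lemma adr_less: "i < M \<Longrightarrow> adr f i < 16 * M" using code_less[of f] unfolding adr_def by linarith

definition hp :: "state \<Rightarrow> fld \<Rightarrow> nat \<Rightarrow> nat" where "hp s f i = mem s (adr f i)"

definition fa :: "fld \<Rightarrow> aexp \<Rightarrow> aexp" where
 "fa f e = Plus (Times (Const 16) e) (Const (code f))"

abbreviation "ld f e \<equiv> Load (fa f e)"
abbreviation "st f e v \<equiv> Store (fa f e) v"
abbreviation seq (infixr ";;" 60) where "c1 ;; c2 \<equiv> Seq c1 c2"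

definition Equal :: "aexp \<Rightarrow> aexp \<Rightarrow> bexp" where
 "Equal a b = And (Neg (Less a b)) (Neg (Less b a))"

lemma bval_Equal [simp]: "bval \<pi> (Equal a b) s \<longleftrightarrow> aval a s = aval b s" unfolding Equal_def by auto

lemma aval_fa [simp]: "aval (fa f e) s = adr f (aval e s)" unfolding fa_def adr_def by simp

lemma mem_adr: "mem s (adr f i) = hp s f i" unfolding hp_def by simp

lemma hp_set_mem [simp]: "hp (set_mem (adr f i) v s) = (hp s)(f := (hp s f)(i := v))" unfolding hp_def set_mem_def by (auto simp: fun_eq_iff)

lemma hp_set_reg [simp]: "hp (set_reg x v s) = hp s" unfolding hp_def set_reg_def by simp

lemma regs_set_mem [simp]: "regs (set_mem a v s) = regs s" unfolding set_mem_def by simp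

lemma regs_set_reg [simp]: "regs (set_reg x v s) = (regs s)(x := v)" unfolding set_reg_def by simp

definition eqx :: "string set \<Rightarrow> state \<Rightarrow> state \<Rightarrow> bool" where
 "eqx X s s' \<longleftrightarrow> (\<forall>x. x \<notin> X \<longrightarrow> regs s' x = regs s x)"

lemma exec_nonempty: "exec \<pi> c s tr \<Longrightarrow> tr \<noteq> []" by (induction rule: exec.induct) auto

text \<open>Loop-free code is verified by evaluation: \<open>fin\<close> computes the final state
  and \<open>cost\<close> bounds the number of steps, so the simplifier can settle a whole block at
  once. Their values at \<open>While\<close> are placeholders, which \<open>lfree\<close>
  excludes.\<close>

primrec lfree :: "com \<Rightarrow> bool" where
 "lfree Skip \<longleftrightarrow> True"
| "lfree (Assign x a) \<longleftrightarrow> True"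
| "lfree (Store a b) \<longleftrightarrow> True"
| "lfree (Seq c d) \<longleftrightarrow> lfree c \<and> lfree d"
| "lfree (Cond b c d) \<longleftrightarrow> lfree c \<and> lfree d"
| "lfree (While b c) \<longleftrightarrow> False"

primrec cost :: "com \<Rightarrow> nat" where
 "cost Skip = 1"
| "cost (Assign x a) = 1"
| "cost (Store a b) = 1"
| "cost (Seq c d) = cost c + cost d"
| "cost (Cond b c d) = 1 + max (cost c) (cost d)"
| "cost (While b c) = 0"

primrec fin :: "(param \<Rightarrow> real) \<Rightarrow> com \<Rightarrow> state \<Rightarrow> state" where
 "fin \<pi> Skip s = s"
| "fin \<pi> (Assign x a) s = set_reg x (aval a s) s"
| "fin \<pi> (Store a b) s = set_mem (aval a s) (aval b s) s"
| "fin \<pi> (Seq c d) s = fin \<pi> d (fin \<pi> c s)"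
| "fin \<pi> (Cond b c d) s = (if bval \<pi> b s then fin \<pi> c s else fin \<pi> d s)"
| "fin \<pi> (While b c) s = s"

text \<open>Registers and cells of a state that fits the word size need no new bound when they are copied.\<close>

primrec copied :: "aexp \<Rightarrow> bool" where
 "copied (Const k) \<longleftrightarrow> False"
| "copied (Reg x) \<longleftrightarrow> True"
| "copied (Load a) \<longleftrightarrow> True"
| "copied (Plus a b) \<longleftrightarrow> False"
| "copied (Minus a b) \<longleftrightarrow> copied a"
| "copied (Times a b) \<longleftrightarrow> False"
| "copied (Div a b) \<longleftrightarrow> copied a"
| "copied (Mod a b) \<longleftrightarrow> copied a"

section \<open>A calculus of terminating runs with bounds on time, space and word size\<close>

locale ram =
 fixes \<pi> :: "param \<Rightarrow> real" and M W :: nat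
begin

definition okst :: "state \<Rightarrow> bool" where
 "okst s \<longleftrightarrow> fits_space (16 * M) s \<and> fits_words W s"

text \<open>Verification conditions that keep every intermediate state within \<open>16 * M\<close>
  cells and the word bound \<open>W\<close>. Writing 0 outside the space is permitted, because such
  a cell holds 0 anyway; this spares clearing stores a bound on their address.\<close>

primrec ok :: "com \<Rightarrow> state \<Rightarrow> bool" where
 "ok Skip s \<longleftrightarrow> True"
| "ok (Assign x a) s \<longleftrightarrow> copied a \<or> aval a s \<le> W"
| "ok (Store a b) s \<longleftrightarrow> (aval a s < 16 * M \<or> aval b s = 0) \<and> (copied b \<or> aval b s \<le> W)"
| "ok (Seq c d) s \<longleftrightarrow> ok c s \<and> ok d (fin \<pi> c s)"
| "ok (Cond b c d) s \<longleftrightarrow> (if bval \<pi> b s then ok c s else ok d s)"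
| "ok (While b c) s \<longleftrightarrow> True"

definition run :: "com \<Rightarrow> state \<Rightarrow> (nat \<Rightarrow> state \<Rightarrow> bool) \<Rightarrow> bool" where
 "run c s Q \<longleftrightarrow> (\<exists>tr. exec \<pi> c s tr \<and> (\<forall>s' \<in> set tr. okst s') \<and> Q (length tr) (last tr))"

lemma okst_reg: "okst s \<Longrightarrow> k \<le> W \<Longrightarrow> okst (set_reg x k s)"
 unfolding okst_def fits_space_def fits_words_def set_reg_def by auto

lemma okst_mem: "okst s \<Longrightarrow> a < 16 * M \<or> k = 0 \<Longrightarrow> k \<le> W \<Longrightarrow> okst (set_mem a k s)"
 unfolding okst_def fits_space_def fits_words_def set_mem_def by auto

lemma okst_regs_le: "okst s \<Longrightarrow> regs s x \<le> W" unfolding okst_def fits_words_def by auto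

lemma okst_hp_le: "okst s \<Longrightarrow> hp s f i \<le> W" unfolding okst_def fits_words_def hp_def by auto

lemma copied_le: "okst s \<Longrightarrow> copied a \<Longrightarrow> aval a s \<le> W"
proof (induction a)
 case (Reg x)
 thus ?case by (simp add: okst_regs_le)
next case (Load a)
 thus ?case by (simp add: okst_def fits_words_def)
next case (Minus a b)
 thus ?case by (simp add: diff_le_mono order_trans[OF diff_le_self])
next case (Div a b)
 thus ?case by (simp add: order_trans[OF div_le_dividend])
next case (Mod a b)
 thus ?case by (simp add: order_trans[OF mod_less_eq_dividend])
qed auto

lemma exec_fin:
 assumes "lfree c" "okst s" "ok c s"
 shows "\<exists>tr. exec \<pi> c s tr \<and> (\<forall>s' \<in> set tr. okst s') \<and> length tr \<le> cost c \<and> last tr = fin \<pi> c s"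
 using assms
proof (induction c arbitrary: s)
 case Skip
 thus ?case by (intro exI[of _ "[s]"]) (auto intro: exec.intros)
next case (Assign x a)
 hence "okst (set_reg x (aval a s) s)" using copied_le okst_reg by fastforce
 thus ?case by (intro exI[of _ "[set_reg x (aval a s) s]"]) (auto intro: exec.intros)
next case (Store a b)
 hence "okst (set_mem (aval a s) (aval b s) s)" using copied_le[of s b] by (intro okst_mem) auto
 thus ?case by (intro exI[of _ "[set_mem (aval a s) (aval b s) s]"]) (auto intro: exec.intros)
next case (Seq c d)
 then obtain tr1 where 1: "exec \<pi> c s tr1" "\<forall>s' \<in> set tr1. okst s'" "length tr1 \<le> cost c"
  "last tr1 = fin \<pi> c s" by fastforce
 have "tr1 \<noteq> []" using 1(1) exec_nonempty by blast
 hence "okst (fin \<pi> c s)" using 1(2,4) last_in_set by metis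
 with Seq obtain tr2 where 2: "exec \<pi> d (fin \<pi> c s) tr2" "\<forall>s' \<in> set tr2. okst s'"
  "length tr2 \<le> cost d" "last tr2 = fin \<pi> d (fin \<pi> c s)" by fastforce
 have "tr2 \<noteq> []" using 2(1) exec_nonempty by blast
 with 1 2 show ?case by (intro exI[of _ "tr1 @ tr2"]) (auto intro: exec.intros)
next case (Cond b c d)
 show ?case
 proof (cases "bval \<pi> b s")
  case True
  with Cond obtain tr where 1: "exec \<pi> c s tr" "\<forall>s' \<in> set tr. okst s'" "length tr \<le> cost c"
   "last tr = fin \<pi> c s" by fastforce
  have "tr \<noteq> []" using 1(1) exec_nonempty by blast
  with 1 True Cond show ?thesis by (intro exI[of _ "s # tr"]) (auto intro: exec.intros)
 next case False
  with Cond obtain tr where 1: "exec \<pi> d s tr" "\<forall>s' \<in> set tr. okst s'" "length tr \<le> cost d"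
   "last tr = fin \<pi> d s" by fastforce
  have "tr \<noteq> []" using 1(1) exec_nonempty by blast
  with 1 False Cond show ?thesis by (intro exI[of _ "s # tr"]) (auto intro: exec.intros)
 qed
qed auto

lemma run_okst: "run c s Q \<Longrightarrow> run c s (\<lambda>t s'. Q t s' \<and> okst s')"
 unfolding run_def using exec_nonempty last_in_set by blast

lemma run_mono:
 "run c s P \<Longrightarrow> (\<And>t s'. P t s' \<Longrightarrow> okst s' \<Longrightarrow> Q t s') \<Longrightarrow> run c s Q"
 using run_okst[of c s P] unfolding run_def by blast

lemma run_fin:
 assumes "okst s" "lfree c" "ok c s" "\<And>t. t \<le> cost c \<Longrightarrow> Q t (fin \<pi> c s)"
 shows "run c s Q" using exec_fin[OF assms(2,1,3)] assms(4) unfolding run_def by metis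

lemma run_seq:
 assumes "run c s (\<lambda>t1 s1. run d s1 (\<lambda>t2 s2. Q (t1 + t2) s2))"
 shows "run (c ;; d) s Q"
proof -
 obtain tr1 where 1: "exec \<pi> c s tr1" "\<forall>s' \<in> set tr1. okst s'"
  "run d (last tr1) (\<lambda>t2 s2. Q (length tr1 + t2) s2)" using assms unfolding run_def by blast
 then obtain tr2 where 2: "exec \<pi> d (last tr1) tr2" "\<forall>s' \<in> set tr2. okst s'"
  "Q (length tr1 + length tr2) (last tr2)" unfolding run_def by blast
 have "tr2 \<noteq> []" using 2(1) exec_nonempty by blast
 with 1 2 show ?thesis unfolding run_def by (intro exI[of _ "tr1 @ tr2"]) (auto intro: exec.intros)
qed

lemma run_cond:
 assumes "okst s" "bval \<pi> b s \<Longrightarrow> run c s (\<lambda>t. Q (Suc t))" "\<not> bval \<pi> b s \<Longrightarrow> run d s (\<lambda>t. Q (Suc t))"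
 shows "run (Cond b c d) s Q"
proof (cases "bval \<pi> b s")
 case True
 then obtain tr where 1: "exec \<pi> c s tr" "\<forall>s' \<in> set tr. okst s'" "Q (Suc (length tr)) (last tr)"
  using assms(2) unfolding run_def by blast
 have "tr \<noteq> []" using 1(1) exec_nonempty by blast
 with 1 True assms(1) show ?thesis unfolding run_def by (intro exI[of _ "s # tr"]) (auto intro: exec.intros)
next case False
 then obtain tr where 1: "exec \<pi> d s tr" "\<forall>s' \<in> set tr. okst s'" "Q (Suc (length tr)) (last tr)"
  using assms(3) unfolding run_def by blast
 have "tr \<noteq> []" using 1(1) exec_nonempty by blast
 with 1 False assms(1) show ?thesis unfolding run_def by (intro exI[of _ "s # tr"]) (auto intro: exec.intros)
qed

text \<open>The potential \<open>g\<close> of the ghost state pays for the iterations; what is left of it is reported.\<close>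

lemma run_while:
 fixes g :: "'g \<Rightarrow> real"
 assumes step: "\<And>cc s. I cc s \<Longrightarrow> okst s \<Longrightarrow> bval \<pi> b s \<Longrightarrow>
   run c s (\<lambda>t s'. \<exists>cc'. I cc' s' \<and> real t + 1 + g cc' \<le> g cc)"
  and nonneg: "\<And>cc s. I cc s \<Longrightarrow> 0 \<le> g cc" and init: "I cc s" "okst s"
 shows "run (While b c) s (\<lambda>t s'. \<exists>cc'. I cc' s' \<and> \<not> bval \<pi> b s' \<and> real t + g cc' \<le> g cc + 1)"
proof -
 \<comment> \<open>Every iteration uses up at least one unit of the nonnegative potential, so a
   natural number above it serves as fuel. This gives termination together with the time
   bound.\<close>
 have "\<exists>tr. exec \<pi> (While b c) s tr \<and> (\<forall>s' \<in> set tr. okst s') \<and>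
   (\<exists>cc'. I cc' (last tr) \<and> \<not> bval \<pi> b (last tr) \<and> real (length tr) + g cc' \<le> g cc + 1)"
  if "I cc s" "okst s" "g cc \<le> real m" for m cc s using that
 proof (induction m arbitrary: cc s)
  case 0
  have "\<not> bval \<pi> b s"
  proof
   assume "bval \<pi> b s"
   then obtain t s' cc' where "I cc' s'" "real t + 1 + g cc' \<le> g cc" using step[OF 0(1,2)] unfolding run_def by blast
   with nonneg[OF \<open>I cc' s'\<close>] 0(3) show False by simp
  qed
  with 0 show ?case by (intro exI[of _ "[s]"]) (auto intro: exec.intros)
 next case (Suc m)
  show ?case
  proof (cases "bval \<pi> b s")
   case False
   with Suc show ?thesis by (intro exI[of _ "[s]"]) (auto intro: exec.intros)
  next case True
   then obtain tr cc' where 1: "exec \<pi> c s tr" "\<forall>s' \<in> set tr. okst s'" "I cc' (last tr)"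
    "real (length tr) + 1 + g cc' \<le> g cc" using step[OF Suc.prems(1,2)] unfolding run_def by blast
   have ne: "tr \<noteq> []" using 1(1) exec_nonempty by blast
   hence "okst (last tr)" using 1(2) by simp
   moreover have "g cc' \<le> real m" using 1(4) Suc.prems(3) by simp
   ultimately obtain tr' cc'' where 2: "exec \<pi> (While b c) (last tr) tr'"
    "\<forall>s' \<in> set tr'. okst s'" "I cc'' (last tr')" "\<not> bval \<pi> b (last tr')"
    "real (length tr') + g cc'' \<le> g cc' + 1" using Suc.IH 1(3) by blast
   have ne': "tr' \<noteq> []" using 2(1) exec_nonempty by blast
   show ?thesis by (intro exI[of _ "s # tr @ tr'"] conjI exI[of _ cc''])
     (use 1 2 ne' True Suc.prems in \<open>auto intro: exec.intros\<close>)
  qed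
 qed
 from this[OF init, of "nat \<lceil>g cc\<rceil>"] show ?thesis unfolding run_def using real_nat_ceiling_ge by blast
qed

end

text \<open>Identifiers of the buckets created since the last rebuild, whether in use or on the free
  stack.\<close>

definition bids :: "nat \<Rightarrow> nat set" where "bids nb = (\<lambda>j. 4 * j + 3) ` {..<nb}"

section \<open>Buckets of half-edges\<close>

text \<open>
 \<open>kap h\<close> is the key of the half-edge \<open>h\<close> and \<open>C x k\<close> the number of live edges with key \<open>k\<close> at node \<open>x\<close>.
 Each node heads a circular list, sorted by key, of its nonempty buckets. \<open>FS\<close> is the stack of free buckets,
 and only the buckets in \<open>X\<close> may be empty.
\<close>

definition WF :: "nat set \<Rightarrow> heap \<Rightarrow> nat \<Rightarrow> nat \<Rightarrow> nat set \<Rightarrow> (nat \<Rightarrow> nat) \<Rightarrow>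
  (nat \<Rightarrow> nat \<Rightarrow> nat) \<Rightarrow> nat set \<Rightarrow> (nat \<Rightarrow> nat) \<Rightarrow> nat set \<Rightarrow> bool" where
 "WF V H nb nf A kap C B bo X \<longleftrightarrow>
  finite A \<and> (\<forall>x\<in>V. x mod 4 = 1 \<and> H KEY x = 0) \<and> H KEY 0 = 0 \<and> (\<forall>h\<in>A. h mod 4 = 2) \<and>
  B \<subseteq> bids nb \<and>
  (\<forall>x\<in>V. (H UP x = 0 \<and> H DN x = 0 \<and> {b\<in>B. bo b = x} = {}) \<or>
    oring (H KEY) (H UP) (H DN) x {b\<in>B. bo b = x}) \<and>
  (\<forall>b\<in>B. ring (H NX) (H PV) b {h\<in>A. H BK h = b}) \<and>
  (\<forall>h\<in>A. H BK h \<in> B \<and> bo (H BK h) = H OWN h \<and> H KEY (H BK h) = kap h \<and> H OWN h \<in> V) \<and>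
  (\<forall>b\<in>B. bo b \<in> V \<and> 1 \<le> H KEY b \<and> H CNT b = C (bo b) (H KEY b)) \<and>
  (\<forall>x\<in>V. \<forall>k. (\<forall>b\<in>B. bo b = x \<longrightarrow> H KEY b \<noteq> k) \<longrightarrow> C x k = 0) \<and>
  inj_on (H FS) {..<nf} \<and> H FS ` {..<nf} = bids nb - B \<and>
  (\<forall>b\<in>B - X. {h\<in>A. H BK h = b} \<noteq> {})"

lemma WFI:
 assumes "finite A" "\<And>x. x \<in> V \<Longrightarrow> x mod 4 = 1 \<and> H KEY x = 0" "H KEY 0 = 0" "\<And>h. h \<in> A \<Longrightarrow> h mod 4 = 2"
  "B \<subseteq> bids nb"
  "\<And>x. x \<in> V \<Longrightarrow> (H UP x = 0 \<and> H DN x = 0 \<and> {b\<in>B. bo b = x} = {}) \<or>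
    oring (H KEY) (H UP) (H DN) x {b\<in>B. bo b = x}"
  "\<And>b. b \<in> B \<Longrightarrow> ring (H NX) (H PV) b {h\<in>A. H BK h = b}"
  "\<And>h. h \<in> A \<Longrightarrow> H BK h \<in> B \<and> bo (H BK h) = H OWN h \<and> H KEY (H BK h) = kap h \<and> H OWN h \<in> V"
  "\<And>b. b \<in> B \<Longrightarrow> bo b \<in> V \<and> 1 \<le> H KEY b \<and> H CNT b = C (bo b) (H KEY b)"
  "\<And>x k. x \<in> V \<Longrightarrow> (\<And>b. b \<in> B \<Longrightarrow> bo b = x \<Longrightarrow> H KEY b \<noteq> k) \<Longrightarrow> C x k = 0"
  "inj_on (H FS) {..<nf}" "H FS ` {..<nf} = bids nb - B"
  "\<And>b. b \<in> B - X \<Longrightarrow> {h\<in>A. H BK h = b} \<noteq> {}"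
 shows "WF V H nb nf A kap C B bo X"
 unfolding WF_def by (intro conjI ballI allI impI; (erule assms(6) | erule assms(13) | simp add: assms[unfolded One_nat_def]))

lemma WFD:
 assumes "WF V H nb nf A kap C B bo X"
 shows "finite A" "\<And>x. x \<in> V \<Longrightarrow> x mod 4 = 1" "\<And>x. x \<in> V \<Longrightarrow> H KEY x = 0" "H KEY 0 = 0"
  "\<And>h. h \<in> A \<Longrightarrow> h mod 4 = 2"
  "B \<subseteq> bids nb"
  "\<And>x. x \<in> V \<Longrightarrow> (H UP x = 0 \<and> H DN x = 0 \<and> {b\<in>B. bo b = x} = {}) \<or>
    oring (H KEY) (H UP) (H DN) x {b\<in>B. bo b = x}"
  "\<And>b. b \<in> B \<Longrightarrow> ring (H NX) (H PV) b {h\<in>A. H BK h = b}"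
  "\<And>h. h \<in> A \<Longrightarrow> H BK h \<in> B" "\<And>h. h \<in> A \<Longrightarrow> bo (H BK h) = H OWN h"
  "\<And>h. h \<in> A \<Longrightarrow> H KEY (H BK h) = kap h" "\<And>h. h \<in> A \<Longrightarrow> H OWN h \<in> V"
  "\<And>b. b \<in> B \<Longrightarrow> bo b \<in> V" "\<And>b. b \<in> B \<Longrightarrow> 1 \<le> H KEY b" "\<And>b. b \<in> B \<Longrightarrow> H CNT b = C (bo b) (H KEY b)"
  "\<And>x k. x \<in> V \<Longrightarrow> (\<And>b. b \<in> B \<Longrightarrow> bo b = x \<Longrightarrow> H KEY b \<noteq> k) \<Longrightarrow> C x k = 0"
  "inj_on (H FS) {..<nf}" "H FS ` {..<nf} = bids nb - B"
  "\<And>b. b \<in> B - X \<Longrightarrow> {h\<in>A. H BK h = b} \<noteq> {}" using assms unfolding WF_def by (elim conjE; simp)+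

lemma bids_mod: "b \<in> bids nb \<Longrightarrow> b mod 4 = 3" unfolding bids_def by auto

lemma WF_B_mod: "WF V H nb nf A kap C B bo X \<Longrightarrow> b \<in> B \<Longrightarrow> b mod 4 = 3" using WFD(6) bids_mod by blast

lemma WF_cong:
 assumes "WF V H nb nf A kap C B bo X"
  "\<And>f. f \<in> {NX, PV, KEY, CNT, UP, DN, FS} \<Longrightarrow> H' f = H f"
  "\<And>h. h \<in> A \<Longrightarrow> H' BK h = H BK h \<and> H' OWN h = H OWN h \<and> kap' h = kap h"
  "\<And>x k. x \<in> V \<Longrightarrow> C' x k = C x k"
 shows "WF V H' nb nf A kap' C' B bo X"
proof -
 have s: "{h\<in>A. H' BK h = b} = {h\<in>A. H BK h = b}" for b using assms(3) by auto
 note D = WFD[OF assms(1)]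
 have f: "H' NX = H NX" "H' PV = H PV" "H' KEY = H KEY" "H' CNT = H CNT" "H' UP = H UP"
  "H' DN = H DN" "H' FS = H FS" using assms(2) by auto
 show ?thesis
 proof (rule WFI, goal_cases)
  case (6 x)
  thus ?case unfolding f using D(7) by blast
 next case (10 x k)
  thus ?case unfolding f using D(16) assms(4) by simp
 next case (13 b)
  thus ?case unfolding s using D(19) by blast
 qed (use D assms(3,4) in \<open>simp_all add: s f\<close>)
qed

text \<open>Keys are distinct within the list of an owner, so \<open>b\<close> is the only bucket
  with its owner and key, and changing its \<open>CNT\<close> changes exactly one entry of
  \<open>C\<close>.\<close>

lemma WF_cnt:
 assumes "WF V H nb nf A kap C B bo X" "b \<in> B"
 shows "WF V (H(CNT := (H CNT)(b := c))) nb nf A kap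
  (\<lambda>x k. if x = bo b \<and> k = H KEY b then c else C x k) B bo X"
proof -
 note D = WFD[OF assms(1)]
 have i: "b' = b" if "b' \<in> B" "bo b' = bo b" "H KEY b' = H KEY b" for b'
 proof -
  have "oring (H KEY) (H UP) (H DN) (bo b) {b'\<in>B. bo b' = bo b}" using D(7)[OF D(13)[OF assms(2)]] assms(2) by auto
  thus ?thesis using oring_inj that assms(2) by (metis (mono_tags, lifting) mem_Collect_eq)
 qed
 show ?thesis
 proof (rule WFI, goal_cases)
  case (9 b')
  thus ?case using D(13-15) i by auto
 next case (10 x k)
  thus ?case using D(16)[of x k] assms(2) by auto
 next case (6 x) thus ?case using D(7) by auto
 next case (7 b) thus ?case using D(8) by auto
 next case (8 h) thus ?case using D(9-12) by auto
 next case 11 thus ?case using D(17) by auto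
 next case 12 thus ?case using D(18) by auto
 next case 13 thus ?case using D(19) by auto
 qed (use D(1-6) in auto)
qed

text \<open>Zero memory cannot hold the self-pointers of an empty circle, so the head of a node is
  linked to itself at first use. The value 0 of \<open>UP\<close> marks an untouched node reliably:
  pointers of a circle lead to its head or to its buckets, and none of these is 0.\<close>

lemma WF_init_node:
 assumes "WF V H nb nf A kap C B bo X" "x \<in> V" "H UP x = 0"
 shows "WF V (H(UP := (H UP)(x := x), DN := (H DN)(x := x))) nb nf A kap C B bo X"
  "{b\<in>B. bo b = x} = {}"
proof -
 note D = WFD[OF assms(1)]
 show e: "{b\<in>B. bo b = x} = {}"
 proof (rule ccontr)
  assume ne: "{b\<in>B. bo b = x} \<noteq> {}"
  hence "ring (H UP) (H DN) x {b\<in>B. bo b = x}" using D(7)[OF assms(2)] oring_ring by auto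
  hence "H UP x \<in> insert x {b\<in>B. bo b = x}" using ring_closed(1) by blast
  thus False using assms(3) D(2)[OF assms(2)] WF_B_mod[OF assms(1)] by fastforce
 qed
 show "WF V (H(UP := (H UP)(x := x), DN := (H DN)(x := x))) nb nf A kap C B bo X"
 proof (rule WFI, goal_cases)
  case (6 y)
  show ?case
  proof (cases "y = x")
   case True
   have "oring (H KEY) ((H UP)(x := x)) ((H DN)(x := x)) x {b\<in>B. bo b = x}" unfolding e by (rule oring_empty) auto
   thus ?thesis using True by simp
  next case False
   show ?thesis
   proof (cases "H UP y = 0 \<and> H DN y = 0 \<and> {b\<in>B. bo b = y} = {}")
    case True
    thus ?thesis using False by auto
   next case nt: False
    hence "oring (H KEY) (H UP) (H DN) y {b\<in>B. bo b = y}" using D(7)[OF 6] by blast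
    hence "oring (H KEY) ((H UP)(x := x)) ((H DN)(x := x)) y {b\<in>B. bo b = y}"
     by (rule oring_cong) (use False D(2)[OF assms(2)] WF_B_mod[OF assms(1)] in fastforce)
    thus ?thesis by simp
   qed
  qed
 qed (use D in simp_all)
qed

text \<open>The frame part rests on identifiers: residues modulo 4 separate nodes, half-edges and
  buckets, and each bucket has one owner, so the lists of other owners miss the cells written. The
  count 0 is right because the gap hypothesis leaves no old bucket with key \<open>q\<close>; being
  empty, the new bucket joins the exceptions \<open>X\<close>.\<close>

lemma WF_newb:
 assumes wf: "WF V H nb nf A kap C B bo X" and x: "x \<in> V" and o: "oring (H KEY) (H UP) (H DN) x {b\<in>B. bo b = x}"
  and a: "a \<in> insert x {b\<in>B. bo b = x}" and q: "H KEY a < q"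
  and gap: "\<And>b. b \<in> B \<Longrightarrow> bo b = x \<Longrightarrow> H KEY b \<le> H KEY a \<or> q < H KEY b"
  and f: "f \<notin> B" "insert f B \<subseteq> bids nb'" and fs: "inj_on (H FS) {..<nf'}"
   "H FS ` {..<nf'} = bids nb' - insert f B"
 shows "WF V (H(UP := (H UP)(a := f, f := H UP a), DN := (H DN)(f := a, H UP a := f),
   KEY := (H KEY)(f := q), CNT := (H CNT)(f := 0), NX := (H NX)(f := f), PV := (H PV)(f := f)))
   nb' nf' A kap C (insert f B) (bo(f := x)) (insert f X)" (is "WF V ?H _ _ _ _ _ ?B ?bo _")
proof -
 note D = WFD[OF wf]
 have fm: "f mod 4 = 3" using f bids_mod by blast
 have fV: "f \<notin> V" using fm D(2) by fastforce
 have fA: "f \<notin> A" using fm D(5) by fastforce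
 have f0: "f \<noteq> 0" using fm by auto
 have Bm: "b mod 4 = 3" if "b \<in> B" for b using WF_B_mod[OF wf that] .
 have c: "H UP a \<in> insert x {b\<in>B. bo b = x}" using oring_ring[OF o] ring_closed(1) a by blast
 have Bx: "{b \<in> ?B. ?bo b = y} = (if y = x then insert f {b\<in>B. bo b = x} else {b\<in>B. bo b = y})" for y using f by auto
 show ?thesis
 proof (rule WFI, goal_cases)
  case (2 y)
  thus ?case using D(2,3) fV by auto
 next case (6 y)
  show ?case
  proof (cases "y = x")
   case True
   have "oring ((H KEY)(f := q)) ((H UP)(a := f, f := H UP a)) ((H DN)(f := a, H UP a := f)) x
     (insert f {b\<in>B. bo b = x})" by (rule oring_insert[OF o a]) (use x fV f q gap in auto)
   thus ?thesis unfolding Bx using True by simp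
  next case False
   have ny: "a \<noteq> i" "f \<noteq> i" "H UP a \<noteq> i" if "i \<in> insert y {b\<in>B. bo b = y}" for i
    using that a c 6 x False D(2)[OF x] D(2)[OF 6] Bm fm f(1) by fastforce+
   show ?thesis
   proof (cases "H UP y = 0 \<and> H DN y = 0 \<and> {b\<in>B. bo b = y} = {}")
    case True
    thus ?thesis unfolding Bx using False ny by auto
   next case nt: False
    hence "oring (H KEY) (H UP) (H DN) y {b\<in>B. bo b = y}" using D(7)[OF 6] by blast
    hence "oring ((H KEY)(f := q)) ((H UP)(a := f, f := H UP a))
      ((H DN)(f := a, H UP a := f)) y {b\<in>B. bo b = y}" by (rule oring_cong) (use ny in fastforce)
    thus ?thesis unfolding Bx using False by simp
   qed
  qed
 next case (7 b)
  show ?case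
  proof (cases "b = f")
   case True
   have e: "{h\<in>A. H BK h = f} = {}" using D(9) f(1) by blast
   have "ring ((H NX)(f := f)) ((H PV)(f := f)) f {h\<in>A. H BK h = f}" unfolding e by (rule ring_empty) auto
   thus ?thesis using True by simp
  next case False
   hence "ring (H NX) (H PV) b {h\<in>A. H BK h = b}" using D(8) 7 by auto
   hence "ring ((H NX)(f := f)) ((H PV)(f := f)) b {h\<in>A. H BK h = b}" by (rule ring_cong) (use False fA in auto)
   thus ?thesis by simp
  qed
 next case (8 h)
  thus ?case using D(9)[OF 8] D(10-12) f(1) by auto
 next case (9 b)
  have "C x q = 0" by (rule D(16)[OF x]) (use q gap in fastforce)
  thus ?case using 9 D(13-15) x q by auto
 next case (10 y k)
  have "H KEY b \<noteq> k" if "b \<in> B" "bo b = y" for b using 10(2)[of b] that f(1) by (cases "b = f") auto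
  thus ?case using D(16) 10(1) by blast
 next case 11 thus ?case using fs by simp
 next case 12 thus ?case using fs by simp
 next case (13 b)
  thus ?case using D(19)[of b] by auto
 qed (use D f f0 in \<open>auto\<close>)
qed

lemma WF_push:
 assumes wf: "WF V H nb nf A kap C B bo X" and a: "a \<in> B" and h: "h \<notin> A" "h mod 4 = 2" "H OWN h = bo a"
 shows "WF V (H(NX := (H NX)(a := h, h := H NX a), PV := (H PV)(h := a, H NX a := h),
   BK := (H BK)(h := a))) nb nf (insert h A) (kap(h := H KEY a)) C B bo (X - {a})"
  (is "WF V ?H _ _ ?A _ _ _ _ _")
proof -
 note D = WFD[OF wf]
 have hB: "h \<notin> B" using h WF_B_mod[OF wf] by fastforce
 have bkt: "{g \<in> ?A. ?H BK g = b} = (if b = a then insert h {g\<in>A. H BK g = a} else {g\<in>A. H BK g = b})" for b using h by auto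
 have c: "H NX a \<in> insert a {g\<in>A. H BK g = a}" using ring_closed(1)[OF D(8)[OF a]] by blast
 show ?thesis
 proof (rule WFI, goal_cases)
  case (7 b)
  show ?case
  proof (cases "b = a")
   case True
   have "ring ((H NX)(a := h, h := H NX a)) ((H PV)(h := a, H NX a := h)) a (insert h {g\<in>A. H BK g = a})"
    by (rule ring_push[OF D(8)[OF a]]) (use h hB a in auto)
   thus ?thesis unfolding bkt using True by simp
  next case False
   have ne: "i \<noteq> a" "i \<noteq> h" "i \<noteq> H NX a" if "i \<in> insert b {g\<in>A. H BK g = b}" for i
    using that False c a 7 h hB WF_B_mod[OF wf] D(5) by fastforce+
   have "ring ((H NX)(a := h, h := H NX a)) ((H PV)(h := a, H NX a := h)) b {g\<in>A. H BK g = b}"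
    by (rule ring_cong[OF D(8)[OF 7]]) (use ne in fastforce)
   thus ?thesis unfolding bkt using False by simp
  qed
 next case (6 x) thus ?case using D(7) by auto
 next case (8 g)
  thus ?case using D(9-12) a h D(13)[OF a] by auto
 next case (13 b)
  thus ?case unfolding bkt using D(19)[of b] by auto
 next case (10 y k)
  thus ?case using D(16)[of y k] by auto
 qed (use D h in auto)
qed

definition unlinked :: "nat \<Rightarrow> heap \<Rightarrow> fld \<Rightarrow> nat \<Rightarrow> nat" where
 "unlinked h H = H(NX := (H NX)(H PV h := H NX h), PV := (H PV)(H NX h := H PV h))"

definition freed :: "nat \<Rightarrow> nat \<Rightarrow> heap \<Rightarrow> fld \<Rightarrow> nat \<Rightarrow> nat" where
 "freed nf b H = H(UP := (H UP)(H DN b := H UP b), DN := (H DN)(H UP b := H DN b),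
  FS := (H FS)(nf := b))"

lemma WF_unlink:
 assumes wf: "WF V H nb nf A kap C B bo X" and h: "h \<in> A"
 shows "WF V (unlinked h H) nb nf (A - {h}) kap C B bo (insert (H BK h) X)"
proof -
 note D = WFD[OF wf]
 let ?b = "H BK h"
 have b: "?b \<in> B" using D(9) h by blast
 have hb: "h \<in> {g\<in>A. H BK g = ?b}" using h by simp
 have bkt: "{g \<in> A - {h}. H BK g = b} = (if b = ?b then {g\<in>A. H BK g = ?b} - {h} else {g\<in>A. H BK g = b})" for b by auto
 have c: "H NX h \<in> insert ?b {g\<in>A. H BK g = ?b}" "H PV h \<in> insert ?b {g\<in>A. H BK g = ?b}"
  using ring_closed(1,2)[OF D(8)[OF b]] hb by blast+
 have f: "unlinked h H f = H f" if "f \<noteq> NX" "f \<noteq> PV" for f using that unfolding unlinked_def by simp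
 have r: "ring (unlinked h H NX) (unlinked h H PV) b {g \<in> A - {h}. H BK g = b}" if B: "b \<in> B" for b
 proof (cases "b = ?b")
  case True
  show ?thesis unfolding bkt using ring_remove[OF D(8)[OF b] hb] True by (simp add: unlinked_def)
 next case False
  have ne: "i \<noteq> H NX h" "i \<noteq> H PV h" if "i \<in> insert b {g\<in>A. H BK g = b}" for i
   using that False c b B WF_B_mod[OF wf] D(5) by fastforce+
  have "ring (unlinked h H NX) (unlinked h H PV) b {g\<in>A. H BK g = b}"
   by (rule ring_cong[OF D(8)[OF B]]) (use ne in \<open>auto simp: unlinked_def\<close>)
  thus ?thesis unfolding bkt using False by simp
 qed
 show ?thesis
 proof (rule WFI, goal_cases)
  case (7 b)
  thus ?case using r[OF 7] f by simp
 next case (6 x) thus ?case using D(7) f by auto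
 next case (8 g)
  thus ?case using D(9-12) f by auto
 next case (13 b)
  thus ?case using D(19)[of b] f by auto
 next case (10 y k)
  thus ?case using D(16)[of y k] f by auto
 qed (use D f in auto)
qed

text \<open>A key without a bucket must have count 0, so a bucket may go only when its count is 0.
  The absence of records does not say this by itself; callers derive it from the fact that every
  live edge has a record.\<close>

lemma WF_free:
 assumes wf: "WF V H nb nf A kap C B bo X" and b: "b \<in> B" and e: "{h\<in>A. H BK h = b} = {}" and C: "C (bo b) (H KEY b) = 0"
 shows "WF V (freed nf b H) nb (nf + 1) A kap C (B - {b}) bo X"
proof -
 note D = WFD[OF wf]
 have f: "freed nf b H f = H f" if "f \<noteq> UP" "f \<noteq> DN" "f \<noteq> FS" for f using that unfolding freed_def by simp
 define x where "x = bo b"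
 have x: "x \<in> V" using D(13) b x_def by blast
 have bx: "b \<in> {b\<in>B. bo b = x}" using b x_def by simp
 have o: "oring (H KEY) (H UP) (H DN) x {b\<in>B. bo b = x}" using D(7)[OF x] bx by blast
 have Bx: "{b' \<in> B - {b}. bo b' = y} = (if y = x then {b\<in>B. bo b = x} - {b} else {b\<in>B. bo b = y})" for y using x_def by auto
 have c: "H UP b \<in> insert x {b\<in>B. bo b = x}" "H DN b \<in> insert x {b\<in>B. bo b = x}"
  using ring_closed(1,2)[OF oring_ring[OF o]] bx by blast+
 have Bm: "b mod 4 = 3" if "b \<in> B" for b using WF_B_mod[OF wf that] .
 show ?thesis
 proof (rule WFI, goal_cases)
  case (6 y)
  show ?case
  proof (cases "y = x")
   case True
   show ?thesis unfolding Bx using oring_remove[OF o bx] True by (simp add: freed_def)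
  next case False
   have ny: "H UP b \<noteq> i" "H DN b \<noteq> i" if "i \<in> insert y {b\<in>B. bo b = y}" for i
    using that c 6 x False D(2)[OF x] D(2)[OF 6] Bm by fastforce+
   show ?thesis
   proof (cases "H UP y = 0 \<and> H DN y = 0 \<and> {b\<in>B. bo b = y} = {}")
    case True
    thus ?thesis unfolding Bx using False ny by (auto simp: freed_def)
   next case nt: False
    hence "oring (H KEY) (H UP) (H DN) y {b\<in>B. bo b = y}" using D(7)[OF 6] by blast
    hence "oring (freed nf b H KEY) (freed nf b H UP) (freed nf b H DN) y {b\<in>B. bo b = y}"
     by (rule oring_cong) (use ny in \<open>fastforce simp: freed_def\<close>)
    thus ?thesis unfolding Bx using False by simp
   qed
  qed
 next case (8 h)
  thus ?case using D(9-12) f e by auto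
 next case (10 y k)
  show ?case
  proof (cases "y = x \<and> k = H KEY b")
   case True
   thus ?thesis using C x_def by simp
  next case False
   show ?thesis by (rule D(16)[OF 10(1)]) (use 10(2) f False x_def in auto)
  qed
 next case 11
  have "b \<notin> H FS ` {..<nf}" using D(18) b by auto
  thus ?case using D(17) by (auto simp: freed_def inj_on_def lessThan_Suc)
 next case 12
  have "b \<notin> H FS ` {..<nf}" using D(18) b by auto
  have "freed nf b H FS ` {..<nf + 1} = insert b (H FS ` {..<nf})" by (auto simp: freed_def lessThan_Suc image_iff)
  thus ?case using D(6,18) b by auto
 next case (13 b')
  thus ?case using D(19)[of b'] f by auto
 qed (use D f in auto)
qed

section \<open>Programs on buckets and their verification\<close>

abbreviation "rr x \<equiv> Reg x"

definition alloc :: com where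
 "alloc = Cond (Less (Const 0) (rr ''nf''))
  (Assign ''nf'' (Minus (rr ''nf'') (Const 1)) ;; Assign ''f'' (ld FS (rr ''nf'')))
  (Assign ''f'' (Plus (Times (Const 4) (rr ''nb'')) (Const 3)) ;;
   Assign ''nb'' (Plus (rr ''nb'') (Const 1)))"

definition linkb :: com where
 "linkb = Assign ''c'' (ld UP (rr ''a'')) ;; st UP (rr ''a'') (rr ''f'') ;; st DN (rr ''f'') (rr ''a'') ;;
  st UP (rr ''f'') (rr ''c'') ;; st DN (rr ''c'') (rr ''f'') ;; st KEY (rr ''f'') (rr ''q'') ;;
  st CNT (rr ''f'') (Const 0) ;; st NX (rr ''f'') (rr ''f'') ;; st PV (rr ''f'') (rr ''f'') ;;
  Assign ''a'' (rr ''f'')"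

text \<open>Register \<open>a\<close> is a starting point for a downward search, so the caller has
  to place it at or above the largest key that does not exceed \<open>q\<close>.\<close>

definition getb :: com where
 "getb = While (Less (rr ''q'') (ld KEY (rr ''a''))) (Assign ''a'' (ld DN (rr ''a''))) ;;
  Cond (Less (ld KEY (rr ''a'')) (rr ''q'')) (alloc ;; linkb) Skip"

definition push :: com where
 "push = Assign ''c'' (ld NX (rr ''a'')) ;; st NX (rr ''a'') (rr ''h'') ;; st PV (rr ''h'') (rr ''a'') ;;
  st NX (rr ''h'') (rr ''c'') ;; st PV (rr ''c'') (rr ''h'') ;; st BK (rr ''h'') (rr ''a'')"

definition unlink :: com where
 "unlink = Assign ''p'' (ld PV (rr ''h'')) ;; Assign ''c'' (ld NX (rr ''h'')) ;;
  st NX (rr ''p'') (rr ''c'') ;; st PV (rr ''c'') (rr ''p'') ;; Assign ''b'' (ld BK (rr ''h''))"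

definition freeb :: com where
 "freeb = Assign ''p'' (ld DN (rr ''b'')) ;; Assign ''c'' (ld UP (rr ''b'')) ;;
  st UP (rr ''p'') (rr ''c'') ;; st DN (rr ''c'') (rr ''p'') ;; st FS (rr ''nf'') (rr ''b'') ;;
  Assign ''nf'' (Plus (rr ''nf'') (Const 1))"

definition remove :: com where
 "remove = unlink ;; Cond (Equal (ld NX (rr ''b'')) (rr ''b'')) freeb Skip"

definition nodes :: "nat \<Rightarrow> nat set" where "nodes n = (\<lambda>j. 4 * j + 1) ` {..<2 * n}"

lemma nodes_less: "x \<in> nodes n \<Longrightarrow> x < 8 * n" unfolding nodes_def by auto

lemma bids_less: "b \<in> bids nb \<Longrightarrow> b < 4 * nb" unfolding bids_def by auto

lemma card_bids: "card (bids nb) = nb" "finite (bids nb)" unfolding bids_def by (auto simp: card_image inj_on_def)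

lemma bids_Suc: "bids (Suc nb) = insert (4 * nb + 3) (bids nb)" unfolding bids_def by (simp add: lessThan_Suc)

lemma WF_nf:
 assumes "WF V H nb nf A kap C B bo X"
 shows "nf + card B = nb" "finite B"
proof -
 show fB: "finite B" using WFD(6)[OF assms] card_bids(2) finite_subset by blast
 have "nf = card (H FS ` {..<nf})" using WFD(17)[OF assms] by (simp add: card_image)
 also have "\<dots> = nb - card B" using WFD(6,18)[OF assms] fB card_bids by (simp add: card_Diff_subset)
 finally show "nf + card B = nb" using card_mono[OF card_bids(2) WFD(6)[OF assms]] card_bids by simp
qed

lemma WF_card:
 assumes "WF V H nb nf A kap C B bo {}"
 shows "card B \<le> card A"
proof -
 have "B \<subseteq> H BK ` A" using WFD(19)[OF assms] by fastforce
 thus ?thesis using WFD(1)[OF assms] surj_card_le by blast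
qed

lemma WF_mono: "WF V H nb nf A kap C B bo X \<Longrightarrow> X \<subseteq> Y \<Longrightarrow> WF V H nb nf A kap C B bo Y"
 unfolding WF_def by (elim conjE) (intro conjI; (assumption | blast))

text \<open>A cursor over one bucket. \<open>D \<union> T\<close> is always the whole bucket,
  because an element removed on the way leaves \<open>A\<close> as well.\<close>

definition it :: "heap \<Rightarrow> nat set \<Rightarrow> nat \<Rightarrow> nat set \<Rightarrow> nat set \<Rightarrow> nat \<Rightarrow> bool" where
 "it H A b D T c \<longleftrightarrow> D \<union> T = {h\<in>A. H BK h = b} \<and> iter (H NX) (H PV) b D T c"

lemma it_start: "WF V H nb nf A kap C B bo X \<Longrightarrow> b \<in> B \<Longrightarrow> it H A b {} {h\<in>A. H BK h = b} (H NX b)"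
 unfolding it_def using iter_start WFD(8) by blast

lemma it_keep: "it H A b D T c \<Longrightarrow> c \<noteq> b \<Longrightarrow> it H A b (insert c D) (T - {c}) (H NX c)"
 unfolding it_def using iter_keep[of "H NX" "H PV" b D T c] iter_mem[of "H NX" "H PV" b D T c] by blast

lemma it_cong:
 assumes "it H A b D T c" "\<And>h. h \<in> A \<Longrightarrow> H' BK h = H BK h"
  "\<And>i. i \<in> insert b {h\<in>A. H BK h = b} \<Longrightarrow> H' NX i = H NX i \<and> H' PV i = H PV i"
 shows "it H' A b D T c"
proof -
 have "{h\<in>A. H' BK h = b} = {h\<in>A. H BK h = b}" using assms(2) by auto
 thus ?thesis using assms iter_cong[of "H NX" "H PV" b D T c "H' NX" "H' PV"] unfolding it_def by simp
qed

lemma it_unlink: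
 assumes "it H A b D T h" "h \<noteq> b"
 shows "it (unlinked h H) (A - {h}) b D (T - {h}) (H NX h)"
proof -
 have i: "iter (H NX) (H PV) b D T h" and u: "D \<union> T = {h\<in>A. H BK h = b}" using assms unfolding it_def by auto
 have "h \<in> T" "D \<inter> T = {}" using iter_mem[OF i] assms iter_disj[OF i] by auto
 hence "D \<union> (T - {h}) = {g\<in>A - {h}. H BK g = b}" using u by blast
 thus ?thesis using iter_remove[OF i assms(2)] unfolding it_def unlinked_def by simp
qed

lemma it_unlink_other:
 assumes wf: "WF V H nb nf A kap C B bo X" and "it H A b D T c" "h \<in> A" "b \<in> B" "b \<noteq> H BK h"
 shows "it (unlinked h H) (A - {h}) b D T c"
proof -
 note D = WFD[OF wf]
 have c: "H NX h \<in> insert (H BK h) {g\<in>A. H BK g = H BK h}" "H PV h \<in> insert (H BK h) {g\<in>A. H BK g = H BK h}"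
  using ring_closed(1,2)[OF D(8)[OF D(9)[OF assms(3)]]] assms(3) by blast+
 have ne: "i \<noteq> H NX h" "i \<noteq> H PV h" if "i \<in> insert b {g\<in>A. H BK g = b}" for i
  using that assms c WF_B_mod[OF wf] D(5) D(9)[OF assms(3)] by fastforce+
 have "it (unlinked h H) A b D T c" by (rule it_cong[OF assms(2)]) (use ne in \<open>auto simp: unlinked_def\<close>)
 moreover have "{g\<in>A - {h}. H BK g = b} = {g\<in>A. H BK g = b}" using assms(5) by blast
 ultimately show ?thesis unfolding it_def unlinked_def by simp
qed

definition pushed :: "nat \<Rightarrow> nat \<Rightarrow> heap \<Rightarrow> fld \<Rightarrow> nat \<Rightarrow> nat" where
 "pushed a h H = H(NX := (H NX)(a := h, h := H NX a), PV := (H PV)(h := a, H NX a := h),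
   BK := (H BK)(h := a))"

lemma it_push_other:
 assumes wf: "WF V H nb nf A kap C B bo X" and "it H A b D T c" "h \<notin> A" "h mod 4 = 2" "a \<in> B" "b \<in> B" "b \<noteq> a"
 shows "it (pushed a h H) (insert h A) b D T c"
proof -
 note D = WFD[OF wf]
 have c: "H NX a \<in> insert a {g\<in>A. H BK g = a}" using ring_closed(1)[OF D(8)[OF assms(5)]] by blast
 have hB: "h \<notin> B" using assms WF_B_mod[OF wf] by fastforce
 have ne: "i \<noteq> a" "i \<noteq> h" "i \<noteq> H NX a" if "i \<in> insert b {g\<in>A. H BK g = b}" for i
  using that assms c hB WF_B_mod[OF wf] D(5) by fastforce+
 have "it (pushed a h H) A b D T c" by (rule it_cong[OF assms(2)]) (use ne assms(3) in \<open>auto simp: pushed_def\<close>)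
 moreover have "{g\<in>insert h A. pushed a h H BK g = b} = {g\<in>A. pushed a h H BK g = b}" using assms(3,7) by (auto simp: pushed_def)
 ultimately show ?thesis unfolding it_def by simp
qed

lemma fld_eqI:
 assumes "H NX = H' NX" "H PV = H' PV" "H BK = H' BK" "H OWN = H' OWN" "H SG = H' SG"
  "H KEY = H' KEY" "H CNT = H' CNT" "H UP = H' UP" "H DN = H' DN" "H LEV = H' LEV"
  "H SLOT = H' SLOT" "H WL = H' WL" "H INW = H' INW" "H FS = H' FS"
 shows "H = (H' :: fld \<Rightarrow> 'a)"
proof
 show "H f = H' f" for f using assms by (cases f) simp_all
qed

definition linked :: "nat \<Rightarrow> nat \<Rightarrow> nat \<Rightarrow> heap \<Rightarrow> fld \<Rightarrow> nat \<Rightarrow> nat" where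
 "linked a f q H = H(UP := (H UP)(a := f, f := H UP a), DN := (H DN)(f := a, H UP a := f),
   KEY := (H KEY)(f := q), CNT := (H CNT)(f := 0), NX := (H NX)(f := f), PV := (H PV)(f := f))"

text \<open>Identifiers in use are below \<open>M\<close> and each owns 16 cells. \<open>M\<close>
  is arbitrary here because it has to follow the number of records; \<open>W\<close> leaves room for
  every address and every key.\<close>

locale mach = ram \<pi> M W for \<pi> M W +
 fixes n L :: nat
 assumes MW: "16 * M + L + 3 \<le> W" and nM: "8 * n + 8 \<le> M"
begin

abbreviation "WFs s A kap C B bo X \<equiv>
 WF (nodes n) (hp s) (regs s ''nb'') (regs s ''nf'') A kap C B bo X"

text \<open>If the free stack is empty, all \<open>nb\<close> buckets are in use; none of them is
  empty, so there are at most \<open>card A\<close> of them, and the fresh identifier still lies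
  below \<open>M\<close>.\<close>

lemma run_alloc:
 assumes "okst s" and wf: "WFs s A kap C B bo {}" and b: "4 * regs s ''nb'' \<le> M" "4 * card A + 3 < M"
 shows "run alloc s (\<lambda>t s'. regs s' ''f'' \<notin> B \<and> insert (regs s' ''f'') B \<subseteq> bids (regs s' ''nb'') \<and>
  inj_on (hp s FS) {..<regs s' ''nf''} \<and>
  hp s FS ` {..<regs s' ''nf''} = bids (regs s' ''nb'') - insert (regs s' ''f'') B \<and>
  hp s' = hp s \<and> 4 * regs s' ''nb'' \<le> M \<and> eqx {''f'', ''nb'', ''nf''} s s' \<and> t \<le> 3)"
proof (cases "regs s ''nf'' = 0")
 case True
 have nb: "regs s ''nb'' = card B" using WF_nf[OF wf] True by simp
 have B: "B = bids (regs s ''nb'')" using WFD(6,18)[OF wf] True by auto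
 have l: "4 * regs s ''nb'' + 3 < M" using nb WF_card[OF wf] b by simp
 hence l': "4 * regs s ''nb'' + 4 \<le> M" by simp
 have f: "4 * regs s ''nb'' + 3 \<notin> B" unfolding B bids_def by auto
 have B': "insert (4 * regs s ''nb'' + 3) B = bids (Suc (regs s ''nb''))" unfolding bids_Suc B ..
 show ?thesis
 proof (rule run_fin[OF assms(1)])
  fix t assume t: "t \<le> cost alloc"
  have "regs (fin \<pi> alloc s) ''f'' = 4 * regs s ''nb'' + 3"
   "regs (fin \<pi> alloc s) ''nb'' = Suc (regs s ''nb'')" "regs (fin \<pi> alloc s) ''nf'' = 0"
   "hp (fin \<pi> alloc s) = hp s" "eqx {''f'', ''nb'', ''nf''} s (fin \<pi> alloc s)" "t \<le> 3"
   using True t by (simp_all add: alloc_def eqx_def)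
  thus "regs (fin \<pi> alloc s) ''f'' \<notin> B \<and> insert (regs (fin \<pi> alloc s) ''f'') B \<subseteq> bids (regs (fin \<pi> alloc s) ''nb'') \<and>
  inj_on (hp s FS) {..<regs (fin \<pi> alloc s) ''nf''} \<and>
  hp s FS ` {..<regs (fin \<pi> alloc s) ''nf''} = bids (regs (fin \<pi> alloc s) ''nb'') - insert (regs (fin \<pi> alloc s) ''f'') B \<and>
  hp (fin \<pi> alloc s) = hp s \<and> 4 * regs (fin \<pi> alloc s) ''nb'' \<le> M \<and>
  eqx {''f'', ''nb'', ''nf''} s (fin \<pi> alloc s) \<and> t \<le> 3" using f B' l' by simp
 qed (use True l MW in \<open>simp_all add: alloc_def\<close>)
next case False
 define m where "m = regs s ''nf'' - 1"
 have m: "regs s ''nf'' = Suc m" using False m_def by simp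
 have f: "hp s FS m \<in> bids (regs s ''nb'') - B" using WFD(18)[OF wf] m by auto
 have i: "inj_on (hp s FS) {..<Suc m}" using WFD(17)[OF wf] m by simp
 hence "hp s FS ` {..<m} = hp s FS ` {..<Suc m} - {hp s FS m}" by (auto simp: inj_on_def lessThan_Suc)
 hence im: "hp s FS ` {..<m} = bids (regs s ''nb'') - insert (hp s FS m) B" using WFD(18)[OF wf] m by auto
 show ?thesis
 proof (rule run_fin[OF assms(1)])
  fix t assume t: "t \<le> cost alloc"
  have "regs (fin \<pi> alloc s) ''f'' = hp s FS m"
   "regs (fin \<pi> alloc s) ''nb'' = regs s ''nb''" "regs (fin \<pi> alloc s) ''nf'' = m"
   "hp (fin \<pi> alloc s) = hp s" "eqx {''f'', ''nb'', ''nf''} s (fin \<pi> alloc s)" "t \<le> 3"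
   using m t by (simp_all add: alloc_def eqx_def mem_adr)
  moreover have "inj_on (hp s FS) {..<m}" using i by (rule inj_on_subset) auto
  ultimately show "regs (fin \<pi> alloc s) ''f'' \<notin> B \<and> insert (regs (fin \<pi> alloc s) ''f'') B \<subseteq> bids (regs (fin \<pi> alloc s) ''nb'') \<and>
  inj_on (hp s FS) {..<regs (fin \<pi> alloc s) ''nf''} \<and>
  hp s FS ` {..<regs (fin \<pi> alloc s) ''nf''} = bids (regs (fin \<pi> alloc s) ''nb'') - insert (regs (fin \<pi> alloc s) ''f'') B \<and>
  hp (fin \<pi> alloc s) = hp s \<and> 4 * regs (fin \<pi> alloc s) ''nb'' \<le> M \<and>
  eqx {''f'', ''nb'', ''nf''} s (fin \<pi> alloc s) \<and> t \<le> 3" using f im b(1) WFD(6)[OF wf] by simp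
 qed (use m in \<open>simp_all add: alloc_def\<close>)
qed

lemma run_linkb:
 assumes "okst s" "regs s ''a'' < M" "regs s ''f'' < M" "hp s UP (regs s ''a'') < M"
 shows "run linkb s (\<lambda>t s'. hp s' = linked (regs s ''a'') (regs s ''f'') (regs s ''q'') (hp s) \<and>
  regs s' ''a'' = regs s ''f'' \<and> eqx {''a'', ''c''} s s' \<and> t \<le> 10)" by (rule run_fin[OF assms(1)]; (intro conjI fld_eqI)?)
  (use assms MW in \<open>simp_all add: linkb_def linked_def eqx_def mem_adr adr_less\<close>)

lemma run_push:
 assumes "okst s" "regs s ''a'' < M" "regs s ''h'' < M" "hp s NX (regs s ''a'') < M"
 shows "run push s (\<lambda>t s'. hp s' = pushed (regs s ''a'') (regs s ''h'') (hp s) \<and> eqx {''c''} s s' \<and> t \<le> 6)"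
 by (rule run_fin[OF assms(1)]; (intro conjI fld_eqI)?)
  (use assms MW in \<open>simp_all add: push_def pushed_def eqx_def mem_adr adr_less Let_def\<close>)

lemma run_unlink:
 assumes "okst s" "hp s NX (regs s ''h'') < M" "hp s PV (regs s ''h'') < M"
 shows "run unlink s (\<lambda>t s'. hp s' = unlinked (regs s ''h'') (hp s) \<and>
  regs s' ''b'' = hp s BK (regs s ''h'') \<and> eqx {''p'', ''c'', ''b''} s s' \<and> t \<le> 5)"
 by (rule run_fin[OF assms(1)]; (intro conjI fld_eqI)?)
  (use assms MW in \<open>simp_all add: unlink_def unlinked_def eqx_def mem_adr adr_less Let_def\<close>)

lemma run_freeb:
 assumes "okst s" "hp s UP (regs s ''b'') < M" "hp s DN (regs s ''b'') < M" "regs s ''nf'' < M"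
 shows "run freeb s (\<lambda>t s'. hp s' = freed (regs s ''nf'') (regs s ''b'') (hp s) \<and>
  regs s' ''nf'' = regs s ''nf'' + 1 \<and> eqx {''p'', ''c'', ''nf''} s s' \<and> t \<le> 6)"
 by (rule run_fin[OF assms(1)]; (intro conjI fld_eqI)?)
  (use assms MW in \<open>simp_all add: freeb_def freed_def eqx_def mem_adr adr_less Let_def\<close>)

text \<open>Each step lowers the key by at least one, which pays for it, and the head with its key 0
  stops the walk at the latest. The invariant is that no bucket with key at most \<open>q\<close>
  lies above the current position.\<close>

lemma run_walk:
 assumes "okst s" and x: "x \<in> nodes n" and o: "oring (hp s KEY) (hp s UP) (hp s DN) x X"
  and a: "regs s ''a'' \<in> insert x X" and kx: "hp s KEY x = 0"
  and g: "\<And>b. b \<in> X \<Longrightarrow> hp s KEY b \<le> regs s ''q'' \<Longrightarrow> hp s KEY b \<le> hp s KEY (regs s ''a'')"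
 shows "run (While (Less (rr ''q'') (ld KEY (rr ''a''))) (Assign ''a'' (ld DN (rr ''a'')))) s
  (\<lambda>t s'. hp s' = hp s \<and> eqx {''a''} s s' \<and> regs s' ''a'' \<in> insert x X \<and>
   hp s KEY (regs s' ''a'') \<le> regs s ''q'' \<and>
   (\<forall>b\<in>X. hp s KEY b \<le> hp s KEY (regs s' ''a'') \<or> regs s ''q'' < hp s KEY b) \<and>
   t \<le> 2 * (hp s KEY (regs s ''a'') - regs s ''q'') + 1)"
proof -
 let ?q = "regs s ''q''" and ?K = "hp s KEY"
 let ?I = "\<lambda>a s'. hp s' = hp s \<and> eqx {''a''} s s' \<and> regs s' ''a'' = a \<and> a \<in> insert x X \<and>
   (\<forall>b\<in>X. ?K b \<le> ?q \<longrightarrow> ?K b \<le> ?K a)"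
 have "run (While (Less (rr ''q'') (ld KEY (rr ''a''))) (Assign ''a'' (ld DN (rr ''a'')))) s
  (\<lambda>t s'. \<exists>a. ?I a s' \<and> \<not> bval \<pi> (Less (rr ''q'') (ld KEY (rr ''a''))) s' \<and>
   real t + 2 * real (?K a - ?q) \<le> 2 * real (?K (regs s ''a'') - ?q) + 1)"
 proof (rule run_while[where I = ?I and g = "\<lambda>a. 2 * real (?K a - ?q)"])
  fix a s' assume I: "?I a s'" and ok: "okst s'" and b: "bval \<pi> (Less (rr ''q'') (ld KEY (rr ''a''))) s'"
  have q: "regs s' ''q'' = ?q" using I by (simp add: eqx_def)
  have ak: "?q < ?K a" using b I q by (simp add: mem_adr)
  hence aX: "a \<in> X" using I kx by auto
  note d = oring_down[OF o aX]
  have "2 * real (?K (hp s DN a) - ?q) + 2 \<le> 2 * real (?K a - ?q)" using d(2) ak by linarith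
  moreover have "\<forall>b\<in>X. ?K b \<le> ?q \<longrightarrow> ?K b \<le> ?K (hp s DN a)" using d(3) ak by (meson le_less_trans)
  ultimately show "run (Assign ''a'' (ld DN (rr ''a''))) s' (\<lambda>t s'. \<exists>a'. ?I a' s' \<and>
    real t + 1 + 2 * real (?K a' - ?q) \<le> 2 * real (?K a - ?q))"
   by (intro run_fin) (use ok I d(1) in \<open>auto simp: mem_adr eqx_def\<close>)
 qed (use assms in \<open>auto simp: eqx_def\<close>)
 thus ?thesis
 proof (rule run_mono)
  fix t s' assume "\<exists>a. ?I a s' \<and> \<not> bval \<pi> (Less (rr ''q'') (ld KEY (rr ''a''))) s' \<and>
   real t + 2 * real (?K a - ?q) \<le> 2 * real (?K (regs s ''a'') - ?q) + 1"
  then obtain a where I: "?I a s'" and b: "\<not> bval \<pi> (Less (rr ''q'') (ld KEY (rr ''a''))) s'"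
   and t: "real t + 2 * real (?K a - ?q) \<le> 2 * real (?K (regs s ''a'') - ?q) + 1" by blast
  have q: "regs s' ''q'' = ?q" using I by (simp add: eqx_def)
  have "real t \<le> real (2 * (?K (regs s ''a'') - ?q) + 1)" using t by simp
  hence "t \<le> 2 * (?K (regs s ''a'') - ?q) + 1" by (simp only: of_nat_le_iff)
  thus "hp s' = hp s \<and> eqx {''a''} s s' \<and> regs s' ''a'' \<in> insert x X \<and>
   hp s KEY (regs s' ''a'') \<le> regs s ''q'' \<and>
   (\<forall>b\<in>X. hp s KEY b \<le> hp s KEY (regs s' ''a'') \<or> regs s ''q'' < hp s KEY b) \<and>
   t \<le> 2 * (hp s KEY (regs s ''a'') - regs s ''q'') + 1" using I b q by (auto simp: mem_adr not_less)
 qed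
qed

lemma run_skip: "okst s \<Longrightarrow> Q 1 s \<Longrightarrow> run Skip s Q" unfolding run_def by (intro exI[of _ "[s]"]) (auto intro: exec.intros)

lemma V_less: "x \<in> nodes n \<Longrightarrow> x < M" using nodes_less nM by fastforce

lemma B_less: "WFs s A kap C B bo X \<Longrightarrow> 4 * regs s ''nb'' \<le> M \<Longrightarrow> b \<in> B \<Longrightarrow> b < M"
 using WFD(6) bids_less by fastforce

text \<open>The clause on \<open>NX\<close> and \<open>PV\<close> is there for cursors: old buckets
  and half-edges keep their list pointers, so an iteration in progress survives the creation of a
  bucket.\<close>

lemma run_getb:
 assumes ok: "okst s" and wf: "WFs s A kap C B bo {}" and x: "x \<in> nodes n" and o: "oring (hp s KEY) (hp s UP) (hp s DN) x {b\<in>B. bo b = x}"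
  and a: "regs s ''a'' \<in> insert x {b\<in>B. bo b = x}"
  and g: "\<And>b. b \<in> B \<Longrightarrow> bo b = x \<Longrightarrow> hp s KEY b \<le> regs s ''q'' \<Longrightarrow> hp s KEY b \<le> hp s KEY (regs s ''a'')"
  and q: "1 \<le> regs s ''q''" and bd: "4 * regs s ''nb'' \<le> M" "4 * card A + 3 < M"
 shows "run getb s (\<lambda>t s'. \<exists>B' bo'. WFs s' A kap C B' bo' {regs s' ''a''} \<and> regs s' ''a'' \<in> B' \<and>
  bo' (regs s' ''a'') = x \<and> hp s' KEY (regs s' ''a'') = regs s ''q'' \<and> B \<subseteq> B' \<and>
  (\<forall>b\<in>B. bo' b = bo b \<and> hp s' KEY b = hp s KEY b \<and> hp s' CNT b = hp s CNT b) \<and>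
  4 * regs s' ''nb'' \<le> M \<and>
  (\<forall>f\<in>{BK, OWN, SG, LEV, SLOT, WL, INW}. hp s' f = hp s f) \<and>
  (\<forall>i. i mod 4 = 2 \<or> i \<in> B \<longrightarrow> hp s' NX i = hp s NX i \<and> hp s' PV i = hp s PV i) \<and>
  eqx halfrs s s' \<and>
  t \<le> 2 * (hp s KEY (regs s ''a'') - regs s ''q'') + 15)"
  (is "run getb s ?Q")
proof -
 let ?q = "regs s ''q''" and ?k = "2 * (hp s KEY (regs s ''a'') - regs s ''q'') + 1"
 have kx: "hp s KEY x = 0" using WFD(3)[OF wf x] .
 show ?thesis unfolding getb_def
 proof (rule run_seq, rule run_mono[OF run_walk[OF ok x o a kx g]], goal_cases)
  case (1 b) thus ?case by simp
 next case (2 b) thus ?case by simp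
 next case (3 b) thus ?case by simp
 next case (4 t1 s1)
  hence h1: "hp s1 = hp s" and e1: "eqx {''a''} s s1" and a1: "regs s1 ''a'' \<in> insert x {b\<in>B. bo b = x}"
   and k1: "hp s KEY (regs s1 ''a'') \<le> ?q"
   and g1: "\<And>b. b \<in> B \<Longrightarrow> bo b = x \<Longrightarrow> hp s KEY b \<le> hp s KEY (regs s1 ''a'') \<or> ?q < hp s KEY b"
   and t1: "t1 \<le> ?k" and ok1: "okst s1" by simp_all
  have q1: "regs s1 ''q'' = ?q" "regs s1 ''nb'' = regs s ''nb''" "regs s1 ''nf'' = regs s ''nf''" using e1 by (simp_all add: eqx_def)
  have wf1: "WFs s1 A kap C B bo {}" using wf h1 q1 by simp
  show ?case
  proof (rule run_cond[OF ok1])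
   assume b: "bval \<pi> (Less (ld KEY (rr ''a'')) (rr ''q'')) s1"
   hence lt: "hp s KEY (regs s1 ''a'') < ?q" using h1 q1 by (simp add: mem_adr)
   have bd1: "4 * regs s1 ''nb'' \<le> M" using bd q1 by simp
   show "run (alloc ;; linkb) s1 (\<lambda>t. ?Q (t1 + Suc t))"
   proof (rule run_seq, rule run_mono[OF run_alloc[OF ok1 wf1 bd1 bd(2)]], goal_cases)
    case (1 t2 s2)
    hence f: "regs s2 ''f'' \<notin> B" "insert (regs s2 ''f'') B \<subseteq> bids (regs s2 ''nb'')"
     "inj_on (hp s FS) {..<regs s2 ''nf''}"
     "hp s FS ` {..<regs s2 ''nf''} = bids (regs s2 ''nb'') - insert (regs s2 ''f'') B"
     and h2: "hp s2 = hp s" and nb2: "4 * regs s2 ''nb'' \<le> M"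
     and e2: "eqx {''f'', ''nb'', ''nf''} s1 s2" and t2: "t2 \<le> 3" and ok2: "okst s2" using h1 by simp_all
    have r2: "regs s2 ''a'' = regs s1 ''a''" "regs s2 ''q'' = ?q" using e2 q1 by (simp_all add: eqx_def)
    let ?a = "regs s1 ''a''" and ?f = "regs s2 ''f''"
    have aM: "?a < M" using a1 V_less[OF x] B_less[OF wf bd(1)] by auto
    have "hp s UP ?a \<in> insert x {b\<in>B. bo b = x}" using ring_closed(1)[OF oring_ring[OF o] a1] .
    hence uM: "hp s UP ?a < M" using V_less[OF x] B_less[OF wf bd(1)] by auto
    have fM: "?f < M" using f(2) bids_less nb2 by fastforce
    have fm: "?f mod 4 = 3" using f(2) bids_mod by blast
    have wf3: "WF (nodes n) (linked ?a ?f ?q (hp s)) (regs s2 ''nb'') (regs s2 ''nf'') A kap C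
      (insert ?f B) (bo(?f := x)) (insert ?f {})" unfolding linked_def by (rule WF_newb[OF wf x o a1 lt g1 f])
    show ?case
    proof (rule run_mono[OF run_linkb[OF ok2]], goal_cases)
     case (4 t3 s3)
     hence h3: "hp s3 = linked ?a ?f ?q (hp s)" and e3: "eqx {''a'', ''c''} s2 s3"
      and a3: "regs s3 ''a'' = ?f" and t3: "t3 \<le> 10" using h2 r2 by simp_all
     have n3: "regs s3 ''nb'' = regs s2 ''nb''" "regs s3 ''nf'' = regs s2 ''nf''" using e3 by (simp_all add: eqx_def)
     have fB: "i \<noteq> ?f" if "i mod 4 = 2 \<or> i \<in> B" for i using that fm f(1) by auto
     have "eqx halfrs s s3" using e1 e2 e3 by (simp add: eqx_def)
     thus ?case by (intro exI[of _ "insert ?f B"] exI[of _ "bo(?f := x)"])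
       (use wf3 h3 a3 n3 nb2 fB t1 t2 t3 in \<open>simp add: linked_def subset_insertI\<close>)
    qed (use aM fM uM r2 h2 in simp_all)
   qed
  next
   assume b: "\<not> bval \<pi> (Less (ld KEY (rr ''a'')) (rr ''q'')) s1"
   hence eq: "hp s KEY (regs s1 ''a'') = ?q" using h1 q1 k1 by (simp add: mem_adr)
   hence aB: "regs s1 ''a'' \<in> B" "bo (regs s1 ''a'') = x" using a1 kx q by auto
   have w: "WFs s1 A kap C B bo {regs s1 ''a''}" using WF_mono[OF wf1] by simp
   have e: "eqx halfrs s s1" using e1 by (simp add: eqx_def)
   have "?Q (t1 + Suc 1) s1" by (intro exI[of _ B] exI[of _ bo]) (use w aB eq h1 e t1 bd q1 in simp)
   thus "run Skip s1 (\<lambda>t. ?Q (t1 + Suc t))" by (rule run_skip[OF ok1])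
  qed
 qed
qed

text \<open>An emptied bucket shows itself by its self-pointer and is freed at once, so buckets
  outside \<open>X\<close> stay nonempty. \<open>single\<close> supplies the count 0 that freeing
  demands.\<close>

lemma run_remove:
 assumes ok: "okst s" and wf: "WFs s A kap C B bo X" and h: "regs s ''h'' \<in> A" and X: "hp s BK (regs s ''h'') \<notin> X"
  and single: "{g\<in>A. hp s BK g = hp s BK (regs s ''h'')} = {regs s ''h''} \<Longrightarrow>
   C (hp s OWN (regs s ''h'')) (kap (regs s ''h'')) = 0" and bd: "4 * regs s ''nb'' \<le> M" "\<And>g. g \<in> A \<Longrightarrow> g < M"
 shows "run remove s (\<lambda>t s'. \<exists>B'. WFs s' (A - {regs s ''h''}) kap C B' bo X \<and>
  B' = (if {g\<in>A. hp s BK g = hp s BK (regs s ''h'')} = {regs s ''h''} then B - {hp s BK (regs s ''h'')} else B) \<and>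
  (\<forall>f\<in>{BK, OWN, SG, KEY, CNT, LEV, SLOT, WL, INW}. hp s' f = hp s f) \<and>
  (\<forall>f\<in>{NX, PV}. hp s' f = unlinked (regs s ''h'') (hp s) f) \<and>
  regs s' ''nb'' = regs s ''nb'' \<and> eqx {''p'', ''c'', ''b'', ''nf''} s s' \<and> t \<le> 12)"
  (is "run remove s ?Q")
proof -
 let ?h = "regs s ''h''" and ?b = "hp s BK (regs s ''h'')" and ?H = "unlinked (regs s ''h'') (hp s)"
 note D = WFD[OF wf]
 have bB: "?b \<in> B" using D(9)[OF h] .
 have hb: "?h \<in> {g\<in>A. hp s BK g = ?b}" using h by simp
 have c: "hp s NX ?h \<in> insert ?b {g\<in>A. hp s BK g = ?b}" "hp s PV ?h \<in> insert ?b {g\<in>A. hp s BK g = ?b}"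
  using ring_closed(1,2)[OF D(8)[OF bB]] hb by blast+
 have cM: "hp s NX ?h < M" "hp s PV ?h < M" using c B_less[OF wf bd(1) bB] bd(2) by auto
 have wf1: "WF (nodes n) ?H (regs s ''nb'') (regs s ''nf'') (A - {?h}) kap C B bo (insert ?b X)" by (rule WF_unlink[OF wf h])
 have Hf: "?H f = hp s f" if "f \<noteq> NX" "f \<noteq> PV" for f using that by (simp add: unlinked_def)
 have bkt: "{g\<in>A - {?h}. ?H BK g = ?b} = {g\<in>A. hp s BK g = ?b} - {?h}" using Hf by auto
 have emp: "?H NX ?b = ?b \<longleftrightarrow> {g\<in>A. hp s BK g = ?b} = {?h}" using ring_empty_iff[OF WFD(8)[OF wf1 bB]] bkt hb by auto
 show ?thesis unfolding remove_def
 proof (rule run_seq, rule run_mono[OF run_unlink[OF ok cM]], goal_cases)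
  case (1 t1 s1)
  hence h1: "hp s1 = ?H" and b1: "regs s1 ''b'' = ?b" and e1: "eqx {''p'', ''c'', ''b''} s s1" and t1: "t1 \<le> 5" and ok1: "okst s1" by simp_all
  have n1: "regs s1 ''nb'' = regs s ''nb''" "regs s1 ''nf'' = regs s ''nf''" using e1 by (simp_all add: eqx_def)
  show ?case
  proof (rule run_cond[OF ok1])
   assume "bval \<pi> (Equal (ld NX (rr ''b'')) (rr ''b'')) s1"
   hence sg: "{g\<in>A. hp s BK g = ?b} = {?h}" using emp h1 b1 by (simp add: mem_adr)
   have e: "{g\<in>A - {?h}. ?H BK g = ?b} = {}" using bkt sg by simp
   have C0: "C (bo ?b) (?H KEY ?b) = 0" using single[OF sg] D(10,11)[OF h] Hf by simp
   have wf2: "WF (nodes n) (freed (regs s ''nf'') ?b ?H) (regs s ''nb'') (regs s ''nf'' + 1)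
     (A - {?h}) kap C (B - {?b}) bo (insert ?b X)" by (rule WF_free[OF wf1 bB e C0])
   have wf3: "WF (nodes n) (freed (regs s ''nf'') ?b ?H) (regs s ''nb'') (regs s ''nf'' + 1)
     (A - {?h}) kap C (B - {?b}) bo X" by (rule WFI) (use WFD[OF wf2] in \<open>simp_all\<close>)
   have nfM: "regs s ''nf'' < M"
   proof -
    have "card B > 0" using bB WF_nf(2)[OF wf] card_gt_0_iff by blast
    thus ?thesis using WF_nf(1)[OF wf] bd(1) by simp
   qed
   have "bo ?b \<in> nodes n" using D(13)[OF bB] .
   moreover have "oring (hp s KEY) (hp s UP) (hp s DN) (bo ?b) {b\<in>B. bo b = bo ?b}" using D(7)[OF calculation] bB by blast
   ultimately have "hp s UP ?b \<in> insert (bo ?b) {b\<in>B. bo b = bo ?b}"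
     "hp s DN ?b \<in> insert (bo ?b) {b\<in>B. bo b = bo ?b}" using ring_closed(1,2)[OF oring_ring] bB by blast+
   hence uM: "?H UP ?b < M" "?H DN ?b < M" using V_less[OF \<open>bo ?b \<in> nodes n\<close>] B_less[OF wf bd(1)] Hf by auto
   show "run freeb s1 (\<lambda>t. ?Q (t1 + Suc t))"
   proof (rule run_mono[OF run_freeb[OF ok1]], goal_cases)
    case (4 t2 s2)
    hence h2: "hp s2 = freed (regs s ''nf'') ?b ?H" "regs s2 ''nf'' = regs s ''nf'' + 1"
     and e2: "eqx {''p'', ''c'', ''nf''} s1 s2" and t2: "t2 \<le> 6" using h1 b1 n1 by simp_all
    have n2: "regs s2 ''nb'' = regs s ''nb''" using e2 n1 by (simp add: eqx_def)
    have "eqx {''p'', ''c'', ''b'', ''nf''} s s2" using e1 e2 by (simp add: eqx_def)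
    thus ?case by (intro exI[of _ "B - {?b}"]) (use wf3 h2 n2 t1 t2 sg Hf in \<open>simp add: freed_def\<close>)
   qed (use uM nfM h1 b1 n1 in simp_all)
  next
   assume "\<not> bval \<pi> (Equal (ld NX (rr ''b'')) (rr ''b'')) s1"
   hence sg: "{g\<in>A. hp s BK g = ?b} \<noteq> {?h}" using emp h1 b1 by (simp add: mem_adr)
   hence "{g\<in>A. hp s BK g = ?b} - {?h} \<noteq> {}" using hb by blast
   hence ne: "{g\<in>A - {?h}. ?H BK g = ?b} \<noteq> {}" using bkt by simp
   have wf3: "WF (nodes n) ?H (regs s ''nb'') (regs s ''nf'') (A - {?h}) kap C B bo X"
   proof (rule WFI, goal_cases)
    case (13 b)
    thus ?case using WFD(19)[OF wf1, of b] ne by (cases "b = ?b") auto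
   qed (use WFD[OF wf1] in \<open>simp_all\<close>)
   have e: "eqx {''p'', ''c'', ''b'', ''nf''} s s1" using e1 by (simp add: eqx_def)
   have "?Q (t1 + Suc 1) s1" by (intro exI[of _ "B"]) (use wf3 h1 n1 t1 sg Hf e in simp)
   thus "run Skip s1 (\<lambda>t. ?Q (t1 + Suc t))" by (rule run_skip[OF ok1])
  qed
 qed
qed

end

section \<open>Moving a half-edge to an adjacent key and adding a half-edge\<close>

definition shiftprep :: com where
 "shiftprep = Assign ''b'' (ld BK (rr ''h'')) ;;
  st CNT (rr ''b'') (Minus (ld CNT (rr ''b'')) (Const 1)) ;;
  Assign ''a'' (ld UP (rr ''b'')) ;;
  Cond (Equal (ld KEY (rr ''a'')) (rr ''q'')) Skip (Assign ''a'' (rr ''b''))"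

definition inccnt :: com where
 "inccnt = st CNT (rr ''a'') (Plus (ld CNT (rr ''a'')) (Const 1))"

text \<open>The target bucket is found before \<open>h\<close> is taken out, while the source bucket
  still stands as an anchor. As \<open>q\<close> differs from the old key by one, the target is next
  to the source: \<open>shiftprep\<close> starts at the upper neighbour if that has key
  \<open>q\<close> and at the source otherwise, and the walk then takes at most one step.\<close>

definition shift :: com where
 "shift = shiftprep ;; getb ;; inccnt ;; remove ;; push"

definition addprep :: com where
 "addprep = st OWN (rr ''h'') (rr ''x'') ;;
  Cond (Equal (ld UP (rr ''x'')) (Const 0))
   (st UP (rr ''x'') (rr ''x'') ;; st DN (rr ''x'') (rr ''x'')) Skip ;;
  Assign ''a'' (ld DN (rr ''x''))"

text \<open>Adds 1 for a positive record (\<open>g = 0\<close>) and subtracts 1 for a negative one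
  (\<open>g = 1\<close>). Adding first keeps the natural subtraction exact: a negative record is
  added for a live edge only, so the sum is at least 2.\<close>

definition addcnt :: com where
 "addcnt = st CNT (rr ''a'') (Minus (Plus (ld CNT (rr ''a'')) (Const 1)) (Times (Const 2) (rr ''g'')))"

definition addhalf :: com where
 "addhalf = addprep ;; getb ;; addcnt ;; push"

definition moved :: "(nat \<Rightarrow> nat \<Rightarrow> nat) \<Rightarrow> nat \<Rightarrow> nat \<Rightarrow> nat \<Rightarrow> nat \<Rightarrow> nat \<Rightarrow> nat" where
 "moved C x k q = (\<lambda>y j. if y = x \<and> j = q then C x q + 1 else if y = x \<and> j = k then C x k - 1 else C y j)"

context mach
begin

lemma run_shiftprep:
 assumes "okst s" "hp s BK (regs s ''h'') < M"
 shows "run shiftprep s (\<lambda>t s'. hp s' = (hp s)(CNT := (hp s CNT)(hp s BK (regs s ''h'') :=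
   hp s CNT (hp s BK (regs s ''h'')) - 1)) \<and>
  regs s' ''a'' = (if hp s KEY (hp s UP (hp s BK (regs s ''h''))) = regs s ''q''
   then hp s UP (hp s BK (regs s ''h'')) else hp s BK (regs s ''h'')) \<and>
  eqx {''a'', ''b''} s s' \<and> t \<le> 5)" by (rule run_fin[OF assms(1)]; (intro conjI fld_eqI)?)
  (use assms in \<open>simp_all add: shiftprep_def eqx_def mem_adr adr_less\<close>)

lemma run_inccnt:
 assumes "okst s" "regs s ''a'' < M" "hp s CNT (regs s ''a'') < M"
 shows "run inccnt s (\<lambda>t s'. hp s' = (hp s)(CNT := (hp s CNT)(regs s ''a'' := hp s CNT (regs s ''a'') + 1)) \<and>
  regs s' = regs s \<and> t \<le> 1)" by (rule run_fin[OF assms(1)]; (intro conjI fld_eqI)?)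
  (use assms MW in \<open>simp_all add: inccnt_def eqx_def mem_adr adr_less\<close>)

lemma run_addcnt:
 assumes "okst s" "regs s ''a'' < M" "hp s CNT (regs s ''a'') < M"
 shows "run addcnt s (\<lambda>t s'. hp s' = (hp s)(CNT := (hp s CNT)(regs s ''a'' :=
   hp s CNT (regs s ''a'') + 1 - 2 * regs s ''g'')) \<and>
  regs s' = regs s \<and> t \<le> 1)" by (rule run_fin[OF assms(1)]; (intro conjI fld_eqI)?)
  (use assms MW in \<open>simp_all add: addcnt_def eqx_def mem_adr adr_less\<close>)

lemma run_addprep:
 assumes "okst s" "regs s ''h'' < M" "regs s ''x'' < M"
 shows "run addprep s (\<lambda>t s'. hp s' = (if hp s UP (regs s ''x'') = 0
   then (hp s)(OWN := (hp s OWN)(regs s ''h'' := regs s ''x''), UP := (hp s UP)(regs s ''x'' := regs s ''x''),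
     DN := (hp s DN)(regs s ''x'' := regs s ''x''))
   else (hp s)(OWN := (hp s OWN)(regs s ''h'' := regs s ''x''))) \<and>
  regs s' ''a'' = hp s' DN (regs s ''x'') \<and> eqx {''a''} s s' \<and> t \<le> 5)" by (rule run_fin[OF assms(1)]; (intro conjI fld_eqI)?)
  (use assms in \<open>simp_all add: addprep_def eqx_def mem_adr adr_less\<close>)

lemma pushed_other: "f \<noteq> NX \<Longrightarrow> f \<noteq> PV \<Longrightarrow> f \<noteq> BK \<Longrightarrow> pushed a h H f = H f"
 unfolding pushed_def by simp

text \<open>\<open>single\<close> ensures that a source bucket left without records has count 0
  after the decrement, so that it may be freed. The clauses on \<open>it\<close> are for the loops
  that call it: an iteration standing at \<open>h\<close> goes on at the old successor if the bucket
  survives, and buckets of other owners keep their cursors.\<close>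

lemma run_shift:
 assumes ok: "okst s" and wf: "WFs s A kap C B bo {}" and h: "regs s ''h'' \<in> A"
  and q: "regs s ''q'' = kap (regs s ''h'') + 1 \<or> regs s ''q'' + 1 = kap (regs s ''h'')" "1 \<le> regs s ''q''"
  and single: "{g\<in>A. hp s BK g = hp s BK (regs s ''h'')} = {regs s ''h''} \<Longrightarrow>
   C (hp s OWN (regs s ''h'')) (kap (regs s ''h'')) = 1" and CM: "C (hp s OWN (regs s ''h'')) (regs s ''q'') < M"
  and bd: "4 * regs s ''nb'' \<le> M" "4 * card A + 3 < M" "\<And>g. g \<in> A \<Longrightarrow> g < M"
 shows "run shift s (\<lambda>t s'. \<exists>B' bo'.
  WFs s' A (kap(regs s ''h'' := regs s ''q''))
   (moved C (hp s OWN (regs s ''h'')) (kap (regs s ''h'')) (regs s ''q'')) B' bo' {} \<and>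
  4 * regs s' ''nb'' \<le> M \<and>
  (\<forall>f\<in>{OWN, SG, LEV, SLOT, WL, INW}. hp s' f = hp s f) \<and>
  eqx {''a'', ''b'', ''c'', ''f'', ''p'', ''nb'', ''nf''} s s' \<and>
  (\<forall>D T. it (hp s) A (hp s BK (regs s ''h'')) D T (regs s ''h'') \<longrightarrow>
    {g\<in>A. hp s BK g = hp s BK (regs s ''h'')} \<noteq> {regs s ''h''} \<longrightarrow>
    hp s BK (regs s ''h'') \<in> B' \<and>
    it (hp s') A (hp s BK (regs s ''h'')) D (T - {regs s ''h''}) (hp s NX (regs s ''h''))) \<and>
  (\<forall>b\<in>B. b \<noteq> hp s BK (regs s ''h'') \<and> bo b \<noteq> hp s OWN (regs s ''h'') \<longrightarrow> b \<in> B' \<and>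
    (\<forall>D T c. it (hp s) A b D T c \<longrightarrow> it (hp s') A b D T c)) \<and>
  (\<forall>b\<in>B \<inter> B'. bo' b = bo b \<and> hp s' KEY b = hp s KEY b) \<and>
  (\<forall>g. g \<noteq> regs s ''h'' \<longrightarrow> hp s' BK g = hp s BK g) \<and> t \<le> 60)"
  (is "run shift s ?Q")
proof -
 let ?h = "regs s ''h''" and ?q = "regs s ''q''"
 let ?b = "hp s BK ?h" and ?x = "hp s OWN ?h" and ?k = "kap ?h"
 note D = WFD[OF wf]
 have bB: "?b \<in> B" and bo: "bo ?b = ?x" and kb: "hp s KEY ?b = ?k" and xV: "?x \<in> nodes n" using D(9-12)[OF h] by auto
 have hm: "?h mod 4 = 2" and hM: "?h < M" using D(5) bd(3) h by auto
 have bM: "?b < M" using B_less[OF wf bd(1) bB] .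
 have o: "oring (hp s KEY) (hp s UP) (hp s DN) ?x {b\<in>B. bo b = ?x}" using D(7)[OF xV] bB bo by blast
 have bX: "?b \<in> {b\<in>B. bo b = ?x}" using bB bo by simp
 have kq: "?k \<noteq> ?q" using q(1) by linarith
 let ?C1 = "\<lambda>y j. if y = bo ?b \<and> j = hp s KEY ?b then hp s CNT ?b - 1 else C y j"
 have wf1: "WF (nodes n) ((hp s)(CNT := (hp s CNT)(?b := hp s CNT ?b - 1))) (regs s ''nb'') (regs s ''nf'')
   A kap ?C1 B bo {}" by (rule WF_cnt[OF wf bB])
 show ?thesis unfolding shift_def
 proof (rule run_seq, rule run_mono[OF run_shiftprep[OF ok bM]], goal_cases)
  case (1 t1 s1)
  hence h1: "hp s1 = (hp s)(CNT := (hp s CNT)(?b := hp s CNT ?b - 1))"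
   and a1: "regs s1 ''a'' = (if hp s KEY (hp s UP ?b) = ?q then hp s UP ?b else ?b)"
   and e1: "eqx {''a'', ''b''} s s1" and t1: "t1 \<le> 5" and ok1: "okst s1" by simp_all
  have r1: "regs s1 ''q'' = ?q" "regs s1 ''h'' = ?h" "regs s1 ''nb'' = regs s ''nb''" "regs s1 ''nf'' = regs s ''nf''"
   using e1 by (simp_all add: eqx_def)
  have wf1': "WFs s1 A kap ?C1 B bo {}" using wf1 h1 r1 by simp
  have f1: "hp s1 f = hp s f" if "f \<noteq> CNT" for f using h1 that by simp
  have ub: "hp s UP ?b \<in> insert ?x {b\<in>B. bo b = ?x}" using ring_closed(1)[OF oring_ring[OF o]] bX by blast
  have aX: "regs s1 ''a'' \<in> insert ?x {b\<in>B. bo b = ?x}" using a1 ub bX by auto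
  have g: "hp s1 KEY b \<le> hp s1 KEY (regs s1 ''a'')" if "b \<in> B" "bo b = ?x" "hp s1 KEY b \<le> regs s1 ''q''" for b
  proof (cases "hp s KEY (hp s UP ?b) = ?q")
   case True
   thus ?thesis using a1 that f1 r1 by simp
  next case False
   \<comment> \<open>Here the upper neighbour does not have key \<open>q\<close>. Keys increase
     strictly along the list and \<open>q\<close> is at most \<open>?k + 1\<close>, so no bucket has
     a key above \<open>?k\<close> and at most \<open>q\<close>.\<close>
   have "hp s KEY b \<le> ?k"
   proof (rule ccontr)
    assume "\<not> hp s KEY b \<le> ?k"
    hence lt: "hp s KEY ?b < hp s KEY b" using kb by simp
    with oring_up(3)[OF o, of ?b b] that bX
    have u: "hp s UP ?b \<in> {b\<in>B. bo b = ?x}" "hp s KEY (hp s UP ?b) \<le> hp s KEY b" by auto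
    have "?k < hp s KEY (hp s UP ?b)" using oring_up(2)[OF o, of ?b] u(1) bX kb by auto
    moreover have "hp s KEY b \<le> ?q" using that f1 r1 by simp
    ultimately show False using False q lt u(2) kb by auto
   qed
   thus ?thesis using a1 False f1 kb by simp
  qed
  have o1: "oring (hp s1 KEY) (hp s1 UP) (hp s1 DN) ?x {b\<in>B. bo b = ?x}" using o f1 by simp
  have ka: "hp s1 KEY (regs s1 ''a'') \<le> ?q + 1" using a1 f1 kb q by auto
  have q1: "1 \<le> regs s1 ''q''" using q r1 by simp
  have bd1: "4 * regs s1 ''nb'' \<le> M" using bd r1 by simp
  show ?case
  proof (rule run_seq, rule run_mono[OF run_getb[OF ok1 wf1' xV o1 aX _ q1 bd1 bd(2)]], goal_cases)
   case (1 b) thus ?case by (rule g)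
  next case (2 t2 s2)
   then obtain B2 bo2 where wf2: "WFs s2 A kap ?C1 B2 bo2 {regs s2 ''a''}" and a2: "regs s2 ''a'' \<in> B2"
    "bo2 (regs s2 ''a'') = ?x" "hp s2 KEY (regs s2 ''a'') = ?q" and BB: "B \<subseteq> B2"
    and same: "\<forall>b\<in>B. bo2 b = bo b \<and> hp s2 KEY b = hp s1 KEY b \<and> hp s2 CNT b = hp s1 CNT b"
    and nb2: "4 * regs s2 ''nb'' \<le> M" and f2: "\<forall>f\<in>{BK, OWN, SG, LEV, SLOT, WL, INW}. hp s2 f = hp s1 f"
    and n2: "\<forall>i. i mod 4 = 2 \<or> i \<in> B \<longrightarrow> hp s2 NX i = hp s1 NX i \<and> hp s2 PV i = hp s1 PV i"
    and e2: "eqx halfrs s1 s2" and t2: "t2 \<le> 2 * (hp s1 KEY (regs s1 ''a'') - regs s1 ''q'') + 15" and ok2: "okst s2" using r1 by auto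
   have t2': "t2 \<le> 17" using t2 ka r1 by simp
   have r2: "regs s2 ''h'' = ?h" using e2 r1 by (simp add: eqx_def)
   let ?a = "regs s2 ''a''"
   have aM: "?a < M" using B_less[OF wf2 nb2 a2(1)] .
   have cnt2: "hp s2 CNT ?a = C ?x ?q" using WFD(15)[OF wf2 a2(1)] a2 bo kb kq by auto
   let ?C2 = "\<lambda>y j. if y = bo2 ?a \<and> j = hp s2 KEY ?a then hp s2 CNT ?a + 1 else ?C1 y j"
   have wf3: "WF (nodes n) ((hp s2)(CNT := (hp s2 CNT)(?a := hp s2 CNT ?a + 1))) (regs s2 ''nb'') (regs s2 ''nf'')
    A kap ?C2 B2 bo2 {?a}" by (rule WF_cnt[OF wf2 a2(1)])
   have ab: "?b \<noteq> ?a" using same a2 bB kb kq f1 by force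
   show ?case
   proof (rule run_seq, rule run_mono[OF run_inccnt[OF ok2 aM]], goal_cases)
    case 1 thus ?case using cnt2 CM by simp
   next case (2 t3 s3)
    hence h3: "hp s3 = (hp s2)(CNT := (hp s2 CNT)(?a := hp s2 CNT ?a + 1))"
     and r3: "regs s3 = regs s2" and t3: "t3 \<le> 1" and ok3: "okst s3" by simp_all
    have wf3': "WFs s3 A kap ?C2 B2 bo2 {?a}" using wf3 h3 r3 by simp
    have f3: "hp s3 f = hp s2 f" if "f \<noteq> CNT" for f using h3 that by simp
    have own3: "hp s3 OWN = hp s OWN" "hp s3 BK = hp s BK" using f3 f2 f1 by simp_all
    have nx3: "hp s3 NX i = hp s NX i" "hp s3 PV i = hp s PV i" if "i mod 4 = 2 \<or> i \<in> B" for i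
     using n2[rule_format, OF that] f3[of NX] f3[of PV] f1[of NX] f1[of PV] by simp_all
    have h3A: "regs s3 ''h'' \<in> A" using r3 r2 h by simp
    have b3: "hp s3 BK (regs s3 ''h'') \<notin> {?a}" using own3 r3 r2 ab by simp
    have sg: "?C2 (hp s3 OWN (regs s3 ''h'')) (kap (regs s3 ''h'')) = 0"
     if "{g\<in>A. hp s3 BK g = hp s3 BK (regs s3 ''h'')} = {regs s3 ''h''}"
    proof -
     have "C ?x ?k = 1" by (rule single) (use that own3 r3 r2 in simp)
     moreover have "hp s CNT ?b = C ?x ?k" using D(15)[OF bB] bo kb by simp
     ultimately show ?thesis using a2 kq own3 r3 r2 bo kb by auto
    qed
    have bd3: "4 * regs s3 ''nb'' \<le> M" using nb2 r3 by simp
    show ?case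
    proof (rule run_seq, rule run_mono[OF run_remove[OF ok3 wf3', OF h3A b3 sg bd3 bd(3)]], goal_cases)
     case 1 thus ?case by assumption
    next case 2 thus ?case by assumption
    next case (3 t4 s4)
     then obtain B4 where wf4: "WFs s4 (A - {?h}) kap ?C2 B4 bo2 {?a}"
      and B4: "B4 = (if {g\<in>A. hp s BK g = ?b} = {?h} then B2 - {?b} else B2)"
      and f4: "\<forall>f\<in>{BK, OWN, SG, KEY, CNT, LEV, SLOT, WL, INW}. hp s4 f = hp s3 f"
      and n4': "\<forall>f\<in>{NX, PV}. hp s4 f = unlinked ?h (hp s3) f"
      and nb4: "regs s4 ''nb'' = regs s3 ''nb''" and e4: "eqx {''p'', ''c'', ''b'', ''nf''} s3 s4" and t4: "t4 \<le> 12" and ok4: "okst s4"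
      unfolding r3 r2 own3 by (elim exE conjE) iprover
     have n4: "hp s4 NX = unlinked ?h (hp s3) NX" "hp s4 PV = unlinked ?h (hp s3) PV" using n4' by simp_all
     have r4: "regs s4 ''h'' = ?h" "regs s4 ''a'' = ?a" using e4 r3 r2 by (simp_all add: eqx_def)
     have aB4: "?a \<in> B4" using B4 a2 ab by auto
     have "hp s4 NX ?a \<in> insert ?a {g\<in>A - {?h}. hp s4 BK g = ?a}" using ring_closed(1)[OF WFD(8)[OF wf4 aB4]] by blast
     hence nM: "hp s4 NX ?a < M" using aM bd(3) by auto
     have ka4: "hp s4 KEY ?a = ?q" using f4 f3 a2 by simp
     have own4: "hp s4 OWN ?h = bo2 ?a" using f4 own3 a2 by simp
     have wf5: "WF (nodes n) (pushed ?a ?h (hp s4)) (regs s4 ''nb'') (regs s4 ''nf'')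
       (insert ?h (A - {?h})) (kap(?h := hp s4 KEY ?a)) ?C2 B4 bo2 ({?a} - {?a})"
      unfolding pushed_def by (rule WF_push[OF wf4 aB4 _ hm own4]) simp
     have ih: "insert ?h (A - {?h}) = A" using h by auto
     have C2: "?C2 = moved C ?x ?k ?q" using a2 bo kb kq cnt2 D(15)[OF bB] by (auto simp: moved_def fun_eq_iff)
     have wf5': "WF (nodes n) (pushed ?a ?h (hp s4)) (regs s4 ''nb'') (regs s4 ''nf'')
       A (kap(?h := ?q)) (moved C ?x ?k ?q) B4 bo2 {}" using wf5 unfolding ih ka4 C2 by simp
     have it3: "it (hp s3) A b' D' T' c'" if "it (hp s) A b' D' T' c'" "b' \<in> B" for b' D' T' c'
      by (rule it_cong[OF that(1)]) (use own3 nx3 that(2) D(5) in auto)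
     have it4: "it (hp s4) A' b' D' T' c'" if "it (unlinked ?h (hp s3)) A' b' D' T' c'" for A' b' D' T' c'
      by (rule it_cong[OF that]) (use f4 n4 in \<open>auto simp: unlinked_def\<close>)
     have P1: "?b \<in> B4 \<and> it (pushed ?a ?h (hp s4)) A ?b D' (T' - {?h}) (hp s NX ?h)"
      if "it (hp s) A ?b D' T' ?h" "{g\<in>A. hp s BK g = ?b} \<noteq> {?h}" for D' T'
     proof
      show b4: "?b \<in> B4" using that B4 bB BB by auto
      have hb: "?h \<noteq> ?b" using hm WF_B_mod[OF wf bB] by auto
      have "it (hp s4) (A - {?h}) ?b D' (T' - {?h}) (hp s NX ?h)" using it4[OF it_unlink[OF it3[OF that(1) bB] hb]] nx3 hm by simp
      from it_push_other[OF wf4 this _ hm aB4 b4 ab]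
      show "it (pushed ?a ?h (hp s4)) A ?b D' (T' - {?h}) (hp s NX ?h)" using ih by simp
     qed
     have P2: "b' \<in> B4 \<and> (\<forall>D' T' c'. it (hp s) A b' D' T' c' \<longrightarrow> it (pushed ?a ?h (hp s4)) A b' D' T' c')"
      if b': "b' \<in> B" "b' \<noteq> ?b" "bo b' \<noteq> ?x" for b'
     proof (intro conjI allI impI)
      show b4: "b' \<in> B4" using that B4 BB by auto
      fix D' T' c' assume i: "it (hp s) A b' D' T' c'"
      have ba: "b' \<noteq> ?a" using same b' a2 by auto
      have b2: "b' \<in> B2" using b' BB by auto
      have "b' \<noteq> hp s3 BK ?h" using b' own3 by simp
      hence "it (hp s4) (A - {?h}) b' D' T' c'" using it4[OF it_unlink_other[OF wf3' it3[OF i b'(1)] h b2]] by simp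
      from it_push_other[OF wf4 this _ hm aB4 b4 ba]
      show "it (pushed ?a ?h (hp s4)) A b' D' T' c'" using ih by simp
     qed
     have P3: "bo2 b' = bo b' \<and> hp s4 KEY b' = hp s KEY b'" if "b' \<in> B" for b' using same that f4 f3 f1 by simp
     have f5: "\<forall>f\<in>{OWN, SG, LEV, SLOT, WL, INW}. hp s4 f = hp s f" using f4 f3 f2 f1 by simp
     show ?case
     proof (rule run_mono[OF run_push[OF ok4]], goal_cases)
      case (4 t5 s5)
      hence h5: "hp s5 = pushed ?a ?h (hp s4)" and e5: "eqx {''c''} s4 s5" and t5: "t5 \<le> 6" using r4 by simp_all
      have r5: "regs s5 ''nb'' = regs s4 ''nb''" "regs s5 ''nf'' = regs s4 ''nf''" using e5 by (simp_all add: eqx_def)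
      have wf6: "WFs s5 A (kap(?h := ?q)) (moved C ?x ?k ?q) B4 bo2 {}" using wf5' h5 r5 by simp
      have e: "eqx {''a'', ''b'', ''c'', ''f'', ''p'', ''nb'', ''nf''} s s5" using e1 e2 r3 e4 e5 by (simp add: eqx_def)
      have n5: "4 * regs s5 ''nb'' \<le> M" using r5 nb4 r3 nb2 by simp
      have f6: "\<forall>f\<in>{OWN, SG, LEV, SLOT, WL, INW}. hp s5 f = hp s f" using f5 h5 by (simp add: pushed_other)
      have k5: "hp s5 KEY = hp s4 KEY" using h5 by (simp add: pushed_other)
      show ?case
       apply (rule exI[of _ B4], rule exI[of _ bo2])
       apply (intro conjI)
       subgoal by (rule wf6)
       subgoal by (rule n5)
       subgoal by (rule f6)
       subgoal by (rule e)
       subgoal using P1 unfolding h5 by blast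
       subgoal using P2 unfolding h5 by blast
       subgoal using P3 unfolding k5 by blast
       subgoal using f4 own3 h5 by (simp add: pushed_def)
       subgoal using t1 t2' t3 t4 t5 by simp
       done
     qed (use r4 aM hM nM in simp_all)
    qed
   qed
  qed
 qed
qed

text \<open>The search begins at the largest key of the node. Buckets are nonempty, so this is the
  key of some record and at most \<open>L\<close>; the walk down from it is the linear term of the
  bound.\<close>

lemma run_addhalf:
 assumes ok: "okst s" and wf: "WFs s A kap C B bo {}" and h: "regs s ''h'' \<notin> A"
  "regs s ''h'' mod 4 = 2" "regs s ''h'' < M" and x: "regs s ''x'' \<in> nodes n"
  and q: "1 \<le> regs s ''q''" and kL: "\<And>g. g \<in> A \<Longrightarrow> kap g \<le> L" and CM: "C (regs s ''x'') (regs s ''q'') < M"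
  and bd: "4 * regs s ''nb'' \<le> M" "4 * card A + 3 < M" "\<And>g. g \<in> A \<Longrightarrow> g < M"
 shows "run addhalf s (\<lambda>t s'. \<exists>B' bo'.
  WFs s' (insert (regs s ''h'') A) (kap(regs s ''h'' := regs s ''q''))
   (\<lambda>y k. if y = regs s ''x'' \<and> k = regs s ''q'' then C y k + 1 - 2 * regs s ''g'' else C y k) B' bo' {} \<and>
  4 * regs s' ''nb'' \<le> M \<and>
  hp s' OWN = (hp s OWN)(regs s ''h'' := regs s ''x'') \<and>
  (\<forall>f\<in>{SG, LEV, SLOT, WL, INW}. hp s' f = hp s f) \<and>
  (\<forall>g. g \<noteq> regs s ''h'' \<longrightarrow> hp s' BK g = hp s BK g) \<and>
  eqx halfrs s s' \<and> t \<le> 2 * L + 40)"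
  (is "run addhalf s ?Q")
proof -
 let ?h = "regs s ''h''" and ?q = "regs s ''q''" and ?x = "regs s ''x''"
 note D = WFD[OF wf]
 show ?thesis unfolding addhalf_def
 proof (rule run_seq, rule run_mono[OF run_addprep[OF ok h(3) V_less[OF x]]], goal_cases)
  case (1 t1 s1)
  hence h1: "hp s1 = (if hp s UP ?x = 0
   then (hp s)(OWN := (hp s OWN)(?h := ?x), UP := (hp s UP)(?x := ?x), DN := (hp s DN)(?x := ?x))
   else (hp s)(OWN := (hp s OWN)(?h := ?x)))"
   and a1: "regs s1 ''a'' = hp s1 DN ?x" and e1: "eqx {''a''} s s1" and t1: "t1 \<le> 5" and ok1: "okst s1" by simp_all
  have f1: "hp s1 f = hp s f" if "f \<notin> {OWN, UP, DN}" for f using h1 that by simp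
  have O1: "hp s1 OWN = (hp s OWN)(?h := ?x)" using h1 by simp
  have r1: "regs s1 ''q'' = ?q" "regs s1 ''h'' = ?h" "regs s1 ''g'' = regs s ''g''"
   "regs s1 ''nb'' = regs s ''nb''" "regs s1 ''nf'' = regs s ''nf''" using e1 by (simp_all add: eqx_def)
  have wfo: "WF (nodes n) ((hp s)(OWN := (hp s OWN)(?h := ?x))) (regs s ''nb'') (regs s ''nf'') A kap C B bo {}"
   by (rule WF_cong[OF wf]) (use h in auto)
  have wf1: "WFs s1 A kap C B bo {} \<and> oring (hp s1 KEY) (hp s1 UP) (hp s1 DN) ?x {b\<in>B. bo b = ?x}"
  proof (cases "hp s UP ?x = 0")
   case True
   note W = WF_init_node[OF wfo x]
   have e: "{b\<in>B. bo b = ?x} = {}" by (rule W(2)) (use True in simp)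
   have "oring (hp s KEY) ((hp s UP)(?x := ?x)) ((hp s DN)(?x := ?x)) ?x {b\<in>B. bo b = ?x}" unfolding e by (rule oring_empty) auto
   thus ?thesis using W(1) True h1 r1 by simp
  next case False
   have "oring (hp s KEY) (hp s UP) (hp s DN) ?x {b\<in>B. bo b = ?x}" by (rule disjE[OF D(7)[OF x]]) (use False in simp_all)
   thus ?thesis using wfo h1 r1 False by simp
  qed
  have o1: "oring (hp s1 KEY) (hp s1 UP) (hp s1 DN) ?x {b\<in>B. bo b = ?x}" using wf1 by simp
  have aX: "regs s1 ''a'' \<in> insert ?x {b\<in>B. bo b = ?x}" using oring_top(1)[OF o1] a1 by simp
  have g: "hp s1 KEY b \<le> hp s1 KEY (regs s1 ''a'')" if "b \<in> B" "bo b = ?x" "hp s1 KEY b \<le> regs s1 ''q''" for b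
   using oring_top(2)[OF o1] a1 that by simp
  have ka: "hp s1 KEY (regs s1 ''a'') \<le> L"
  proof (cases "regs s1 ''a'' = ?x")
   case True
   thus ?thesis using WFD(3)[OF conjunct1[OF wf1] x] by simp
  next case False
   hence "regs s1 ''a'' \<in> B - {}" using aX by auto
   then obtain g where "g \<in> A" "hp s1 BK g = regs s1 ''a''" using WFD(19)[OF conjunct1[OF wf1]] by blast
   thus ?thesis using WFD(11)[OF conjunct1[OF wf1], of g] kL by simp
  qed
  have q1: "1 \<le> regs s1 ''q''" using q r1 by simp
  have bd1: "4 * regs s1 ''nb'' \<le> M" using bd r1 by simp
  show ?case
  proof (rule run_seq, rule run_mono[OF run_getb[OF ok1 conjunct1[OF wf1] x o1 aX _ q1 bd1 bd(2)]], goal_cases)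
   case (1 b) thus ?case by (rule g)
  next case (2 t2 s2)
   then obtain B2 bo2 where wf2: "WFs s2 A kap C B2 bo2 {regs s2 ''a''}" and a2: "regs s2 ''a'' \<in> B2"
    "bo2 (regs s2 ''a'') = ?x" "hp s2 KEY (regs s2 ''a'') = ?q" and nb2: "4 * regs s2 ''nb'' \<le> M"
    and f2: "\<forall>f\<in>{BK, OWN, SG, LEV, SLOT, WL, INW}. hp s2 f = hp s1 f" and e2: "eqx halfrs s1 s2"
    and t2: "t2 \<le> 2 * (hp s1 KEY (regs s1 ''a'') - regs s1 ''q'') + 15" and ok2: "okst s2" using r1 by auto
   have t2': "t2 \<le> 2 * L + 15" using t2 ka by simp
   have r2: "regs s2 ''h'' = ?h" "regs s2 ''g'' = regs s ''g''" using e2 r1 by (simp_all add: eqx_def)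
   let ?a = "regs s2 ''a''"
   have aM: "?a < M" using B_less[OF wf2 nb2 a2(1)] .
   have cnt2: "hp s2 CNT ?a = C ?x ?q" using WFD(15)[OF wf2 a2(1)] a2 by auto
   let ?C2 = "\<lambda>y j. if y = bo2 ?a \<and> j = hp s2 KEY ?a then hp s2 CNT ?a + 1 - 2 * regs s ''g'' else C y j"
   have wf3: "WF (nodes n) ((hp s2)(CNT := (hp s2 CNT)(?a := hp s2 CNT ?a + 1 - 2 * regs s ''g'')))
    (regs s2 ''nb'') (regs s2 ''nf'') A kap ?C2 B2 bo2 {?a}" by (rule WF_cnt[OF wf2 a2(1)])
   show ?case
   proof (rule run_seq, rule run_mono[OF run_addcnt[OF ok2 aM]], goal_cases)
    case 1 thus ?case using cnt2 CM by simp
   next case (2 t3 s3)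
    hence h3: "hp s3 = (hp s2)(CNT := (hp s2 CNT)(?a := hp s2 CNT ?a + 1 - 2 * regs s ''g''))"
     and r3: "regs s3 = regs s2" and t3: "t3 \<le> 1" and ok3: "okst s3" using r2 by simp_all
    have f3: "hp s3 f = hp s2 f" if "f \<noteq> CNT" for f using h3 that by simp
    have wf3': "WFs s3 A kap ?C2 B2 bo2 {?a}" using wf3 h3 r3 by simp
    have own3: "hp s3 OWN ?h = bo2 ?a" using f3 f2 h1 a2 by simp
    have wf4: "WF (nodes n) (pushed ?a ?h (hp s3)) (regs s3 ''nb'') (regs s3 ''nf'')
       (insert ?h A) (kap(?h := hp s3 KEY ?a)) ?C2 B2 bo2 ({?a} - {?a})" unfolding pushed_def by (rule WF_push[OF wf3' a2(1) h(1,2) own3])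
    have "hp s3 NX ?a \<in> insert ?a {g\<in>A. hp s3 BK g = ?a}" using ring_closed(1)[OF WFD(8)[OF wf3' a2(1)]] by blast
    hence nM: "hp s3 NX ?a < M" using aM bd(3) by auto
    have C2: "?C2 = (\<lambda>y k. if y = ?x \<and> k = ?q then C y k + 1 - 2 * regs s ''g'' else C y k)" using a2 cnt2 by (simp add: fun_eq_iff)
    have wf4': "WF (nodes n) (pushed ?a ?h (hp s3)) (regs s3 ''nb'') (regs s3 ''nf'')
       (insert ?h A) (kap(?h := ?q))
       (\<lambda>y k. if y = ?x \<and> k = ?q then C y k + 1 - 2 * regs s ''g'' else C y k) B2 bo2 {}"
     using wf4 unfolding C2 using f3 a2 by simp
    show ?case
    proof (rule run_mono[OF run_push[OF ok3]], goal_cases)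
     case (4 t5 s5)
     hence h5: "hp s5 = pushed ?a ?h (hp s3)" and e5: "eqx {''c''} s3 s5" and t5: "t5 \<le> 6" using r3 r2 by simp_all
     have r5: "regs s5 ''nb'' = regs s3 ''nb''" "regs s5 ''nf'' = regs s3 ''nf''" using e5 by (simp_all add: eqx_def)
     have wf6: "WFs s5 (insert ?h A) (kap(?h := ?q))
      (\<lambda>y k. if y = ?x \<and> k = ?q then C y k + 1 - 2 * regs s ''g'' else C y k) B2 bo2 {}" using wf4' h5 r5 by simp
     have e: "eqx halfrs s s5" using e1 e2 r3 e5 by (simp add: eqx_def)
     have n5: "4 * regs s5 ''nb'' \<le> M" using r5 r3 nb2 by simp
     have f6: "\<forall>f\<in>{SG, LEV, SLOT, WL, INW}. hp s5 f = hp s f" using h5 f3 f2 f1 by (simp add: pushed_other)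
     have "hp s5 OWN = hp s1 OWN" using h5 f3 f2 by (simp add: pushed_other)
     hence o6: "hp s5 OWN = (hp s OWN)(?h := ?x)" using O1 by simp
     show ?case
      apply (rule exI[of _ B2], rule exI[of _ bo2])
      apply (intro conjI)
      subgoal by (rule wf6)
      subgoal by (rule n5)
      subgoal by (rule o6)
      subgoal by (rule f6)
      subgoal using f1 f2 f3 h5 by (simp add: pushed_def)
      subgoal by (rule e)
      subgoal using t1 t2' t3 t5 by simp
      done
    qed (use r3 r2 aM h nM in simp_all)
   qed
  qed
 qed
qed

end

section \<open>Edge records as pairs of twin half-edges\<close>

definition tw :: "nat \<Rightarrow> nat" where "tw h = h + 4 - 8 * (h div 4 mod 2)"

abbreviation far :: "state \<Rightarrow> nat \<Rightarrow> nat" where "far s h \<equiv> hp s OWN (tw h)"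

text \<open>\<open>tw\<close> exchanges \<open>8 * e + 2\<close> and \<open>8 * e + 6\<close>. Since
  expressions cannot branch, the parity of the quotient by 4 decides between adding 4 and
  subtracting 4.\<close>

definition twE :: "aexp \<Rightarrow> aexp" where
 "twE e = Minus (Plus e (Const 4)) (Times (Const 8) (Mod (Div e (Const 4)) (Const 2)))"

lemma aval_twE [simp]: "aval (twE e) s = tw (aval e s)" unfolding twE_def tw_def by simp

lemma mod4_mod8: "(h :: nat) mod 4 = 2 \<longleftrightarrow> h mod 8 = 2 \<or> h mod 8 = 6" by presburger

lemma tw_2: "h mod 8 = 2 \<Longrightarrow> tw h = h + 4" unfolding tw_def by (subgoal_tac "h div 4 mod 2 = 0") (simp, presburger)

lemma tw_6: "h mod 8 = 6 \<Longrightarrow> tw h = h - 4" unfolding tw_def by (subgoal_tac "h div 4 mod 2 = 1") (simp, presburger)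

lemma tw_props:
 assumes "h mod 4 = 2"
 shows "tw (tw h) = h" "tw h mod 4 = 2" "tw h \<noteq> h" "h mod 8 = 2 \<longleftrightarrow> tw h mod 8 = 6"
  "h < 8 * R \<longleftrightarrow> tw h < 8 * R"
proof -
 consider e where "h = 8 * e + 2" | e where "h = 8 * e + 6" using assms mod4_mod8 by (metis mult_div_mod_eq)
 thus "tw (tw h) = h" "tw h mod 4 = 2" "tw h \<noteq> h" "h mod 8 = 2 \<longleftrightarrow> tw h mod 8 = 6"
  "h < 8 * R \<longleftrightarrow> tw h < 8 * R"
 proof (atomize (full), cases, goal_cases)
  case (1 e)
  have m: "(8 * e + 6) mod 4 = (2::nat)" "(8 * e + 6) mod 8 = (6::nat)" "(8 * e + 2) mod 8 = (2::nat)" by presburger+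
  have "tw (8 * e + 2) = 8 * e + 6" "tw (8 * e + 6) = 8 * e + 2" using tw_2[OF m(3)] tw_6[OF m(2)] by simp_all
  moreover have "8 * e + 2 < 8 * R \<longleftrightarrow> e < R" "8 * e + 6 < 8 * R \<longleftrightarrow> e < R" by linarith+
  ultimately show ?case unfolding 1 using m by (simp del: add_2_eq_Suc')
 next case (2 e)
  have m: "(8 * e + 2) mod 4 = (2::nat)" "(8 * e + 6) mod 8 = (6::nat)" "(8 * e + 2) mod 8 = (2::nat)" by presburger+
  have "tw (8 * e + 2) = 8 * e + 6" "tw (8 * e + 6) = 8 * e + 2" using tw_2[OF m(3)] tw_6[OF m(2)] by simp_all
  moreover have "8 * e + 2 < 8 * R \<longleftrightarrow> e < R" "8 * e + 6 < 8 * R \<longleftrightarrow> e < R" by linarith+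
  ultimately show ?case unfolding 2 using m by (simp del: add_2_eq_Suc')
 qed
qed

definition degk :: "graph \<Rightarrow> (nat \<Rightarrow> nat \<Rightarrow> nat) \<Rightarrow> nat \<Rightarrow> nat \<Rightarrow> nat" where
 "degk adj K x k = card {y. adj x y \<and> K x y = k}"

definition adjok :: "nat \<Rightarrow> graph \<Rightarrow> bool" where
 "adjok n adj \<longleftrightarrow> (\<forall>x y. adj x y \<longrightarrow> adj y x \<and> x \<in> nodes n \<and> y \<in> nodes n \<and> x mod 8 \<noteq> y mod 8)"

text \<open>Half-edges with residue 2 modulo 8 belong to source nodes, their twins with residue 6 to
  target nodes. A dead record has \<open>BK = 0\<close>, which no live one has because buckets are 3
  modulo 4; programs test liveness in this way.\<close>

definition recok :: "heap \<Rightarrow> nat \<Rightarrow> nat set \<Rightarrow> bool" where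
 "recok H R A \<longleftrightarrow> (\<forall>h\<in>A. h mod 4 = 2 \<and> h < 8 * R \<and> tw h \<in> A \<and> (h mod 8 = 2 \<longrightarrow> H OWN h mod 8 = 1) \<and>
  (h mod 8 = 6 \<longrightarrow> H OWN h mod 8 = 5) \<and> H SG (tw h) = H SG h \<and> H SG h \<le> 1) \<and>
 (\<forall>h. h mod 4 = 2 \<longrightarrow> h < 8 * R \<longrightarrow> h \<notin> A \<longrightarrow> H BK h = 0)"

text \<open>Weaker than the signed count \<open>net\<close>, which is out of balance in the middle
  of a cleaning pass. \<open>cover\<close> holds throughout and is what makes it safe to free a
  bucket.\<close>

definition cover :: "heap \<Rightarrow> nat set \<Rightarrow> graph \<Rightarrow> bool" where
 "cover H A adj \<longleftrightarrow> (\<forall>x y. adj x y \<longrightarrow> (\<exists>g\<in>A. H OWN g = x \<and> H OWN (tw g) = y))"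

lemma finite_nodes: "finite (nodes n)" unfolding nodes_def by simp

lemma card_nodes: "card (nodes n) = 2 * n" unfolding nodes_def by (simp add: card_image inj_on_def)

lemma adj_finite: "adjok n adj \<Longrightarrow> finite {y. adj x y \<and> P y}"
 by (rule finite_subset[OF _ finite_nodes[of n]]) (auto simp: adjok_def)

lemma degk_le: "adjok n adj \<Longrightarrow> degk adj K x k \<le> 2 * n"
 unfolding degk_def card_nodes[symmetric] by (rule card_mono[OF finite_nodes]) (auto simp: adjok_def)

lemma WF_bk_eq:
 assumes wf: "WF V H nb nf A kap C B bo X" and "g \<in> A" "h \<in> A" "H OWN g = H OWN h" "kap g = kap h"
 shows "H BK g = H BK h"
proof -
 note D = WFD[OF wf]
 let ?x = "H OWN h"
 have x: "?x \<in> V" using D(12) assms(3) by blast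
 have bs: "H BK g \<in> {b\<in>B. bo b = ?x}" "H BK h \<in> {b\<in>B. bo b = ?x}" using D(9,10) assms by auto
 hence "oring (H KEY) (H UP) (H DN) ?x {b\<in>B. bo b = ?x}" using D(7)[OF x] by blast
 thus ?thesis using oring_inj[OF _ bs] D(11) assms by auto
qed

lemma WF_bucket:
 assumes wf: "WF V H nb nf A kap C B bo X" and "b \<in> B"
 shows "{g\<in>A. H BK g = b} = {g\<in>A. H OWN g = bo b \<and> kap g = H KEY b}"
proof -
 note D = WFD[OF wf]
 have "H BK g = b" if "g \<in> A" "H OWN g = bo b" "kap g = H KEY b" for g
 proof -
  have x: "bo b \<in> V" using D(13) assms(2) by blast
  have bs: "H BK g \<in> {b'\<in>B. bo b' = bo b}" "b \<in> {b'\<in>B. bo b' = bo b}" using D(9,10) assms that by auto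
  hence "oring (H KEY) (H UP) (H DN) (bo b) {b'\<in>B. bo b' = bo b}" using D(7)[OF x] by blast
  thus ?thesis using oring_inj[OF _ bs] D(11) that by auto
 qed
 moreover have "H OWN g = bo b \<and> kap g = H KEY b" if "g \<in> A" "H BK g = b" for g using D(10)[OF that(1)] D(11)[OF that(1)] that(2) by simp
 ultimately show ?thesis by blast
qed

lemma recokD:
 assumes "recok H R A" "h \<in> A"
 shows "h mod 4 = 2" "h < 8 * R" "tw h \<in> A" "H OWN h mod 8 \<noteq> H OWN (tw h) mod 8" "H SG (tw h) = H SG h" "H SG h \<le> 1"
  "H OWN h \<noteq> H OWN (tw h)"
proof -
 show *: "h mod 4 = 2" "h < 8 * R" "tw h \<in> A" "H SG (tw h) = H SG h" "H SG h \<le> 1" using assms unfolding recok_def by blast+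
 show "H OWN h mod 8 \<noteq> H OWN (tw h) mod 8"
 proof (cases "h mod 8 = 2")
  case True
  hence "tw h mod 8 = 6" using tw_props(4)[OF *(1)] by simp
  hence "H OWN (tw h) mod 8 = 5" "H OWN h mod 8 = 1" using assms *(3) True unfolding recok_def by blast+
  thus ?thesis by simp
 next case False
  hence h6: "h mod 8 = 6" using *(1) mod4_mod8 by blast
  hence "tw h mod 8 = 2" using tw_props(1,2)[OF *(1)] tw_props(4)[of "tw h"] by simp
  hence "H OWN (tw h) mod 8 = 1" "H OWN h mod 8 = 5" using assms *(3) h6 unfolding recok_def by blast+
  thus ?thesis by simp
 qed
 thus "H OWN h \<noteq> H OWN (tw h)" by auto
qed

lemma recok_card:
 assumes "recok H R A" shows "card A \<le> 2 * R" "finite A"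
proof -
 have "A \<subseteq> (\<lambda>j. 4 * j + 2) ` {..<2 * R}"
 proof
  fix h assume "h \<in> A"
  hence "h mod 4 = 2" "h < 8 * R" using recokD assms by blast+
  hence "h = 4 * (h div 4) + 2" "h div 4 < 2 * R" using mult_div_mod_eq[of 4 h] less_mult_imp_div_less[of h "2 * R" 4] by simp_all
  thus "h \<in> (\<lambda>j. 4 * j + 2) ` {..<2 * R}" by blast
 qed
 moreover have "card ((\<lambda>j. 4 * j + 2) ` {..<2 * R}) = 2 * R" by (simp add: card_image inj_on_def)
 moreover have "finite ((\<lambda>j. 4 * j + 2) ` {..<2 * R})" by simp
 ultimately show "card A \<le> 2 * R" "finite A" using card_mono finite_subset by metis+
qed

definition kill :: com where
 "kill = remove ;; st BK (rr ''h'') (Const 0) ;; Assign ''h'' (twE (rr ''h'')) ;; remove ;; st BK (rr ''h'') (Const 0)"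

definition shift2 :: com where
 "shift2 = Assign ''h'' (rr ''i'') ;; shift ;; Assign ''h'' (twE (rr ''i'')) ;; shift"

context mach
begin

text \<open>Keys are given by an arbitrary symmetric function \<open>K\<close> rather than by
  levels: halfway through a move only some edges of the node have their new key, so no assignment of
  levels need describe them.\<close>

definition Inv0 :: "graph \<Rightarrow> (nat \<Rightarrow> nat \<Rightarrow> nat) \<Rightarrow> nat set \<Rightarrow> nat set \<Rightarrow> (nat \<Rightarrow> nat) \<Rightarrow> state \<Rightarrow> bool" where
 "Inv0 adj K A B bo s \<longleftrightarrow>
  WFs s A (\<lambda>h. K (hp s OWN h) (far s h)) (degk adj K) B bo {} \<and>
  4 * regs s ''nb'' \<le> M \<and> 8 * regs s ''R'' + 8 \<le> M \<and>
  recok (hp s) (regs s ''R'') A \<and> adjok n adj \<and> cover (hp s) A adj \<and>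
  (\<forall>x y. K x y = K y x \<and> 1 \<le> K x y \<and> K x y \<le> L)"

lemma Inv0D:
 assumes "Inv0 adj K A B bo s"
 shows "WFs s A (\<lambda>h. K (hp s OWN h) (far s h)) (degk adj K) B bo {}"
  "4 * regs s ''nb'' \<le> M" "8 * regs s ''R'' + 8 \<le> M"
  "recok (hp s) (regs s ''R'') A" "adjok n adj" "cover (hp s) A adj"
  "K x y = K y x" "1 \<le> K x y" "K x y \<le> L" using assms unfolding Inv0_def by simp_all

lemma Inv0_card:
 assumes "Inv0 adj K A B bo s"
 shows "4 * card A + 3 < M" "g \<in> A \<Longrightarrow> g < M"
proof -
 show "4 * card A + 3 < M" using recok_card(1)[OF Inv0D(4)[OF assms]] Inv0D(3)[OF assms] by linarith
 show "g < M" if "g \<in> A" using recokD(2)[OF Inv0D(4)[OF assms] that] Inv0D(3)[OF assms] by linarith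
qed

text \<open>If a live edge counted under the key of the last half-edge of a bucket, the record
  covering it after the kill would lie in the same bucket, a contradiction; so the count is 0 and
  the bucket may be freed. The twin has another owner, hence its removal does not disturb a cursor
  in the bucket of \<open>h\<close>.\<close>

lemma run_kill:
 assumes ok: "okst s" and I: "Inv0 adj K A B bo s" and h: "regs s ''h'' \<in> A" and cov: "cover (hp s) (A - {regs s ''h'', tw (regs s ''h'')}) adj"
 shows "run kill s (\<lambda>t s'. \<exists>B'. Inv0 adj K (A - {regs s ''h'', tw (regs s ''h'')}) B' bo s' \<and>
  (\<forall>f\<in>{OWN, SG, KEY, CNT, LEV, SLOT, WL, INW}. hp s' f = hp s f) \<and>
  eqx {''p'', ''c'', ''b'', ''nf'', ''h''} s s' \<and>
  (\<forall>D T. it (hp s) A (hp s BK (regs s ''h'')) D T (regs s ''h'') \<longrightarrow>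
    {g\<in>A. hp s BK g = hp s BK (regs s ''h'')} \<noteq> {regs s ''h''} \<longrightarrow>
    hp s BK (regs s ''h'') \<in> B' \<and>
    it (hp s') (A - {regs s ''h'', tw (regs s ''h'')}) (hp s BK (regs s ''h'')) D (T - {regs s ''h''})
     (hp s NX (regs s ''h''))) \<and> t \<le> 30)"
  (is "run kill s ?Q")
proof -
 let ?h = "regs s ''h''" let ?t = "tw ?h" let ?b = "hp s BK ?h"
 note i = Inv0D[OF I]
 let ?kap = "\<lambda>h. K (hp s OWN h) (far s h)"
 note D = WFD[OF i(1)]
 note rh = recokD[OF i(4) h] note rt = recokD[OF i(4) rh(3)]
 have tt: "tw ?t = ?h" using tw_props(1)[OF rh(1)] .
 have th: "?t \<noteq> ?h" using tw_props(3)[OF rh(1)] .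
 have hM: "?h < M" "?t < M" using Inv0_card(2)[OF I] h rh(3) by auto
 have zero: "degk adj K (hp s OWN g) (?kap g) = 0"
  if g: "g \<in> {?h, ?t}" and A': "A - {?h, ?t} \<subseteq> A'" "A' \<subseteq> A" and sg: "{g'\<in>A'. hp s BK g' = hp s BK g} = {g}" for g A'
 proof (rule ccontr)
  assume "degk adj K (hp s OWN g) (?kap g) \<noteq> 0"
  then obtain y where y: "adj (hp s OWN g) y" "K (hp s OWN g) y = ?kap g"
   unfolding degk_def by (metis (mono_tags, lifting) card.empty empty_Collect_eq)
  then obtain g' where g': "g' \<in> A - {?h, ?t}" "hp s OWN g' = hp s OWN g" "hp s OWN (tw g') = y" using cov unfolding cover_def by blast
  have "hp s BK g' = hp s BK g" by (rule WF_bk_eq[OF i(1)]) (use g g' h rh(3) y in auto)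
  hence "g' \<in> {g'\<in>A'. hp s BK g' = hp s BK g}" using g' A' by blast
  thus False using sg g g' by auto
 qed
 have bB: "?b \<in> B" using D(9)[OF h] .
 have bt: "bo (hp s BK ?t) \<noteq> bo ?b" using D(10)[OF h] D(10)[OF rh(3)] rh(7) by simp
 show ?thesis unfolding kill_def
 proof (rule run_seq, rule run_mono[OF run_remove[OF ok i(1), OF h _ _ i(2) Inv0_card(2)[OF I]]], goal_cases)
  case 1 thus ?case by simp
 next case 2 thus ?case using zero[of ?h A] by simp
 next case (3 g) thus ?case .
 next case (4 t1 s1)
  then obtain B1 where wf1: "WFs s1 (A - {?h}) ?kap (degk adj K) B1 bo {}" and B1: "B1 = (if {g\<in>A. hp s BK g = ?b} = {?h} then B - {?b} else B)"
   and f1: "\<forall>f\<in>{BK, OWN, SG, KEY, CNT, LEV, SLOT, WL, INW}. hp s1 f = hp s f"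
   and n1: "\<forall>f\<in>{NX, PV}. hp s1 f = unlinked ?h (hp s) f"
   and nb1: "regs s1 ''nb'' = regs s ''nb''" and e1: "eqx {''p'', ''c'', ''b'', ''nf''} s s1" and t1: "t1 \<le> 12" and ok1: "okst s1" by iprover
  have r1: "regs s1 ''h'' = ?h" using e1 by (simp add: eqx_def)
  show ?case
  proof (rule run_seq, rule run_fin[OF ok1], goal_cases)
   case 1 show ?case by simp
  next case 2 show ?case by simp
  next case (3 t2)
   define s2 where "s2 = fin \<pi> (st BK (rr ''h'') (Const 0)) s1"
   have h2: "hp s2 = (hp s1)(BK := (hp s1 BK)(?h := 0))" "regs s2 = regs s1" unfolding s2_def using r1 by simp_all
   have ok2: "okst s2" unfolding s2_def using ok1 by (auto intro: okst_mem)
   show ?case unfolding s2_def[symmetric]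
   proof (rule run_seq, rule run_fin[OF ok2], goal_cases)
    case 1 show ?case by simp
   next case 2 show ?case using h2 r1 hM MW by simp
   next case (3 t3)
    define s3 where "s3 = fin \<pi> (Assign ''h'' (twE (rr ''h''))) s2"
    have h3: "hp s3 = (hp s1)(BK := (hp s1 BK)(?h := 0))" "regs s3 = (regs s1)(''h'' := ?t)" unfolding s3_def using r1 h2 by simp_all
    have ok3: "okst s3" unfolding s3_def using ok2 h2 r1 hM MW by (auto intro: okst_reg)
    have wf3: "WFs s3 (A - {?h}) ?kap (degk adj K) B1 bo {}"
    proof -
     have "WF (nodes n) (hp s3) (regs s1 ''nb'') (regs s1 ''nf'') (A - {?h}) ?kap (degk adj K) B1 bo {}"
      by (rule WF_cong[OF wf1]) (auto simp: h3(1))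
     thus ?thesis using h3(2) by simp
    qed
    have r3: "regs s3 ''h'' = ?t" "regs s3 ''nb'' = regs s ''nb''" using h3 nb1 by simp_all
    have own3: "hp s3 OWN = hp s OWN" using h3 f1 by simp
    have bk3: "hp s3 BK g = hp s BK g" if "g \<in> A - {?h}" for g using h3 f1 that by simp
    have hin3: "regs s3 ''h'' \<in> A - {?h}" using r3 rh(3) th by simp
    show ?case unfolding s3_def[symmetric]
    proof (rule run_seq, rule run_mono[OF run_remove[OF ok3 wf3, OF hin3]], goal_cases)
     case 1 thus ?case by simp
    next case 2
     have bt3: "hp s3 BK ?t = hp s BK ?t" using bk3[of ?t] hin3 r3 by simp
     have "{g'\<in>A - {?h}. hp s BK g' = hp s BK ?t} = {g'\<in>A - {?h}. hp s3 BK g' = hp s3 BK ?t}"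
      using bk3 bt3 by (intro Collect_cong conj_cong refl) simp
     hence P: "{g'\<in>A - {?h}. hp s BK g' = hp s BK ?t} = {?t}" using 2 r3 by simp
     have "?t \<in> {?h, ?t}" "A - {?h, ?t} \<subseteq> A - {?h}" "A - {?h} \<subseteq> A" by blast+
     from zero[OF this P] show ?case unfolding r3 own3 .
    next case 3 thus ?case using r3 i(2) by simp
    next case (4 g) thus ?case using Inv0_card(2)[OF I] by simp
    next case (5 t4 s4)
     then obtain B4 where wf4: "WFs s4 (A - {?h} - {?t}) ?kap (degk adj K) B4 bo {}"
      and B4: "B4 = (if {g\<in>A - {?h}. hp s3 BK g = hp s3 BK ?t} = {?t} then B1 - {hp s3 BK ?t} else B1)"
      and f4: "\<forall>f\<in>{BK, OWN, SG, KEY, CNT, LEV, SLOT, WL, INW}. hp s4 f = hp s3 f"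
      and n4: "\<forall>f\<in>{NX, PV}. hp s4 f = unlinked ?t (hp s3) f" and e4: "eqx {''p'', ''c'', ''b'', ''nf''} s3 s4" and t4: "t4 \<le> 12"
      and ok4: "okst s4" unfolding r3 by iprover
     have r4: "regs s4 ''h'' = ?t" using e4 r3 by (simp add: eqx_def)
     define s5 where "s5 = fin \<pi> (st BK (rr ''h'') (Const 0)) s4"
     have h5: "hp s5 = (hp s4)(BK := (hp s4 BK)(?t := 0))" "regs s5 = regs s4" unfolding s5_def using r4 by simp_all
     have AA: "A - {?h} - {?t} = A - {?h, ?t}" by blast
     have wf5: "WFs s5 (A - {?h, ?t}) ?kap (degk adj K) B4 bo {}"
     proof -
      have "WFs s4 (A - {?h, ?t}) ?kap (degk adj K) B4 bo {}" using wf4 AA by simp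
      hence "WF (nodes n) (hp s5) (regs s4 ''nb'') (regs s4 ''nf'') (A - {?h, ?t}) ?kap (degk adj K) B4 bo {}"
       by (rule WF_cong) (auto simp: h5(1))
      thus ?thesis using h5(2) by simp
     qed
     have f5: "\<forall>f\<in>{OWN, SG, KEY, CNT, LEV, SLOT, WL, INW}. hp s5 f = hp s f" using h5 f4 h3 f1 by simp
     have e5: "eqx {''p'', ''c'', ''b'', ''nf'', ''h''} s s5" using e1 h3 e4 h5 by (simp add: eqx_def)
     have bk5: "hp s5 BK g = (if g \<in> {?h, ?t} then 0 else hp s BK g)" for g using h5 f4 h3 f1 by simp
     have rec5: "recok (hp s5) (regs s5 ''R'') (A - {?h, ?t})"
     proof -
      have R5: "regs s5 ''R'' = regs s ''R''" using e5 by (simp add: eqx_def)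
      have "tw g \<notin> {?h, ?t}" if "g \<in> A - {?h, ?t}" for g using that tw_props(1)[OF recokD(1)[OF i(4), of g]] tt by auto
      moreover have "hp s5 OWN = hp s OWN" "hp s5 SG = hp s SG" using f5 by simp_all
      ultimately show ?thesis using i(4) unfolding recok_def R5 bk5 by auto
     qed
     have own5: "hp s5 OWN = hp s OWN" using f5 by simp
     have inv5: "Inv0 adj K (A - {?h, ?t}) B4 bo s5" unfolding Inv0_def own5 using wf5 rec5 i cov e5 own5 by (simp add: cover_def eqx_def)
     have P: "?b \<in> B4 \<and> it (hp s5) (A - {?h, ?t}) ?b D' (T' - {?h}) (hp s NX ?h)"
      if *: "it (hp s) A ?b D' T' ?h" "{g\<in>A. hp s BK g = ?b} \<noteq> {?h}" for D' T'
     proof -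
      have b1: "?b \<in> B1" using B1 * bB by simp
      have bne: "?b \<noteq> hp s3 BK ?t" using bk3[of ?t] rh(3) th bt by auto
      have b4: "?b \<in> B4" using B4 b1 bne by simp
      have hb: "?h \<noteq> ?b" using rh(1) WF_B_mod[OF i(1) bB] by auto
      have "it (hp s3) (A - {?h}) ?b D' (T' - {?h}) (hp s NX ?h)"
       by (rule it_cong[OF it_unlink[OF *(1) hb]]) (use h3 f1 n1 in \<open>auto simp: unlinked_def\<close>)
      from it_unlink_other[OF wf3 this _ b1 bne]
      have "it (unlinked ?t (hp s3)) (A - {?h} - {?t}) ?b D' (T' - {?h}) (hp s NX ?h)" using hin3 r3 by simp
      hence "it (hp s5) (A - {?h} - {?t}) ?b D' (T' - {?h}) (hp s NX ?h)"
       by (rule it_cong) (use h5 f4 n4 in \<open>auto simp: unlinked_def\<close>)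
      thus ?thesis using b4 AA by simp
     qed
     show ?case
     proof (rule run_fin[OF ok4], goal_cases)
      case (3 t5)
      show ?case unfolding s5_def[symmetric]
       apply (rule exI[of _ B4])
       apply (intro conjI)
       subgoal by (rule inv5)
       subgoal by (rule f5)
       subgoal by (rule e5)
       subgoal using P by blast
       subgoal using t1 \<open>t2 \<le> _\<close> \<open>t3 \<le> _\<close> t4 3 by simp
       done
     qed simp_all
    qed
   qed
  qed
 qed
qed

end

section \<open>Cancelling positive against negative records within a bucket\<close>

definition pass1 :: com where
 "pass1 = Assign ''i'' (ld NX (rr ''s'')) ;;
  While (Neg (Equal (rr ''i'') (rr ''s'')))
   (Cond (Less (Const 0) (ld SG (rr ''i'')))
     (st SLOT (ld OWN (twE (rr ''i''))) (Plus (ld SLOT (ld OWN (twE (rr ''i'')))) (Const 1))) Skip ;;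
    Assign ''i'' (ld NX (rr ''i'')))"

definition decslot :: com where
 "decslot = st SLOT (ld OWN (twE (rr ''i''))) (Minus (ld SLOT (ld OWN (twE (rr ''i'')))) (Const 1))"

text \<open>\<open>pass1\<close> has left in \<open>SLOT\<close> the number of negative records
  towards each node. Now all negative records go, and as many positive ones as the counters say.
  There are always enough positive ones, so the counters end at 0 and no separate clearing is
  needed. The successor is saved in \<open>j\<close> before the current record can
  disappear.\<close>

definition pass2 :: com where
 "pass2 = Assign ''i'' (ld NX (rr ''s'')) ;;
  While (Neg (Equal (rr ''i'') (rr ''s'')))
   ((Assign ''j'' (ld NX (rr ''i'')) ;; Assign ''h'' (rr ''i'')) ;;
    Cond (Less (Const 0) (ld SG (rr ''i''))) kill
     (Cond (Less (Const 0) (ld SLOT (ld OWN (twE (rr ''i''))))) (decslot ;; kill) Skip) ;;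
    Assign ''i'' (rr ''j''))"

definition clean :: com where "clean = pass1 ;; pass2"

text \<open>
 Deleting an edge adds a record with \<open>SG = 1\<close> instead of searching for the positive one.
 \<open>clean\<close> cancels such pairs within one bucket; its cost is the size of the bucket after cancellation plus the number of cancelled records.
\<close>

definition net :: "heap \<Rightarrow> nat set \<Rightarrow> graph \<Rightarrow> bool" where
 "net H A adj \<longleftrightarrow> (\<forall>x y. card {g\<in>A. H OWN g = x \<and> H OWN (tw g) = y \<and> H SG g = 0} =
  card {g\<in>A. H OWN g = x \<and> H OWN (tw g) = y \<and> 0 < H SG g} + of_bool (adj x y))"

text \<open>\<open>tw\<close> is an involution that keeps the sign and swaps the endpoints. Signed
  counts need therefore be checked from one end of an edge only.\<close>

lemma net_sym:
 assumes "recok H R A"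
 shows "card {g\<in>A. H OWN g = x \<and> H OWN (tw g) = y \<and> \<phi> (H SG g)} =
  card {g\<in>A. H OWN g = y \<and> H OWN (tw g) = x \<and> \<phi> (H SG g)}"
proof (rule bij_betw_same_card[of tw], rule bij_betw_byWitness[where f' = tw])
 have *: "tw g \<in> A \<and> tw (tw g) = g \<and> H SG (tw g) = H SG g" if "g \<in> A" for g using recokD[OF assms that] tw_props(1) by blast
 show "tw ` {g \<in> A. H OWN g = x \<and> H OWN (tw g) = y \<and> \<phi> (H SG g)} \<subseteq> {g \<in> A. H OWN g = y \<and> H OWN (tw g) = x \<and> \<phi> (H SG g)}"
  "tw ` {g \<in> A. H OWN g = y \<and> H OWN (tw g) = x \<and> \<phi> (H SG g)} \<subseteq> {g \<in> A. H OWN g = x \<and> H OWN (tw g) = y \<and> \<phi> (H SG g)}"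
  using * by auto
 show "\<forall>g\<in>{g \<in> A. H OWN g = x \<and> H OWN (tw g) = y \<and> \<phi> (H SG g)}. tw (tw g) = g"
  "\<forall>g\<in>{g \<in> A. H OWN g = y \<and> H OWN (tw g) = x \<and> \<phi> (H SG g)}. tw (tw g) = g" using * by blast+
qed

lemma net_cover: "net H A adj \<Longrightarrow> adj x y \<Longrightarrow> \<exists>g\<in>A. H OWN g = x \<and> H OWN (tw g) = y"
proof (rule ccontr)
 assume "net H A adj" "adj x y" and n: "\<not> (\<exists>g\<in>A. H OWN g = x \<and> H OWN (tw g) = y)"
 hence "{g\<in>A. H OWN g = x \<and> H OWN (tw g) = y \<and> H SG g = 0} \<noteq> {}"
  unfolding net_def by (metis (mono_tags, lifting) add_is_0 card.empty of_bool_eq(2) zero_neq_one)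
 thus False using n by blast
qed

lemma single_deg:
 assumes "cover H A adj" "h \<in> A" "adj (H OWN h) (H OWN (tw h))" "K (H OWN h) (H OWN (tw h)) = k"
  "\<And>g. g \<in> A \<Longrightarrow> H OWN g = H OWN h \<Longrightarrow> K (H OWN g) (H OWN (tw g)) = k \<Longrightarrow> g = h"
 shows "degk adj K (H OWN h) k = 1"
proof -
 have "{y. adj (H OWN h) y \<and> K (H OWN h) y = k} = {H OWN (tw h)}"
 proof (intro equalityI subsetI)
  fix y assume y: "y \<in> {y. adj (H OWN h) y \<and> K (H OWN h) y = k}"
  then obtain g where "g \<in> A" "H OWN g = H OWN h" "H OWN (tw g) = y" using assms(1) unfolding cover_def by blast
  with assms(5)[of g] y show "y \<in> {H OWN (tw h)}" by simp
 qed (use assms(3,4) in simp)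
 thus ?thesis unfolding degk_def by simp
qed

definition setK :: "(nat \<Rightarrow> nat \<Rightarrow> nat) \<Rightarrow> nat \<Rightarrow> nat \<Rightarrow> nat \<Rightarrow> nat \<Rightarrow> nat \<Rightarrow> nat" where
 "setK K x y q = (\<lambda>z w. if z = x \<and> w = y \<or> z = y \<and> w = x then q else K z w)"

lemma degk_setK:
 assumes "adjok n adj" "adj x y" "K x y = k" "K y x = k" "k \<noteq> q"
 shows "degk adj (setK K x y q) = moved (moved (degk adj K) x k q) y k q"
proof (intro ext)
 fix z j
 have xy: "x \<noteq> y" "adj y x" using assms unfolding adjok_def by blast+
 have f: "finite {w. adj z w \<and> K z w = j}" using adj_finite[OF assms(1)] .
 have key: "degk adj (setK K x y q) z j = (if j = q then degk adj K z q + 1 else if j = k then degk adj K z k - 1 else degk adj K z j)"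
  if zw: "z = x \<and> w = y \<or> z = y \<and> w = x" for w
 proof -
  have a: "adj z w" "K z w = k" using zw assms xy by auto
  have "{v. adj z v \<and> setK K x y q z v = j} =
   (if j = q then insert w {v. adj z v \<and> K z v = j} else {v. adj z v \<and> K z v = j} - {w})" using zw a xy assms(5) by (auto simp: setK_def)
  moreover have "w \<notin> {v. adj z v \<and> K z v = j}" if "j \<noteq> k" using a that by simp
  moreover have "w \<in> {v. adj z v \<and> K z v = k}" using a by simp
  ultimately show ?thesis using f assms(5) unfolding degk_def by (auto simp: card_Diff_singleton)
 qed
 consider "z = x" | "z = y" | "z \<noteq> x" "z \<noteq> y" by blast
 thus "degk adj (setK K x y q) z j = moved (moved (degk adj K) x k q) y k q z j"
 proof cases
  case 1 thus ?thesis using key[of y] xy assms(5) by (simp add: moved_def)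
 next case 2 thus ?thesis using key[of x] xy assms(5) by (simp add: moved_def)
 next case 3
  hence "setK K x y q z = K z" by (auto simp: setK_def)
  thus ?thesis using 3 by (simp add: moved_def degk_def)
 qed
qed

context mach
begin

text \<open>Changing \<open>K x y\<close> changes the key of every record that joins
  \<open>x\<close> and \<open>y\<close>, while only one record is moved; \<open>u\<close> says that
  there is no other. Cleaning the bucket beforehand is what establishes \<open>u\<close>.\<close>

lemma run_shift2:
 assumes ok: "okst s" and I: "Inv0 adj K A B bo s" and h: "regs s ''i'' \<in> A"
  and x: "x = hp s OWN (regs s ''i'')" and y: "y = hp s OWN (tw (regs s ''i''))" and a: "adj x y"
  and u: "\<And>g. g \<in> A \<Longrightarrow> hp s OWN g = x \<Longrightarrow> far s g = y \<Longrightarrow> g = regs s ''i''"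
  and q: "regs s ''q'' = K x y + 1 \<or> regs s ''q'' + 1 = K x y" "1 \<le> regs s ''q''" "regs s ''q'' \<le> L"
 shows "run shift2 s (\<lambda>t s'. \<exists>B' bo'. Inv0 adj (setK K x y (regs s ''q'')) A B' bo' s' \<and>
  (\<forall>f\<in>{OWN, SG, LEV, SLOT, WL, INW}. hp s' f = hp s f) \<and>
  eqx shiftrs s s' \<and>
  (\<forall>D T. it (hp s) A (hp s BK (regs s ''i'')) D T (regs s ''i'') \<longrightarrow>
    {g\<in>A. hp s BK g = hp s BK (regs s ''i'')} \<noteq> {regs s ''i''} \<longrightarrow>
    hp s BK (regs s ''i'') \<in> B' \<and> bo' (hp s BK (regs s ''i'')) = bo (hp s BK (regs s ''i'')) \<and>
    hp s' KEY (hp s BK (regs s ''i'')) = hp s KEY (hp s BK (regs s ''i'')) \<and>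
    it (hp s') A (hp s BK (regs s ''i'')) D (T - {regs s ''i''}) (hp s NX (regs s ''i''))) \<and> t \<le> 130)"
  (is "run shift2 s ?Q")
proof -
 let ?h = "regs s ''i''" let ?t = "tw ?h" let ?b = "hp s BK ?h" let ?q = "regs s ''q''"
 note i = Inv0D[OF I]
 let ?kap = "\<lambda>h. K (hp s OWN h) (far s h)"
 note D = WFD[OF i(1)]
 note rh = recokD[OF i(4) h] note rt = recokD[OF i(4) rh(3)]
 have tt: "tw ?t = ?h" using tw_props(1)[OF rh(1)] .
 have th: "?t \<noteq> ?h" using tw_props(3)[OF rh(1)] .
 have xy: "x \<noteq> y" using rh(7) x y by simp
 have hM: "?h < M" "?t < M" using Inv0_card(2)[OF I] h rh(3) by auto
 have ax: "adj y x" using i(5) a unfolding adjok_def by blast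
 have u': "g = ?t" if "g \<in> A" "hp s OWN g = y" "far s g = x" for g using u[of "tw g"] recokD(1,3)[OF i(4) that(1)] tw_props(1)[of g] that by auto
 define k where "k = K x y"
 have kq: "k \<noteq> ?q" using q(1) k_def by linarith
 have kx: "?kap ?h = k" "?kap ?t = k" using x y tt i(7) k_def by simp_all
 have dM: "degk adj K z j < M" for z j using degk_le[OF i(5), of K z j] nM by linarith
 define s0 where "s0 = fin \<pi> (Assign ''h'' (rr ''i'')) s"
 have h0: "hp s0 = hp s" "regs s0 = (regs s)(''h'' := ?h)" unfolding s0_def by simp_all
 have ok0: "okst s0" unfolding s0_def using okst_reg[OF ok okst_regs_le[OF ok]] by simp
 have wf0: "WFs s0 A ?kap (degk adj K) B bo {}" using i(1) h0 by simp
 have r0: "regs s0 ''h'' = ?h" "regs s0 ''q'' = ?q" "regs s0 ''nb'' = regs s ''nb''" using h0 by simp_all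
 have bb: "4 * regs s0 ''nb'' \<le> M" using i(2) r0 by simp
 have h0A: "regs s0 ''h'' \<in> A" using h r0 by simp
 have q0: "regs s0 ''q'' = ?kap (regs s0 ''h'') + 1 \<or> regs s0 ''q'' + 1 = ?kap (regs s0 ''h'')" "1 \<le> regs s0 ''q''"
  unfolding r0 kx using q k_def by simp_all
 have C0: "degk adj K (hp s0 OWN (regs s0 ''h'')) (regs s0 ''q'') < M" using dM .
 have sg0: "degk adj K (hp s0 OWN (regs s0 ''h'')) (?kap (regs s0 ''h'')) = 1"
  if *: "{g\<in>A. hp s0 BK g = hp s0 BK (regs s0 ''h'')} = {regs s0 ''h''}"
 proof -
  have "degk adj K (hp s OWN ?h) k = 1"
  proof (rule single_deg[OF i(6) h])
   show "adj (hp s OWN ?h) (far s ?h)" using a x y by simp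
   show "K (hp s OWN ?h) (far s ?h) = k" using kx by simp
   fix g assume g: "g \<in> A" "hp s OWN g = hp s OWN ?h" "K (hp s OWN g) (far s g) = k"
   have "hp s BK g = hp s BK ?h" by (rule WF_bk_eq[OF i(1) g(1) h g(2)]) (use g kx in simp)
   hence "g \<in> {g\<in>A. hp s0 BK g = hp s0 BK (regs s0 ''h'')}" using g(1) h0 by simp
   hence "g \<in> {regs s0 ''h''}" unfolding * .
   thus "g = ?h" using r0 by simp
  qed
  thus ?thesis unfolding r0 kx h0(1) .
 qed
 show ?thesis unfolding shift2_def
 proof (rule run_seq, rule run_fin[OF ok], goal_cases)
  case 1 show ?case by simp
 next case 2 show ?case by simp
 next case (3 t0)
  show ?case unfolding s0_def[symmetric]
  proof (rule run_seq, rule run_mono[OF run_shift[OF ok0 wf0, OF h0A q0 sg0 C0 bb Inv0_card(1)[OF I] Inv0_card(2)[OF I]]], goal_cases)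
   case 1 thus ?case by assumption
  next case 2 thus ?case by assumption
  next case (3 t1 s1)
   then obtain B1 bo1 where wf1: "WFs s1 A (?kap(?h := ?q)) (moved (degk adj K) x k ?q) B1 bo1 {}" and n1: "4 * regs s1 ''nb'' \<le> M"
    and f1: "\<forall>f\<in>{OWN, SG, LEV, SLOT, WL, INW}. hp s1 f = hp s f"
    and e1: "eqx {''a'', ''b'', ''c'', ''f'', ''p'', ''nb'', ''nf''} s0 s1"
    and P1: "\<forall>D T. it (hp s) A ?b D T ?h \<longrightarrow> {g\<in>A. hp s BK g = ?b} \<noteq> {?h} \<longrightarrow>
     ?b \<in> B1 \<and> it (hp s1) A ?b D (T - {?h}) (hp s NX ?h)"
    and K1: "\<forall>b\<in>B \<inter> B1. bo1 b = bo b \<and> hp s1 KEY b = hp s KEY b"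
    and bk1: "\<forall>g. g \<noteq> ?h \<longrightarrow> hp s1 BK g = hp s BK g" and t1: "t1 \<le> 60" and ok1: "okst s1"
    unfolding r0 h0(1) x[symmetric] y[symmetric] k_def[symmetric] by iprover
   have r1: "regs s1 ''h'' = ?h" "regs s1 ''i'' = ?h" "regs s1 ''q'' = ?q" using e1 h0 by (simp_all add: eqx_def)
   have own1: "hp s1 OWN = hp s OWN" using f1 by simp
   define s2 where "s2 = fin \<pi> (Assign ''h'' (twE (rr ''i''))) s1"
   have h2: "hp s2 = hp s1" "regs s2 = (regs s1)(''h'' := ?t)" unfolding s2_def using r1 by simp_all
   have ok2: "okst s2" unfolding s2_def using ok1 r1 hM MW by (auto intro: okst_reg)
   have wf2: "WFs s2 A (?kap(?h := ?q)) (moved (degk adj K) x k ?q) B1 bo1 {}" using wf1 h2 by simp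
   have r2: "regs s2 ''h'' = ?t" "regs s2 ''q'' = ?q" "regs s2 ''nb'' = regs s1 ''nb''" using h2 r1 by simp_all
   have kt: "(?kap(?h := ?q)) ?t = k" using th kx by simp
   have h2A: "regs s2 ''h'' \<in> A" using rh(3) r2 by simp
   have q2: "regs s2 ''q'' = (?kap(?h := ?q)) (regs s2 ''h'') + 1 \<or> regs s2 ''q'' + 1 = (?kap(?h := ?q)) (regs s2 ''h'')"
    "1 \<le> regs s2 ''q''" unfolding r2 kt using q k_def by simp_all
   have ot: "hp s2 OWN ?t = y" using h2 own1 y by simp
   have C2: "moved (degk adj K) x k ?q (hp s2 OWN (regs s2 ''h'')) (regs s2 ''q'') < M" unfolding r2 ot using dM xy by (simp add: moved_def)
   have n2: "4 * regs s2 ''nb'' \<le> M" using n1 r2 by simp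
   have sg2: "moved (degk adj K) x k ?q (hp s2 OWN (regs s2 ''h'')) ((?kap(?h := ?q)) (regs s2 ''h'')) = 1"
    if *: "{g\<in>A. hp s2 BK g = hp s2 BK (regs s2 ''h'')} = {regs s2 ''h''}"
   proof -
    have "degk adj K (hp s OWN ?t) k = 1"
    proof (rule single_deg[OF i(6) rh(3)])
     show "adj (hp s OWN ?t) (far s ?t)" using ax x y tt by simp
     show "K (hp s OWN ?t) (far s ?t) = k" using kx by simp
     fix g assume g: "g \<in> A" "hp s OWN g = hp s OWN ?t" "K (hp s OWN g) (far s g) = k"
     have "g \<noteq> ?h" using g(2) rh(7) by auto
     hence "hp s2 BK g = hp s2 BK ?t" by (intro WF_bk_eq[OF wf2 g(1) rh(3)]) (use g kx th h2 own1 in simp_all)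
     hence "g \<in> {g\<in>A. hp s2 BK g = hp s2 BK (regs s2 ''h'')}" using g(1) r2 by simp
     hence "g \<in> {regs s2 ''h''}" unfolding * .
     thus "g = ?t" using r2 by simp
    qed
    thus ?thesis unfolding r2 kt ot using xy y by (simp add: moved_def)
   qed
   show ?case
   proof (rule run_seq, rule run_fin[OF ok1], goal_cases)
    case 1 show ?case by simp
   next case 2 show ?case using r1 hM MW by simp
   next case (3 t2)
    show ?case unfolding s2_def[symmetric]
    proof (rule run_mono[OF run_shift[OF ok2 wf2, OF h2A q2 sg2 C2 n2 Inv0_card(1)[OF I] Inv0_card(2)[OF I]]], goal_cases)
     case 1 thus ?case by assumption
    next case 2 thus ?case by assumption
    next case (3 t3 s3)
     then obtain B3 bo3 where wf3: "WFs s3 A ((?kap(?h := ?q))(?t := ?q)) (moved (moved (degk adj K) x k ?q) y k ?q) B3 bo3 {}"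
      and n3: "4 * regs s3 ''nb'' \<le> M" and f3: "\<forall>f\<in>{OWN, SG, LEV, SLOT, WL, INW}. hp s3 f = hp s2 f"
      and e3: "eqx {''a'', ''b'', ''c'', ''f'', ''p'', ''nb'', ''nf''} s2 s3"
      and P3: "\<forall>b\<in>B1. b \<noteq> hp s2 BK ?t \<and> bo1 b \<noteq> y \<longrightarrow> b \<in> B3 \<and>
       (\<forall>D T c. it (hp s2) A b D T c \<longrightarrow> it (hp s3) A b D T c)"
      and K3: "\<forall>b\<in>B1 \<inter> B3. bo3 b = bo1 b \<and> hp s3 KEY b = hp s2 KEY b"
      and bk3: "\<forall>g. g \<noteq> ?t \<longrightarrow> hp s3 BK g = hp s2 BK g" and t3: "t3 \<le> 60" unfolding r2 kt ot by iprover
     have f: "\<forall>f\<in>{OWN, SG, LEV, SLOT, WL, INW}. hp s3 f = hp s f" using f3 h2 f1 by simp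
     have own3: "hp s3 OWN = hp s OWN" and sg3: "hp s3 SG = hp s SG" using f by simp_all
     have e: "eqx shiftrs s s3" using e1 e3 h0 h2 by (simp add: eqx_def)
     have R3: "regs s3 ''R'' = regs s ''R''" using e by (simp add: eqx_def)
     \<comment> \<open>By \<open>u\<close> and its mirror image \<open>u'\<close>, the two halves of
       the record are the only half-edges affected by \<open>setK\<close>.\<close>
     have kap3: "setK K x y ?q (hp s OWN g) (far s g) = ((?kap(?h := ?q))(?t := ?q)) g" if "g \<in> A" for g
     proof -
      have "(hp s OWN g = x \<and> far s g = y) \<longleftrightarrow> g = ?h" using u[OF that] x y by auto
      moreover have "(hp s OWN g = y \<and> far s g = x) \<longleftrightarrow> g = ?t" using u'[OF that] x y tt by auto
      ultimately show ?thesis by (simp add: setK_def)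
     qed
     have wf3': "WFs s3 A (\<lambda>g. setK K x y ?q (hp s3 OWN g) (far s3 g)) (degk adj (setK K x y ?q)) B3 bo3 {}"
     proof -
      have yx: "K y x = k" using i(7)[of y x] k_def by simp
      show ?thesis unfolding degk_setK[of n adj x y K k ?q, OF i(5) a k_def[symmetric] yx kq] own3
       by (rule WF_cong[OF wf3]) (simp_all add: kap3)
     qed
     have rec3: "recok (hp s3) (regs s3 ''R'') A"
     proof -
      have "hp s3 BK g = hp s BK g" if "g \<notin> A" for g using bk3 bk1 h2 that h rh(3) by metis
      thus ?thesis using i(4) unfolding recok_def own3 sg3 R3 by simp
     qed
     have inv3: "Inv0 adj (setK K x y ?q) A B3 bo3 s3"
     proof -
      have "cover (hp s3) A adj" using i(6) own3 by (simp add: cover_def)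
      moreover have "\<forall>z w. setK K x y ?q z w = setK K x y ?q w z \<and> 1 \<le> setK K x y ?q z w \<and> setK K x y ?q z w \<le> L"
       using i(7-9) q by (auto simp: setK_def)
      ultimately show ?thesis unfolding Inv0_def using wf3' n3 rec3 i(3,5) R3 by simp
     qed
     have bB: "?b \<in> B" using D(9)[OF h] .
     have bx: "bo ?b = x" using D(10)[OF h] x by simp
     have P: "?b \<in> B3 \<and> bo3 ?b = bo ?b \<and> hp s3 KEY ?b = hp s KEY ?b \<and> it (hp s3) A ?b D' (T' - {?h}) (hp s NX ?h)"
      if "it (hp s) A ?b D' T' ?h" "{g\<in>A. hp s BK g = ?b} \<noteq> {?h}" for D' T'
     proof -
      have 1: "?b \<in> B1" "it (hp s1) A ?b D' (T' - {?h}) (hp s NX ?h)" using P1 that by blast+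
      have 2: "bo1 ?b = bo ?b" "hp s1 KEY ?b = hp s KEY ?b" using K1 1 bB by blast+
      have "bo1 (hp s2 BK ?t) = y" using WFD(10)[OF wf2 rh(3)] ot by simp
      hence "?b \<noteq> hp s2 BK ?t" using 2 bx xy by auto
      moreover have "bo1 ?b \<noteq> y" using 2 bx xy by simp
      ultimately have "?b \<in> B3 \<and> (\<forall>D T c. it (hp s2) A ?b D T c \<longrightarrow> it (hp s3) A ?b D T c)"
       using P3 1(1) by blast
      thus ?thesis using K3 1 2 h2 by simp
     qed
     show ?case
      apply (rule exI[of _ B3], rule exI[of _ bo3])
      apply (intro conjI)
      subgoal by (rule inv3)
      subgoal by (rule f)
      subgoal by (rule e)
      subgoal using P by blast
      subgoal using t1 t3 \<open>t2 \<le> _\<close> \<open>t0 \<le> _\<close> by simp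
      done
    qed
   qed
  qed
 qed
qed

lemma run_pass1:
 assumes ok: "okst s" and I: "Inv0 adj K A B bo s" and b: "regs s ''s'' \<in> B" and z: "\<And>y. y \<in> nodes n \<Longrightarrow> hp s SLOT y = 0"
 shows "run pass1 s (\<lambda>t s'. hp s' = (hp s)(SLOT := \<lambda>y. hp s SLOT y +
   card {g\<in>{g\<in>A. hp s BK g = regs s ''s''}. far s g = y \<and> 0 < hp s SG g}) \<and>
  eqx {''i''} s s' \<and> t \<le> 4 * card {g\<in>A. hp s BK g = regs s ''s''} + 2)"
proof -
 let ?b = "regs s ''s''" and ?Hb = "{g\<in>A. hp s BK g = regs s ''s''}"
 note i = Inv0D[OF I]
 note D = WFD[OF i(1)]
 have fA: "finite A" using D(1) .
 let ?f = "\<lambda>D. (hp s)(SLOT := \<lambda>y. hp s SLOT y + card {g\<in>D. far s g = y \<and> 0 < hp s SG g})"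
 let ?I = "\<lambda>(D, T) s'. hp s' = ?f D \<and> it (hp s) A ?b D T (regs s' ''i'') \<and> eqx {''i''} s s'"
 let ?g = "\<lambda>(D :: nat set, T :: nat set). 4 * real (card T)"
 define s0 where "s0 = fin \<pi> (Assign ''i'' (ld NX (rr ''s''))) s"
 have h0: "hp s0 = hp s" "regs s0 = (regs s)(''i'' := hp s NX ?b)" unfolding s0_def by (simp_all add: mem_adr)
 have ok0: "okst s0" unfolding s0_def using okst_reg[OF ok okst_hp_le[OF ok]] by (simp add: mem_adr)
 have I0: "?I ({}, ?Hb) s0" using it_start[OF i(1) b] h0 by (simp add: eqx_def fun_upd_idem)
 let ?W = "While (Neg (Equal (rr ''i'') (rr ''s'')))
   (Cond (Less (Const 0) (ld SG (rr ''i'')))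
     (st SLOT (ld OWN (twE (rr ''i''))) (Plus (ld SLOT (ld OWN (twE (rr ''i'')))) (Const 1))) Skip ;;
    Assign ''i'' (ld NX (rr ''i'')))"
 have W: "run ?W s0 (\<lambda>t s'. \<exists>cc'. ?I cc' s' \<and> \<not> bval \<pi> (Neg (Equal (rr ''i'') (rr ''s''))) s' \<and>
   real t + ?g cc' \<le> ?g ({}, ?Hb) + 1)"
 proof (rule run_while[where I = ?I and g = ?g])
  fix cc s1 assume I1: "?I cc s1" and ok1: "okst s1" and bv: "bval \<pi> (Neg (Equal (rr ''i'') (rr ''s''))) s1"
  obtain D' T' where cc: "cc = (D', T')" by (cases cc)
  define c where "c = regs s1 ''i''"
  have h1: "hp s1 = ?f D'" and it1: "it (hp s) A ?b D' T' c" and e1: "eqx {''i''} s s1" using I1 cc c_def by simp_all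
  have s1s: "regs s1 ''s'' = ?b" using e1 by (simp add: eqx_def)
  have cb: "c \<noteq> ?b" using bv s1s c_def by simp
  have u: "D' \<union> T' = ?Hb" and itr: "iter (hp s NX) (hp s PV) ?b D' T' c" using it1 unfolding it_def by blast+
  have cT: "c \<in> T'" using iter_mem[OF itr cb] .
  have dj: "c \<notin> D'" using iter_disj[OF itr] cT by blast
  have cA: "c \<in> A" using cT u by blast
  have "finite (D' \<union> T')" using u fA by simp
  hence fin: "finite D'" "finite T'" by simp_all
  have it2: "it (hp s) A ?b (insert c D') (T' - {c}) (hp s NX c)" using it_keep[OF it1 cb] .
  have oN: "far s c \<in> nodes n" using D(12) recokD(3)[OF i(4) cA] by blast
  have oM: "far s c < M" using V_less[OF oN] .
  have "card {g\<in>D'. far s g = far s c \<and> 0 < hp s SG g} \<le> card A" by (rule card_mono[OF fA]) (use u in blast)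
  hence sl: "Suc (hp s SLOT (far s c) + card {g\<in>D'. far s g = far s c \<and> 0 < hp s SG g}) \<le> W"
   using z[OF oN] Inv0_card(1)[OF I] MW by linarith
  have ins: "{g\<in>insert c D'. far s g = y \<and> 0 < hp s SG g} =
   (if far s c = y \<and> 0 < hp s SG c then insert c {g\<in>D'. far s g = y \<and> 0 < hp s SG g}
   else {g\<in>D'. far s g = y \<and> 0 < hp s SG g})" for y by auto
  have cd: "card {g\<in>insert c D'. far s g = y \<and> 0 < hp s SG g} =
   card {g\<in>D'. far s g = y \<and> 0 < hp s SG g} + (if far s c = y \<and> 0 < hp s SG c then 1 else 0)" for y
   unfolding ins using fin dj by simp
  have cT': "card (T' - {c}) + 1 = card T'" using fin cT by (metis Suc_eq_plus1 card_Suc_Diff1)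
  define s2 where "s2 = fin \<pi> (Cond (Less (Const 0) (ld SG (rr ''i'')))
     (st SLOT (ld OWN (twE (rr ''i''))) (Plus (ld SLOT (ld OWN (twE (rr ''i'')))) (Const 1))) Skip ;;
    Assign ''i'' (ld NX (rr ''i''))) s1"
  have "hp s2 = (if 0 < hp s SG c then (hp s1)(SLOT := (hp s1 SLOT)(far s c := hp s1 SLOT (far s c) + 1)) else hp s1)"
   "regs s2 = (regs s1)(''i'' := hp s NX c)" unfolding s2_def using h1 c_def by (simp_all add: mem_adr)
  hence h2: "hp s2 = ?f (insert c D')" "regs s2 = (regs s1)(''i'' := hp s NX c)" using h1 cd by (auto simp: fun_eq_iff)
  have I2: "?I (insert c D', T' - {c}) s2" using h2 it2 e1 by (simp add: eqx_def)
  show "run (Cond (Less (Const 0) (ld SG (rr ''i'')))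
     (st SLOT (ld OWN (twE (rr ''i''))) (Plus (ld SLOT (ld OWN (twE (rr ''i'')))) (Const 1))) Skip ;;
    Assign ''i'' (ld NX (rr ''i''))) s1 (\<lambda>t s'. \<exists>cc'. ?I cc' s' \<and> real t + 1 + ?g cc' \<le> ?g cc)"
  proof (rule run_fin[OF ok1], goal_cases)
   case 1 show ?case by simp
  next case 2 show ?case using h1 c_def[symmetric] oM sl by (simp add: mem_adr adr_less)
  next case (3 t)
   have "real t + 1 + ?g (insert c D', T' - {c}) \<le> ?g cc" using 3 cT' cc by simp
   thus ?case unfolding s2_def[symmetric] using I2 by blast
  qed
 next
  show "0 \<le> ?g cc" for cc by (cases cc) simp
 next
  show "?I ({}, ?Hb) s0" by (rule I0)
 next
  show "okst s0" by (rule ok0)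
 qed
 show ?thesis unfolding pass1_def
 proof (rule run_seq, rule run_fin[OF ok], goal_cases)
  case (3 t0)
  show ?case unfolding s0_def[symmetric]
  proof (rule run_mono[OF W], goal_cases)
   case (1 t s')
   then obtain cc' where Icc: "?I cc' s'" and nb: "\<not> bval \<pi> (Neg (Equal (rr ''i'') (rr ''s''))) s'"
    and tcc: "real t + ?g cc' \<le> ?g ({}, ?Hb) + 1" by iprover
   obtain D' T' where cc': "cc' = (D', T')" by (cases cc')
   have I': "?I (D', T') s'" and t: "real t + ?g (D', T') \<le> ?g ({}, ?Hb) + 1" using Icc tcc cc' by simp_all
   hence h': "hp s' = ?f D'" and it': "it (hp s) A ?b D' T' (regs s' ''i'')" and e': "eqx {''i''} s s'" by simp_all
   have "regs s' ''i'' = ?b" using nb e' by (simp add: eqx_def)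
   hence "T' = {}" using it' iter_cur unfolding it_def by metis
   hence "D' = ?Hb" using it' unfolding it_def by simp
   moreover have "t0 + t \<le> 4 * card ?Hb + 2"
   proof -
    have "real t \<le> 4 * real (card ?Hb) + 1" using t by simp
    hence "real t \<le> real (4 * card ?Hb + 1)" by simp
    hence "t \<le> 4 * card ?Hb + 1" by (simp only: of_nat_le_iff)
    thus ?thesis using 3 by simp
   qed
   ultimately show ?case using h' e' by simp
  qed
 qed simp_all
qed

end

text \<open>An edge that avoids the cleaned bucket from both ends keeps its records. One that meets
  the bucket is served by \<open>ne\<close>, through the twin if it is seen from the far
  end.\<close>

lemma cover_after:
 assumes net: "net H A adj" and rec: "recok H R A" and sym: "\<And>z w. adj z w \<Longrightarrow> adj w z" "\<And>z w. K z w = (K w z :: nat)"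
  and Hb: "Hb = {g\<in>A. H OWN g = x \<and> K x (H OWN (tw g)) = k}"
  and A2: "\<And>g. g \<in> A2 \<Longrightarrow> g \<in> A \<and> tw g \<in> A2" "\<And>g. g \<in> A \<Longrightarrow> g \<notin> Hb \<Longrightarrow> tw g \<notin> Hb \<Longrightarrow> g \<in> A2"
  and ne: "\<And>y. adj x y \<Longrightarrow> K x y = k \<Longrightarrow> \<exists>g\<in>A2. g \<in> Hb \<and> H OWN (tw g) = y"
 shows "cover H A2 adj" unfolding cover_def
proof (intro allI impI)
 fix z w assume a: "adj z w"
 show "\<exists>g\<in>A2. H OWN g = z \<and> H OWN (tw g) = w"
 proof (cases "z = x \<and> K x w = k")
  case True
  thus ?thesis using ne[of w] a Hb by auto
 next case f1: False
  show ?thesis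
  proof (cases "w = x \<and> K x z = k")
   case True
   then obtain g where g: "g \<in> A2" "g \<in> Hb" "H OWN (tw g) = z" using ne[of z] sym(1)[OF a] by auto
   have "tw (tw g) = g" using recokD(1)[OF rec] A2(1)[OF g(1)] tw_props(1) by blast
   thus ?thesis using g A2(1)[OF g(1)] Hb True by (intro bexI[of _ "tw g"]) auto
  next case False
   obtain g where g: "g \<in> A" "H OWN g = z" "H OWN (tw g) = w" using net_cover[OF net a] by blast
   have t: "tw (tw g) = g" using recokD(1)[OF rec g(1)] tw_props(1) by blast
   have "g \<notin> Hb" using g f1 Hb by auto
   moreover have "tw g \<notin> Hb" using g False Hb t by auto
   ultimately show ?thesis using A2(2) g by blast
  qed
 qed
qed

text \<open>Within the bucket only positive records are left, one per live edge, so the count is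
  exact; from the other end it follows by \<open>net_sym\<close>; records of all other pairs are
  untouched.\<close>

lemma net_after:
 assumes net: "net H A adj" and rec: "recok H R A" and rec2: "recok H2 R2 A2" and own: "H2 OWN = H OWN" "H2 SG = H SG"
  and sym: "\<And>z w. adj z w \<Longrightarrow> adj w z" "\<And>z w. K z w = (K w z :: nat)"
  and Hb: "Hb = {g\<in>A. H OWN g = x \<and> K x (H OWN (tw g)) = k}"
  and A2: "A2 \<subseteq> A" "\<And>g. g \<in> A \<Longrightarrow> g \<notin> Hb \<Longrightarrow> tw g \<notin> Hb \<Longrightarrow> g \<in> A2"
  and sg: "\<And>g. g \<in> A2 \<Longrightarrow> g \<in> Hb \<Longrightarrow> H SG g = 0"
  and cnt: "\<And>y. card {g\<in>A2. g \<in> Hb \<and> H OWN (tw g) = y} = of_bool (adj x y \<and> K x y = k)"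
 shows "net H2 A2 adj"
proof -
 have bucket: "card {g\<in>A2. H OWN g = x \<and> H OWN (tw g) = w \<and> H SG g = 0} =
  card {g\<in>A2. H OWN g = x \<and> H OWN (tw g) = w \<and> 0 < H SG g} + of_bool (adj x w)" if w: "K x w = k" for w
 proof -
  have m: "g \<in> Hb" if "g \<in> A2" "H OWN g = x" "H OWN (tw g) = w" for g using that w Hb A2 by auto
  have "{g\<in>A2. H OWN g = x \<and> H OWN (tw g) = w \<and> H SG g = 0} = {g\<in>A2. g \<in> Hb \<and> H OWN (tw g) = w}" using m sg Hb by auto
  moreover have e: "{g\<in>A2. H OWN g = x \<and> H OWN (tw g) = w \<and> 0 < H SG g} = {}" using m sg by fastforce
  ultimately show ?thesis unfolding e using cnt[of w] w by simp
 qed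
 have "card {g\<in>A2. H OWN g = z \<and> H OWN (tw g) = w \<and> H SG g = 0} =
  card {g\<in>A2. H OWN g = z \<and> H OWN (tw g) = w \<and> 0 < H SG g} + of_bool (adj z w)" for z w
 proof (cases "z = x \<and> K x w = k")
  case True
  thus ?thesis using bucket by simp
 next case f1: False
  show ?thesis
  proof (cases "w = x \<and> K x z = k")
   case True
   have "adj z x = adj x z" using sym(1) by blast
   thus ?thesis using bucket[of z] True
     net_sym[OF rec2, unfolded own, where x = z and y = x and \<phi> = "\<lambda>v. v = 0"]
     net_sym[OF rec2, unfolded own, where x = z and y = x and \<phi> = "\<lambda>v. 0 < v"] by simp
  next case False
   have "g \<in> A2" if "g \<in> A" "H OWN g = z" "H OWN (tw g) = w" for g
   proof (rule A2(2)[OF that(1)])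
    show "g \<notin> Hb" using that f1 Hb by auto
    have t: "tw (tw g) = g" using recokD(1)[OF rec that(1)] tw_props(1) by blast
    show "tw g \<notin> Hb" using that False Hb t by auto
   qed
   hence "{g\<in>A2. H OWN g = z \<and> H OWN (tw g) = w \<and> H SG g = 0} = {g\<in>A. H OWN g = z \<and> H OWN (tw g) = w \<and> H SG g = 0}"
    "{g\<in>A2. H OWN g = z \<and> H OWN (tw g) = w \<and> 0 < H SG g} = {g\<in>A. H OWN g = z \<and> H OWN (tw g) = w \<and> 0 < H SG g}"
    using A2(1) by blast+
   thus ?thesis using net unfolding net_def by simp
  qed
 qed
 thus ?thesis unfolding net_def own by blast
qed

lemma net_recok_cong: "net H A adj \<Longrightarrow> H' OWN = H OWN \<Longrightarrow> H' SG = H SG \<Longrightarrow> net H' A adj"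
 unfolding net_def by simp

context mach
begin

lemma Inv0_cong:
 assumes "Inv0 adj K A B bo s" "\<And>f. f \<notin> {LEV, SLOT, WL, INW} \<Longrightarrow> hp s' f = hp s f"
  "regs s' ''nb'' = regs s ''nb''" "regs s' ''nf'' = regs s ''nf''" "regs s' ''R'' = regs s ''R''"
 shows "Inv0 adj K A B bo s'"
proof -
 have f: "hp s' OWN = hp s OWN" "hp s' SG = hp s SG" "hp s' BK = hp s BK" using assms(2) by simp_all
 have "WFs s' A (\<lambda>h. K (hp s OWN h) (far s h)) (degk adj K) B bo {}"
  unfolding assms(3,4) by (rule WF_cong[OF Inv0D(1)[OF assms(1)]]) (use assms(2) in \<open>auto\<close>)
 thus ?thesis using assms(1) unfolding Inv0_def f assms(3-5) recok_def cover_def by simp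
qed

text \<open>The ghost sets are the kept part \<open>D\<close> and the unvisited part
  \<open>T\<close> of the bucket. \<open>SLOT y\<close> is the number of positive records towards
  \<open>y\<close> that still have to go: kept and remaining positive ones exceed it by one exactly
  if the edge is live. The first alternative for the cursor is needed when the last record has been
  killed, since bucket \<open>b\<close> is then freed. Each kill takes one half-edge of the bucket
  and its twin outside, hence the factor 2 in the last equation.\<close>

definition clnI where
 "clnI adj K A x k b bo s cc s1 \<longleftrightarrow> (case cc of (A1, B1, D, T) \<Rightarrow>
  Inv0 adj K A1 B1 bo s1 \<and> A1 \<subseteq> A \<and>
  (\<forall>g\<in>A. g \<notin> {g\<in>A. hp s OWN g = x \<and> K x (far s g) = k} \<longrightarrow>
    tw g \<notin> {g\<in>A. hp s OWN g = x \<and> K x (far s g) = k} \<longrightarrow> g \<in> A1) \<and>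
  (\<forall>f\<in>{OWN, SG, LEV, WL, INW}. hp s1 f = hp s f) \<and>
  regs s1 ''s'' = b \<and> eqx cleanrs s s1 \<and>
  D \<union> T = {g\<in>A1. hp s OWN g = x \<and> K x (far s g) = k} \<and> D \<inter> T = {} \<and>
  (T = {} \<and> regs s1 ''i'' = b \<or> b \<in> B1 \<and> it (hp s1) A1 b D T (regs s1 ''i'')) \<and>
  (\<forall>g\<in>D. hp s SG g = 0) \<and>
  (\<forall>y\<in>nodes n. hp s1 SLOT y \<le> card {g\<in>T. far s g = y \<and> hp s SG g = 0} \<and>
    card {g\<in>D. far s g = y} + card {g\<in>T. far s g = y \<and> hp s SG g = 0} =
     hp s1 SLOT y + of_bool (adj x y \<and> K x y = k)) \<and>
  card A + 2 * card (D \<union> T) = card A1 + 2 * card {g\<in>A. hp s OWN g = x \<and> K x (far s g) = k})"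

text \<open>Serves both kinds of kill: of a negative record, which leaves the counters alone, and of
  a positive one whose counter has just been lowered. In both cases \<open>sl\<close> is the counter
  equation for what remains.\<close>

lemma clnI_kill:
 assumes N: "net (hp s) A adj" and rec: "recok (hp s) (regs s ''R'') A"
  and I: "clnI adj K A x k b bo s (A1, B1, D, T) s1" and ok2: "okst s2" and cT: "c \<in> T" and cb: "regs s1 ''i'' = c"
  and it: "b \<in> B1" "it (hp s1) A1 b D T c" and h: "regs s2 ''h'' = c" "regs s2 ''j'' = hp s1 NX c"
  and s2: "\<And>f. f \<noteq> SLOT \<Longrightarrow> hp s2 f = hp s1 f" "eqx {''h'', ''j''} s1 s2"
  and sl: "\<And>y. y \<in> nodes n \<Longrightarrow> hp s2 SLOT y \<le> card {g\<in>T - {c}. far s g = y \<and> hp s SG g = 0} \<and>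
    card {g\<in>D. far s g = y} + card {g\<in>T - {c}. far s g = y \<and> hp s SG g = 0} =
     hp s2 SLOT y + of_bool (adj x y \<and> K x y = k)"
 shows "run kill s2 (\<lambda>t s3. t \<le> 30 \<and> regs s3 ''j'' = hp s1 NX c \<and>
  (\<exists>B3. clnI adj K A x k b bo s (A1 - {c, tw c}, B3, D, T - {c}) (set_reg ''i'' (regs s3 ''j'') s3)))"
proof -
 let ?Hb = "{g\<in>A. hp s OWN g = x \<and> K x (far s g) = k}"
 have I1: "Inv0 adj K A1 B1 bo s1" and sub: "A1 \<subseteq> A"
  and oth': "\<forall>g\<in>A. g \<notin> ?Hb \<longrightarrow> tw g \<notin> ?Hb \<longrightarrow> g \<in> A1"
  and f1: "\<forall>f\<in>{OWN, SG, LEV, WL, INW}. hp s1 f = hp s f" and r1: "regs s1 ''s'' = b" "eqx cleanrs s s1"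
  and DT: "D \<union> T = {g\<in>A1. hp s OWN g = x \<and> K x (far s g) = k}" "D \<inter> T = {}" and Dsg: "\<forall>g\<in>D. hp s SG g = 0"
  and cc: "card A + 2 * card (D \<union> T) = card A1 + 2 * card ?Hb" using I unfolding clnI_def prod.case by - (elim conjE, assumption)+
 have oth: "\<And>g. g \<in> A \<Longrightarrow> g \<notin> ?Hb \<Longrightarrow> tw g \<notin> ?Hb \<Longrightarrow> g \<in> A1" using oth' by blast
 have own1: "hp s1 OWN = hp s OWN" "hp s1 SG = hp s SG" using f1 by simp_all
 have I2: "Inv0 adj K A1 B1 bo s2" by (rule Inv0_cong[OF I1]) (use s2 in \<open>simp_all add: eqx_def\<close>)
 note i = Inv0D[OF I2]
 have own2: "hp s2 OWN = hp s OWN" "hp s2 SG = hp s SG" using s2(1) own1 by simp_all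
 have cA: "c \<in> A1" and cx: "hp s OWN c = x" "K x (far s c) = k" using DT(1) cT by auto
 note rc = recokD[OF i(4) cA]
 have tx: "far s c \<noteq> x" using rc(7) own2 cx by simp
 have tn: "tw c \<notin> D \<union> T" using DT(1) tx by simp
 have ct: "c \<noteq> tw c" using tw_props(3)[OF rc(1)] by simp
 have DT2: "D \<union> (T - {c}) = {g\<in>A1 - {c, tw c}. hp s OWN g = x \<and> K x (far s g) = k}" using DT cT tn by blast
 have symA: "adj w z" if "adj z w" for z w using i(5) that unfolding adjok_def by blast
 have tA2: "tw g \<in> A1 - {c, tw c}" if "g \<in> A1 - {c, tw c}" for g
 proof -
  have "tw g \<in> A1" using recokD(3)[OF i(4)] that by blast
  moreover have "tw (tw g) = g" "tw (tw c) = c" using recokD(1)[OF i(4)] that cA tw_props(1) by blast+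
  hence "tw g \<noteq> c" "tw g \<noteq> tw c" using that by auto
  ultimately show ?thesis by blast
 qed
 have yn: "y \<in> nodes n" if "adj x y" for y using i(5) that unfolding adjok_def by blast
 have cHb: "c \<in> ?Hb" using cA sub cx by blast
 have oth2: "g \<in> A1 - {c, tw c}" if "g \<in> A" "g \<notin> ?Hb" "tw g \<notin> ?Hb" for g
 proof -
  have "tw (tw c) = c" using tw_props(1)[OF rc(1)] .
  hence "g \<noteq> c" "g \<noteq> tw c" using that(2,3) cHb by auto
  thus ?thesis using oth[OF that] by blast
 qed
 have fin: "finite A1" using WFD(1)[OF i(1)] .
 \<comment> \<open>For a live edge the right-hand side of \<open>sl\<close> is at least 1, so some
   kept record or some remaining positive one joins the same endpoints.\<close>
 have ne: "\<exists>g\<in>A1 - {c, tw c}. g \<in> ?Hb \<and> far s g = y" if a: "adj x y" "K x y = k" for y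
 proof (rule ccontr)
  assume n: "\<not> (\<exists>g\<in>A1 - {c, tw c}. g \<in> ?Hb \<and> far s g = y)"
  have e: "g \<notin> D \<union> (T - {c}) \<or> far s g \<noteq> y" for g using n DT2 sub by blast
  have e1: "{g\<in>D. far s g = y} = {}" and e2: "{g\<in>T - {c}. far s g = y \<and> hp s SG g = 0} = {}" using e by blast+
  have "of_bool (adj x y \<and> K x y = k) = (1 :: nat)" using a by simp
  thus False using sl[OF yn[OF a(1)]] unfolding e1 e2 card.empty by linarith
 qed
 have cov: "cover (hp s2) (A1 - {c, tw c}) adj"
 proof -
  have "cover (hp s) (A1 - {c, tw c}) adj" by (rule cover_after[OF N rec symA i(7) refl _ oth2 ne]) (use tA2 sub in auto)
  thus ?thesis unfolding cover_def own2 .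
 qed
 have hA: "regs s2 ''h'' \<in> A1" using h cA by simp
 have cov': "cover (hp s2) (A1 - {regs s2 ''h'', tw (regs s2 ''h'')}) adj" using cov h by simp
 have bx: "{g\<in>A1. hp s2 BK g = b} = D \<union> T" using it(2) s2(1) unfolding it_def by simp
 have bkc: "hp s2 BK c = b" using bx cT by blast
 have it2: "it (hp s2) A1 b D T c" by (rule it_cong[OF it(2)]) (use s2(1) in simp_all)
 show ?thesis
 proof (rule run_mono[OF run_kill[OF ok2 I2 hA cov']], goal_cases)
  case (1 t s3)
  then obtain B3 where I3: "Inv0 adj K (A1 - {c, tw c}) B3 bo s3"
   and f3: "\<forall>f\<in>{OWN, SG, KEY, CNT, LEV, SLOT, WL, INW}. hp s3 f = hp s2 f" and e3: "eqx {''p'', ''c'', ''b'', ''nf'', ''h''} s2 s3"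
   and P3: "\<forall>D T. it (hp s2) A1 b D T c \<longrightarrow> {g\<in>A1. hp s2 BK g = b} \<noteq> {c} \<longrightarrow>
    b \<in> B3 \<and> it (hp s3) (A1 - {c, tw c}) b D (T - {c}) (hp s2 NX c)" and t: "t \<le> 30" unfolding h bkc by iprover
  let ?s4 = "set_reg ''i'' (regs s3 ''j'') s3"
  have j3: "regs s3 ''j'' = hp s1 NX c" using e3 h by (simp add: eqx_def)
  have p1: "Inv0 adj K (A1 - {c, tw c}) B3 bo ?s4" by (rule Inv0_cong[OF I3]) simp_all
  have p2: "A1 - {c, tw c} \<subseteq> A" using sub by blast
  have p3: "\<forall>f\<in>{OWN, SG, LEV, WL, INW}. hp ?s4 f = hp s f" using f3 s2(1) f1 by simp
  have p4: "regs ?s4 ''s'' = b" using e3 s2(2) r1 by (simp add: eqx_def)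
  have p5: "eqx cleanrs s ?s4" using r1(2) s2(2) e3 by (simp add: eqx_def)
  have p6: "D \<inter> (T - {c}) = {}" using DT(2) by blast
  \<comment> \<open>If \<open>c\<close> was alone, its bucket has been freed and there is no cursor
    in it any more; the successor read beforehand is then the bucket identifier itself, which ends
    the loop.\<close>
  have p7: "T - {c} = {} \<and> regs ?s4 ''i'' = b \<or> b \<in> B3 \<and> it (hp ?s4) (A1 - {c, tw c}) b D (T - {c}) (regs ?s4 ''i'')"
  proof (cases "D \<union> T = {c}")
   case True
   hence "T \<subseteq> {c}" "D \<subseteq> {c}" by blast+
   hence T: "T = {c}" "D = {}" using cT DT(2) by (auto simp: subset_singleton_iff)
   have "iter (hp s1 NX) (hp s1 PV) b D T c" using it(2) unfolding it_def by blast
   moreover have "c \<noteq> b" using rc(1) WF_B_mod[OF i(1) it(1)] by auto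
   ultimately have "iter (hp s1 NX) (hp s1 PV) b (insert c D) (T - {c}) (hp s1 NX c)" by (rule iter_keep)
   hence "hp s1 NX c = b" using iter_cur T by blast
   thus ?thesis using T j3 by simp
  next case False
   hence "b \<in> B3 \<and> it (hp s3) (A1 - {c, tw c}) b D (T - {c}) (hp s2 NX c)" using P3 it2 bx by simp
   thus ?thesis using j3 s2(1) by simp
  qed
  have p8: "hp ?s4 SLOT = hp s2 SLOT" using f3 by simp
  have p9: "card A + 2 * card (D \<union> (T - {c})) = card (A1 - {c, tw c}) + 2 * card ?Hb"
  proof -
   have "finite (D \<union> T)" using DT(1) fin by simp
   hence "card (D \<union> T) = Suc (card (D \<union> (T - {c})))"
   proof -
    have "D \<union> (T - {c}) = (D \<union> T) - {c}" using DT(2) cT by blast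
    thus ?thesis using \<open>finite (D \<union> T)\<close> cT by (metis UnCI card_Suc_Diff1)
   qed
   moreover have "card A1 = card (A1 - {c, tw c}) + 2"
   proof -
    have "card {c, tw c} = 2" using ct by simp
    moreover have "{c, tw c} \<subseteq> A1" using cA rc(3) by blast
    ultimately show ?thesis using fin by (metis add.commute card_Diff_subset card_mono finite.emptyI finite.insertI le_add_diff_inverse)
   qed
   ultimately show ?thesis using cc by simp
  qed
  have p10: "\<forall>g\<in>A. g \<notin> ?Hb \<longrightarrow> tw g \<notin> ?Hb \<longrightarrow> g \<in> A1 - {c, tw c}"
   by (intro ballI impI oth2)
  have p11: "\<forall>y\<in>nodes n. hp ?s4 SLOT y \<le> card {g\<in>T - {c}. far s g = y \<and> hp s SG g = 0} \<and>
    card {g\<in>D. far s g = y} + card {g\<in>T - {c}. far s g = y \<and> hp s SG g = 0} =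
     hp ?s4 SLOT y + of_bool (adj x y \<and> K x y = k)" unfolding p8 using sl by blast
  have "clnI adj K A x k b bo s (A1 - {c, tw c}, B3, D, T - {c}) ?s4" unfolding clnI_def prod.case
   by (intro conjI p1 p2 p3 p4 p5 p6 p7 p9 p10 p11 DT2 Dsg)
  thus ?case using t j3 by iprover
 qed
qed

lemma run_pass2:
 assumes ok: "okst s" and I: "Inv0 adj K A B bo s" and N: "net (hp s) A adj"
  and b: "regs s ''s'' \<in> B" and x: "x = bo (regs s ''s'')" and k: "k = hp s KEY (regs s ''s'')"
  and z: "\<And>y. y \<in> nodes n \<Longrightarrow> hp s SLOT y =
   card {g\<in>{g\<in>A. hp s BK g = regs s ''s''}. far s g = y \<and> 0 < hp s SG g}"
 shows "run pass2 s (\<lambda>t s'. \<exists>A' B'. Inv0 adj K A' B' bo s' \<and> net (hp s') A' adj \<and> A' \<subseteq> A \<and>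
  (\<forall>g\<in>A'. hp s OWN g = x \<longrightarrow> K x (far s g) = k \<longrightarrow> hp s SG g = 0) \<and>
  (\<forall>y\<in>nodes n. hp s' SLOT y = 0) \<and>
  (\<forall>f\<in>{OWN, SG, LEV, WL, INW}. hp s' f = hp s f) \<and>
  eqx cleanrs s s' \<and>
  card A + 2 * degk adj K x k = card A' + 2 * card {g\<in>A. hp s BK g = regs s ''s''} \<and>
  t \<le> 40 * card {g\<in>A. hp s BK g = regs s ''s''} + 2)"
proof -
 let ?b = "regs s ''s''"
 let ?Hb = "{g\<in>A. hp s OWN g = x \<and> K x (far s g) = k}"
 note i = Inv0D[OF I]
 note D = WFD[OF i(1)]
 have fA: "finite A" using D(1) .
 have Hb: "{g\<in>A. hp s BK g = ?b} = ?Hb" unfolding WF_bucket[OF i(1) b] x k by (intro Collect_cong) metis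
 have symA: "adj w z" if "adj z w" for z w using i(5) that unfolding adjok_def by blast
 let ?I = "clnI adj K A x k ?b bo s"
 let ?g = "\<lambda>(A1 :: nat set, B1 :: nat set, D :: nat set, T :: nat set). 40 * real (card T)"
 define s0 where "s0 = fin \<pi> (Assign ''i'' (ld NX (rr ''s''))) s"
 have h0: "hp s0 = hp s" "regs s0 = (regs s)(''i'' := hp s NX ?b)" unfolding s0_def by (simp_all add: mem_adr)
 have ok0: "okst s0" unfolding s0_def using okst_reg[OF ok okst_hp_le[OF ok]] by (simp add: mem_adr)
 have I0: "?I (A, B, {}, ?Hb) s0"
 proof -
  have "Inv0 adj K A B bo s0" by (rule Inv0_cong[OF I]) (use h0 in simp_all)
  moreover have "it (hp s0) A ?b {} ?Hb (regs s0 ''i'')" using it_start[OF i(1) b] h0 Hb by simp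
  moreover have "hp s0 SLOT y \<le> card {g\<in>?Hb. far s g = y \<and> hp s SG g = 0} \<and>
    card {g\<in>{}. far s g = y} + card {g\<in>?Hb. far s g = y \<and> hp s SG g = 0} =
     hp s0 SLOT y + of_bool (adj x y \<and> K x y = k)" if y: "y \<in> nodes n" for y
  proof (cases "K x y = k")
   case True
   have 1: "{g\<in>?Hb. far s g = y \<and> hp s SG g = 0} = {g\<in>A. hp s OWN g = x \<and> far s g = y \<and> hp s SG g = 0}"
    "{g\<in>?Hb. far s g = y \<and> 0 < hp s SG g} = {g\<in>A. hp s OWN g = x \<and> far s g = y \<and> 0 < hp s SG g}" using True by blast+
   have 2: "hp s0 SLOT y = card {g\<in>?Hb. far s g = y \<and> 0 < hp s SG g}" using z[OF y] h0 Hb by simp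
   have "card {g\<in>A. hp s OWN g = x \<and> far s g = y \<and> hp s SG g = 0} =
    card {g\<in>A. hp s OWN g = x \<and> far s g = y \<and> 0 < hp s SG g} + of_bool (adj x y)" using N unfolding net_def by blast
   thus ?thesis unfolding 2 1 using True by simp
  next case False
   have 1: "{g\<in>?Hb. far s g = y \<and> hp s SG g = 0} = {}"
    "{g\<in>?Hb. far s g = y \<and> 0 < hp s SG g} = {}" using False by blast+
   have 2: "hp s0 SLOT y = card {g\<in>?Hb. far s g = y \<and> 0 < hp s SG g}" using z[OF y] h0 Hb by simp
   show ?thesis unfolding 2 1 using False by simp
  qed
  ultimately show ?thesis unfolding clnI_def prod.case using b h0 by (intro conjI ballI impI) (simp_all add: eqx_def)
 qed
 let ?body = "(Assign ''j'' (ld NX (rr ''i'')) ;; Assign ''h'' (rr ''i'')) ;;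
    Cond (Less (Const 0) (ld SG (rr ''i''))) kill
     (Cond (Less (Const 0) (ld SLOT (ld OWN (twE (rr ''i''))))) (decslot ;; kill) Skip) ;;
    Assign ''i'' (rr ''j'')"
 let ?W = "While (Neg (Equal (rr ''i'') (rr ''s''))) (?body)"
 have W: "run ?W s0 (\<lambda>t s'. \<exists>cc'. ?I cc' s' \<and> \<not> bval \<pi> (Neg (Equal (rr ''i'') (rr ''s''))) s' \<and>
   real t + ?g cc' \<le> ?g (A, B, {}, ?Hb) + 1)"
 proof (rule run_while[where I = ?I and g = ?g])
  fix cc s1 assume I1: "?I cc s1" and ok1: "okst s1" and bv: "bval \<pi> (Neg (Equal (rr ''i'') (rr ''s''))) s1"
  obtain A1 B1 D' T' where cc: "cc = (A1, B1, D', T')" by (cases cc)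
  define c where "c = regs s1 ''i''"
  have I1': "?I (A1, B1, D', T') s1" using I1 cc by simp
  have J: "Inv0 adj K A1 B1 bo s1" and sub: "A1 \<subseteq> A" and f1: "\<forall>f\<in>{OWN, SG, LEV, WL, INW}. hp s1 f = hp s f"
   and rs: "regs s1 ''s'' = ?b" and DT: "D' \<union> T' = {g\<in>A1. hp s OWN g = x \<and> K x (far s g) = k}" "D' \<inter> T' = {}"
   and cur: "T' = {} \<and> regs s1 ''i'' = ?b \<or> ?b \<in> B1 \<and> it (hp s1) A1 ?b D' T' (regs s1 ''i'')"
   and Dsg: "\<forall>g\<in>D'. hp s SG g = 0"
   and slot: "\<forall>y\<in>nodes n. hp s1 SLOT y \<le> card {g\<in>T'. far s g = y \<and> hp s SG g = 0} \<and>
    card {g\<in>D'. far s g = y} + card {g\<in>T'. far s g = y \<and> hp s SG g = 0} =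
     hp s1 SLOT y + of_bool (adj x y \<and> K x y = k)" using I1' unfolding clnI_def prod.case by - (elim conjE, assumption)+
  have cb: "c \<noteq> ?b" using bv rs c_def by simp
  have bB1: "?b \<in> B1" and it1: "it (hp s1) A1 ?b D' T' c" using cur cb c_def by blast+
  have itr: "iter (hp s1 NX) (hp s1 PV) ?b D' T' c" using it1 unfolding it_def by blast
  have cT: "c \<in> T'" using iter_mem[OF itr cb] .
  have cA1: "c \<in> A1" using cT DT by blast
  note ii = Inv0D[OF J]
  have fin: "finite T'" "finite D'"
  proof -
   have "finite (D' \<union> T')" unfolding DT(1) using fA sub finite_subset by fastforce
   thus "finite T'" "finite D'" by simp_all
  qed
  have cT': "real (card (T' - {c})) + 1 = real (card T')" using card_Suc_Diff1[OF fin(1) cT] by linarith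
  have own1: "hp s1 OWN = hp s OWN" "hp s1 SG = hp s SG" using f1 by simp_all
  define y where "y = far s c"
  have yN: "y \<in> nodes n" using WFD(12)[OF ii(1) recokD(3)[OF ii(4) cA1]] own1 y_def by simp
  have cM: "c \<le> W" using Inv0_card(2)[OF J cA1] MW by linarith
  define s2 where "s2 = fin \<pi> (Assign ''j'' (ld NX (rr ''i'')) ;; Assign ''h'' (rr ''i'')) s1"
  have h2: "hp s2 = hp s1" "regs s2 = (regs s1)(''j'' := hp s1 NX c, ''h'' := c)" unfolding s2_def using c_def by (simp_all add: mem_adr)
  have ok2: "okst s2" unfolding s2_def using okst_reg[OF okst_reg[OF ok1 okst_hp_le[OF ok1]] cM] c_def by (simp add: mem_adr)
  have r2: "regs s2 ''i'' = c" "regs s2 ''h'' = c" "regs s2 ''j'' = hp s1 NX c" using h2 c_def by simp_all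
  have e2: "eqx {''h'', ''j''} s1 s2" using h2 by (simp add: eqx_def)
  let ?P = "\<lambda>t s'. t \<le> 33 \<and> (\<exists>A3 B3 D3. ?I (A3, B3, D3, T' - {c}) (set_reg ''i'' (regs s' ''j'') s'))"
  have mid: "run (Cond (Less (Const 0) (ld SG (rr ''i''))) kill
     (Cond (Less (Const 0) (ld SLOT (ld OWN (twE (rr ''i''))))) (decslot ;; kill) Skip)) s2 ?P"
  proof (rule run_cond[OF ok2])
   assume "bval \<pi> (Less (Const 0) (ld SG (rr ''i''))) s2"
   hence sg: "0 < hp s SG c" using h2 r2 own1 by (simp add: mem_adr)
   have e: "{g\<in>T' - {c}. far s g = y' \<and> hp s SG g = 0} = {g\<in>T'. far s g = y' \<and> hp s SG g = 0}" for y' using sg by auto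
   have "run kill s2 (\<lambda>t s3. t \<le> 30 \<and> regs s3 ''j'' = hp s1 NX c \<and>
     (\<exists>B3. ?I (A1 - {c, tw c}, B3, D', T' - {c}) (set_reg ''i'' (regs s3 ''j'') s3)))"
    by (rule clnI_kill[OF N i(4) I1' ok2 cT c_def[symmetric] bB1 it1 r2(2,3) _ e2])
     (use h2 slot e in simp_all)
   thus "run kill s2 (\<lambda>t. ?P (Suc t))"
   proof (rule run_mono, goal_cases)
    case (1 t s3)
    thus ?case by (intro conjI) (linarith, iprover)
   qed
  next
   assume "\<not> bval \<pi> (Less (Const 0) (ld SG (rr ''i''))) s2"
   hence sg: "hp s SG c = 0" using h2 r2 own1 by (simp add: mem_adr)
   have e: "card {g\<in>T'. far s g = y' \<and> hp s SG g = 0} =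
     card {g\<in>T' - {c}. far s g = y' \<and> hp s SG g = 0} + of_bool (y' = y)" for y'
   proof (cases "y' = y")
    case True
    have "{g\<in>T'. far s g = y' \<and> hp s SG g = 0} = insert c {g\<in>T' - {c}. far s g = y' \<and> hp s SG g = 0}"
     using True cT sg y_def by blast
    thus ?thesis using True fin by simp
   next case False
    hence "{g\<in>T'. far s g = y' \<and> hp s SG g = 0} = {g\<in>T' - {c}. far s g = y' \<and> hp s SG g = 0}" using y_def by blast
    thus ?thesis using False by simp
   qed
   show "run (Cond (Less (Const 0) (ld SLOT (ld OWN (twE (rr ''i''))))) (decslot ;; kill) Skip) s2 (\<lambda>t. ?P (Suc t))"
   proof (rule run_cond[OF ok2])
    assume "bval \<pi> (Less (Const 0) (ld SLOT (ld OWN (twE (rr ''i''))))) s2"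
    hence sl: "0 < hp s1 SLOT y" using h2 r2 own1 y_def by (simp add: mem_adr)
    define s3 where "s3 = fin \<pi> decslot s2"
    have h3: "hp s3 = (hp s1)(SLOT := (hp s1 SLOT)(y := hp s1 SLOT y - 1))" "regs s3 = regs s2"
     unfolding s3_def decslot_def using h2 r2 own1 y_def by (simp_all add: mem_adr)
    have ok3: "okst s3" unfolding s3_def decslot_def using okst_mem[OF ok2, of "adr SLOT y" "hp s1 SLOT y - 1"]
      V_less[OF yN] h2 r2 own1 y_def[symmetric] okst_hp_le[OF ok1, of SLOT y] by (simp add: mem_adr adr_less)
    have "run kill s3 (\<lambda>t s4. t \<le> 30 \<and> regs s4 ''j'' = hp s1 NX c \<and>
      (\<exists>B3. ?I (A1 - {c, tw c}, B3, D', T' - {c}) (set_reg ''i'' (regs s4 ''j'') s4)))"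
    proof (rule clnI_kill[OF N i(4) I1' ok3 cT c_def[symmetric] bB1 it1], goal_cases)
     case (5 y')
     have "hp s3 SLOT y' + of_bool (y' = y) = hp s1 SLOT y'" using h3 sl by simp
     thus ?case using slot[rule_format, OF 5] e[of y'] by linarith
    qed (use h3 r2 e2 in \<open>simp_all add: eqx_def\<close>)
    hence K: "run kill s3 (\<lambda>t. ?P (Suc (Suc (1 + t))))"
    proof (rule run_mono, goal_cases)
     case (1 t s4)
     thus ?case by (intro conjI) (linarith, iprover)
    qed
    show "run (decslot ;; kill) s2 (\<lambda>t. ?P (Suc (Suc t)))"
    proof (rule run_seq, rule run_fin[OF ok2], goal_cases)
     case (3 t)
     hence "t \<le> 1" by (simp add: decslot_def)
     thus ?case unfolding s3_def[symmetric] by (intro run_mono[OF K]) auto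
    qed (use h2 r2 own1 y_def[symmetric] V_less[OF yN] in \<open>simp_all add: decslot_def mem_adr adr_less\<close>)
   next
    assume "\<not> bval \<pi> (Less (Const 0) (ld SLOT (ld OWN (twE (rr ''i''))))) s2"
    hence sl: "hp s1 SLOT y = 0" using h2 r2 own1 y_def by (simp add: mem_adr)
    let ?s3 = "set_reg ''i'' (regs s2 ''j'') s2"
    have h3: "hp ?s3 = hp s1" "regs ?s3 = (regs s1)(''j'' := hp s1 NX c, ''h'' := c, ''i'' := hp s1 NX c)" using h2 by simp_all
    have d: "card {g\<in>insert c D'. far s g = y'} = card {g\<in>D'. far s g = y'} + of_bool (y' = y)" for y'
    proof (cases "y' = y")
     case True
     have "{g\<in>insert c D'. far s g = y'} = insert c {g\<in>D'. far s g = y'}" using True y_def by blast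
     moreover have "c \<notin> D'" using cT DT(2) by blast
     ultimately show ?thesis using True fin by simp
    next case False
     hence "{g\<in>insert c D'. far s g = y'} = {g\<in>D'. far s g = y'}" using y_def by blast
     thus ?thesis using False by simp
    qed
    have J3: "Inv0 adj K A1 B1 bo ?s3" by (rule Inv0_cong[OF J]) (use h3 in simp_all)
    have it3: "it (hp ?s3) A1 ?b (insert c D') (T' - {c}) (regs ?s3 ''i'')" using it_keep[OF it1 cb] h3 by simp
    have U: "insert c D' \<union> (T' - {c}) = D' \<union> T'" using cT by blast
    have ND: "insert c D' \<inter> (T' - {c}) = {}" using DT(2) by blast
    have sl3: "hp ?s3 SLOT y' \<le> card {g\<in>T' - {c}. far s g = y' \<and> hp s SG g = 0} \<and>
     card {g\<in>insert c D'. far s g = y'} + card {g\<in>T' - {c}. far s g = y' \<and> hp s SG g = 0} =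
     hp ?s3 SLOT y' + of_bool (adj x y' \<and> K x y' = k)" if "y' \<in> nodes n" for y'
    proof (cases "y' = y")
     case True
     thus ?thesis using slot[rule_format, OF that] e[of y'] d[of y'] sl h3(1) by simp
    next case False
     thus ?thesis using slot[rule_format, OF that] e[of y'] d[of y'] h3(1) by simp
    qed
    have rest: "(\<forall>g\<in>A. g \<notin> ?Hb \<longrightarrow> tw g \<notin> ?Hb \<longrightarrow> g \<in> A1)"
     "eqx cleanrs s s1"
     "card A + 2 * card (D' \<union> T') = card A1 + 2 * card ?Hb" using I1' unfolding clnI_def prod.case by - (elim conjE, assumption)+
    have f3: "\<forall>f\<in>{OWN, SG, LEV, WL, INW}. hp ?s3 f = hp s f" using f1 h3(1) by simp
    have rs3: "regs ?s3 ''s'' = ?b" using rs h3(2) by simp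
    have e3: "eqx cleanrs s ?s3" using rest(2) unfolding eqx_def h3(2) by simp
    have DT3: "insert c D' \<union> (T' - {c}) = {g\<in>A1. hp s OWN g = x \<and> K x (far s g) = k}" using U DT(1) by simp
    have cur3: "T' - {c} = {} \<and> regs ?s3 ''i'' = ?b \<or>
     ?b \<in> B1 \<and> it (hp ?s3) A1 ?b (insert c D') (T' - {c}) (regs ?s3 ''i'')" by (rule disjI2, rule conjI[OF bB1 it3])
    have Dsg3: "\<forall>g\<in>insert c D'. hp s SG g = 0" using Dsg sg by simp
    have cc3: "card A + 2 * card (insert c D' \<union> (T' - {c})) = card A1 + 2 * card ?Hb" using rest(3) U by simp
    have "?I (A1, B1, insert c D', T' - {c}) ?s3" unfolding clnI_def prod.case
     by (intro conjI J3 sub rest(1) f3 rs3 e3 DT3 ND cur3 Dsg3 cc3 ballI[OF conjI[OF conjunct1[OF sl3] conjunct2[OF sl3]]])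
    hence "?P (Suc (Suc 1)) s2" by (intro conjI) (simp, iprover)
    thus "run Skip s2 (\<lambda>t. ?P (Suc (Suc t)))" by (rule run_skip[OF ok2])
   qed
  qed
  show "run ?body s1 (\<lambda>t s'. \<exists>cc'. ?I cc' s' \<and> real t + 1 + ?g cc' \<le> ?g cc)"
  proof (rule run_seq, rule run_fin[OF ok1], goal_cases)
   case (3 t0)
   show ?case unfolding s2_def[symmetric]
   proof (rule run_seq, rule run_mono[OF mid], goal_cases)
    case (1 t1 s3)
    then obtain A3 B3 D3 where I3: "?I (A3, B3, D3, T' - {c}) (set_reg ''i'' (regs s3 ''j'') s3)"
     and t1: "t1 \<le> 33" and ok3: "okst s3" by iprover
    show ?case
    proof (rule run_fin[OF ok3], goal_cases)
     case (3 t2)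
     have "real (t0 + (t1 + t2)) + 1 + ?g (A3, B3, D3, T' - {c}) \<le> ?g cc"
      unfolding cc prod.case using cT' t1 3 \<open>t0 \<le> _\<close> by simp
     moreover have "?I (A3, B3, D3, T' - {c}) (fin \<pi> (Assign ''i'' (rr ''j'')) s3)" using I3 by simp
     ultimately show ?case by iprover
    qed simp_all
   qed
  qed simp_all
 next
  show "0 \<le> ?g cc" for cc by (cases cc) simp
 next
  show "?I (A, B, {}, ?Hb) s0" by (rule I0)
 next
  show "okst s0" by (rule ok0)
 qed
 show ?thesis unfolding pass2_def
 proof (rule run_seq, rule run_fin[OF ok], goal_cases)
  case (3 t0)
  show ?case unfolding s0_def[symmetric]
  proof (rule run_mono[OF W], goal_cases)
   case (1 t s')
   then obtain cc' where Icc: "?I cc' s'" and nb: "\<not> bval \<pi> (Neg (Equal (rr ''i'') (rr ''s''))) s'"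
    and tcc: "real t + ?g cc' \<le> ?g (A, B, {}, ?Hb) + 1" by iprover
   obtain A1 B1 D' T' where cc': "cc' = (A1, B1, D', T')" by (cases cc')
   have t: "real t + ?g (A1, B1, D', T') \<le> ?g (A, B, {}, ?Hb) + 1" using tcc cc' by simp
   have J: "Inv0 adj K A1 B1 bo s'" and sub: "A1 \<subseteq> A"
    and oth: "\<forall>g\<in>A. g \<notin> ?Hb \<longrightarrow> tw g \<notin> ?Hb \<longrightarrow> g \<in> A1"
    and f1: "\<forall>f\<in>{OWN, SG, LEV, WL, INW}. hp s' f = hp s f" and rs: "regs s' ''s'' = ?b" and e: "eqx cleanrs s s'"
    and DT: "D' \<union> T' = {g\<in>A1. hp s OWN g = x \<and> K x (far s g) = k}" "D' \<inter> T' = {}"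
    and cur: "T' = {} \<and> regs s' ''i'' = ?b \<or> ?b \<in> B1 \<and> it (hp s') A1 ?b D' T' (regs s' ''i'')"
    and Dsg: "\<forall>g\<in>D'. hp s SG g = 0"
    and slot: "\<forall>y\<in>nodes n. hp s' SLOT y \<le> card {g\<in>T'. far s g = y \<and> hp s SG g = 0} \<and>
     card {g\<in>D'. far s g = y} + card {g\<in>T'. far s g = y \<and> hp s SG g = 0} =
      hp s' SLOT y + of_bool (adj x y \<and> K x y = k)" and cc: "card A + 2 * card (D' \<union> T') = card A1 + 2 * card ?Hb"
    using Icc unfolding cc' clnI_def prod.case by - (elim conjE, assumption)+
   have ib: "regs s' ''i'' = ?b" using nb rs by simp
   have T: "T' = {}"
   proof (rule ccontr)
    assume ne: "T' \<noteq> {}"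
    hence "iter (hp s' NX) (hp s' PV) ?b D' T' (regs s' ''i'')" using cur unfolding it_def by blast
    thus False using iter_cur ib ne by blast
   qed
   have D1: "D' = {g\<in>A1. g \<in> ?Hb}" using DT(1) T sub by blast
   have slot0: "hp s' SLOT y = 0" "card {g\<in>D'. far s g = y} = of_bool (adj x y \<and> K x y = k)"
    if "y \<in> nodes n" for y using slot[rule_format, OF that] unfolding T by simp_all
   note ii = Inv0D[OF J]
   have own1: "hp s' OWN = hp s OWN" "hp s' SG = hp s SG" using f1 by simp_all
   have cnt: "card {g\<in>A1. g \<in> ?Hb \<and> far s g = y} = of_bool (adj x y \<and> K x y = k)" for y
   proof (cases "y \<in> nodes n")
    case True
    have "{g\<in>A1. g \<in> ?Hb \<and> far s g = y} = {g\<in>D'. far s g = y}" using D1 by blast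
    thus ?thesis using slot0(2)[OF True] by simp
   next case False
    have "far s g \<noteq> y" if "g \<in> A1" for g using WFD(12)[OF ii(1) recokD(3)[OF ii(4) that]] False own1 by auto
    hence e: "{g\<in>A1. g \<in> ?Hb \<and> far s g = y} = {}" by blast
    have "\<not> adj x y" using False i(5) unfolding adjok_def by blast
    thus ?thesis unfolding e by simp
   qed
   have N': "net (hp s') A1 adj" by (rule net_after[OF N i(4) ii(4) own1 symA i(7) refl sub _ _ cnt]) (use oth Dsg D1 in blast)+
   \<comment> \<open>The kept records are one per live neighbour under this key, so their number is
     the degree. This turns the size of the bucket into degree plus deletions.\<close>
   have dk: "card D' = degk adj K x k"
   proof -
    have "inj_on (\<lambda>g. far s g) D'"
    proof (rule inj_onI)
     fix g g' assume g: "g \<in> D'" "g' \<in> D'" "far s g = hp s OWN (tw g')"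
     have fD: "finite D'" using D1 sub fA finite_subset by fastforce
     have "card {h\<in>D'. far s h = far s g} \<le> 1"
     proof -
      have "g \<in> A1" using g(1) D1 by blast
      hence "far s g \<in> nodes n" using WFD(12)[OF ii(1) recokD(3)[OF ii(4)]] own1 by simp
      thus ?thesis using slot0(2) by simp
     qed
     thus "g = g'" using g fD by (auto simp: card_le_Suc0_iff_eq)
    qed
    hence "card D' = card ((\<lambda>g. far s g) ` D')" by (simp add: card_image)
    moreover have "(\<lambda>g. far s g) ` D' = {y. adj x y \<and> K x y = k}"
    proof (intro equalityI subsetI)
     fix y assume "y \<in> (\<lambda>g. far s g) ` D'"
     then obtain g where g: "g \<in> D'" "far s g = y" by blast
     hence yn: "y \<in> nodes n" using WFD(12)[OF ii(1) recokD(3)[OF ii(4)], of g] own1 D1 by auto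
     have "finite {h\<in>D'. far s h = y}" using D1 sub fA finite_subset by fastforce
     hence "card {h\<in>D'. far s h = y} \<noteq> 0" using g by auto
     thus "y \<in> {y. adj x y \<and> K x y = k}" using slot0(2)[OF yn] by (auto split: if_splits)
    next
     fix y assume y: "y \<in> {y. adj x y \<and> K x y = k}"
     hence yn: "y \<in> nodes n" using i(5) unfolding adjok_def by blast
     have "card {h\<in>D'. far s h = y} \<noteq> 0" using slot0(2)[OF yn] y by simp
     hence "{h\<in>D'. far s h = y} \<noteq> {}" by (metis card.empty)
     thus "y \<in> (\<lambda>g. far s g) ` D'" by blast
    qed
    ultimately show ?thesis unfolding degk_def by simp
   qed
   have tt: "t0 + t \<le> 40 * card ?Hb + 2"
   proof -
    have "real t \<le> 40 * real (card ?Hb) + 1" using t unfolding T prod.case by simp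
    hence "real t \<le> real (40 * card ?Hb + 1)" by simp
    hence "t \<le> 40 * card ?Hb + 1" by (simp only: of_nat_le_iff)
    thus ?thesis using 3 by simp
   qed
   have sgA: "\<forall>g\<in>A1. hp s OWN g = x \<longrightarrow> K x (far s g) = k \<longrightarrow> hp s SG g = 0" using Dsg D1 sub by blast
   have c2: "card A + 2 * degk adj K x k = card A1 + 2 * card ?Hb" using cc T dk by simp
   have sl0: "\<forall>y\<in>nodes n. hp s' SLOT y = 0" using slot0(1) by simp
   show ?case unfolding Hb by (rule exI[of _ A1], rule exI[of _ B1]) (intro conjI J N' sub sgA sl0 f1 e c2 tt)
  qed
 qed simp_all
qed

end

section \<open>Queueing nodes and rebucketing the edges of a node\<close>

definition pushwl :: com where
 "pushwl = Cond (Equal (ld INW (rr ''y'')) (Const 0))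
  (st INW (rr ''y'') (Const 1) ;; st WL (rr ''top'') (rr ''y'') ;;
   Assign ''top'' (Plus (rr ''top'') (Const 1))) Skip"

text \<open>Register \<open>l\<close> is the least level at which a neighbour's edge gets the new
  key \<open>q\<close>: one above the old level when moving up, because an edge to a node left
  behind keeps its minimum, and 0 when moving down. Every neighbour met is queued.\<close>

definition moveloop :: com where
 "moveloop = Assign ''i'' (ld NX (rr ''s'')) ;;
  While (Neg (Equal (rr ''i'') (rr ''s'')))
   ((Assign ''j'' (ld NX (rr ''i'')) ;; Assign ''y'' (ld OWN (twE (rr ''i'')))) ;;
    Cond (Less (ld LEV (rr ''y'')) (rr ''l'')) Skip shift2 ;;
    pushwl ;; Assign ''i'' (rr ''j''))"

definition queue :: "nat \<Rightarrow> heap \<Rightarrow> nat set" where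
 "queue n H = {x\<in>nodes n. H INW x \<noteq> 0}"

definition wlok :: "nat \<Rightarrow> heap \<Rightarrow> nat \<Rightarrow> bool" where
 "wlok n H tp \<longleftrightarrow> inj_on (H WL) {..<tp} \<and> H WL ` {..<tp} = queue n H"

text \<open>The flag \<open>INW\<close> keeps the stack free of duplicates, so its height is at most
  the number of nodes and its cells fit into the space.\<close>

lemma wlok_top: "wlok n H tp \<Longrightarrow> tp = card (queue n H) \<and> tp \<le> 2 * n"
proof -
 assume *: "wlok n H tp"
 have inj: "inj_on (H WL) {..<tp}" using * unfolding wlok_def by simp
 have "tp = card (H WL ` {..<tp})" by (simp only: card_image[OF inj] card_lessThan)
 also have "\<dots> = card (queue n H)" using * unfolding wlok_def by simp
 finally have "tp = card (queue n H)" .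
 moreover have "card (queue n H) \<le> card (nodes n)" by (rule card_mono[OF finite_nodes]) (auto simp: queue_def)
 ultimately show ?thesis using card_nodes by simp
qed

definition moveK :: "(nat \<Rightarrow> nat \<Rightarrow> nat) \<Rightarrow> nat \<Rightarrow> nat set \<Rightarrow> nat \<Rightarrow> nat \<Rightarrow> nat \<Rightarrow> nat" where
 "moveK K x Y q = (\<lambda>z w. if z = x \<and> w \<in> Y \<or> w = x \<and> z \<in> Y then q else K z w)"

lemma setK_moveK: "x \<noteq> y \<Longrightarrow> x \<notin> Y \<Longrightarrow> setK (moveK K x Y q) x y q = moveK K x (insert y Y) q"
 unfolding setK_def moveK_def by (auto simp: fun_eq_iff)

context mach
begin

abbreviation "qu s \<equiv> queue n (hp s)"
abbreviation "wl_ok s \<equiv> wlok n (hp s) (regs s ''top'')"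

lemma run_pushwl:
 assumes ok: "okst s" and w: "wl_ok s" and y: "regs s ''y'' \<in> nodes n"
 shows "run pushwl s (\<lambda>t s'. wl_ok s' \<and>
  qu s' = insert (regs s ''y'') (qu s) \<and>
  (\<forall>f. f \<noteq> WL \<longrightarrow> f \<noteq> INW \<longrightarrow> hp s' f = hp s f) \<and> eqx {''top''} s s' \<and> t \<le> 4)"
proof -
 let ?y = "regs s ''y''" and ?t = "regs s ''top''"
 have tM: "?t < M" using wlok_top[OF w] nM by linarith
 have yM: "?y < M" using V_less[OF y] .
 define s' where "s' = fin \<pi> pushwl s"
 have h: "hp s' = (if hp s INW ?y = 0 then (hp s)(INW := (hp s INW)(?y := 1), WL := (hp s WL)(?t := ?y)) else hp s)"
  "regs s' = (if hp s INW ?y = 0 then (regs s)(''top'' := ?t + 1) else regs s)" unfolding s'_def pushwl_def by (simp_all add: mem_adr)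
 have wl: "wl_ok s' \<and> qu s' = insert ?y (qu s)"
 proof (cases "hp s INW ?y = 0")
  case True
  have q: "qu s' = insert ?y (qu s)" using h(1) True y unfolding queue_def by auto
  have yq: "?y \<notin> qu s" using True unfolding queue_def by simp
  have im: "hp s WL ` {..<?t} = qu s" and inj: "inj_on (hp s WL) {..<?t}" using w unfolding wlok_def by blast+
  have e: "((hp s WL)(?t := ?y)) ` {..<?t} = hp s WL ` {..<?t}" by (intro image_cong) auto
  have "inj_on ((hp s WL)(?t := ?y)) {..<?t}" using inj by (auto simp: inj_on_def)
  hence "inj_on ((hp s WL)(?t := ?y)) {..<Suc ?t}" unfolding lessThan_Suc inj_on_insert using yq e unfolding im[symmetric] by simp
  moreover have "((hp s WL)(?t := ?y)) ` {..<Suc ?t} = insert ?y (hp s WL ` {..<?t})" unfolding lessThan_Suc by auto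
  ultimately show ?thesis using q im h True unfolding wlok_def by simp
 next case False
  thus ?thesis using w h y unfolding queue_def by auto
 qed
 show ?thesis by (rule run_fin[OF ok]; (unfold s'_def[symmetric])?)
   (use wl h tM yM MW in \<open>simp_all add: pushwl_def adr_less mem_adr eqx_def\<close>)
qed

text \<open>By the cardinality equation of \<open>run_pass2\<close>, the bucket has
  \<open>degk adj K x k\<close> half-edges plus half the number of those deleted. The two passes
  take 4 and 40 steps for each of them, hence 44 per live edge and 22 per deleted half-edge.\<close>

lemma run_clean:
 assumes ok: "okst s" and I: "Inv0 adj K A B bo s" and N: "net (hp s) A adj"
  and b: "regs s ''s'' \<in> B" and x: "x = bo (regs s ''s'')" and k: "k = hp s KEY (regs s ''s'')"
  and z: "\<And>y. y \<in> nodes n \<Longrightarrow> hp s SLOT y = 0"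
 shows "run clean s (\<lambda>t s'. \<exists>A' B'. Inv0 adj K A' B' bo s' \<and> net (hp s') A' adj \<and> A' \<subseteq> A \<and>
  (\<forall>g\<in>A'. hp s OWN g = x \<longrightarrow> K x (far s g) = k \<longrightarrow> hp s SG g = 0) \<and>
  (\<forall>y\<in>nodes n. hp s' SLOT y = 0) \<and>
  (\<forall>f\<in>{OWN, SG, LEV, WL, INW}. hp s' f = hp s f) \<and>
  eqx cleanrs s s' \<and>
  t \<le> 44 * degk adj K x k + 22 * (card A - card A') + 4)" unfolding clean_def
proof (rule run_seq, rule run_mono[OF run_pass1[OF ok I b z]], goal_cases)
 case (1 y) thus ?case .
next case (2 t1 s1)
 let ?Hb = "{g\<in>A. hp s BK g = regs s ''s''}"
 from 2 have h1: "hp s1 = (hp s)(SLOT := \<lambda>y. hp s SLOT y +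
   card {g\<in>?Hb. far s g = y \<and> 0 < hp s SG g})" and e1: "eqx {''i''} s s1"
  and t1: "t1 \<le> 4 * card ?Hb + 2" and ok1: "okst s1" by simp_all
 have I1: "Inv0 adj K A B bo s1" by (rule Inv0_cong[OF I]) (use h1 e1 in \<open>simp_all add: eqx_def\<close>)
 have f1: "hp s1 f = hp s f" if "f \<noteq> SLOT" for f using h1 that by simp
 have rs: "regs s1 ''s'' = regs s ''s''" using e1 by (simp add: eqx_def)
 have N1: "net (hp s1) A adj" by (rule net_recok_cong[OF N]) (simp_all add: f1)
 have b1: "regs s1 ''s'' \<in> B" using b rs by simp
 have x1: "x = bo (regs s1 ''s'')" using x rs by simp
 have k1: "k = hp s1 KEY (regs s1 ''s'')" using k rs f1 by simp
 have z1: "hp s1 SLOT y = card {g\<in>{g\<in>A. hp s1 BK g = regs s1 ''s''}. far s1 g = y \<and> 0 < hp s1 SG g}"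
  if "y \<in> nodes n" for y unfolding rs f1[of BK, simplified] f1[of OWN, simplified] f1[of SG, simplified] using z[OF that] h1 by simp
 show ?case
 proof (rule run_mono[OF run_pass2[OF ok1 I1 N1 b1 x1 k1 z1]], goal_cases)
  case (1 y) thus ?case .
 next case (2 t2 s2)
  then obtain A' B' where *: "Inv0 adj K A' B' bo s2" "net (hp s2) A' adj" "A' \<subseteq> A"
   "\<forall>g\<in>A'. hp s1 OWN g = x \<longrightarrow> K x (far s1 g) = k \<longrightarrow> hp s1 SG g = 0"
   "\<forall>y\<in>nodes n. hp s2 SLOT y = 0"
   "\<forall>f\<in>{OWN, SG, LEV, WL, INW}. hp s2 f = hp s1 f"
   "eqx cleanrs s1 s2"
   "card A + 2 * degk adj K x k = card A' + 2 * card {g\<in>A. hp s1 BK g = regs s1 ''s''}"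
   "t2 \<le> 40 * card {g\<in>A. hp s1 BK g = regs s1 ''s''} + 2" by iprover
  have hb: "{g\<in>A. hp s1 BK g = regs s1 ''s''} = ?Hb" using rs f1 by simp
  have own: "hp s1 OWN = hp s OWN" "hp s1 SG = hp s SG" using f1 by simp_all
  have cA: "card A' \<le> card A" using *(3) recok_card(2)[OF Inv0D(4)[OF I]] card_mono by blast
  have t: "t1 + t2 \<le> 44 * degk adj K x k + 22 * (card A - card A') + 4" using *(8,9) t1 cA unfolding hb by linarith
  have f: "\<forall>f\<in>{OWN, SG, LEV, WL, INW}. hp s2 f = hp s f" using *(6) f1 by simp
  have e: "eqx cleanrs s s2" using *(7) e1 by (simp add: eqx_def)
  show ?case by (rule exI[of _ A'], rule exI[of _ B']) (intro conjI *(1-3) *(4)[unfolded own] *(5) f e t)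
 qed
qed

text \<open>\<open>Y\<close> collects the neighbours whose edge has its new key. These edges have
  left the bucket, so \<open>Y\<close> can be read off from the half-edges that are in neither
  \<open>D\<close> nor \<open>T\<close>.\<close>

definition mlI where
 "mlI adj K A x k q b Q0 l s cc s1 \<longleftrightarrow> (case cc of (D, T, Y) \<Rightarrow> \<exists>B bo.
  Inv0 adj (moveK K x Y q) A B bo s1 \<and>
  (\<forall>f\<in>{OWN, SG, LEV, SLOT}. hp s1 f = hp s f) \<and>
  eqx looprs s s1 \<and>
  D \<inter> T = {} \<and>
  (T = {} \<and> regs s1 ''i'' = b \<or> b \<in> B \<and> bo b = x \<and> hp s1 KEY b = k \<and> it (hp s1) A b D T (regs s1 ''i'')) \<and>
  D \<union> T \<subseteq> {g\<in>A. hp s OWN g = x \<and> K x (far s g) = k} \<and>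
  Y = {y. \<exists>g\<in>{g\<in>A. hp s OWN g = x \<and> K x (far s g) = k} - (D \<union> T). far s g = y} \<and>
  (\<forall>g\<in>D. hp s LEV (far s g) < l) \<and> (\<forall>y\<in>Y. l \<le> hp s LEV y) \<and>
  wl_ok s1 \<and>
  qu s1 = Q0 \<union> Y \<union> (\<lambda>g. far s g) ` D)"

lemma run_moveloop:
 assumes ok: "okst s" and I: "Inv0 adj K A B bo s" and N: "net (hp s) A adj"
  and b: "regs s ''s'' \<in> B" and x: "x = bo (regs s ''s'')" and k: "k = hp s KEY (regs s ''s'')"
  and pos: "\<And>g. g \<in> A \<Longrightarrow> hp s OWN g = x \<Longrightarrow> K x (far s g) = k \<Longrightarrow> hp s SG g = 0"
  and q: "regs s ''q'' = k + 1 \<or> regs s ''q'' + 1 = k" "1 \<le> regs s ''q''" "regs s ''q'' \<le> L" and wl: "wl_ok s"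
 shows "run moveloop s (\<lambda>t s'. \<exists>B' bo'. Inv0 adj (moveK K x {y. adj x y \<and> K x y = k \<and> regs s ''l'' \<le> hp s LEV y} (regs s ''q'')) A B' bo' s' \<and>
  (\<forall>f\<in>{OWN, SG, LEV, SLOT}. hp s' f = hp s f) \<and>
  eqx looprs s s' \<and>
  wl_ok s' \<and> qu s' = qu s \<union> {y. adj x y \<and> K x y = k} \<and>
  t \<le> 150 * degk adj K x k + 2)"
proof -
 let ?b = "regs s ''s''" and ?q = "regs s ''q''" and ?l = "regs s ''l''" and ?Q = "qu s"
 let ?Hb = "{g\<in>A. hp s OWN g = x \<and> K x (far s g) = k}"
 note i = Inv0D[OF I]
 have fA: "finite A" using WFD(1)[OF i(1)] .
 have Hb: "{g\<in>A. hp s BK g = ?b} = ?Hb" unfolding WF_bucket[OF i(1) b] x k by (intro Collect_cong) metis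
 \<comment> \<open>The bucket holds positive records only, and then \<open>net\<close> leaves
   exactly one record for a live edge and none for any other pair.\<close>
 have uniq: "adj x (far s g) \<and> (\<forall>g'\<in>A. hp s OWN g' = x \<longrightarrow> hp s OWN (tw g') = far s g \<longrightarrow> g' = g)"
  if g: "g \<in> ?Hb" for g
 proof -
  let ?y = "far s g"
  have z: "{g'\<in>A. hp s OWN g' = x \<and> hp s OWN (tw g') = ?y \<and> 0 < hp s SG g'} = {}" using pos g by fastforce
  have n1: "card {g'\<in>A. hp s OWN g' = x \<and> hp s OWN (tw g') = ?y \<and> hp s SG g' = 0} = of_bool (adj x ?y)"
  proof -
   have "card {g'\<in>A. hp s OWN g' = x \<and> hp s OWN (tw g') = ?y \<and> hp s SG g' = 0} =
    card {g'\<in>A. hp s OWN g' = x \<and> hp s OWN (tw g') = ?y \<and> 0 < hp s SG g'} + of_bool (adj x ?y)" using N unfolding net_def by blast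
   thus ?thesis unfolding z by simp
  qed
  have gi: "g \<in> {g'\<in>A. hp s OWN g' = x \<and> hp s OWN (tw g') = ?y \<and> hp s SG g' = 0}" using g pos by blast
  have fi: "finite {g'\<in>A. hp s OWN g' = x \<and> hp s OWN (tw g') = ?y \<and> hp s SG g' = 0}" using fA by simp
  have "card {g'\<in>A. hp s OWN g' = x \<and> hp s OWN (tw g') = ?y \<and> hp s SG g' = 0} \<noteq> 0" using gi fi card_0_eq by blast
  hence a: "adj x ?y" using n1 by (simp split: if_splits)
  have "g' = g" if g': "g' \<in> A" "hp s OWN g' = x" "hp s OWN (tw g') = ?y" for g'
  proof -
   have "hp s SG g' = 0" using pos[OF g'(1,2)] g'(3) g by simp
   hence "g' \<in> {g'\<in>A. hp s OWN g' = x \<and> hp s OWN (tw g') = ?y \<and> hp s SG g' = 0}" using g' by blast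
   moreover have "card {g'\<in>A. hp s OWN g' = x \<and> hp s OWN (tw g') = ?y \<and> hp s SG g' = 0} \<le> Suc 0" using n1 a by simp
   ultimately show ?thesis using gi card_le_Suc0_iff_eq[OF fi] by blast
  qed
  with a show ?thesis by blast
 qed
 have im: "(\<lambda>g. far s g) ` ?Hb = {y. adj x y \<and> K x y = k}"
 proof (intro equalityI subsetI)
  fix y assume "y \<in> (\<lambda>g. far s g) ` ?Hb"
  then obtain g where g: "g \<in> ?Hb" "y = far s g" by blast
  hence "K x y = k" by simp
  thus "y \<in> {y. adj x y \<and> K x y = k}" using conjunct1[OF uniq[OF g(1)]] g(2) by simp
 next
  fix y assume y: "y \<in> {y. adj x y \<and> K x y = k}"
  then obtain g where "g \<in> A" "hp s OWN g = x" "far s g = y" using i(6) unfolding cover_def by blast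
  thus "y \<in> (\<lambda>g. far s g) ` ?Hb" using y by blast
 qed
 have cHb: "card ?Hb = degk adj K x k"
 proof -
  have "inj_on (\<lambda>g. far s g) ?Hb"
  proof (rule inj_onI)
   fix g g' assume g: "g \<in> ?Hb" "g' \<in> ?Hb" "far s g = hp s OWN (tw g')"
   hence "g \<in> A" "hp s OWN g = x" by blast+
   thus "g = g'" using conjunct2[OF uniq[OF g(2)]] g(3) by blast
  qed
  thus ?thesis unfolding degk_def im[symmetric] by (simp add: card_image)
 qed
 let ?I = "mlI adj K A x k ?q ?b ?Q ?l s"
 let ?g = "\<lambda>(D :: nat set, T :: nat set, Y :: nat set). 150 * real (card T)"
 define s0 where "s0 = fin \<pi> (Assign ''i'' (ld NX (rr ''s''))) s"
 have h0: "hp s0 = hp s" "regs s0 = (regs s)(''i'' := hp s NX ?b)" unfolding s0_def by (simp_all add: mem_adr)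
 have ok0: "okst s0" unfolding s0_def using okst_reg[OF ok okst_hp_le[OF ok]] by (simp add: mem_adr)
 have I0: "?I ({}, ?Hb, {}) s0"
 proof -
  have mk: "moveK K x {} ?q = K" by (simp add: moveK_def fun_eq_iff)
  have p1: "Inv0 adj (moveK K x {} ?q) A B bo s0" unfolding mk by (rule Inv0_cong[OF I]) (use h0 in simp_all)
  have "it (hp s0) A ?b {} ?Hb (regs s0 ''i'')" using it_start[OF i(1) b] h0 Hb by simp
  hence p2: "?Hb = {} \<and> regs s0 ''i'' = ?b \<or> ?b \<in> B \<and> bo ?b = x \<and> hp s0 KEY ?b = k \<and> it (hp s0) A ?b {} ?Hb (regs s0 ''i'')"
   using b x k h0(1) by (intro disjI2 conjI) simp_all
  have p3: "wl_ok s0" using wl h0 by simp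
  have p4: "eqx looprs s s0" using h0(2) by (simp add: eqx_def)
  have p5: "\<forall>f\<in>{OWN, SG, LEV, SLOT}. hp s0 f = hp s f" using h0(1) by simp
  show ?thesis unfolding mlI_def prod.case by (rule exI[of _ B], rule exI[of _ bo], intro conjI p1 p2 p3 p4 p5) (simp_all add: h0(1))
 qed
 let ?body = "(Assign ''j'' (ld NX (rr ''i'')) ;; Assign ''y'' (ld OWN (twE (rr ''i'')))) ;;
    Cond (Less (ld LEV (rr ''y'')) (rr ''l'')) Skip shift2 ;;
    pushwl ;; Assign ''i'' (rr ''j'')"
 let ?W = "While (Neg (Equal (rr ''i'') (rr ''s''))) (?body)"
 have W: "run ?W s0 (\<lambda>t s'. \<exists>cc'. ?I cc' s' \<and> \<not> bval \<pi> (Neg (Equal (rr ''i'') (rr ''s''))) s' \<and>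
   real t + ?g cc' \<le> ?g ({}, ?Hb, {}) + 1)"
 proof (rule run_while[where I = ?I and g = ?g])
  fix cc s1 assume I1: "?I cc s1" and ok1: "okst s1" and bv: "bval \<pi> (Neg (Equal (rr ''i'') (rr ''s''))) s1"
  obtain D' T' Y where cc: "cc = (D', T', Y)" by (cases cc)
  define c where "c = regs s1 ''i''"
  from I1 obtain B1 bo1 where J: "Inv0 adj (moveK K x Y ?q) A B1 bo1 s1" and f1: "\<forall>f\<in>{OWN, SG, LEV, SLOT}. hp s1 f = hp s f"
   and e1: "eqx looprs s s1" and ND: "D' \<inter> T' = {}"
   and cur: "T' = {} \<and> regs s1 ''i'' = ?b \<or> ?b \<in> B1 \<and> bo1 ?b = x \<and> hp s1 KEY ?b = k \<and> it (hp s1) A ?b D' T' (regs s1 ''i'')"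
   and DT: "D' \<union> T' \<subseteq> ?Hb" and Y: "Y = {y. \<exists>g\<in>?Hb - (D' \<union> T'). far s g = y}"
   and DP: "\<forall>g\<in>D'. hp s LEV (far s g) < ?l" and YP: "\<forall>y\<in>Y. ?l \<le> hp s LEV y"
   and wl1: "wl_ok s1" and Q1: "qu s1 = ?Q \<union> Y \<union> (\<lambda>g. far s g) ` D'" unfolding cc mlI_def prod.case by iprover
  have rs: "regs s1 ''s'' = ?b" "regs s1 ''q'' = ?q" "regs s1 ''l'' = ?l" using e1 by (simp_all add: eqx_def)
  have cb: "c \<noteq> ?b" using bv rs c_def by simp
  have bB1: "?b \<in> B1" "bo1 ?b = x" "hp s1 KEY ?b = k" and it1: "it (hp s1) A ?b D' T' c" using cur cb c_def by blast+
  have itr: "iter (hp s1 NX) (hp s1 PV) ?b D' T' c" using it1 unfolding it_def by blast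
  have cT: "c \<in> T'" using iter_mem[OF itr cb] .
  have cH: "c \<in> ?Hb" using cT DT by blast
  have cA: "c \<in> A" "hp s OWN c = x" using cH by blast+
  note ii = Inv0D[OF J]
  have "finite ?Hb" using fA by simp
  hence fT: "finite T'" using DT finite_subset by blast
  have cT': "real (card (T' - {c})) + 1 = real (card T')" using card_Suc_Diff1[OF fT cT] by linarith
  have own1: "hp s1 OWN = hp s OWN" "hp s1 SG = hp s SG" "hp s1 LEV = hp s LEV" using f1 by simp_all
  define y where "y = far s c"
  have ay: "adj x y" "K x y = k" and un: "\<And>g'. g' \<in> A \<Longrightarrow> hp s OWN g' = x \<Longrightarrow> hp s OWN (tw g') = y \<Longrightarrow> g' = c"
  proof -
   show "adj x y" using conjunct1[OF uniq[OF cH]] y_def by simp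
   show "K x y = k" using cH y_def by simp
   show "g' = c" if "g' \<in> A" "hp s OWN g' = x" "hp s OWN (tw g') = y" for g' using conjunct2[OF uniq[OF cH]] that unfolding y_def by blast
  qed
  have yN: "y \<in> nodes n" and xy: "x \<noteq> y" using ay i(5) unfolding adjok_def by blast+
  have yY: "y \<notin> Y"
  proof
   assume "y \<in> Y"
   then obtain g where "g \<in> ?Hb - (D' \<union> T')" "far s g = y" unfolding Y by blast
   hence "g = c" using un by blast
   thus False using \<open>g \<in> ?Hb - (D' \<union> T')\<close> cT by blast
  qed
  have xY: "x \<notin> Y"
  proof
   assume "x \<in> Y"
   then obtain g where g: "g \<in> ?Hb" "far s g = x" unfolding Y by blast
   hence "adj x x" using uniq[OF g(1)] by simp
   thus False using i(5) unfolding adjok_def by blast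
  qed
  have Kxy: "moveK K x Y ?q x y = k" using yY xY ay by (simp add: moveK_def)
  have cM: "tw c < M" using Inv0_card(2)[OF I] recokD(3)[OF i(4) cA(1)] by blast
  define s2 where "s2 = fin \<pi> (Assign ''j'' (ld NX (rr ''i'')) ;; Assign ''y'' (ld OWN (twE (rr ''i'')))) s1"
  have h2: "hp s2 = hp s1" "regs s2 = (regs s1)(''j'' := hp s1 NX c, ''y'' := y)" unfolding s2_def using c_def own1 y_def by (simp_all add: mem_adr)
  have "y \<le> W" using V_less[OF yN] MW by linarith
  hence ok2: "okst s2" unfolding s2_def using okst_reg[OF okst_reg[OF ok1 okst_hp_le[OF ok1]]] c_def own1 y_def by (simp add: mem_adr)
  have r2: "regs s2 ''i'' = c" "regs s2 ''y'' = y" "regs s2 ''j'' = hp s1 NX c" "regs s2 ''l'' = ?l" "regs s2 ''q'' = ?q"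
   using h2 c_def rs by simp_all
  have J2: "Inv0 adj (moveK K x Y ?q) A B1 bo1 s2" by (rule Inv0_cong[OF J]) (use h2 in simp_all)
  let ?P = "\<lambda>t s'. t \<le> 132 \<and> wl_ok s' \<and> qu s' = qu s1 \<and>
   regs s' ''y'' = y \<and> regs s' ''j'' = hp s1 NX c \<and>
   (\<exists>D3 Y3 B3 bo3. Inv0 adj (moveK K x Y3 ?q) A B3 bo3 s' \<and>
   (\<forall>f\<in>{OWN, SG, LEV, SLOT}. hp s' f = hp s f) \<and>
   eqx looprs s s' \<and>
   D3 \<inter> (T' - {c}) = {} \<and>
   (T' - {c} = {} \<and> regs s' ''j'' = ?b \<or> ?b \<in> B3 \<and> bo3 ?b = x \<and> hp s' KEY ?b = k \<and> it (hp s') A ?b D3 (T' - {c}) (regs s' ''j'')) \<and>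
   D3 \<union> (T' - {c}) \<subseteq> ?Hb \<and>
   Y3 = {y. \<exists>g\<in>?Hb - (D3 \<union> (T' - {c})). far s g = y} \<and>
   (\<forall>g\<in>D3. hp s LEV (far s g) < ?l) \<and> (\<forall>y\<in>Y3. ?l \<le> hp s LEV y) \<and>
   insert y (?Q \<union> Y \<union> (\<lambda>g. far s g) ` D') = ?Q \<union> Y3 \<union> (\<lambda>g. far s g) ` D3)"
  have mid: "run (Cond (Less (ld LEV (rr ''y'')) (rr ''l'')) Skip shift2) s2 ?P"
  proof (rule run_cond[OF ok2])
   assume "bval \<pi> (Less (ld LEV (rr ''y'')) (rr ''l'')) s2"
   hence lt: "hp s LEV y < ?l" using h2 r2 own1 by (simp add: mem_adr)
   have p1: "\<forall>f\<in>{OWN, SG, LEV, SLOT}. hp s2 f = hp s f" using f1 h2 by simp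
   have p2: "eqx looprs s s2" using e1 h2 by (simp add: eqx_def)
   have p3: "insert c D' \<inter> (T' - {c}) = {}" using ND by blast
   have "it (hp s2) A ?b (insert c D') (T' - {c}) (regs s2 ''j'')" using it_keep[OF it1 cb] h2 r2 by simp
   hence p4: "T' - {c} = {} \<and> regs s2 ''j'' = ?b \<or> ?b \<in> B1 \<and> bo1 ?b = x \<and> hp s2 KEY ?b = k \<and> it (hp s2) A ?b (insert c D') (T' - {c}) (regs s2 ''j'')"
    using bB1 h2 by (intro disjI2 conjI) simp_all
   have U: "insert c D' \<union> (T' - {c}) = D' \<union> T'" using cT by blast
   have p5: "\<forall>g\<in>insert c D'. hp s LEV (far s g) < ?l" using DP lt y_def by simp
   have p6: "insert y (?Q \<union> Y \<union> (\<lambda>g. far s g) ` D') = ?Q \<union> Y \<union> (\<lambda>g. far s g) ` (insert c D')"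
    using y_def by blast
   have w: "wl_ok s2" "qu s2 = qu s1" using wl1 h2 by simp_all
   have "?P (Suc 1) s2"
    by (rule conjI, simp, intro conjI w r2(2,3), rule exI[of _ "insert c D'"], rule exI[of _ Y], rule exI[of _ B1], rule exI[of _ bo1],
     unfold U, intro conjI J2 p1 p2 p3 p4 DT Y p5 YP p6)
   thus "run Skip s2 (\<lambda>t. ?P (Suc t))" by (rule run_skip[OF ok2])
  next
   assume "\<not> bval \<pi> (Less (ld LEV (rr ''y'')) (rr ''l'')) s2"
   hence ge: "?l \<le> hp s LEV y" using h2 r2 own1 by (simp add: mem_adr)
   have q2: "regs s2 ''q'' = moveK K x Y ?q x y + 1 \<or> regs s2 ''q'' + 1 = moveK K x Y ?q x y"
    "1 \<le> regs s2 ''q''" "regs s2 ''q'' \<le> L" unfolding Kxy r2 by (rule q)+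
   have c2: "regs s2 ''i'' \<in> A" using cA r2 by simp
   have x2: "x = hp s2 OWN (regs s2 ''i'')" "y = hp s2 OWN (tw (regs s2 ''i''))" using cA r2 h2 own1 y_def by simp_all
   have u2: "g = regs s2 ''i''" if "g \<in> A" "hp s2 OWN g = x" "far s2 g = y" for g using un that h2 own1 r2 by simp
   show "run shift2 s2 (\<lambda>t. ?P (Suc t))"
   proof (rule run_mono[OF run_shift2[OF ok2 J2 c2 x2 ay(1) u2 q2]], goal_cases)
    case (1 g) thus ?case by simp
   next case (2 g) thus ?case by simp
   next case (3 g) thus ?case by simp
   next case (4 t s3)
    have "c \<in> {h\<in>A. hp s1 BK h = ?b}" using it1 cT unfolding it_def by blast
    hence bkc: "hp s2 BK c = ?b" using h2(1) by simp
    from 4 obtain B3 bo3 where J3: "Inv0 adj (setK (moveK K x Y ?q) x y ?q) A B3 bo3 s3"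
     and f3: "\<forall>f\<in>{OWN, SG, LEV, SLOT, WL, INW}. hp s3 f = hp s2 f" and e3: "eqx shiftrs s2 s3"
     and P3: "\<forall>D T. it (hp s2) A ?b D T c \<longrightarrow> {g\<in>A. hp s2 BK g = ?b} \<noteq> {c} \<longrightarrow>
      ?b \<in> B3 \<and> bo3 ?b = bo1 ?b \<and> hp s3 KEY ?b = hp s2 KEY ?b \<and> it (hp s3) A ?b D (T - {c}) (hp s2 NX c)"
     and t: "t \<le> 130" unfolding r2 bkc by iprover
    have J3': "Inv0 adj (moveK K x (insert y Y) ?q) A B3 bo3 s3" using J3 unfolding setK_moveK[OF xy xY] .
    have p1: "\<forall>f\<in>{OWN, SG, LEV, SLOT}. hp s3 f = hp s f" using f3 f1 h2 by simp
    have p2: "eqx looprs s s3" using e1 h2 e3 by (simp add: eqx_def)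
    have p3: "D' \<inter> (T' - {c}) = {}" using ND by blast
    have j3: "regs s3 ''j'' = hp s1 NX c" "regs s3 ''y'' = y" "regs s3 ''top'' = regs s1 ''top''" using e3 h2 by (simp_all add: eqx_def)
    have p4: "T' - {c} = {} \<and> regs s3 ''j'' = ?b \<or> ?b \<in> B3 \<and> bo3 ?b = x \<and> hp s3 KEY ?b = k \<and> it (hp s3) A ?b D' (T' - {c}) (regs s3 ''j'')"
    proof (cases "D' \<union> T' = {c}")
     case True
     hence "T' \<subseteq> {c}" "D' \<subseteq> {c}" by blast+
     hence T: "T' = {c}" "D' = {}" using cT ND by (auto simp: subset_singleton_iff)
     have "iter (hp s1 NX) (hp s1 PV) ?b (insert c D') (T' - {c}) (hp s1 NX c)" by (rule iter_keep[OF itr cb])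
     hence "hp s1 NX c = ?b" using iter_cur T by blast
     thus ?thesis using T j3 by simp
    next case False
     have "it (hp s2) A ?b D' T' c" using it1 h2 by simp
     moreover have "{g\<in>A. hp s2 BK g = ?b} \<noteq> {c}" using it1 False h2 unfolding it_def by simp
     ultimately have "?b \<in> B3 \<and> bo3 ?b = bo1 ?b \<and> hp s3 KEY ?b = hp s2 KEY ?b \<and> it (hp s3) A ?b D' (T' - {c}) (hp s2 NX c)"
      using P3 by iprover
     thus ?thesis using j3 h2 bB1 by simp
    qed
    have p5: "D' \<union> (T' - {c}) \<subseteq> ?Hb" using DT by blast
    have p6: "insert y Y = {y. \<exists>g\<in>?Hb - (D' \<union> (T' - {c})). far s g = y}"
    proof -
     have "?Hb - (D' \<union> (T' - {c})) = insert c (?Hb - (D' \<union> T'))" using cT cH ND by blast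
     thus ?thesis unfolding Y using y_def by auto
    qed
    have p7: "\<forall>y\<in>insert y Y. ?l \<le> hp s LEV y" using YP ge by simp
    have p8: "insert y (?Q \<union> Y \<union> (\<lambda>g. far s g) ` D') = ?Q \<union> insert y Y \<union> (\<lambda>g. far s g) ` D'" by blast
    have w: "wl_ok s3" "qu s3 = qu s1" using wl1 j3 f3 h2 unfolding wlok_def queue_def by simp_all
    have t': "Suc t \<le> 132" using t by simp
    show ?case by (intro conjI t' w j3, rule exI[of _ D'], rule exI[of _ "insert y Y"], rule exI[of _ B3], rule exI[of _ bo3],
      intro conjI J3' p1 p2 p3 p4 p5 p6 DP p7 p8)
   qed
  qed
  show "run ?body s1 (\<lambda>t s'. \<exists>cc'. ?I cc' s' \<and> real t + 1 + ?g cc' \<le> ?g cc)"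
  proof (rule run_seq, rule run_fin[OF ok1], goal_cases)
   case (3 t0)
   hence t0: "t0 \<le> 2" by simp
   show ?case unfolding s2_def[symmetric]
   proof (rule run_seq, rule run_mono[OF mid], goal_cases)
    case (1 t1 s3)
    then obtain D3 Y3 B3 bo3 where t1: "t1 \<le> 132" and wl3: "wl_ok s3"
     and Q3: "qu s3 = qu s1" and y3: "regs s3 ''y'' = y" and j3: "regs s3 ''j'' = hp s1 NX c" and J3: "Inv0 adj (moveK K x Y3 ?q) A B3 bo3 s3"
     and f3: "\<forall>f\<in>{OWN, SG, LEV, SLOT}. hp s3 f = hp s f" and e3: "eqx looprs s s3" and m3: "D3 \<inter> (T' - {c}) = {}"
     and cur3: "T' - {c} = {} \<and> regs s3 ''j'' = ?b \<or> ?b \<in> B3 \<and> bo3 ?b = x \<and> hp s3 KEY ?b = k \<and> it (hp s3) A ?b D3 (T' - {c}) (regs s3 ''j'')"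
     and n3: "D3 \<union> (T' - {c}) \<subseteq> ?Hb" and Y3: "Y3 = {y. \<exists>g\<in>?Hb - (D3 \<union> (T' - {c})). far s g = y}"
     and o3: "\<forall>g\<in>D3. hp s LEV (far s g) < ?l" "\<forall>y\<in>Y3. ?l \<le> hp s LEV y"
     and U3: "insert y (?Q \<union> Y \<union> (\<lambda>g. far s g) ` D') = ?Q \<union> Y3 \<union> (\<lambda>g. far s g) ` D3"
     and ok3: "okst s3"
    proof (elim exE conjE, goal_cases)
     case (1 D3 Y3 B3 bo3)
     show ?case by (rule 1(1); rule 1)
    qed
    have yN3: "regs s3 ''y'' \<in> nodes n" using yN y3 by simp
    show ?case
    proof (rule run_seq, rule run_mono[OF run_pushwl[OF ok3 wl3 yN3]], goal_cases)
     case (1 t2 s4)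
     hence wl4: "wl_ok s4" and Q4: "qu s4 = insert y (qu s3)"
      and f4: "\<forall>f. f \<noteq> WL \<longrightarrow> f \<noteq> INW \<longrightarrow> hp s4 f = hp s3 f" and e4: "eqx {''top''} s3 s4" and t2: "t2 \<le> 4" and ok4: "okst s4"
      using y3 by simp_all
     define s5 where "s5 = fin \<pi> (Assign ''i'' (rr ''j'')) s4"
     have h5: "hp s5 = hp s4" "regs s5 = (regs s4)(''i'' := regs s3 ''j'')" unfolding s5_def using e4 by (simp_all add: eqx_def)
     have J5: "Inv0 adj (moveK K x Y3 ?q) A B3 bo3 s5" by (rule Inv0_cong[OF J3]) (use h5 f4 e4 in \<open>simp_all add: eqx_def\<close>)
     have f5: "\<forall>f\<in>{OWN, SG, LEV, SLOT}. hp s5 f = hp s f" using f3 f4 h5 by simp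
     have e5: "eqx looprs s s5" using e3 e4 h5 by (simp add: eqx_def)
     have i5: "regs s5 ''i'' = regs s3 ''j''" using h5 by simp
     have n5: "hp s5 NX = hp s3 NX" "hp s5 PV = hp s3 PV" "hp s5 BK = hp s3 BK" "hp s5 KEY = hp s3 KEY" using h5 f4 by simp_all
     have cur5: "T' - {c} = {} \<and> regs s5 ''i'' = ?b \<or> ?b \<in> B3 \<and> bo3 ?b = x \<and> hp s5 KEY ?b = k \<and> it (hp s5) A ?b D3 (T' - {c}) (regs s5 ''i'')"
      using cur3 unfolding i5 it_def n5 .
     have wl5: "wl_ok s5" using wl4 h5 by simp
     have Q5: "qu s5 = ?Q \<union> Y3 \<union> (\<lambda>g. far s g) ` D3" using Q4 Q3 Q1 U3 h5 by simp
     have I5: "?I (D3, T' - {c}, Y3) s5" unfolding mlI_def prod.case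
      by (rule exI[of _ B3], rule exI[of _ bo3], intro conjI J5 f5 e5 m3 cur5 n3 Y3 o3 wl5 Q5)
     show ?case
     proof (rule run_fin[OF ok4], goal_cases)
      case (3 t3)
      hence "t3 \<le> 1" by simp
      hence "real (t0 + (t1 + (t2 + t3))) + 1 + ?g (D3, T' - {c}, Y3) \<le> ?g cc" unfolding cc prod.case using cT' t0 t1 t2 by simp
      thus ?case unfolding s5_def[symmetric] using I5 by iprover
     qed simp_all
    qed
   qed
  qed (use cM own1 c_def y_def \<open>y \<le> W\<close> in \<open>simp_all add: mem_adr\<close>)
 next
  show "0 \<le> ?g cc" for cc by (cases cc) simp
 next
  show "?I ({}, ?Hb, {}) s0" by (rule I0)
 next
  show "okst s0" by (rule ok0)
 qed
 show ?thesis unfolding moveloop_def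
 proof (rule run_seq, rule run_fin[OF ok], goal_cases)
  case (3 t0)
  show ?case unfolding s0_def[symmetric]
  proof (rule run_mono[OF W], goal_cases)
   case (1 t s')
   then obtain cc' where Icc: "?I cc' s'" and nb: "\<not> bval \<pi> (Neg (Equal (rr ''i'') (rr ''s''))) s'"
    and tcc: "real t + ?g cc' \<le> ?g ({}, ?Hb, {}) + 1" by iprover
   obtain D' T' Y where cc': "cc' = (D', T', Y)" by (cases cc')
   from Icc obtain B1 bo1 where J: "Inv0 adj (moveK K x Y ?q) A B1 bo1 s'" and f1: "\<forall>f\<in>{OWN, SG, LEV, SLOT}. hp s' f = hp s f"
    and e1: "eqx looprs s s'"
    and cur: "T' = {} \<and> regs s' ''i'' = ?b \<or> ?b \<in> B1 \<and> bo1 ?b = x \<and> hp s' KEY ?b = k \<and> it (hp s') A ?b D' T' (regs s' ''i'')"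
    and DT: "D' \<union> T' \<subseteq> ?Hb" and Y: "Y = {y. \<exists>g\<in>?Hb - (D' \<union> T'). far s g = y}"
    and DP: "\<forall>g\<in>D'. hp s LEV (far s g) < ?l" and YP: "\<forall>y\<in>Y. ?l \<le> hp s LEV y"
    and wl1: "wl_ok s'" and Q1: "qu s' = ?Q \<union> Y \<union> (\<lambda>g. far s g) ` D'" unfolding cc' mlI_def prod.case by iprover
   have ib: "regs s' ''i'' = ?b" using nb e1 by (simp add: eqx_def)
   have T: "T' = {}"
   proof (rule ccontr)
    assume ne: "T' \<noteq> {}"
    hence "iter (hp s' NX) (hp s' PV) ?b D' T' (regs s' ''i'')" using cur unfolding it_def by blast
    thus False using iter_cur ib ne by blast
   qed
   have YY: "Y = {y. adj x y \<and> K x y = k \<and> ?l \<le> hp s LEV y}"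
   proof (intro equalityI subsetI)
    fix y assume y: "y \<in> Y"
    hence "y \<in> (\<lambda>g. far s g) ` ?Hb" unfolding Y by blast
    thus "y \<in> {y. adj x y \<and> K x y = k \<and> ?l \<le> hp s LEV y}" using y YP unfolding im by blast
   next
    fix y assume y: "y \<in> {y. adj x y \<and> K x y = k \<and> ?l \<le> hp s LEV y}"
    hence "y \<in> (\<lambda>g. far s g) ` ?Hb" unfolding im by blast
    then obtain g where g: "g \<in> ?Hb" "y = far s g" by blast
    have "g \<notin> D'" using DP g y by auto
    thus "y \<in> Y" unfolding Y T using g by blast
   qed
   have QQ: "qu s' = ?Q \<union> {y. adj x y \<and> K x y = k}"
   proof -
    have "Y \<union> (\<lambda>g. far s g) ` D' = (\<lambda>g. far s g) ` ?Hb" unfolding Y T using DT by blast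
    thus ?thesis unfolding Q1 im[symmetric] by blast
   qed
   have tt: "t0 + t \<le> 150 * degk adj K x k + 2"
   proof -
    have "real t \<le> 150 * real (card ?Hb) + 1" using tcc unfolding cc' T prod.case by simp
    hence "real t \<le> real (150 * card ?Hb + 1)" by simp
    hence "t \<le> 150 * card ?Hb + 1" by (simp only: of_nat_le_iff)
    thus ?thesis using 3 cHb by simp
   qed
   show ?case by (rule exI[of _ B1], rule exI[of _ bo1], intro conjI J[unfolded YY] f1 e1 wl1 QQ tt)
  qed
 qed simp_all
qed

end

section \<open>Degrees into levels and their change under updates\<close>

definition Dg :: "graph \<Rightarrow> (nat \<Rightarrow> nat) \<Rightarrow> nat \<Rightarrow> nat \<Rightarrow> nat" where
 "Dg adj lev x i = card {y. adj x y \<and> i \<le> lev y}"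

definition upd_adj :: "graph \<Rightarrow> nat \<Rightarrow> nat \<Rightarrow> bool \<Rightarrow> nat \<Rightarrow> nat \<Rightarrow> bool" where
 "upd_adj adj u v b = (\<lambda>z w. if z = u \<and> w = v \<or> z = v \<and> w = u then b else adj z w)"

text \<open>Only the row and the column of \<open>x\<close> contribute, and symmetry makes these two
  arms equal.\<close>

lemma sum_cross:
 fixes g :: "nat \<Rightarrow> nat \<Rightarrow> real"
 assumes "finite V" "x \<in> V" "g x x = 0" "\<And>z y. g z y = g y z" "\<And>z y. z \<noteq> x \<Longrightarrow> y \<noteq> x \<Longrightarrow> g z y = 0"
 shows "(\<Sum>z\<in>V. \<Sum>y\<in>V. g z y) = 2 * (\<Sum>y\<in>V. g x y)"
proof -
 have "(\<Sum>y\<in>V. g z y) = g z x" if "z \<in> V - {x}" for z using that assms by (subst sum.remove[OF assms(1,2)]) auto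
 hence "(\<Sum>z\<in>V - {x}. \<Sum>y\<in>V. g z y) = (\<Sum>z\<in>V - {x}. g z x)" by (rule sum.cong[OF refl])
 also have "\<dots> = (\<Sum>z\<in>V - {x}. g x z)" using assms(4) by (intro sum.cong) auto
 also have "\<dots> = (\<Sum>y\<in>V. g x y)" using sum.remove[OF assms(1,2), of "g x"] assms(3) by simp
 finally show ?thesis by (subst sum.remove[OF assms(1,2)]) simp
qed

section \<open>The potential\<close>

locale pot =
 fixes V :: "nat set" and d :: "nat \<Rightarrow> real" and \<alpha> \<epsilon> :: real and L :: nat
 assumes fV: "finite V" and d0: "\<And>x. 0 \<le> d x" and e0: "0 < \<epsilon>" "\<epsilon> < 1" and al: "2 + 3 * \<epsilon> \<le> \<alpha>" and L1: "1 \<le> L"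
begin

text \<open>The tie term spreads the change of the minimum. When a node rises from level l to l + 1,
  its term drops by 1 for a neighbour on level l, where the minimum stays and a tie is lost, and by
  1 for a neighbour on level l + 1, where the minimum rises and a tie appears. Neighbours below l
  keep their term.\<close>

definition psi :: "nat \<Rightarrow> nat \<Rightarrow> real" where
 "psi a b = 2 * (real L - real (min a b)) + of_bool (a = b)"

text \<open>For every level below its own, a node stores the shortfall of its degree from \<alpha>
  d. The entry is 0 at the moment when the node climbs past that level, grows as neighbours sink or
  edges disappear, and is released when the node moves down again.\<close>

definition NP :: "graph \<Rightarrow> (nat \<Rightarrow> nat) \<Rightarrow> nat \<Rightarrow> real" where
 "NP adj lev z = (\<Sum>i<lev z. max 0 (\<alpha> * d z - real (Dg adj lev z i)))"

definition EP :: "graph \<Rightarrow> (nat \<Rightarrow> nat) \<Rightarrow> real" where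
 "EP adj lev = (\<Sum>z\<in>V. \<Sum>y\<in>V. of_bool (adj z y) * psi (lev z) (lev y))"

text \<open>
 Moving a node up costs its degree on its own level, which the edge term pays for. The edge term increases when a node
 moves down; this is paid by the node term, since the degree is then below \<open>d\<close> and \<open>\<alpha> d\<close> exceeds \<open>2 d\<close> by \<open>3 \<epsilon> d\<close>.
\<close>

definition Phi :: "graph \<Rightarrow> (nat \<Rightarrow> nat) \<Rightarrow> real" where
 "Phi adj lev = 2 / \<epsilon> * (\<Sum>z\<in>V. NP adj lev z) + EP adj lev + (\<Sum>z\<in>V. real (lev z))"

definition good :: "graph \<Rightarrow> bool" where
 "good adj \<longleftrightarrow> (\<forall>x y. adj x y \<longrightarrow> adj y x \<and> x \<in> V \<and> y \<in> V \<and> x \<noteq> y)"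

lemma good_fin: "good adj \<Longrightarrow> finite {y. adj x y \<and> P y}" by (rule finite_subset[OF _ fV]) (auto simp: good_def)

lemma psi_sym: "psi a b = psi b a" unfolding psi_def by (auto simp: min.commute)

lemma psi_nonneg: "a \<le> L \<Longrightarrow> b \<le> L \<Longrightarrow> 0 \<le> psi a b" unfolding psi_def by (auto simp: min_def)

lemma psi_le: "psi a b \<le> 2 * real L + 1" unfolding psi_def by auto

lemma NP_nonneg: "0 \<le> NP adj lev z" unfolding NP_def by (rule sum_nonneg) simp

lemma Phi_nonneg: "(\<And>x. lev x \<le> L) \<Longrightarrow> 0 \<le> Phi adj lev" unfolding Phi_def EP_def using e0
 by (intro add_nonneg_nonneg mult_nonneg_nonneg sum_nonneg NP_nonneg psi_nonneg) auto

lemma card_sum: "good adj \<Longrightarrow> real (card {y. adj x y \<and> P y}) = (\<Sum>y\<in>V. of_bool (adj x y \<and> P y))"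
proof -
 assume g: "good adj"
 have "{y. adj x y \<and> P y} = {y\<in>V. adj x y \<and> P y}" using g unfolding good_def by blast
 thus ?thesis using fV by (simp add: sum.inter_filter[symmetric] of_bool_def)
qed

lemma Dg_upd:
 assumes "good adj"
 shows "Dg adj (lev(x := m)) z i + of_bool (adj z x \<and> i \<le> lev x) = Dg adj lev z i + of_bool (adj z x \<and> i \<le> m)"
proof -
 have f: "finite {y. adj z y \<and> y \<noteq> x \<and> i \<le> lev y}" using good_fin[OF assms] .
 have "{y. adj z y \<and> i \<le> (lev(x := m)) y} =
   (if adj z x \<and> i \<le> m then insert x {y. adj z y \<and> y \<noteq> x \<and> i \<le> lev y} else {y. adj z y \<and> y \<noteq> x \<and> i \<le> lev y})"
  "{y. adj z y \<and> i \<le> lev y} =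
   (if adj z x \<and> i \<le> lev x then insert x {y. adj z y \<and> y \<noteq> x \<and> i \<le> lev y} else {y. adj z y \<and> y \<noteq> x \<and> i \<le> lev y})"
  by auto
 thus ?thesis using f unfolding Dg_def by simp
qed

lemma Dg_self:
 assumes "good adj" shows "Dg adj (lev(x := m)) x i = Dg adj lev x i"
proof -
 have "\<not> adj x x" using assms unfolding good_def by blast
 thus ?thesis using Dg_upd[OF assms, of lev x m x i] by simp
qed

lemma EP_upd:
 assumes "good adj" "x \<in> V"
 shows "EP adj (lev(x := m)) - EP adj lev =
  2 * (\<Sum>y\<in>V. of_bool (adj x y) * (psi m (lev y) - psi (lev x) (lev y)))"
proof -
 let ?g = "\<lambda>z y. of_bool (adj z y) * (psi ((lev(x := m)) z) ((lev(x := m)) y) - psi (lev z) (lev y))"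
 have sy: "adj z y = adj y z" for z y using assms(1) unfolding good_def by blast
 have nx: "\<not> adj x x" using assms(1) unfolding good_def by blast
 have "EP adj (lev(x := m)) - EP adj lev = (\<Sum>z\<in>V. \<Sum>y\<in>V. ?g z y)"
  unfolding EP_def by (simp add: sum_subtractf[symmetric] right_diff_distrib)
 also have "\<dots> = 2 * (\<Sum>y\<in>V. ?g x y)" by (rule sum_cross[OF fV assms(2)]) (use nx sy in \<open>auto simp: psi_sym\<close>)
 also have "(\<Sum>y\<in>V. ?g x y) = (\<Sum>y\<in>V. of_bool (adj x y) * (psi m (lev y) - psi (lev x) (lev y)))"
  by (rule sum.cong[OF refl]) (use nx in auto)
 finally show ?thesis .
qed

lemma lev_sum:
 assumes "x \<in> V" shows "(\<Sum>z\<in>V. real ((lev(x := m)) z)) = (\<Sum>z\<in>V. real (lev z)) + real m - real (lev x)"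
proof -
 have "(\<Sum>z\<in>V - {x}. real ((lev(x := m)) z)) = (\<Sum>z\<in>V - {x}. real (lev z))" by (rule sum.cong) auto
 thus ?thesis using sum.remove[OF fV assms, of "\<lambda>z. real ((lev(x := m)) z)"] sum.remove[OF fV assms, of "\<lambda>z. real (lev z)"] by simp
qed

text \<open>The node term of \<open>x\<close> gains an entry only for the level it leaves, and this
  is 0 because the degree there exceeds \<alpha> d; degrees of other nodes cannot fall.
  \<open>EP\<close> counts each edge in both directions and so drops by at least twice the
  degree.\<close>

lemma Phi_up:
 assumes g: "good adj" and x: "x \<in> V" and up: "\<alpha> * d x < real (Dg adj lev x (lev x))"
 shows "Phi adj (lev(x := lev x + 1)) + (real (Dg adj lev x (lev x)) + 1) / 2 \<le> Phi adj lev"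
proof -
 let ?l = "lev x" let ?lev = "lev(x := lev x + 1)" let ?D = "Dg adj lev x (lev x)"
 have np: "NP adj ?lev z \<le> NP adj lev z" if "z \<in> V" for z
 proof (cases "z = x")
  case True
  have "NP adj ?lev x = (\<Sum>i<?l. max 0 (\<alpha> * d x - real (Dg adj lev x i))) + max 0 (\<alpha> * d x - real ?D)"
   unfolding NP_def Dg_self[OF g] by simp
  thus ?thesis using up True unfolding NP_def by simp
 next case False
  have "max 0 (\<alpha> * d z - real (Dg adj ?lev z i)) \<le> max 0 (\<alpha> * d z - real (Dg adj lev z i))" for i
  proof -
   have "Dg adj lev z i \<le> Dg adj ?lev z i" using Dg_upd[OF g, of lev x "?l + 1" z i] by (cases "adj z x \<and> i \<le> ?l") auto
   thus ?thesis by auto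
  qed
  thus ?thesis unfolding NP_def using False by (auto intro: sum_mono)
 qed
 have n: "2 / \<epsilon> * (\<Sum>z\<in>V. NP adj ?lev z) \<le> 2 / \<epsilon> * (\<Sum>z\<in>V. NP adj lev z)"
  using e0 by (intro mult_left_mono sum_mono np) auto
 have "of_bool (adj x y) * (psi (?l + 1) (lev y) - psi ?l (lev y)) \<le> - of_bool (adj x y \<and> ?l \<le> lev y)" for y
  unfolding psi_def by (auto simp: min_def)
 hence "(\<Sum>y\<in>V. of_bool (adj x y) * (psi (?l + 1) (lev y) - psi ?l (lev y))) \<le> (\<Sum>y\<in>V. - of_bool (adj x y \<and> ?l \<le> lev y))"
  by (rule sum_mono)
 also have "\<dots> = - real ?D" unfolding Dg_def card_sum[OF g] by (simp add: sum_negf)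
 finally have e: "EP adj ?lev - EP adj lev \<le> - 2 * real ?D" unfolding EP_upd[OF g x] by simp
 \<comment> \<open>\<alpha> d is nonnegative, so the test can succeed only with a neighbour present;
   the drop of \<open>EP\<close> by at least 2 then exceeds the increase 1 of the level sum.\<close>
 have D1: "1 \<le> real ?D"
 proof -
  have "0 \<le> \<alpha> * d x" using al e0 d0[of x] by (intro mult_nonneg_nonneg) auto
  hence "0 < real ?D" using up by linarith
  thus ?thesis by simp
 qed
 show ?thesis unfolding Phi_def using n e D1 lev_sum[OF x, of lev "?l + 1"] by (simp add: field_simps)
qed

text \<open>With D the degree into the level below, the node term of \<open>x\<close> loses \<alpha>
  d - D, while at most D neighbours gain 1 each. As D < d, the node terms fall by at least 3
  \<epsilon> d, which the factor 2 / \<epsilon> turns into 6 d; \<open>EP\<close> rises by at most 4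
  D. This is the origin of the 3 in 2 + 3 \<epsilon> and of the factor 2 / \<epsilon> in
  \<open>Phi\<close>.\<close>

lemma Phi_down:
 assumes g: "good adj" and x: "x \<in> V" and l0: "0 < lev x" and dn: "real (Dg adj lev x (lev x - 1)) < d x"
 shows "Phi adj (lev(x := lev x - 1)) + (real (Dg adj lev x (lev x - 1)) + 1) / 2 \<le> Phi adj lev"
proof -
 define l where "l = lev x - 1"
 have lx: "lev x = l + 1" using l0 l_def by simp
 let ?lev = "lev(x := l)" let ?D = "Dg adj lev x l"
 have dn: "real ?D < d x" using dn l_def by simp
 have ad: "2 * d x + 3 * \<epsilon> * d x \<le> \<alpha> * d x" using mult_right_mono[OF al d0[of x]] by (simp add: algebra_simps)
 have npx: "NP adj ?lev x = NP adj lev x - (\<alpha> * d x - real ?D)"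
 proof -
  have "0 \<le> 3 * \<epsilon> * d x" using e0 d0[of x] by simp
  hence "max 0 (\<alpha> * d x - real ?D) = \<alpha> * d x - real ?D" using ad dn d0[of x] by simp
  thus ?thesis unfolding NP_def Dg_self[OF g] lx by simp
 qed
 \<comment> \<open>Sinking from \<open>l + 1\<close> to \<open>l\<close> is noticed only by degrees
   into level \<open>l + 1\<close>, and a neighbour has a term for that level only if it is strictly
   above it.\<close>
 have np: "NP adj ?lev z \<le> NP adj lev z + of_bool (adj z x \<and> l + 1 < lev z)" if zx: "z \<noteq> x" for z
 proof -
  have t: "max 0 (\<alpha> * d z - real (Dg adj ?lev z i)) \<le> max 0 (\<alpha> * d z - real (Dg adj lev z i)) + of_bool (adj z x \<and> i = l + 1)" for i
  proof -
   have "Dg adj lev z i \<le> Dg adj ?lev z i + of_bool (adj z x \<and> i = l + 1)"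
    using Dg_upd[OF g, of lev x l z i] lx by (cases "adj z x"; cases "i \<le> l"; cases "i = l + 1") auto
   hence "real (Dg adj lev z i) \<le> real (Dg adj ?lev z i + of_bool (adj z x \<and> i = l + 1))" by (simp only: of_nat_le_iff)
   thus ?thesis by (auto simp: max_def)
  qed
  have "NP adj ?lev z \<le> (\<Sum>i<lev z. max 0 (\<alpha> * d z - real (Dg adj lev z i)) + of_bool (adj z x \<and> i = l + 1))"
   unfolding NP_def using zx t by (auto intro: sum_mono)
  also have "\<dots> = NP adj lev z + (\<Sum>i<lev z. of_bool (adj z x \<and> i = l + 1))" unfolding NP_def by (rule sum.distrib)
  also have "(\<Sum>i<lev z. of_bool (adj z x \<and> i = l + 1)) = (of_bool (adj z x \<and> l + 1 < lev z) :: real)"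
  proof (cases "adj z x")
   case True
   have "(\<Sum>i<lev z. of_bool (i = l + 1)) = (\<Sum>i<lev z. if i = l + 1 then 1 else (0::real))" by (rule sum.cong) auto
   thus ?thesis using True by (simp add: sum.delta)
  qed simp
  finally show ?thesis .
 qed
 have sy: "adj z y = adj y z" for z y using g unfolding good_def by blast
 have nx: "\<not> adj x x" using g unfolding good_def by blast
 have "(\<Sum>z\<in>V. NP adj ?lev z) \<le> (\<Sum>z\<in>V. NP adj lev z) - (\<alpha> * d x - real ?D) + (\<Sum>z\<in>V. of_bool (adj x z \<and> l \<le> lev z))"
 proof -
  have "(\<Sum>z\<in>V - {x}. NP adj ?lev z) \<le> (\<Sum>z\<in>V - {x}. NP adj lev z + of_bool (adj x z \<and> l \<le> lev z))"
  proof (rule sum_mono)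
   fix z assume "z \<in> V - {x}"
   thus "NP adj ?lev z \<le> NP adj lev z + of_bool (adj x z \<and> l \<le> lev z)"
    using np[of z] sy[of z x] by (cases "adj x z"; cases "l + 1 < lev z"; cases "l \<le> lev z") auto
  qed
  also have "\<dots> = (\<Sum>z\<in>V - {x}. NP adj lev z) + (\<Sum>z\<in>V - {x}. of_bool (adj x z \<and> l \<le> lev z))" by (rule sum.distrib)
  finally have 1: "(\<Sum>z\<in>V - {x}. NP adj ?lev z) \<le> (\<Sum>z\<in>V - {x}. NP adj lev z) + (\<Sum>z\<in>V - {x}. of_bool (adj x z \<and> l \<le> lev z))" .
  show ?thesis using 1 npx nx sum.remove[OF fV x, of "NP adj ?lev"] sum.remove[OF fV x, of "NP adj lev"]
    sum.remove[OF fV x, of "\<lambda>z. of_bool (adj x z \<and> l \<le> lev z) :: real"] by simp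
 qed
 also have "(\<Sum>z\<in>V. of_bool (adj x z \<and> l \<le> lev z)) = real ?D" unfolding Dg_def card_sum[OF g] ..
 finally have "(\<Sum>z\<in>V. NP adj ?lev z) \<le> (\<Sum>z\<in>V. NP adj lev z) - (\<alpha> * d x - 2 * real ?D)" by linarith
 moreover have "3 * \<epsilon> * d x \<le> \<alpha> * d x - 2 * real ?D" using ad dn by linarith
 ultimately have "(\<Sum>z\<in>V. NP adj ?lev z) \<le> (\<Sum>z\<in>V. NP adj lev z) - 3 * \<epsilon> * d x" by linarith
 hence "2 / \<epsilon> * (\<Sum>z\<in>V. NP adj ?lev z) \<le> 2 / \<epsilon> * ((\<Sum>z\<in>V. NP adj lev z) - 3 * \<epsilon> * d x)"
  using e0 by (intro mult_left_mono) auto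
 hence n: "2 / \<epsilon> * (\<Sum>z\<in>V. NP adj ?lev z) \<le> 2 / \<epsilon> * (\<Sum>z\<in>V. NP adj lev z) - 6 * d x"
  using e0 by (simp add: field_simps)
 have "of_bool (adj x y) * (psi l (lev y) - psi (lev x) (lev y)) \<le> 2 * of_bool (adj x y \<and> l \<le> lev y)" for y
  unfolding psi_def lx by (auto simp: min_def)
 hence "(\<Sum>y\<in>V. of_bool (adj x y) * (psi l (lev y) - psi (lev x) (lev y))) \<le> (\<Sum>y\<in>V. 2 * of_bool (adj x y \<and> l \<le> lev y))"
  by (rule sum_mono)
 also have "\<dots> = 2 * real ?D" unfolding Dg_def card_sum[OF g] by (simp add: sum_distrib_left)
 finally have e: "EP adj ?lev - EP adj lev \<le> 4 * real ?D" unfolding EP_upd[OF g x] by simp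
 have "0 \<le> real ?D" by simp
 thus ?thesis unfolding Phi_def l_def[symmetric] using n e dn lev_sum[OF x, of lev l] lx by (simp add: field_simps)
qed

lemma good_upd:
 assumes g: "good adj" and uv: "u \<in> V" "v \<in> V" "u \<noteq> v"
 shows "good (upd_adj adj u v b)" unfolding good_def
proof (intro allI impI)
 fix z w assume a: "upd_adj adj u v b z w"
 show "upd_adj adj u v b w z \<and> z \<in> V \<and> w \<in> V \<and> z \<noteq> w"
 proof (cases "z = u \<and> w = v \<or> z = v \<and> w = u")
  case True
  thus ?thesis using a uv unfolding upd_adj_def by auto
 next case False
  hence "adj z w" using a unfolding upd_adj_def by simp
  hence "adj w z \<and> z \<in> V \<and> w \<in> V \<and> z \<noteq> w" using g unfolding good_def by blast
  thus ?thesis using False unfolding upd_adj_def by auto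
 qed
qed

text \<open>A new neighbour can only shrink the node terms, so 1 / \<epsilon> does not enter; the
  edge adds twice its \<open>psi\<close>, which is at most 2 (2 L + 1) \<le> 6 L.\<close>

lemma Phi_ins:
 assumes g: "good adj" and uv: "u \<in> V" "v \<in> V" "u \<noteq> v" "\<not> adj u v" and lL: "\<And>x. lev x \<le> L"
 shows "Phi (upd_adj adj u v True) lev \<le> Phi adj lev + 6 * real L"
proof -
 let ?a = "upd_adj adj u v True"
 have nuv: "\<not> adj v u" using g uv unfolding good_def by blast
 have ga: "good ?a" using good_upd[OF g uv(1-3)] .
 have np: "NP ?a lev z \<le> NP adj lev z" for z
 proof -
  have "Dg adj lev z i \<le> Dg ?a lev z i" for i unfolding Dg_def by (rule card_mono[OF good_fin[OF ga]]) (auto simp: upd_adj_def)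
  hence "max 0 (\<alpha> * d z - real (Dg ?a lev z i)) \<le> max 0 (\<alpha> * d z - real (Dg adj lev z i))" for i by (intro max.mono) simp_all
  thus ?thesis unfolding NP_def by (intro sum_mono) simp
 qed
 have n: "2 / \<epsilon> * (\<Sum>z\<in>V. NP ?a lev z) \<le> 2 / \<epsilon> * (\<Sum>z\<in>V. NP adj lev z)"
  using e0 by (intro mult_left_mono sum_mono np) auto
 let ?h = "\<lambda>z y. (if z = u \<and> y = v \<or> z = v \<and> y = u then psi (lev u) (lev v) else 0)"
 have "EP ?a lev = EP adj lev + (\<Sum>z\<in>V. \<Sum>y\<in>V. ?h z y)" unfolding EP_def sum.distrib[symmetric]
  by (intro sum.cong refl) (use uv nuv in \<open>auto simp: upd_adj_def psi_sym\<close>)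
 also have "(\<Sum>z\<in>V. \<Sum>y\<in>V. ?h z y) = 2 * (\<Sum>y\<in>V. ?h u y)" by (rule sum_cross[OF fV uv(1)]) (use uv in auto)
 also have "(\<Sum>y\<in>V. ?h u y) = (\<Sum>y\<in>V. if y = v then psi (lev u) (lev v) else 0)" by (rule sum.cong) (use uv in auto)
 also have "\<dots> = psi (lev u) (lev v)" using fV uv by (simp add: sum.delta)
 finally have e: "EP ?a lev \<le> EP adj lev + 6 * real L" using psi_le[of "lev u" "lev v"] L1 by simp
 show ?thesis unfolding Phi_def using n e by simp
qed

text \<open>Each endpoint loses one neighbour on at most L levels, which makes 2 L in all, times the
  factor 2 / \<epsilon>. The edge term can only fall.\<close>

lemma Phi_del:
 assumes g: "good adj" and uv: "u \<in> V" "v \<in> V" "adj u v" and lL: "\<And>x. lev x \<le> L"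
 shows "Phi (upd_adj adj u v False) lev \<le> Phi adj lev + 4 * real L / \<epsilon>"
proof -
 let ?a = "upd_adj adj u v False"
 have ne: "u \<noteq> v" using g uv unfolding good_def by blast
 have np: "NP ?a lev z \<le> NP adj lev z + (if z = u then real L else 0) + (if z = v then real L else 0)" for z
 proof (cases "z = u \<or> z = v")
  case True
  have t: "max 0 (\<alpha> * d z - real (Dg ?a lev z i)) \<le> max 0 (\<alpha> * d z - real (Dg adj lev z i)) + 1" for i
  proof -
   define w where "w = (if z = u then v else u)"
   have "{y. ?a z y \<and> i \<le> lev y} = {y. adj z y \<and> i \<le> lev y} - {w}" using True ne unfolding upd_adj_def w_def by auto
   hence "card {y. adj z y \<and> i \<le> lev y} \<le> card {y. ?a z y \<and> i \<le> lev y} + 1"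
    using card_Suc_Diff1[OF good_fin[OF g], of w z "\<lambda>y. i \<le> lev y"] by (cases "w \<in> {y. adj z y \<and> i \<le> lev y}") auto
   hence "real (Dg adj lev z i) \<le> real (Dg ?a lev z i + 1)" unfolding Dg_def by (simp only: of_nat_le_iff)
   thus ?thesis by (auto simp: max_def)
  qed
  have "NP ?a lev z \<le> (\<Sum>i<lev z. max 0 (\<alpha> * d z - real (Dg adj lev z i)) + 1)" unfolding NP_def by (rule sum_mono) (rule t)
  also have "\<dots> = NP adj lev z + real (lev z)" unfolding NP_def by (simp add: sum.distrib)
  also have "\<dots> \<le> NP adj lev z + real L" using lL by simp
  finally show ?thesis using True ne by auto
 next case False
  hence "Dg ?a lev z i = Dg adj lev z i" for i unfolding Dg_def upd_adj_def by simp
  thus ?thesis using False unfolding NP_def by simp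
 qed
 have "(\<Sum>z\<in>V. NP ?a lev z) \<le> (\<Sum>z\<in>V. NP adj lev z + (if z = u then real L else 0) + (if z = v then real L else 0))"
  by (rule sum_mono) (rule np)
 also have "\<dots> = (\<Sum>z\<in>V. NP adj lev z) + 2 * real L" using fV uv by (simp add: sum.distrib sum.delta)
 finally have "2 / \<epsilon> * (\<Sum>z\<in>V. NP ?a lev z) \<le> 2 / \<epsilon> * ((\<Sum>z\<in>V. NP adj lev z) + 2 * real L)"
  using e0 by (intro mult_left_mono) auto
 hence n: "2 / \<epsilon> * (\<Sum>z\<in>V. NP ?a lev z) \<le> 2 / \<epsilon> * (\<Sum>z\<in>V. NP adj lev z) + 4 * real L / \<epsilon>"
  by (simp add: algebra_simps)
 have e: "EP ?a lev \<le> EP adj lev" unfolding EP_def by (intro sum_mono) (auto simp: upd_adj_def psi_nonneg[OF lL lL])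
 show ?thesis unfolding Phi_def using n e by simp
qed

lemma Phi_zero: "(\<And>x y. \<not> adj x y) \<Longrightarrow> Phi adj (\<lambda>_. 0) = 0" unfolding Phi_def NP_def EP_def by simp

end

section \<open>Moving nodes between levels\<close>

text \<open>No key at a node exceeds its level plus 1, so the bucket with that key counts the degree
  into its own level, and the bucket one key lower supplies the rest of the degree into the level
  below. The test \<open>0 < l\<close> keeps a head or the null pointer, whose key is 0, from being
  taken for a bucket. \<open>z\<close> is the side: the quotient by 4 is even for sources and odd
  for targets.\<close>

definition chk :: com where
 "chk = Assign ''l'' (ld LEV (rr ''x'')) ;; Assign ''b'' (ld DN (rr ''x'')) ;; Assign ''c'' (Const 0) ;;
  Cond (Equal (ld KEY (rr ''b'')) (Plus (rr ''l'') (Const 1)))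
   (Assign ''c'' (ld CNT (rr ''b'')) ;; Assign ''b'' (ld DN (rr ''b''))) Skip ;;
  Assign ''e'' (rr ''c'') ;;
  Cond (And (Less (Const 0) (rr ''l'')) (Equal (ld KEY (rr ''b'')) (rr ''l'')))
   (Assign ''e'' (Plus (rr ''c'') (ld CNT (rr ''b'')))) Skip ;;
  Assign ''z'' (Mod (Div (rr ''x'') (Const 4)) (Const 2))"

text \<open>The top bucket is looked up again after cleaning, which may have deleted it with its
  last record. Without a bucket of that key no record is affected and only the level changes. The
  node queues itself because one step may not be enough.\<close>

definition move :: com where
 "move = Assign ''a'' (ld DN (rr ''x'')) ;;
  Cond (Equal (ld KEY (rr ''a'')) (Plus (ld LEV (rr ''x'')) (Const 1)))
   (Assign ''s'' (rr ''a'') ;; clean ;; Assign ''a'' (ld DN (rr ''x'')) ;;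
    Cond (Equal (ld KEY (rr ''a'')) (Plus (ld LEV (rr ''x'')) (Const 1)))
     (Assign ''s'' (rr ''a'') ;; moveloop) Skip) Skip ;;
  (st LEV (rr ''x'') (Minus (rr ''q'') (Const 1)) ;; Assign ''y'' (rr ''x'')) ;; pushwl"

text \<open>Expressions cannot branch, so the bit \<open>z\<close> selects the threshold
  arithmetically.\<close>

definition thr :: rexp where
 "thr = RPlus (RTimes (RMinus (OfNat (Const 1)) (OfNat (rr ''z''))) (Param DS))
  (RTimes (OfNat (rr ''z'')) (Param DT))"

text \<open>Before \<open>move\<close>, register \<open>l\<close> changes its role from the level of
  the node to the level bound used by \<open>moveloop\<close>. \<open>q\<close> is the new level
  plus 1: \<open>l + 2\<close> on the way up, \<open>l\<close> on the way down.\<close>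

definition fixup :: com where
 "fixup = While (Less (Const 0) (rr ''top''))
  ((Assign ''top'' (Minus (rr ''top'') (Const 1)) ;; Assign ''x'' (ld WL (rr ''top'')) ;;
   st INW (rr ''x'') (Const 0)) ;; chk ;;
   Cond (And (Less (Plus (rr ''l'') (Const 1)) (rr ''L'')) (RLess (RTimes (Param Alpha) thr) (OfNat (rr ''c''))))
    ((Assign ''q'' (Plus (rr ''l'') (Const 2)) ;; Assign ''l'' (Plus (rr ''l'') (Const 1))) ;; move)
    (Cond (And (Less (Const 0) (rr ''l'')) (RLess (OfNat (rr ''e'')) thr))
     ((Assign ''q'' (rr ''l'') ;; Assign ''l'' (Const 0)) ;; move) Skip))"

text \<open>The shift by one makes all keys positive, 0 being the key of heads and of the null
  pointer.\<close>

definition KL :: "(nat \<Rightarrow> nat) \<Rightarrow> nat \<Rightarrow> nat \<Rightarrow> nat" where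
 "KL lev x y = min (lev x) (lev y) + 1"

lemma degk_KL1: "degk adj (KL lev) x (lev x + 1) = Dg adj lev x (lev x)"
 unfolding degk_def Dg_def KL_def by (rule arg_cong[where f = card]) (auto simp: min_def)

lemma degk_KL2:
 assumes "adjok n adj" "0 < lev x"
 shows "degk adj (KL lev) x (lev x + 1) + degk adj (KL lev) x (lev x) = Dg adj lev x (lev x - 1)"
proof -
 have "{y. adj x y \<and> lev x - 1 \<le> lev y} = {y. adj x y \<and> KL lev x y = lev x + 1} \<union> {y. adj x y \<and> KL lev x y = lev x}"
  using assms(2) by (auto simp: KL_def min_def)
 moreover have "{y. adj x y \<and> KL lev x y = lev x + 1} \<inter> {y. adj x y \<and> KL lev x y = lev x} = {}" by auto
 ultimately show ?thesis unfolding degk_def Dg_def using card_Un_disjoint[OF adj_finite[OF assms(1)] adj_finite[OF assms(1)]] by simp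
qed

text \<open>\<open>a\<close> is the largest entry not above \<open>k\<close>, so a bucket with key
  \<open>k\<close> exists only if it is \<open>a\<close>. An untouched node yields the null pointer,
  whose key 0 counts as absent.\<close>

lemma WF_probe:
 assumes wf: "WF V H nb nf A kap C B bo {}" and x: "x \<in> V" and k: "1 \<le> k"
  and a: "a = 0 \<and> {b\<in>B. bo b = x} = {} \<or> a \<in> insert x {b\<in>B. bo b = x}"
  and le: "H KEY a \<le> k" and top: "\<And>b. b \<in> B \<Longrightarrow> bo b = x \<Longrightarrow> H KEY b \<le> k \<Longrightarrow> H KEY b \<le> H KEY a"
 shows "C x k = (if H KEY a = k then H CNT a else 0)" "H KEY a = k \<Longrightarrow> a \<in> B \<and> bo a = x"
proof -
 note D = WFD[OF wf]
 show *: "H KEY a = k \<Longrightarrow> a \<in> B \<and> bo a = x" using a D(3)[OF x] D(4) k by auto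
 show "C x k = (if H KEY a = k then H CNT a else 0)"
 proof (cases "H KEY a = k")
  case True
  thus ?thesis using * D(15)[of a] by simp
 next case False
  have "C x k = 0" by (rule D(16)[OF x]) (use top False le in fastforce)
  thus ?thesis using False by simp
 qed
qed

lemma net_adj:
 assumes N: "net H A adj" and fA: "finite A" and g: "g \<in> A" "H OWN g = x"
  and pos: "\<And>h. h \<in> A \<Longrightarrow> H OWN h = x \<Longrightarrow> H OWN (tw h) = H OWN (tw g) \<Longrightarrow> H SG h = 0"
 shows "adj x (H OWN (tw g))"
proof (rule ccontr)
 assume n: "\<not> adj x (H OWN (tw g))"
 have z: "{h\<in>A. H OWN h = x \<and> H OWN (tw h) = H OWN (tw g) \<and> 0 < H SG h} = {}" using pos by fastforce
 have "card {h\<in>A. H OWN h = x \<and> H OWN (tw h) = H OWN (tw g) \<and> H SG h = 0} =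
  card {h\<in>A. H OWN h = x \<and> H OWN (tw h) = H OWN (tw g) \<and> 0 < H SG h} + of_bool (adj x (H OWN (tw g)))"
  using N unfolding net_def by blast
 hence "card {h\<in>A. H OWN h = x \<and> H OWN (tw h) = H OWN (tw g) \<and> H SG h = 0} = 0" unfolding z using n by simp
 moreover have "g \<in> {h\<in>A. H OWN h = x \<and> H OWN (tw h) = H OWN (tw g) \<and> H SG h = 0}" using g pos by blast
 ultimately show False using fA by auto
qed

context mach
begin

lemma run_chk:
 assumes ok: "okst s" and I: "Inv0 adj (KL lev) A B bo s" and x: "regs s ''x'' \<in> nodes n"
  and lev: "hp s LEV (regs s ''x'') = lev (regs s ''x'')" and lL: "lev (regs s ''x'') < L"
 shows "run chk s (\<lambda>t s'. hp s' = hp s \<and> eqx {''l'', ''b'', ''c'', ''e'', ''z''} s s' \<and>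
  regs s' ''l'' = lev (regs s ''x'') \<and> regs s' ''c'' = Dg adj lev (regs s ''x'') (lev (regs s ''x'')) \<and>
  (0 < lev (regs s ''x'') \<longrightarrow> regs s' ''e'' = Dg adj lev (regs s ''x'') (lev (regs s ''x'') - 1)) \<and>
  regs s' ''z'' = regs s ''x'' div 4 mod 2 \<and> t \<le> 10)"
proof -
 let ?x = "regs s ''x''" let ?l = "lev ?x" let ?H = "hp s"
 note i = Inv0D[OF I] note D = WFD[OF i(1)]
 define b1 where "b1 = ?H DN ?x"
 define b2 where "b2 = (if ?H KEY b1 = ?l + 1 then ?H DN b1 else b1)"
 define c where "c = (if ?H KEY b1 = ?l + 1 then ?H CNT b1 else 0)"
 define e where "e = (if 0 < ?l \<and> ?H KEY b2 = ?l then c + ?H CNT b2 else c)"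
 have kB: "?H KEY b \<le> ?l + 1" if b: "b \<in> B" "bo b = ?x" for b
 proof -
  have "{g\<in>A. ?H BK g = b} \<noteq> {}" using D(19)[of b] b by blast
  then obtain g where g: "g \<in> A" "?H BK g = b" by blast
  hence "?H KEY b = KL lev (?H OWN g) (?H OWN (tw g))" using D(11)[OF g(1)] by simp
  moreover have "?H OWN g = ?x" using D(10)[OF g(1)] g b by simp
  ultimately show ?thesis unfolding KL_def by simp
 qed
 \<comment> \<open>Either the list was never initialised and the pointer is null, or
   \<open>DN\<close> of the head is the largest bucket, with key at most the level plus 1, and its
   own \<open>DN\<close> is the next smaller one.\<close>
 have P: "(b1 = 0 \<and> {b\<in>B. bo b = ?x} = {} \<or> b1 \<in> insert ?x {b\<in>B. bo b = ?x}) \<and> ?H KEY b1 \<le> ?l + 1 \<and>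
  (\<forall>b\<in>B. bo b = ?x \<longrightarrow> ?H KEY b \<le> ?H KEY b1) \<and>
  (?H KEY b1 = ?l + 1 \<longrightarrow> ?H DN b1 \<in> insert ?x {b\<in>B. bo b = ?x} \<and> ?H KEY (?H DN b1) \<le> ?l \<and>
    (\<forall>b\<in>B. bo b = ?x \<longrightarrow> ?H KEY b \<le> ?l \<longrightarrow> ?H KEY b \<le> ?H KEY (?H DN b1)))"
 proof (rule disjE[OF D(7)[OF x]])
  assume *: "?H UP ?x = 0 \<and> ?H DN ?x = 0 \<and> {b\<in>B. bo b = ?x} = {}"
  hence "b1 = 0" "?H KEY b1 = 0" using b1_def D(4) by simp_all
  moreover have "bo b \<noteq> ?x" if "b \<in> B" for b using * that by blast
  ultimately show ?thesis using * by simp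
 next
  assume o: "oring (?H KEY) (?H UP) (?H DN) ?x {b\<in>B. bo b = ?x}"
  have b1: "b1 \<in> insert ?x {b\<in>B. bo b = ?x}" using oring_top(1)[OF o] b1_def by simp
  moreover have "?H KEY b1 \<le> ?l + 1" using b1 kB D(3)[OF x] by auto
  moreover have "\<forall>b\<in>B. bo b = ?x \<longrightarrow> ?H KEY b \<le> ?H KEY b1" using oring_top(2)[OF o] b1_def by simp
  moreover have "?H DN b1 \<in> insert ?x {b\<in>B. bo b = ?x} \<and> ?H KEY (?H DN b1) \<le> ?l \<and>
    (\<forall>b\<in>B. bo b = ?x \<longrightarrow> ?H KEY b \<le> ?l \<longrightarrow> ?H KEY b \<le> ?H KEY (?H DN b1))" if k: "?H KEY b1 = ?l + 1"
  proof -
   have "b1 \<noteq> ?x" using k D(3)[OF x] by auto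
   hence b: "b1 \<in> {b\<in>B. bo b = ?x}" using b1 by simp
   note d = oring_down[OF o b]
   have "?H KEY b \<le> ?H KEY (?H DN b1)" if "b \<in> B" "bo b = ?x" "?H KEY b \<le> ?l" for b using d(3)[of b] that k by simp
   thus ?thesis using d(1,2) k by simp
  qed
  ultimately show ?thesis by blast
 qed
 have b1a: "b1 = 0 \<and> {b\<in>B. bo b = ?x} = {} \<or> b1 \<in> insert ?x {b\<in>B. bo b = ?x}" and b1k: "?H KEY b1 \<le> ?l + 1"
  using P by blast+
 have C1: "degk adj (KL lev) ?x (?l + 1) = c" unfolding c_def by (rule WF_probe(1)[OF i(1) x _ b1a b1k]) (use P in auto)
 have b2a: "b2 = 0 \<and> {b\<in>B. bo b = ?x} = {} \<or> b2 \<in> insert ?x {b\<in>B. bo b = ?x}" unfolding b2_def using P by simp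
 have b2k: "?H KEY b2 \<le> ?l" using P unfolding b2_def by (cases "?H KEY b1 = ?l + 1") auto
 have b2t: "?H KEY b \<le> ?H KEY b2" if "b \<in> B" "bo b = ?x" "?H KEY b \<le> ?l" for b
  using P that unfolding b2_def by (cases "?H KEY b1 = ?l + 1") auto
 have C2: "degk adj (KL lev) ?x ?l = (if ?H KEY b2 = ?l then ?H CNT b2 else 0)" if "0 < ?l"
  by (rule WF_probe(1)[OF i(1) x _ b2a b2k b2t]) (use that in auto)
 have cD: "c = Dg adj lev ?x ?l" using C1 degk_KL1 by simp
 have eD: "e = Dg adj lev ?x (?l - 1)" if "0 < ?l" using degk_KL2[of n adj lev ?x, OF i(5) that] C1 C2[OF that] that unfolding e_def
  by (cases "?H KEY b2 = ?l") simp_all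
 have cW: "c + ?H CNT b2 \<le> W" if "0 < ?l" "?H KEY b2 = ?l"
 proof -
  have "c \<le> 2 * n" using C1 degk_le[OF i(5), of "KL lev" ?x "?l + 1"] by simp
  moreover have "?H CNT b2 \<le> 2 * n" using C2[OF that(1)] that(2) degk_le[OF i(5), of "KL lev" ?x "?l"] by simp
  ultimately show ?thesis using nM MW by linarith
 qed
 have h: "hp (fin \<pi> chk s) = hp s" "regs (fin \<pi> chk s) = (regs s)(''l'' := ?l, ''b'' := b2, ''c'' := c, ''e'' := e, ''z'' := ?x div 4 mod 2)"
  unfolding chk_def b2_def c_def e_def using lev b1_def by (simp_all add: mem_adr fun_upd_twist)
 show ?thesis
 proof (rule run_fin[OF ok], goal_cases)
  case 1 show ?case by (simp add: chk_def)
 next case 2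
  have "okst s" by (rule ok)
  have cW': "0 < ?l \<Longrightarrow> ?H KEY (?H DN b1) = ?l \<Longrightarrow> ?H KEY b1 = Suc ?l \<Longrightarrow> ?H CNT b1 + ?H CNT (?H DN b1) \<le> W"
   "0 < ?l \<Longrightarrow> ?H KEY b1 = ?l \<Longrightarrow> ?H CNT b1 \<le> W" using cW unfolding b2_def c_def by simp_all
  show ?case using cW' lev unfolding chk_def b1_def[symmetric] by (simp add: mem_adr b1_def[symmetric])
 next case (3 t)
  hence "t \<le> 10" by (simp add: chk_def)
  thus ?case using h cD eD by (simp add: eqx_def)
 qed
qed

text \<open>Keys matter only for pairs joined by a record: buckets contain records, and live edges
  have records by \<open>cover\<close>.\<close>

lemma Inv0_K:
 assumes I: "Inv0 adj K A B bo s" and K: "\<And>g. g \<in> A \<Longrightarrow> K' (hp s OWN g) (far s g) = K (hp s OWN g) (far s g)"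
  and K': "\<And>x y. K' x y = K' y x" "\<And>x y. 1 \<le> K' x y" "\<And>x y. K' x y \<le> L"
 shows "Inv0 adj K' A B bo s"
proof -
 note i = Inv0D[OF I]
 have "K' x y = K x y" if "adj x y" for x y using i(6) that K unfolding cover_def by blast
 hence dk: "degk adj K' x k = degk adj K x k" for x k unfolding degk_def by (intro arg_cong[where f = card] Collect_cong) auto
 have "WFs s A (\<lambda>h. K' (hp s OWN h) (far s h)) (degk adj K') B bo {}" by (rule WF_cong[OF i(1)]) (use K dk in simp_all)
 thus ?thesis unfolding Inv0_def using i(2-6) K' by simp
qed

definition Inv1 :: "graph \<Rightarrow> (nat \<Rightarrow> nat) \<Rightarrow> nat set \<Rightarrow> state \<Rightarrow> bool" where
 "Inv1 adj lev A s \<longleftrightarrow> (\<exists>B bo. Inv0 adj (KL lev) A B bo s) \<and> net (hp s) A adj \<and>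
  (\<forall>y\<in>nodes n. hp s SLOT y = 0) \<and> (\<forall>x\<in>nodes n. hp s LEV x = lev x) \<and> (\<forall>x. lev x < L) \<and>
  wl_ok s"

definition mvset :: "string set" where
 "mvset = {''i'', ''j'', ''y'', ''top'', ''a'', ''b'', ''c'', ''f'', ''p'', ''nb'', ''nf'', ''h'', ''s''}"

lemma KL_range: "(\<And>x. lev x < L) \<Longrightarrow> KL lev x y = KL lev y x \<and> 1 \<le> KL lev x y \<and> KL lev x y \<le> L"
 unfolding KL_def by (auto simp: min_def Suc_le_eq)

text \<open>The keys left by the loop are those of the new levels. On the way up, edges to
  neighbours on the old level keep their minimum, which the bound \<open>l\<close> respects; on the
  way down, all edges of the top bucket change. \<open>cl\<close> comes from cleaning: a stale
  record towards a non-neighbour would have been left with its old key.\<close>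

lemma K_switch:
 assumes I: "Inv0 adj (moveK (KL lev) x {y. adj x y \<and> KL lev x y = lev x + 1 \<and> l \<le> lev y} (m + 1)) A B bo s"
  and ml: "m = lev x + 1 \<and> l = lev x + 1 \<or> m + 1 = lev x \<and> l = 0" and lL: "\<And>x. lev x < L" "m < L"
  and cl: "\<And>g. g \<in> A \<Longrightarrow> hp s OWN g = x \<Longrightarrow> lev x \<le> lev (far s g) \<Longrightarrow> adj x (far s g)"
 shows "Inv0 adj (KL (lev(x := m))) A B bo s"
proof (rule Inv0_K[OF I])
 let ?Y = "{y. adj x y \<and> KL lev x y = lev x + 1 \<and> l \<le> lev y}"
 let ?K = "moveK (KL lev) x ?Y (m + 1)"
 note i = Inv0D[OF I]
 have xY: "x \<notin> ?Y" using i(5) unfolding adjok_def by auto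
 have main: "KL (lev(x := m)) x (far s g) = ?K x (far s g)" if g: "g \<in> A" "hp s OWN g = x" for g
 proof -
  let ?y = "far s g"
  have ne: "?y \<noteq> x" using recokD(7)[OF i(4) g(1)] g(2) by simp
  show ?thesis
  proof (cases "lev x \<le> lev ?y")
   case True
   hence a: "adj x ?y" using cl g by blast
   have k: "KL lev x ?y = lev x + 1" using True by (simp add: KL_def)
   show ?thesis
   proof (cases "l \<le> lev ?y")
    case True
    hence "?K x ?y = m + 1" using a k unfolding moveK_def by simp
    thus ?thesis using ml True \<open>lev x \<le> lev ?y\<close> ne by (auto simp: KL_def min_def)
   next case False
    hence "?K x ?y = lev x + 1" using xY k ne unfolding moveK_def by auto
    thus ?thesis using ml False \<open>lev x \<le> lev ?y\<close> ne by (auto simp: KL_def min_def)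
   qed
  next case False
   hence "?K x ?y = KL lev x ?y" using xY by (auto simp: moveK_def KL_def min_def)
   thus ?thesis using ml False ne by (auto simp: KL_def min_def)
  qed
 qed
 have sy: "KL (lev(x := m)) z w = KL (lev(x := m)) w z" "1 \<le> KL (lev(x := m)) z w" "KL (lev(x := m)) z w \<le> L" for z w
 proof -
  have "(lev(x := m)) v < L" for v using lL by simp
  thus "KL (lev(x := m)) z w = KL (lev(x := m)) w z" "1 \<le> KL (lev(x := m)) z w" "KL (lev(x := m)) z w \<le> L" using KL_range by blast+
 qed
 show "KL (lev(x := m)) z w = KL (lev(x := m)) w z" "1 \<le> KL (lev(x := m)) z w" "KL (lev(x := m)) z w \<le> L" for z w using sy by auto
 fix g assume g: "g \<in> A"
 show "KL (lev(x := m)) (hp s OWN g) (far s g) = ?K (hp s OWN g) (far s g)"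
 proof (cases "hp s OWN g = x")
  case True
  thus ?thesis using main[OF g True] by simp
 next case f1: False
  show ?thesis
  proof (cases "far s g = x")
   case True
   have t: "tw (tw g) = g" using tw_props(1)[OF recokD(1)[OF i(4) g]] .
   have "KL (lev(x := m)) x (hp s OWN g) = ?K x (hp s OWN g)" using main[OF recokD(3)[OF i(4) g] True] t by simp
   thus ?thesis using True sy(1)[of x "hp s OWN g"] i(7)[of x "hp s OWN g"] by simp
  next case False
   thus ?thesis using f1 by (simp add: KL_def moveK_def)
  qed
 qed
qed

text \<open>Keys at \<open>x\<close> never exceed \<open>lev x + 1\<close>, and this value is
  reached exactly by records towards nodes that are not below \<open>x\<close>. The largest key thus
  tells whether there are any.\<close>

lemma probe_top:
 assumes I: "Inv0 adj (KL lev) A B bo s" and x: "x \<in> nodes n"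
 shows "hp s KEY (hp s DN x) = lev x + 1 \<Longrightarrow> hp s DN x \<in> B \<and> bo (hp s DN x) = x"
  "hp s KEY (hp s DN x) \<noteq> lev x + 1 \<Longrightarrow> g \<in> A \<Longrightarrow> hp s OWN g = x \<Longrightarrow> \<not> lev x \<le> lev (far s g)"
proof -
 let ?H = "hp s" let ?b = "hp s DN x"
 note D = WFD[OF Inv0D(1)[OF I]]
 have a: "?b = 0 \<or> ?b \<in> insert x {b\<in>B. bo b = x}" using D(7)[OF x] oring_top(1) by blast
 show "?H KEY ?b = lev x + 1 \<Longrightarrow> ?b \<in> B \<and> bo ?b = x" using a D(3)[OF x] D(4) by auto
 show "\<not> lev x \<le> lev (?H OWN (tw g))" if k: "?H KEY ?b \<noteq> lev x + 1" and g: "g \<in> A" "?H OWN g = x"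
 proof
  assume le: "lev x \<le> lev (?H OWN (tw g))"
  have bg: "?H BK g \<in> {b\<in>B. bo b = x}" using D(9,10)[OF g(1)] g(2) by simp
  have kg: "?H KEY (?H BK g) = lev x + 1" using D(11)[OF g(1)] g(2) le by (simp add: KL_def)
  have o: "oring (?H KEY) (?H UP) (?H DN) x {b\<in>B. bo b = x}" using D(7)[OF x] bg by blast
  have "lev x + 1 \<le> ?H KEY ?b" using oring_top(2)[OF o bg] kg by simp
  hence "?b \<in> B - {}" "bo ?b = x" using oring_top(1)[OF o] D(3)[OF x] by auto
  then obtain h where h: "h \<in> A" "?H BK h = ?b" using D(19) by blast
  have "?H KEY ?b = KL lev (?H OWN h) (?H OWN (tw h))" using D(11)[OF h(1)] h(2) by simp
  moreover have "?H OWN h = x" using D(10)[OF h(1)] h(2) \<open>bo ?b = x\<close> by simp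
  ultimately have "?H KEY ?b \<le> lev x + 1" unfolding KL_def by simp
  thus False using k \<open>lev x + 1 \<le> ?H KEY ?b\<close> by simp
 qed
qed

text \<open>Per edge into its own level, cleaning takes 44 steps and the loop 150, together less
  than 200; deleted half-edges account for 22 steps each.\<close>

lemma run_move:
 assumes ok: "okst s" and I: "Inv1 adj lev A s" and x: "regs s ''x'' \<in> nodes n" and q: "regs s ''q'' = m + 1" "m < L"
  and ml: "m = lev (regs s ''x'') + 1 \<and> regs s ''l'' = lev (regs s ''x'') + 1 \<or> m + 1 = lev (regs s ''x'') \<and> regs s ''l'' = 0"
 shows "run move s (\<lambda>t s'. \<exists>A'. A' \<subseteq> A \<and> Inv1 adj (lev(regs s ''x'' := m)) A' s' \<and>
  qu s' = insert (regs s ''x'') (qu s \<union> {y. adj (regs s ''x'') y \<and> lev (regs s ''x'') \<le> lev y}) \<and>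
  eqx mvset s s' \<and>
  t \<le> 200 * Dg adj lev (regs s ''x'') (lev (regs s ''x'')) + 22 * (card A - card A') + 40)"
proof -
 let ?x = "regs s ''x''" and ?l = "regs s ''l''"
 let ?k = "lev ?x + 1" and ?D = "Dg adj lev ?x (lev ?x)"
 let ?Y = "{y. adj ?x y \<and> KL lev ?x y = ?k \<and> ?l \<le> lev y}"
 obtain B bo where I0: "Inv0 adj (KL lev) A B bo s" and N: "net (hp s) A adj"
  and sl: "\<forall>y\<in>nodes n. hp s SLOT y = 0" and lv: "\<forall>x\<in>nodes n. hp s LEV x = lev x" and lL: "\<forall>x. lev x < L"
  and wl: "wl_ok s" using I unfolding Inv1_def by iprover
 note i = Inv0D[OF I0]
 have lvx: "hp s LEV ?x = lev ?x" using lv x by blast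
 have Yk: "{y. adj ?x y \<and> KL lev ?x y = ?k} = {y. adj ?x y \<and> lev ?x \<le> lev y}" by (auto simp: KL_def min_def)
 have dkD: "degk adj (KL lev) ?x ?k = ?D" by (rule degk_KL1)
 let ?P = "\<lambda>t s1. \<exists>A' B' bo'. A' \<subseteq> A \<and> Inv0 adj (KL (lev(?x := m))) A' B' bo' s1 \<and> net (hp s1) A' adj \<and>
  (\<forall>y\<in>nodes n. hp s1 SLOT y = 0) \<and> hp s1 LEV = hp s LEV \<and> wl_ok s1 \<and>
  qu s1 = qu s \<union> {y. adj ?x y \<and> lev ?x \<le> lev y} \<and> eqx mvset s s1 \<and>
  t \<le> 200 * ?D + 22 * (card A - card A') + 20"
 \<comment> \<open>If no record leads to a node that is not below \<open>x\<close>, no key changes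
   with the level of \<open>x\<close> and there is no neighbour to queue.\<close>
 have nob: "Inv0 adj (KL (lev(?x := m))) A1 B1 bo1 s1 \<and> {y. adj ?x y \<and> lev ?x \<le> lev y} = {}"
  if J: "Inv0 adj (KL lev) A1 B1 bo1 s1" and no: "\<And>g. g \<in> A1 \<Longrightarrow> hp s1 OWN g = ?x \<Longrightarrow> \<not> lev ?x \<le> lev (far s1 g)"
  for A1 B1 bo1 s1
 proof -
  have e: "{y. adj ?x y \<and> lev ?x \<le> lev y} = {}"
  proof (rule equals0I)
   fix y assume y: "y \<in> {y. adj ?x y \<and> lev ?x \<le> lev y}"
   then obtain g where "g \<in> A1" "hp s1 OWN g = ?x" "far s1 g = y" using Inv0D(6)[OF J] unfolding cover_def by blast
   thus False using no y by blast
  qed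
  hence "?Y = {}" using Yk by blast
  hence mk: "moveK (KL lev) ?x ?Y (m + 1) = KL lev" unfolding \<open>?Y = {}\<close> by (simp add: moveK_def fun_eq_iff)
  have "Inv0 adj (KL (lev(?x := m))) A1 B1 bo1 s1"
   by (rule K_switch[where l = ?l and lev = lev and x = ?x and m = m, OF _ ml]) (use J mk lL q(2) no in simp_all)
  thus ?thesis using e by simp
 qed
 define s0 where "s0 = fin \<pi> (Assign ''a'' (ld DN (rr ''x''))) s"
 have h0: "hp s0 = hp s" "regs s0 = (regs s)(''a'' := hp s DN ?x)" unfolding s0_def by (simp_all add: mem_adr)
 have ok0: "okst s0" unfolding s0_def using okst_reg[OF ok okst_hp_le[OF ok]] by (simp add: mem_adr)
 let ?test = "Equal (ld KEY (rr ''a'')) (Plus (ld LEV (rr ''x'')) (Const 1))"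
 have mid: "run (Cond ?test
   (Assign ''s'' (rr ''a'') ;; clean ;; Assign ''a'' (ld DN (rr ''x'')) ;;
    Cond ?test (Assign ''s'' (rr ''a'') ;; moveloop) Skip) Skip) s0 ?P"
 proof (rule run_cond[OF ok0])
  assume "\<not> bval \<pi> ?test s0"
  hence "hp s KEY (hp s DN ?x) \<noteq> ?k" using h0 lvx by (simp add: mem_adr)
  note no = probe_top(2)[OF I0 x this]
  have I00: "Inv0 adj (KL lev) A B bo s0" by (rule Inv0_cong[OF I0]) (use h0 in simp_all)
  have dn: "Inv0 adj (KL (lev(?x := m))) A B bo s0 \<and> {y. adj ?x y \<and> lev ?x \<le> lev y} = {}" using nob[OF I00] no h0 by simp
  have "?P (Suc 1) s0"
  proof (rule exI[of _ A], rule exI[of _ B], rule exI[of _ bo], intro conjI)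
   show "Inv0 adj (KL (lev(?x := m))) A B bo s0" using dn by simp
   show "qu s0 = qu s \<union> {y. adj ?x y \<and> lev ?x \<le> lev y}" unfolding conjunct2[OF dn] using h0 by simp
  qed (use N sl wl h0 in \<open>simp_all add: eqx_def mvset_def\<close>)
  thus "run Skip s0 (\<lambda>t. ?P (Suc t))" by (rule run_skip[OF ok0])
 next
  assume "bval \<pi> ?test s0"
  hence k0: "hp s KEY (hp s DN ?x) = ?k" using h0 lvx by (simp add: mem_adr)
  note b0 = probe_top(1)[OF I0 x k0]
  define s1 where "s1 = fin \<pi> (Assign ''s'' (rr ''a'')) s0"
  have h1: "hp s1 = hp s" "regs s1 = (regs s)(''a'' := hp s DN ?x, ''s'' := hp s DN ?x)" unfolding s1_def using h0 by simp_all
  have ok1: "okst s1" unfolding s1_def using okst_reg[OF ok0 okst_regs_le[OF ok0]] by simp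
  have I1: "Inv0 adj (KL lev) A B bo s1" by (rule Inv0_cong[OF I0]) (use h1 in simp_all)
  have N1: "net (hp s1) A adj" using N h1 by simp
  have b1: "regs s1 ''s'' \<in> B" "?x = bo (regs s1 ''s'')" "?k = hp s1 KEY (regs s1 ''s'')" using b0 k0 h1 by simp_all
  have z1: "hp s1 SLOT y = 0" if "y \<in> nodes n" for y using sl that h1 by simp
  show "run (Assign ''s'' (rr ''a'') ;; clean ;; Assign ''a'' (ld DN (rr ''x'')) ;;
    Cond ?test (Assign ''s'' (rr ''a'') ;; moveloop) Skip) s0 (\<lambda>t. ?P (Suc t))"
  proof (rule run_seq, rule run_fin[OF ok0], goal_cases)
   case (3 t1)
   hence t1: "t1 \<le> 1" by simp
   show ?case unfolding s1_def[symmetric]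
   proof (rule run_seq, rule run_mono[OF run_clean[OF ok1 I1 N1 b1 z1]], goal_cases)
    case (1 y) thus ?case .
   next case (2 t2 s2)
    then obtain A2 B2 where J2: "Inv0 adj (KL lev) A2 B2 bo s2" and N2: "net (hp s2) A2 adj" and A2: "A2 \<subseteq> A"
     and pos: "\<forall>g\<in>A2. hp s1 OWN g = ?x \<longrightarrow> KL lev ?x (far s1 g) = ?k \<longrightarrow> hp s1 SG g = 0"
     and sl2: "\<forall>y\<in>nodes n. hp s2 SLOT y = 0" and f2: "\<forall>f\<in>{OWN, SG, LEV, WL, INW}. hp s2 f = hp s1 f"
     and e2: "eqx cleanrs s1 s2" and t2: "t2 \<le> 44 * degk adj (KL lev) ?x ?k + 22 * (card A - card A2) + 4" and ok2: "okst s2" by iprover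
    have own2: "hp s2 OWN = hp s OWN" "hp s2 SG = hp s SG" "hp s2 LEV = hp s LEV" "hp s2 WL = hp s WL" "hp s2 INW = hp s INW"
     using f2 h1 by simp_all
    have r2: "regs s2 ''x'' = ?x" "regs s2 ''q'' = m + 1" "regs s2 ''l'' = ?l" "regs s2 ''top'' = regs s ''top''"
     using e2 h1 q by (simp_all add: eqx_def)
    have fA2: "finite A2" using recok_card(2)[OF Inv0D(4)[OF J2]] .
    have wl2: "wl_ok s2" and Q2: "qu s2 = qu s" using wl own2 r2 unfolding wlok_def queue_def by simp_all
    have aj: "adj ?x (far s g)" if g: "g \<in> A2" "hp s OWN g = ?x" "lev ?x \<le> lev (far s g)" for g
    proof -
     have "adj ?x (far s2 g)"
     proof (rule net_adj[OF N2 fA2 g(1)])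
      fix h assume h: "h \<in> A2" "hp s2 OWN h = ?x" "far s2 h = far s2 g"
      have "KL lev ?x (far s h) = ?k" using g(3) h(3) own2 by (simp add: KL_def)
      thus "hp s2 SG h = 0" using pos h own2 h1 by simp
     qed (use g own2 in simp)
     thus ?thesis using own2 by simp
    qed
    define s3 where "s3 = fin \<pi> (Assign ''a'' (ld DN (rr ''x''))) s2"
    have h3: "hp s3 = hp s2" "regs s3 = (regs s2)(''a'' := hp s2 DN ?x)" unfolding s3_def using r2 by (simp_all add: mem_adr)
    have ok3: "okst s3" unfolding s3_def using okst_reg[OF ok2 okst_hp_le[OF ok2]] r2 by (simp add: mem_adr)
    have J3: "Inv0 adj (KL lev) A2 B2 bo s3" by (rule Inv0_cong[OF J2]) (use h3 in simp_all)
    have e3: "eqx mvset s s3" using e2 h1 h3 by (simp add: eqx_def mvset_def)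
    have t2': "t2 \<le> 44 * ?D + 22 * (card A - card A2) + 4" using t2 unfolding dkD .
    have fin3: "run (Cond ?test (Assign ''s'' (rr ''a'') ;; moveloop) Skip) s3 (\<lambda>t. ?P (Suc (t1 + (t2 + (1 + t)))))"
    proof (rule run_cond[OF ok3])
     assume "\<not> bval \<pi> ?test s3"
     hence "hp s2 KEY (hp s2 DN ?x) \<noteq> ?k" using h3 r2 lvx own2 by (simp add: mem_adr)
     note no = probe_top(2)[OF J2 x this]
     have dn: "Inv0 adj (KL (lev(?x := m))) A2 B2 bo s3 \<and> {y. adj ?x y \<and> lev ?x \<le> lev y} = {}" using nob[OF J3] no h3 by simp
     have "?P (Suc (t1 + (t2 + (1 + Suc 1)))) s3"
     proof (rule exI[of _ A2], rule exI[of _ B2], rule exI[of _ bo], intro conjI)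
      show "Inv0 adj (KL (lev(?x := m))) A2 B2 bo s3" using dn by simp
      show "qu s3 = qu s \<union> {y. adj ?x y \<and> lev ?x \<le> lev y}" unfolding conjunct2[OF dn] using h3 Q2 by simp
      show "Suc (t1 + (t2 + (1 + Suc 1))) \<le> 200 * ?D + 22 * (card A - card A2) + 20" using t1 t2' by linarith
      show "wl_ok s3" using wl2 h3 by simp
     qed (use A2 N2 sl2 h3 own2 e3 in simp_all)
     thus "run Skip s3 (\<lambda>t. ?P (Suc (t1 + (t2 + (1 + Suc t)))))" by (rule run_skip[OF ok3])
    next
     assume "bval \<pi> ?test s3"
     hence k3: "hp s2 KEY (hp s2 DN ?x) = ?k" using h3 r2 lvx own2 by (simp add: mem_adr)
     note b3 = probe_top(1)[OF J2 x k3]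
     define s4 where "s4 = fin \<pi> (Assign ''s'' (rr ''a'')) s3"
     have h4: "hp s4 = hp s2" "regs s4 = (regs s2)(''a'' := hp s2 DN ?x, ''s'' := hp s2 DN ?x)" unfolding s4_def using h3 by simp_all
     have ok4: "okst s4" unfolding s4_def using okst_reg[OF ok3 okst_regs_le[OF ok3]] by simp
     have J4: "Inv0 adj (KL lev) A2 B2 bo s4" by (rule Inv0_cong[OF J2]) (use h4 in simp_all)
     have N4: "net (hp s4) A2 adj" using N2 h4 by simp
     have b4: "regs s4 ''s'' \<in> B2" "?x = bo (regs s4 ''s'')" "?k = hp s4 KEY (regs s4 ''s'')" using b3 k3 h4 by simp_all
     have q4: "regs s4 ''q'' = ?k + 1 \<or> regs s4 ''q'' + 1 = ?k" "1 \<le> regs s4 ''q''" "regs s4 ''q'' \<le> L" using r2 h4 ml q(2) by auto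
     have wl4: "wl_ok s4" using wl2 h4 by simp
     have pos4: "hp s4 SG g = 0" if "g \<in> A2" "hp s4 OWN g = ?x" "KL lev ?x (far s4 g) = ?k" for g using pos that h4 own2 h1 by simp
     show "run (Assign ''s'' (rr ''a'') ;; moveloop) s3 (\<lambda>t. ?P (Suc (t1 + (t2 + (1 + Suc t)))))"
     proof (rule run_seq, rule run_fin[OF ok3], goal_cases)
      case (3 t4)
      hence t4: "t4 \<le> 1" by simp
      show ?case unfolding s4_def[symmetric]
      proof (rule run_mono[OF run_moveloop[OF ok4 J4 N4 b4 pos4 q4 wl4]], goal_cases)
       case (1 g) thus ?case by simp
      next case (2 g) thus ?case by simp
      next case (3 g) thus ?case by simp
      next case (4 t5 s5)
       have rl4: "regs s4 ''l'' = ?l" "regs s4 ''q'' = m + 1" "hp s4 LEV = hp s LEV" using h4 r2 own2 by simp_all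
       from 4 obtain B5 bo5 where J5: "Inv0 adj (moveK (KL lev) ?x {y. adj ?x y \<and> KL lev ?x y = ?k \<and> ?l \<le> hp s LEV y} (m + 1)) A2 B5 bo5 s5"
        and f5: "\<forall>f\<in>{OWN, SG, LEV, SLOT}. hp s5 f = hp s4 f" and e5: "eqx looprs s4 s5" and wl5: "wl_ok s5"
        and Q5: "qu s5 = qu s4 \<union> {y. adj ?x y \<and> KL lev ?x y = ?k}" and t5: "t5 \<le> 150 * degk adj (KL lev) ?x ?k + 2"
        unfolding rl4 by iprover
       have YY: "{y. adj ?x y \<and> KL lev ?x y = ?k \<and> ?l \<le> hp s LEV y} = ?Y"
       proof -
        have "hp s LEV y = lev y" if "adj ?x y" for y using that i(5) lv unfolding adjok_def by blast
        thus ?thesis by (intro Collect_cong) auto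
       qed
       have own5: "hp s5 OWN = hp s OWN" "hp s5 SG = hp s SG" "hp s5 LEV = hp s LEV" "hp s5 SLOT = hp s2 SLOT" using f5 h4 own2 by simp_all
       have "Inv0 adj (KL (lev(?x := m))) A2 B5 bo5 s5"
       proof (rule K_switch[where l = ?l and lev = lev and x = ?x and m = m, OF _ ml])
        show "Inv0 adj (moveK (KL lev) ?x ?Y (m + 1)) A2 B5 bo5 s5" using J5 unfolding YY .
        show "lev y < L" for y using lL by blast
        show "m < L" using q(2) .
        show "adj ?x (far s5 g)" if "g \<in> A2" "hp s5 OWN g = ?x" "lev ?x \<le> lev (far s5 g)" for g using aj that own5 by simp
       qed
       moreover have "net (hp s5) A2 adj" by (rule net_recok_cong[OF N2]) (use own5 own2 in simp_all)
       moreover have "\<forall>y\<in>nodes n. hp s5 SLOT y = 0" using sl2 own5 by simp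
       moreover have "qu s5 = qu s \<union> {y. adj ?x y \<and> lev ?x \<le> lev y}" using Q5 Q2 h4 Yk by simp
       moreover have "eqx mvset s s5" using e5 h4 e2 h1 by (simp add: eqx_def mvset_def)
       moreover have "Suc (t1 + (t2 + (1 + Suc (t4 + t5)))) \<le> 200 * ?D + 22 * (card A - card A2) + 20"
        using t1 t2' t4 t5 unfolding dkD by linarith
       ultimately show ?case using A2 own5(3) wl5 by (intro exI[of _ A2] exI[of _ B5] exI[of _ bo5] conjI)
      qed
     qed simp_all
    qed
    show ?case
    proof (rule run_seq, rule run_fin[OF ok2], goal_cases)
     case (3 t3)
     hence t3: "t3 \<le> 1" by simp
     show ?case unfolding s3_def[symmetric]
     proof (rule run_mono[OF fin3], goal_cases)
      case (1 t s')
      then obtain A' B' bo' where str: "A' \<subseteq> A" "Inv0 adj (KL (lev(?x := m))) A' B' bo' s'" "net (hp s') A' adj"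
       "\<forall>y\<in>nodes n. hp s' SLOT y = 0" "hp s' LEV = hp s LEV" "wl_ok s'"
       "qu s' = qu s \<union> {y. adj ?x y \<and> lev ?x \<le> lev y}" "eqx mvset s s'"
       "Suc (t1 + (t2 + (1 + t))) \<le> 200 * ?D + 22 * (card A - card A') + 20" by iprover
      have tt: "Suc (t1 + (t2 + (t3 + t))) \<le> 200 * ?D + 22 * (card A - card A') + 20" using str(9) t3 by linarith
      show ?case by (rule exI[of _ A'], rule exI[of _ B'], rule exI[of _ bo'], intro conjI str(1-8) tt)
     qed
    qed simp_all
   qed
  qed simp_all
 qed
 show ?thesis unfolding move_def
 proof (rule run_seq, rule run_fin[OF ok], goal_cases)
  case (3 t0)
  hence t0: "t0 \<le> 1" by simp
  show ?case unfolding s0_def[symmetric]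
  proof (rule run_seq, rule run_mono[OF mid], goal_cases)
   case (1 t1 s1)
   then obtain A' B' bo' where A': "A' \<subseteq> A" and J: "Inv0 adj (KL (lev(?x := m))) A' B' bo' s1" and N1: "net (hp s1) A' adj"
    and sl1: "\<forall>y\<in>nodes n. hp s1 SLOT y = 0" and lv1: "hp s1 LEV = hp s LEV" and wl1: "wl_ok s1"
    and Q1: "qu s1 = qu s \<union> {y. adj ?x y \<and> lev ?x \<le> lev y}" and e1: "eqx mvset s s1"
    and t1: "t1 \<le> 200 * ?D + 22 * (card A - card A') + 20" and ok1: "okst s1" by iprover
   have r1: "regs s1 ''x'' = ?x" "regs s1 ''q'' = m + 1" using e1 q by (simp_all add: eqx_def mvset_def)
   have mW: "m \<le> W" using q(2) MW by linarith
   define s2 where "s2 = fin \<pi> (st LEV (rr ''x'') (Minus (rr ''q'') (Const 1)) ;; Assign ''y'' (rr ''x'')) s1"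
   have h2: "hp s2 = (hp s1)(LEV := (hp s1 LEV)(?x := m))" "regs s2 = (regs s1)(''y'' := ?x)" unfolding s2_def using r1 by simp_all
   have xM: "?x < M" using V_less[OF x] .
   have ok2: "okst s2" unfolding s2_def using okst_reg[OF okst_mem[OF ok1, of "adr LEV ?x" m], of ?x "''y''"] r1 adr_less[OF xM] mW xM MW by simp
   have wl2: "wl_ok s2" and Q2: "qu s2 = qu s1" using wl1 h2 unfolding wlok_def queue_def by simp_all
   have y2: "regs s2 ''y'' \<in> nodes n" using h2 x by simp
   show ?case
   proof (rule run_seq, rule run_fin[OF ok1], goal_cases)
    case (3 t2)
    hence t2: "t2 \<le> 2" by simp
    show ?case unfolding s2_def[symmetric]
    proof (rule run_mono[OF run_pushwl[OF ok2 wl2 y2]], goal_cases)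
     case (1 t3 s3)
     hence wl3: "wl_ok s3" and Q3: "qu s3 = insert ?x (qu s2)"
      and f3: "\<forall>f. f \<noteq> WL \<longrightarrow> f \<noteq> INW \<longrightarrow> hp s3 f = hp s2 f" and e3: "eqx {''top''} s2 s3" and t3: "t3 \<le> 4"
      using h2 by simp_all
     have J3: "Inv0 adj (KL (lev(?x := m))) A' B' bo' s3" by (rule Inv0_cong[OF J]) (use f3 h2 e3 in \<open>simp_all add: eqx_def\<close>)
     have N3: "net (hp s3) A' adj" by (rule net_recok_cong[OF N1]) (use f3 h2 in simp_all)
     have sl3: "\<forall>y\<in>nodes n. hp s3 SLOT y = 0" using sl1 f3 h2 by simp
     have lv3: "\<forall>y\<in>nodes n. hp s3 LEV y = (lev(?x := m)) y" using lv lv1 f3 h2 by simp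
     have lL3: "\<forall>y. (lev(?x := m)) y < L" using lL q(2) by simp
     have I3: "Inv1 adj (lev(?x := m)) A' s3" unfolding Inv1_def by (intro conjI N3 sl3 lv3 lL3 wl3 exI[of _ B'] exI[of _ bo'] J3)
     have Q: "qu s3 = insert ?x (qu s \<union> {y. adj ?x y \<and> lev ?x \<le> lev y})" using Q3 Q2 Q1 by simp
     have e: "eqx mvset s s3" using e1 h2 e3 by (simp add: eqx_def mvset_def)
     have t: "t0 + (t1 + (t2 + t3)) \<le> 200 * ?D + 22 * (card A - card A') + 40" using t0 t1 t2 t3 by linarith
     show ?case by (rule exI[of _ A'], intro conjI A' I3 Q e t)
    qed
   qed (use r1 xM adr_less[OF xM] mW in simp_all)
  qed
 qed simp_all
qed

end

section \<open>Restoring the decomposition after an update\<close>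

locale dec = mach \<pi> M W n L for \<pi> M W n L +
 fixes \<alpha> \<epsilon> dS dT :: real
 assumes eps: "0 < \<epsilon>" "\<epsilon> < 1" and alpha: "2 + 3 * \<epsilon> \<le> \<alpha>" and dpos: "0 \<le> dS" "0 \<le> dT" and L1: "1 \<le> L"
  and params: "\<pi> Alpha = \<alpha>" "\<pi> DS = dS" "\<pi> DT = dT"
begin

definition fxset :: "string set" where
 "fxset = mvset \<union> {''x'', ''l'', ''e'', ''z'', ''q''}"

definition dd :: "nat \<Rightarrow> real" where "dd x = (if x mod 8 = 1 then dS else dT)"

sublocale pot "nodes n" dd \<alpha> \<epsilon> L by standard (use finite_nodes eps alpha dpos L1 in \<open>simp_all add: dd_def\<close>)

text \<open>A node on the top level has nowhere to rise, as the decomposition makes demands for i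
  \<le> L - 1 only; a node on the bottom level cannot sink.\<close>

definition dirty :: "graph \<Rightarrow> (nat \<Rightarrow> nat) \<Rightarrow> nat \<Rightarrow> bool" where
 "dirty adj lev x \<longleftrightarrow> x \<in> nodes n \<and>
  (lev x + 1 < L \<and> \<alpha> * dd x < real (Dg adj lev x (lev x)) \<or>
   0 < lev x \<and> real (Dg adj lev x (lev x - 1)) < dd x)"

lemma good_adj: "adjok n adj \<Longrightarrow> good adj" unfolding adjok_def good_def by blast

text \<open>What matters to \<open>y\<close> are its degrees into levels up to its own. If
  \<open>y\<close> is below \<open>x\<close>, then \<open>x\<close> counts for them before and after
  a move by one level; if \<open>y\<close> is not adjacent to \<open>x\<close>, it never
  does.\<close>

lemma dirty_after:
 assumes g: "good adj" and m: "m = lev x + 1 \<or> m + 1 = lev x"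
  and y: "dirty adj (lev(x := m)) y" "y \<noteq> x" "\<not> (adj x y \<and> lev x \<le> lev y)"
 shows "dirty adj lev y"
proof -
 have s: "adj y x \<longleftrightarrow> adj x y" using g unfolding good_def by blast
 have "Dg adj (lev(x := m)) y i = Dg adj lev y i" if "i \<le> lev y" for i using Dg_upd[OF g, of lev x m y i] m y(3) that s by (cases "adj x y") auto
 thus ?thesis using y(1,2) unfolding dirty_def by simp
qed

lemma thr_val: "regs s ''x'' \<in> nodes n \<Longrightarrow> regs s ''z'' = regs s ''x'' div 4 mod 2 \<Longrightarrow> rval \<pi> thr s = dd (regs s ''x'')"
proof -
 assume x: "regs s ''x'' \<in> nodes n" and z: "regs s ''z'' = regs s ''x'' div 4 mod 2"
 obtain j where j: "regs s ''x'' = 4 * j + 1" using x unfolding nodes_def by blast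
 have d: "regs s ''x'' div 4 = j" unfolding j by simp
 have "regs s ''x'' mod 8 = 1 \<longleftrightarrow> j mod 2 = 0" unfolding j by presburger
 thus ?thesis unfolding thr_def dd_def using z d params by (cases "j mod 2 = 0") simp_all
qed

text \<open>A move with degree D takes about 200 D steps and queues at most D nodes at 30 each,
  whereas \<open>Phi\<close> releases (D + 1) / 2; multiplied by 500, this covers 230 D and the
  fixed costs. The 22 per half-edge is the credit used by \<open>run_clean\<close>, and the 30 per
  queued node pays for a check that leads to no move.\<close>

definition fxpot :: "graph \<Rightarrow> (nat \<Rightarrow> nat) \<times> nat set \<times> nat \<Rightarrow> real" where
 "fxpot adj = (\<lambda>(lev, A, q). 500 * Phi adj lev + 22 * real (card A) + 30 * real q)"

lemma run_pop:
 assumes ok: "okst s" and I: "Inv1 adj lev A s" and t: "0 < regs s ''top''"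
 shows "run (Assign ''top'' (Minus (rr ''top'') (Const 1)) ;; Assign ''x'' (ld WL (rr ''top'')) ;;
   st INW (rr ''x'') (Const 0)) s (\<lambda>t s'. Inv1 adj lev A s' \<and> regs s' ''x'' \<in> qu s \<and>
    qu s' = qu s - {regs s' ''x''} \<and> eqx {''top'', ''x''} s s' \<and> t \<le> 3)"
  (is "run ?c s ?Q")
proof -
 obtain B bo where I0: "Inv0 adj (KL lev) A B bo s" and N: "net (hp s) A adj"
  and sl: "\<forall>y\<in>nodes n. hp s SLOT y = 0" and lv: "\<forall>x\<in>nodes n. hp s LEV x = lev x" and lL: "\<forall>x. lev x < L"
  and wl: "wl_ok s" using I unfolding Inv1_def by iprover
 let ?t = "regs s ''top'' - 1"
 let ?x = "hp s WL ?t"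
 have inj: "inj_on (hp s WL) {..<regs s ''top''}" and im: "hp s WL ` {..<regs s ''top''} = qu s" using wl unfolding wlok_def by blast+
 have xq: "?x \<in> qu s" using t unfolding im[symmetric] by simp
 define s' where "s' = fin \<pi> ?c s"
 have h: "hp s' = (hp s)(INW := (hp s INW)(?x := 0))" "regs s' = (regs s)(''top'' := ?t, ''x'' := ?x)" unfolding s'_def by (simp_all add: mem_adr)
 have Q: "qu s' = qu s - {?x}" using h(1) unfolding queue_def by auto
 have e: "{..<regs s ''top''} = insert ?t {..<?t}" using t by auto
 have "hp s WL ` {..<?t} = qu s - {?x}" using inj unfolding im[symmetric] e inj_on_insert by auto
 moreover have "inj_on (hp s WL) {..<?t}" using inj unfolding e inj_on_insert by simp
 ultimately have wl': "wl_ok s'" unfolding wlok_def Q using h by simp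
 have J: "Inv0 adj (KL lev) A B bo s'" by (rule Inv0_cong[OF I0]) (use h in simp_all)
 have I': "Inv1 adj lev A s'" unfolding Inv1_def by (intro conjI exI[of _ B] exI[of _ bo] J wl' net_recok_cong[OF N]) (use h sl lv lL in simp_all)
 show ?thesis by (rule run_fin[OF ok]; (unfold s'_def[symmetric])?)
   (use I' Q h xq in \<open>simp_all add: eqx_def\<close>)
qed

lemma run_fixup:
 assumes ok: "okst s0" and I: "Inv1 adj lev0 A0 s0" and dq: "\<And>x. dirty adj lev0 x \<Longrightarrow> x \<in> qu s0" and rL: "regs s0 ''L'' = L"
 shows "run fixup s0 (\<lambda>t s. \<exists>lev A. A \<subseteq> A0 \<and> Inv1 adj lev A s \<and> (\<forall>x. \<not> dirty adj lev x) \<and> regs s ''top'' = 0 \<and>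
  eqx fxset s0 s \<and> real t + fxpot adj (lev, A, 0) \<le> fxpot adj (lev0, A0, card (qu s0)) + 1)"
proof -
 let ?I = "\<lambda>(lev, A, q) s. A \<subseteq> A0 \<and> Inv1 adj lev A s \<and> (\<forall>x. dirty adj lev x \<longrightarrow> x \<in> qu s) \<and>
  q = card (qu s) \<and> eqx fxset s0 s"
 have g: "good adj" and aj: "adjok n adj" using I good_adj Inv0D(5) unfolding Inv1_def by iprover+
 have "run fixup s0 (\<lambda>t s. \<exists>cc. ?I cc s \<and> \<not> bval \<pi> (Less (Const 0) (rr ''top'')) s \<and>
  real t + fxpot adj cc \<le> fxpot adj (lev0, A0, card (qu s0)) + 1)" unfolding fixup_def
 proof (rule run_while[where I = ?I], goal_cases)
  case (1 cc s)
  obtain lev A q where ga: "cc = (lev, A, q)" by (cases cc)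
  have AA: "A \<subseteq> A0" and J: "Inv1 adj lev A s" and dQ: "\<forall>x. dirty adj lev x \<longrightarrow> x \<in> qu s"
   and q: "q = card (qu s)" and e0: "eqx fxset s0 s" using 1(1) unfolding ga by simp_all
  have t0: "0 < regs s ''top''" using 1(3) by simp
  have fA: "finite A" using J recok_card(2) Inv0D(4) unfolding Inv1_def by iprover
  let ?R = "\<lambda>t s'. \<exists>cc'. ?I cc' s' \<and> real t + 1 + fxpot adj cc' \<le> fxpot adj cc"
  have fq: "finite (queue n H)" for H unfolding queue_def using finite_nodes by simp
  show ?case
  proof (rule run_seq, rule run_mono[OF run_pop[OF 1(2) J t0]], goal_cases)
   case (1 t1 s1)
   hence J1: "Inv1 adj lev A s1" and x1: "regs s1 ''x'' \<in> qu s"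
    and Q1: "qu s1 = qu s - {regs s1 ''x''}" and e1: "eqx {''top'', ''x''} s s1" and t1: "t1 \<le> 3"
    and ok1: "okst s1" by - (elim conjE, assumption)+
   let ?x = "regs s1 ''x''" let ?D = "Dg adj lev ?x (lev ?x)"
   have x: "?x \<in> nodes n" using x1 unfolding queue_def by simp
   obtain B1 bo1 where I1: "Inv0 adj (KL lev) A B1 bo1 s1" and lv1: "\<forall>x\<in>nodes n. hp s1 LEV x = lev x" and lL: "\<forall>x. lev x < L"
    and wl1: "wl_ok s1" and N1: "net (hp s1) A adj" and sl1: "\<forall>y\<in>nodes n. hp s1 SLOT y = 0" using J1 unfolding Inv1_def by iprover
   have lx: "hp s1 LEV ?x = lev ?x" "lev ?x < L" using lv1 lL x by simp_all
   show ?case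
   proof (rule run_seq, rule run_mono[OF run_chk[OF ok1 I1 x lx]], goal_cases)
    case (1 t2 s2)
    hence h2: "hp s2 = hp s1" and e2: "eqx {''l'', ''b'', ''c'', ''e'', ''z''} s1 s2" and l2: "regs s2 ''l'' = lev ?x"
     and c2: "regs s2 ''c'' = ?D" and d2: "0 < lev ?x \<longrightarrow> regs s2 ''e'' = Dg adj lev ?x (lev ?x - 1)"
     and z2: "regs s2 ''z'' = ?x div 4 mod 2" and t2: "t2 \<le> 10" and ok2: "okst s2" by - (elim conjE, assumption)+
    have r2: "regs s2 ''x'' = ?x" "regs s2 ''top'' = regs s1 ''top''" using e2 by (simp_all add: eqx_def)
    have L2: "regs s2 ''L'' = L" using e2 e1 e0 rL by (simp add: eqx_def fxset_def mvset_def)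
    have th: "rval \<pi> thr s2 = dd ?x" using thr_val[of s2] x z2 r2 by simp
    have J2: "Inv1 adj lev A s2" unfolding Inv1_def using lv1 lL wl1 N1 sl1 h2 r2
     by (intro conjI exI[of _ B1] exI[of _ bo1] Inv0_cong[OF I1]) (use e2 in \<open>simp_all add: eqx_def\<close>)
    have e02: "eqx fxset s0 s2" using e0 e1 e2 by (simp add: eqx_def fxset_def mvset_def)
    have mv: "run move s3 (\<lambda>t. ?R (t1 + (t2 + (4 + t))))"
     if ok3: "okst s3" and h3: "hp s3 = hp s2" and e3: "eqx {''q'', ''l''} s2 s3" and q3: "regs s3 ''q'' = m + 1" "m < L"
      and ml: "m = lev ?x + 1 \<and> regs s3 ''l'' = lev ?x + 1 \<or> m + 1 = lev ?x \<and> regs s3 ''l'' = 0"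
      and P: "Phi adj (lev(?x := m)) + (real ?D + 1) / 2 \<le> Phi adj lev" for m s3
    proof -
     have r3: "regs s3 ''x'' = ?x" "regs s3 ''top'' = regs s1 ''top''" using e3 r2 by (simp_all add: eqx_def)
     have J3: "Inv1 adj lev A s3" unfolding Inv1_def using lv1 lL wl1 N1 sl1 h2 h3 r3
      by (intro conjI exI[of _ B1] exI[of _ bo1] Inv0_cong[OF I1]) (use e2 e3 in \<open>simp_all add: eqx_def\<close>)
     show ?thesis
     proof (rule run_mono[OF run_move[OF ok3 J3, of m]], goal_cases)
      case 1 show ?case using x r3 by simp
     next case 2 show ?case using q3 by simp
     next case 3 show ?case using q3 by simp
     next case 4 show ?case unfolding r3 using ml .
     next case (5 t3 s4)
      from 5(1) obtain A' where A': "A' \<subseteq> A" and J4: "Inv1 adj (lev(?x := m)) A' s4"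
       and Q4: "qu s4 = insert ?x (qu s3 \<union> {y. adj ?x y \<and> lev ?x \<le> lev y})"
       and e4: "eqx mvset s3 s4" and t3: "t3 \<le> 200 * ?D + 22 * (card A - card A') + 40" unfolding r3 by iprover
      have "card (qu s4) \<le> card (insert ?x (qu s3)) + ?D" unfolding Q4 Dg_def Un_insert_left[symmetric] by (rule card_Un_le)
      also have "insert ?x (qu s3) = qu s" using Q1 x1 h2 h3 by auto
      finally have cq: "card (qu s4) \<le> q + ?D" unfolding q .
      have cA: "card A' \<le> card A" using card_mono[OF fA A'] .
      have d4: "y \<in> qu s4" if dy: "dirty adj (lev(?x := m)) y" for y
      proof (rule ccontr)
       assume ny: "y \<notin> qu s4"
       have n1: "y \<noteq> ?x" and n2: "\<not> (adj ?x y \<and> lev ?x \<le> lev y)" using ny unfolding Q4 by simp_all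
       have n3: "y \<notin> qu s1" using ny h3 h2 unfolding Q4 by simp
       have "m = lev ?x + 1 \<or> m + 1 = lev ?x" by (rule disjE[OF ml]) simp_all
       hence "dirty adj lev y" using dirty_after[OF g _ dy n1 n2] by simp
       hence "y \<in> qu s" using dQ by simp
       thus False using n3 n1 unfolding Q1 by simp
      qed
      have e04: "eqx fxset s0 s4" using e02 e3 e4 by (simp add: eqx_def fxset_def)
      have "500 * Phi adj (lev(?x := m)) + 250 * real ?D + 250 \<le> 500 * Phi adj lev" using P by (simp add: field_simps)
      moreover have "real t3 \<le> 200 * real ?D + 22 * (real (card A) - real (card A')) + 40"
      proof -
       have "real t3 \<le> real (200 * ?D + 22 * (card A - card A') + 40)" using t3 by (simp only: of_nat_le_iff)
       thus ?thesis using cA by (simp add: of_nat_diff)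
      qed
      moreover have "real (card (qu s4)) \<le> real q + real ?D" using cq by linarith
      ultimately have pt: "real (t1 + (t2 + (4 + t3))) + 1 + fxpot adj (lev(?x := m), A', card (qu s4)) \<le> fxpot adj cc"
       unfolding ga fxpot_def using t1 t2 by simp
      show ?case by (rule exI[of _ "(lev(?x := m), A', card (qu s4))"])
        (use AA A' J4 d4 e04 pt in simp)
     qed
    qed
    show ?case
    proof (rule run_cond[OF ok2], goal_cases)
     case 1
     hence l: "lev ?x + 1 < L" and c: "\<alpha> * dd ?x < real ?D" using l2 L2 th params c2 by simp_all
     show ?case
     proof (rule run_seq, rule run_fin[OF ok2], goal_cases)
      case (3 t)
      hence t: "t \<le> 2" by simp
      let ?s3 = "fin \<pi> (Assign ''q'' (Plus (rr ''l'') (Const 2)) ;; Assign ''l'' (Plus (rr ''l'') (Const 1))) s2"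
      have "okst ?s3" using okst_reg[OF okst_reg[OF ok2, of "lev ?x + 2" "''q''"], of "lev ?x + 1" "''l''"] l2 lx(2) MW by simp
      hence "run move ?s3 (\<lambda>t. ?R (t1 + (t2 + (4 + t))))"
       by (rule mv[of _ "lev ?x + 1"]) (use l l2 Phi_up[OF g x c] in \<open>simp_all add: eqx_def\<close>)
      thus ?case
      proof (rule run_mono, goal_cases)
       case (1 t' s')
       from 1(1) obtain cc' where gg: "?I cc' s' \<and> real (t1 + (t2 + (4 + t'))) + 1 + fxpot adj cc' \<le> fxpot adj cc" ..
       show ?case by (rule exI[of _ cc'], rule conjI[OF conjunct1[OF gg]]) (use conjunct2[OF gg] t in simp)
      qed
     qed (use l2 lx(2) MW in simp_all)
    next case 2
     hence nup: "\<not> (lev ?x + 1 < L \<and> \<alpha> * dd ?x < real ?D)" using l2 L2 th params c2 by simp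
     show ?case
     proof (rule run_cond[OF ok2], goal_cases)
      case 1
      hence l: "0 < lev ?x" and c: "real (Dg adj lev ?x (lev ?x - 1)) < dd ?x" using l2 th d2 by simp_all
      \<comment> \<open>The move scans the edges into the own level of the node, while
        \<open>Phi_down\<close> releases the degree into the level below, which is at least as
        large.\<close>
      have "Dg adj lev ?x (lev ?x) \<le> Dg adj lev ?x (lev ?x - 1)" unfolding Dg_def by (rule card_mono[OF adj_finite[OF aj]]) auto
      hence "real ?D \<le> real (Dg adj lev ?x (lev ?x - 1))" by (simp only: of_nat_le_iff)
      hence P: "Phi adj (lev(?x := lev ?x - 1)) + (real ?D + 1) / 2 \<le> Phi adj lev" using Phi_down[OF g x l c] by argo
      show ?case
      proof (rule run_seq, rule run_fin[OF ok2], goal_cases)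
       case (3 t)
       hence t: "t \<le> 2" by simp
       let ?s3 = "fin \<pi> (Assign ''q'' (rr ''l'') ;; Assign ''l'' (Const 0)) s2"
       have "okst ?s3" using okst_reg[OF okst_reg[OF ok2, of "lev ?x" "''q''"], of 0 "''l''"] l2 lx(2) MW by simp
       hence "run move ?s3 (\<lambda>t. ?R (t1 + (t2 + (4 + t))))"
        by (rule mv[of _ "lev ?x - 1"]) (use l l2 lx(2) P in \<open>simp_all add: eqx_def\<close>)
       thus ?case
       proof (rule run_mono, goal_cases)
        case (1 t' s')
        from 1(1) obtain cc' where gg: "?I cc' s' \<and> real (t1 + (t2 + (4 + t'))) + 1 + fxpot adj cc' \<le> fxpot adj cc" ..
        show ?case by (rule exI[of _ cc'], rule conjI[OF conjunct1[OF gg]]) (use conjunct2[OF gg] t in simp)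
       qed
      qed (use l2 lx(2) MW in simp_all)
     next case 2
      hence ndn: "\<not> (0 < lev ?x \<and> real (Dg adj lev ?x (lev ?x - 1)) < dd ?x)" using l2 th d2 by auto
      have nd: "\<not> dirty adj lev ?x" using nup ndn unfolding dirty_def by blast
      have "y \<in> qu s2" if y: "dirty adj lev y" for y
      proof -
       have "y \<noteq> ?x" by (rule notI) (use y nd in simp)
       thus ?thesis using dQ y unfolding h2 Q1 by simp
      qed
      moreover have "card (qu s2) + 1 = q" unfolding q h2 Q1 using card_Suc_Diff1[OF fq x1] by simp
      ultimately have "?R (t1 + (t2 + Suc (Suc 1))) s2"
       by (intro exI[of _ "(lev, A, card (qu s2))"]) (use AA J2 e02 t1 t2 in \<open>simp add: ga fxpot_def\<close>)
      thus ?case by (rule run_skip[OF ok2])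
     qed
    qed
   qed
  qed
 next case (2 cc s)
  obtain lev A q where ga: "cc = (lev, A, q)" by (cases cc)
  have "\<forall>x. lev x < L" using 2 unfolding ga Inv1_def by simp
  hence "0 \<le> Phi adj lev" by (intro Phi_nonneg) (simp add: less_imp_le)
  thus ?case unfolding ga fxpot_def by simp
 next case 3
  show ?case using I dq by (simp add: eqx_def)
 next case 4
  show ?case by (rule ok)
 qed
 thus ?thesis
 proof (rule run_mono, goal_cases)
  case (1 t s)
  then obtain cc where a: "?I cc s" and b: "\<not> bval \<pi> (Less (Const 0) (rr ''top'')) s"
   and c: "real t + fxpot adj cc \<le> fxpot adj (lev0, A0, card (qu s0)) + 1" by iprover
  obtain lev A q where ga: "cc = (lev, A, q)" by (cases cc)
  have AA: "A \<subseteq> A0" and J: "Inv1 adj lev A s" and dQ: "\<forall>x. dirty adj lev x \<longrightarrow> x \<in> qu s"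
   and q: "q = card (qu s)" and e0: "eqx fxset s0 s" using a unfolding ga by simp_all
  have t0: "regs s ''top'' = 0" using b by simp
  have w: "wl_ok s" using J unfolding Inv1_def by iprover
  have Qe: "qu s = {}" using w t0 unfolding wlok_def by simp
  have q0: "q = 0" unfolding q Qe by simp
  have nd: "\<forall>x. \<not> dirty adj lev x" using dQ unfolding Qe by blast
  show ?case by (rule exI[of _ lev], rule exI[of _ A]) (intro conjI AA J nd t0 e0 c[unfolded ga q0])
 qed
qed

end

section \<open>Edge records and rebuilding\<close>

definition addprelude :: com where
 "addprelude = Assign ''h'' (Plus (Times (Const 8) (rr ''R'')) (Const 2)) ;;
  Assign ''q'' (Plus (ld LEV (rr ''x'')) (Const 1)) ;;
  Cond (Less (ld LEV (rr ''y'')) (ld LEV (rr ''x''))) (Assign ''q'' (Plus (ld LEV (rr ''y'')) (Const 1))) Skip ;;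
  st SG (rr ''h'') (rr ''g'') ;; st SG (Plus (rr ''h'') (Const 4)) (rr ''g'') ;;
  st OWN (Plus (rr ''h'') (Const 4)) (rr ''y'')"

text \<open>The record takes the next identifier \<open>R\<close>. \<open>addhalf\<close> works on
  register \<open>x\<close>, which is replaced by the other endpoint in between; \<open>e\<close>
  keeps the first endpoint so that the caller can queue it.\<close>

definition addrec :: com where
 "addrec = addprelude ;; addhalf ;;
  (Assign ''h'' (Plus (rr ''h'') (Const 4)) ;; Assign ''e'' (rr ''x'') ;; Assign ''x'' (rr ''y'')) ;;
  addhalf ;; Assign ''R'' (Plus (rr ''R'') (Const 1))"

lemma degk_upd:
 assumes aj: "adjok n adj" and K: "\<And>z w. K z w = (K w z :: nat)" and xy: "x \<noteq> y" "adj x y \<longleftrightarrow> g = (1::nat)" and g: "g \<le> 1"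
 shows "degk (upd_adj adj x y (g = 0)) K z k =
  (if z = y \<and> k = K x y then (if z = x \<and> k = K x y then degk adj K z k + 1 - 2 * g else degk adj K z k) + 1 - 2 * g
  else if z = x \<and> k = K x y then degk adj K z k + 1 - 2 * g else degk adj K z k)"
proof -
 have f: "finite {w. adj z w \<and> K z w = k}" for z using adj_finite[OF aj] .
 have g01: "g = 0 \<or> g = 1" using g by linarith
 have aux: "card {w. upd_adj adj x y (g = 0) a w \<and> K a w = k} = card {w. adj a w \<and> K a w = k} + 1 - 2 * g"
  if ab: "a = x \<and> b = y \<or> a = y \<and> b = x" and k: "k = K a b" for a b
 proof -
  have "adj y x \<longleftrightarrow> adj x y" using aj unfolding adjok_def by blast
  hence adj: "adj a b \<longleftrightarrow> g = 1" using ab xy(2) by (elim disjE) simp_all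
  have u: "upd_adj adj x y (g = 0) a w \<longleftrightarrow> (if w = b then g = 0 else adj a w)" for w
   using ab xy(1) unfolding upd_adj_def by (elim disjE) simp_all
  show ?thesis
  proof (rule disjE[OF g01])
   assume g0: "g = 0"
   have "{w. upd_adj adj x y (g = 0) a w \<and> K a w = k} = insert b {w. adj a w \<and> K a w = k}" unfolding u using g0 k by auto
   moreover have "b \<notin> {w. adj a w \<and> K a w = k}" using adj g0 by simp
   ultimately show ?thesis using f[of a] g0 by simp
  next
   assume g1: "g = 1"
   have "{w. upd_adj adj x y (g = 0) a w \<and> K a w = k} = {w. adj a w \<and> K a w = k} - {b}" unfolding u using g1 by auto
   moreover have "b \<in> {w. adj a w \<and> K a w = k}" using adj g1 k by simp
   ultimately show ?thesis using f[of a] g1 card_Suc_Diff1[OF f[of a], of b] by simp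
  qed
 qed
 show ?thesis
 proof (cases "(z = x \<or> z = y) \<and> k = K x y")
  case True
  thus ?thesis using aux[of x y] aux[of y x] xy(1) K[of x y] unfolding degk_def by auto
 next case False
  have "upd_adj adj x y (g = 0) z w \<and> K z w = k \<longleftrightarrow> adj z w \<and> K z w = k" for w
   using False K[of x y] unfolding upd_adj_def by auto
  thus ?thesis using False unfolding degk_def by auto
 qed
qed

lemma half_ids: "(h::nat) mod 4 = 2 \<Longrightarrow> h < 8 * Suc R \<Longrightarrow> h < 8 * R \<or> h = 8 * R + 2 \<or> h = 8 * R + 6" by presburger

lemma tw_ids: "tw (8 * R + 2) = 8 * R + 6" "tw (8 * R + 6) = 8 * R + 2"
proof -
 have "(8 * R + 2) mod 8 = 2" "(8 * R + 6) mod 8 = (6::nat)" by presburger+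
 thus "tw (8 * R + 2) = 8 * R + 6" "tw (8 * R + 6) = 8 * R + 2" using tw_2[of "8 * R + 2"] tw_6[of "8 * R + 6"] by simp_all
qed

lemma recok_add:
 assumes r: "recok H R A" and H: "H' OWN = (H OWN)(8 * R + 2 := x, 8 * R + 6 := y)"
  "H' SG = (H SG)(8 * R + 2 := g, 8 * R + 6 := g)" "\<And>h. h < 8 * R \<Longrightarrow> H' BK h = H BK h"
  and g: "g \<le> 1" and xy: "x mod 8 = 1" "y mod 8 = 5"
 shows "recok H' (Suc R) (insert (8 * R + 2) (insert (8 * R + 6) A))" unfolding recok_def
proof (intro conjI ballI allI impI, goal_cases)
 have m: "(8 * R + 2) mod 4 = 2" "(8 * R + 6) mod 4 = 2" "(8 * R + 2) mod 8 = 2" "(8 * R + 6) mod 8 = (6::nat)" by presburger+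
 have A: "h < 8 * R" "tw h < 8 * R" "tw h \<in> A" if "h \<in> A" for h using recokD(2,3)[OF r that] recokD(2)[OF r recokD(3)[OF r that]] by simp_all
 {
  case (1 h) thus ?case using m recokD(1)[OF r] by blast
 next case (2 h) thus ?case using A(1)[of h] by auto
 next case (3 h) thus ?case using A(3)[of h] tw_ids[of R] by auto
 next case (4 h)
  hence "h = 8 * R + 2 \<or> h \<in> A" using m by auto
  thus ?case using 4(2) A(1)[of h] r xy unfolding H recok_def by auto
 next case (5 h)
  hence "h = 8 * R + 6 \<or> h \<in> A" using m by auto
  thus ?case using 5(2) A(1)[of h] r xy unfolding H recok_def by auto
 next case (6 h)
  then consider "h = 8 * R + 2" | "h = 8 * R + 6" | "h \<in> A" by blast
  thus ?case
  proof cases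
   case 3
   have "H SG (tw h) = H SG h" using recokD(5)[OF r 3] .
   thus ?thesis unfolding H using A[OF 3] by simp
  qed (simp_all add: H tw_ids del: add_2_eq_Suc')
 next case (7 h)
  then consider "h = 8 * R + 2" | "h = 8 * R + 6" | "h \<in> A" by blast
  thus ?case
  proof cases
   case 3
   have "H SG h \<le> 1" using recokD(6)[OF r 3] .
   thus ?thesis unfolding H using g A[OF 3] by simp
  qed (use g in \<open>simp_all add: H del: add_2_eq_Suc'\<close>)
 next case (8 h)
  hence "h < 8 * R" using half_ids[of h R] by blast
  thus ?case using 8 r H(3) unfolding recok_def by simp
 }
qed

text \<open>A positive record is added for an absent edge only and a negative one for a present edge
  only, so the signed count of the pair moves between 0 and 1.\<close>

lemma net_add:
 assumes N: "net H A adj" and r: "recok H R A" and H: "H' OWN = (H OWN)(8 * R + 2 := x, 8 * R + 6 := y)"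
  "H' SG = (H SG)(8 * R + 2 := g, 8 * R + 6 := g)"
  and g: "g \<le> 1" and xy: "x \<noteq> y" "adj x y \<longleftrightarrow> g = 1" "adj y x \<longleftrightarrow> g = 1"
 shows "net H' (insert (8 * R + 2) (insert (8 * R + 6) A)) (upd_adj adj x y (g = 0))" unfolding net_def
proof (intro allI)
 fix z w
 let ?h = "8 * R + 2" and ?t = "8 * R + 6"
 let ?A = "insert ?h (insert ?t A)"
 have A: "h < 8 * R" "tw h < 8 * R" if "h \<in> A" for h using recokD(2)[OF r that] recokD(2)[OF r recokD(3)[OF r that]] by simp_all
 have nA: "?h \<notin> A" "?t \<notin> A" using A(1)[of ?h] A(1)[of ?t] by auto
 have fA: "finite A" using recok_card(2)[OF r] .
 have old: "h \<in> A \<Longrightarrow> H' OWN h = H OWN h \<and> H' OWN (tw h) = H OWN (tw h) \<and> H' SG h = H SG h" for h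
  using A[of h] unfolding H by simp
 have new: "H' OWN ?h = x" "H' OWN ?t = y" "H' SG ?h = g" "H' SG ?t = g" unfolding H by simp_all
 have c: "card {h\<in>?A. H' OWN h = z \<and> H' OWN (tw h) = w \<and> P (H' SG h)} =
  card {h\<in>A. H OWN h = z \<and> H OWN (tw h) = w \<and> P (H SG h)} +
  of_bool (x = z \<and> y = w \<and> P g) + of_bool (y = z \<and> x = w \<and> P g)" for P
 proof -
  let ?S = "{h\<in>A. H OWN h = z \<and> H OWN (tw h) = w \<and> P (H SG h)}"
  have f: "finite ?S" using fA by simp
  have S: "?h \<notin> ?S" "?t \<notin> ?S" using nA by simp_all
  have t: "H' OWN (tw ?h) = y" "H' OWN (tw ?t) = x" unfolding tw_ids new by (rule refl)+
  have cl: "{h\<in>insert a C. Q h} = (if Q a then {a} else {}) \<union> {h\<in>C. Q h}" for a :: nat and C Q by auto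
  have "{h\<in>?A. H' OWN h = z \<and> H' OWN (tw h) = w \<and> P (H' SG h)} =
   (if x = z \<and> y = w \<and> P g then {?h} else {}) \<union> ((if y = z \<and> x = w \<and> P g then {?t} else {}) \<union>
   {h\<in>A. H' OWN h = z \<and> H' OWN (tw h) = w \<and> P (H' SG h)})" unfolding cl t new by (rule refl)
  also have "{h\<in>A. H' OWN h = z \<and> H' OWN (tw h) = w \<and> P (H' SG h)} = ?S" using old by auto
  finally show ?thesis using f S xy(1) by auto
 qed
 have n0: "card {h\<in>A. H OWN h = z \<and> H OWN (tw h) = w \<and> H SG h = 0} =
  card {h\<in>A. H OWN h = z \<and> H OWN (tw h) = w \<and> 0 < H SG h} + of_bool (adj z w)" using N unfolding net_def by blast
 show "card {h\<in>?A. H' OWN h = z \<and> H' OWN (tw h) = w \<and> H' SG h = 0} =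
  card {h\<in>?A. H' OWN h = z \<and> H' OWN (tw h) = w \<and> 0 < H' SG h} + of_bool (upd_adj adj x y (g = 0) z w)"
  unfolding c[of "\<lambda>v. v = 0"] c[of "\<lambda>v. 0 < v"] n0 using g xy unfolding upd_adj_def by auto
qed

lemma cover_add:
 assumes c: "cover H A adj" and r: "recok H R A" and H: "H' OWN = (H OWN)(8 * R + 2 := x, 8 * R + 6 := y)"
 shows "cover H' (insert (8 * R + 2) (insert (8 * R + 6) A)) (upd_adj adj x y b)" unfolding cover_def
proof (intro allI impI)
 fix z w assume a: "upd_adj adj x y b z w"
 show "\<exists>g\<in>insert (8 * R + 2) (insert (8 * R + 6) A). H' OWN g = z \<and> H' OWN (tw g) = w"
 proof (cases "z = x \<and> w = y \<or> z = y \<and> w = x")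
  case True
  have new: "H' OWN (8 * R + 2) = x" "H' OWN (8 * R + 6) = y" unfolding H by simp_all
  show ?thesis
  proof (rule disjE[OF True])
   assume "z = x \<and> w = y"
   thus ?thesis using new tw_ids[of R] by (intro bexI[of _ "8 * R + 2"]) simp_all
  next
   assume "z = y \<and> w = x"
   thus ?thesis using new tw_ids[of R] by (intro bexI[of _ "8 * R + 6"]) simp_all
  qed
 next case False
  hence "adj z w" using a unfolding upd_adj_def by simp
  then obtain g where g: "g \<in> A" "H OWN g = z" "H OWN (tw g) = w" using c unfolding cover_def by blast
  have "g < 8 * R" "tw g < 8 * R" using recokD(2)[OF r g(1)] recokD(2)[OF r recokD(3)[OF r g(1)]] by simp_all
  hence "H' OWN g = z" "H' OWN (tw g) = w" using g(2,3) unfolding H by simp_all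
  thus ?thesis using g(1) by blast
 qed
qed

lemma adjok_upd:
 assumes "adjok n adj" "x \<in> nodes n" "y \<in> nodes n" "x mod 8 \<noteq> y mod 8"
 shows "adjok n (upd_adj adj x y b)" using assms unfolding adjok_def upd_adj_def by auto

context mach
begin

definition addset :: "string set" where
 "addset = {''h'', ''q'', ''e'', ''x'', ''R'', ''a'', ''c'', ''f'', ''nb'', ''nf''}"

lemma run_addrec:
 assumes ok: "okst s" and I: "Inv1 adj lev A s"
  and x: "regs s ''x'' = x" "x \<in> nodes n" "x mod 8 = 1" and y: "regs s ''y'' = y" "y \<in> nodes n" "y mod 8 = 5"
  and g: "regs s ''g'' = g" "g \<le> 1" "adj x y \<longleftrightarrow> g = 1" and R: "regs s ''R'' = R" "8 * R + 16 \<le> M"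
 shows "run addrec s (\<lambda>t s'. Inv1 (upd_adj adj x y (g = 0)) lev (insert (8 * R + 2) (insert (8 * R + 6) A)) s' \<and>
  qu s' = qu s \<and> regs s' ''R'' = R + 1 \<and> regs s' ''e'' = x \<and>
  hp s' OWN = (hp s OWN)(8 * R + 2 := x, 8 * R + 6 := y) \<and>
  eqx addset s s' \<and> t \<le> 4 * L + 100)"
proof -
 let ?h = "8 * R + 2" and ?t = "8 * R + 6" and ?K = "KL lev"
 obtain B bo where I0: "Inv0 adj ?K A B bo s" and N: "net (hp s) A adj"
  and sl: "\<forall>y\<in>nodes n. hp s SLOT y = 0" and lv: "\<forall>x\<in>nodes n. hp s LEV x = lev x" and lL: "\<forall>x. lev x < L"
  and wl: "wl_ok s" using I unfolding Inv1_def by iprover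
 note i = Inv0D[OF I0]
 have rec: "recok (hp s) R A" using i(4) R(1) by simp
 have xy: "x \<noteq> y" using x(3) y(3) by auto
 have ayx: "adj y x \<longleftrightarrow> g = 1" using g(3) i(5) unfolding adjok_def by blast
 let ?q = "KL lev x y"
 have q: "1 \<le> ?q" "?q \<le> L" using KL_range[of lev x y] lL by simp_all
 have A: "g < 8 * R" if "g \<in> A" for g using recokD(2)[OF rec that] .
 have nA: "?h \<notin> A" "?t \<notin> A" using A[of ?h] A[of ?t] by auto
 let ?kap = "\<lambda>h. ?K (hp s OWN h) (far s h)"
 have e4: "8 * R + 2 + 4 = ?t" by simp
 define s1 where "s1 = fin \<pi> addprelude s"
 have lx: "hp s LEV x = lev x" "hp s LEV y = lev y" using lv x(2) y(2) by simp_all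
 have h1: "hp s1 = (hp s)(SG := (hp s SG)(?h := g, ?t := g), OWN := (hp s OWN)(?t := y))"
  "regs s1 = (regs s)(''h'' := ?h, ''q'' := ?q)" unfolding s1_def addprelude_def using x(1) y(1) g(1) R(1) lx
  by (simp_all add: mem_adr KL_def min_def fun_upd_twist e4 del: add_2_eq_Suc')
 have fA: "finite A" "card A \<le> 2 * R" using recok_card[OF rec] by simp_all
 have run1: "run addprelude s (\<lambda>t s'. s' = s1 \<and> t \<le> 8)"
 proof (rule run_fin[OF ok], goal_cases)
  case 1 show ?case by (simp add: addprelude_def)
 next case 2
  show ?case unfolding addprelude_def using x y g R lx lL[rule_format, of x] lL[rule_format, of y] MW by (simp add: mem_adr adr_less)
 next case (3 t) thus ?case by (simp add: s1_def addprelude_def)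
 qed
 have W1: "WFs s1 A ?kap (degk adj ?K) B bo {}" using WF_cong[OF i(1), of "hp s1" ?kap "degk adj ?K"] A h1 by fastforce
 have xM: "x < M" "y < M" using V_less x(2) y(2) by simp_all
 have R1: "regs s1 ''h'' = ?h" "regs s1 ''x'' = x" "regs s1 ''y'' = y" "regs s1 ''q'' = ?q" "regs s1 ''g'' = g" "regs s1 ''R'' = R"
  "regs s1 ''nb'' = regs s ''nb''" "regs s1 ''top'' = regs s ''top''" using h1 x y g R by simp_all
 have ids: "?h mod 4 = 2" "?t mod 4 = 2" by presburger+
 have idM: "?h < M" "?t < M" using R(2) by linarith+
 let ?C1 = "\<lambda>z k. if z = x \<and> k = ?q then degk adj ?K z k + 1 - 2 * g else degk adj ?K z k"
 let ?adj = "upd_adj adj x y (g = 0)" and ?A = "insert ?h (insert ?t A)"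
 show ?thesis unfolding addrec_def
 proof (rule run_seq, rule run_mono[OF run1], goal_cases)
  case (1 t1 s1')
  hence [simp]: "s1' = s1" and t1: "t1 \<le> 8" and ok1: "okst s1" by simp_all
  have k1: "?kap a \<le> L" if "a \<in> A" for a using i(9) .
  have c1: "degk adj ?K x ?q < M" using degk_le[OF i(5), of ?K x ?q] nM by linarith
  show ?case unfolding \<open>s1' = s1\<close>
  proof (rule run_seq, rule run_mono[OF run_addhalf[OF ok1 W1, unfolded R1, OF nA(1) ids(1) idM(1) x(2) q(1) k1 c1]], goal_cases)
   case (1 a) thus ?case .
  next case 2 show ?case using i(2) .
  next case 3 show ?case using Inv0_card(1)[OF I0] .
  next case (4 a) thus ?case using A[of a] R(2) by simp
  next case (5 t2 s2)
   from 5(1) obtain B2 bo2 where W2: "WFs s2 (insert ?h A) (?kap(?h := ?q)) ?C1 B2 bo2 {}"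
    and nb2: "4 * regs s2 ''nb'' \<le> M" and O2: "hp s2 OWN = (hp s1 OWN)(?h := x)"
    and f2: "\<forall>f\<in>{SG, LEV, SLOT, WL, INW}. hp s2 f = hp s1 f" and b2: "\<forall>a. a \<noteq> ?h \<longrightarrow> hp s2 BK a = hp s1 BK a"
    and e2: "eqx halfrs s1 s2" and t2: "t2 \<le> 2 * L + 40" by iprover
   note ok2 = 5(2)
   define s3 where "s3 = fin \<pi> (Assign ''h'' (Plus (rr ''h'') (Const 4)) ;; Assign ''e'' (rr ''x'') ;; Assign ''x'' (rr ''y'')) s2"
   have r2: "regs s2 ''h'' = ?h" "regs s2 ''x'' = x" "regs s2 ''y'' = y" using e2 R1 by (simp_all add: eqx_def)
   have h3: "hp s3 = hp s2" "regs s3 = (regs s2)(''h'' := ?t, ''e'' := x, ''x'' := y)"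
    unfolding s3_def using r2 by (simp_all add: e4 del: add_2_eq_Suc')
   have R3: "regs s3 ''h'' = ?t" "regs s3 ''x'' = y" "regs s3 ''q'' = ?q" "regs s3 ''g'' = g" "regs s3 ''R'' = R"
    "regs s3 ''nb'' = regs s2 ''nb''" "regs s3 ''nf'' = regs s2 ''nf''" "regs s3 ''e'' = x" "regs s3 ''y'' = y"
    using e2 R1 h3 by (simp_all add: eqx_def)
   have tW: "?t \<le> W" "?t < W" using idM MW by linarith+
   show ?case
   proof (rule run_seq, rule run_fin[OF ok2], goal_cases)
    case (3 t3)
    hence t3: "t3 \<le> 3" by simp
    have xW: "x \<le> W" "y \<le> W" using xM MW by linarith+
    have ok3: "okst s3" unfolding s3_def using okst_reg[OF okst_reg[OF okst_reg[OF ok2 tW(1), of "''h''"] xW(1), of "''e''"] xW(2), of "''x''"] r2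
     by (simp add: e4 del: add_2_eq_Suc')
    have W3: "WF (nodes n) (hp s3) (regs s2 ''nb'') (regs s2 ''nf'') (insert ?h A) (?kap(?h := ?q)) ?C1 B2 bo2 {}" using W2 h3 by simp
    have n3: "?t \<notin> insert ?h A" using nA by simp
    have k3: "(?kap(?h := ?q)) a \<le> L" if "a \<in> insert ?h A" for a using i(9) q(2) by simp
    have c3: "?C1 y ?q < M" using degk_le[OF i(5), of ?K y ?q] nM xy by simp
    have cd: "4 * card (insert ?h A) + 3 < M" using fA R(2) nA by simp
    show ?case unfolding s3_def[symmetric]
    proof (rule run_seq, rule run_mono[OF run_addhalf[OF ok3, unfolded R3, OF W3 n3 ids(2) idM(2) y(2) q(1) k3 c3 nb2 cd]], goal_cases)
     case (1 a) thus ?case .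
    next case (2 a) thus ?case using A[of a] R(2) by auto
    next case (3 t4 s4)
     from 3(1) obtain B4 bo4 where W4: "WFs s4 (insert ?t (insert ?h A)) (?kap(?h := ?q, ?t := ?q))
      (\<lambda>z k. if z = y \<and> k = ?q then ?C1 z k + 1 - 2 * g else ?C1 z k) B4 bo4 {}"
      and nb4: "4 * regs s4 ''nb'' \<le> M" and O4: "hp s4 OWN = (hp s3 OWN)(?t := y)"
      and f4: "\<forall>f\<in>{SG, LEV, SLOT, WL, INW}. hp s4 f = hp s3 f" and b4: "\<forall>a. a \<noteq> ?t \<longrightarrow> hp s4 BK a = hp s3 BK a"
      and e4': "eqx halfrs s3 s4" and t4: "t4 \<le> 2 * L + 40" by iprover
     note ok4 = 3(2)
     define s5 where "s5 = fin \<pi> (Assign ''R'' (Plus (rr ''R'') (Const 1))) s4"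
     have r4: "regs s4 ''R'' = R" "regs s4 ''e'' = x" "regs s4 ''top'' = regs s ''top''" using e4' R3 e2 h3 R1 by (simp_all add: eqx_def)
     have h5: "hp s5 = hp s4" "regs s5 = (regs s4)(''R'' := Suc R)" unfolding s5_def using r4 by simp_all
     have own: "hp s5 OWN = (hp s OWN)(?h := x, ?t := y)" unfolding h5 O4 h3 O2 h1 by (simp add: fun_eq_iff)
     have sg: "hp s5 SG = (hp s SG)(?h := g, ?t := g)" unfolding h5 using f4 f2 h3 h1 by simp
     have bk: "hp s5 BK a = hp s BK a" if "a < 8 * R" for a using b4 b2 that h1 by (simp add: h5 h3)
     have ff: "hp s5 f = hp s f" if "f \<in> {LEV, SLOT, WL, INW}" for f using f4 f2 h5 h3 h1 that by auto
     have rec5: "recok (hp s5) (Suc R) ?A" by (rule recok_add[where R = R, OF rec own sg bk g(2) x(3) y(3)])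
     have net5: "net (hp s5) ?A ?adj" by (rule net_add[OF N rec own sg g(2) xy g(3) ayx])
     have cov5: "cover (hp s5) ?A ?adj" by (rule cover_add[where R = R and x = x and y = y and b = "g = 0", OF i(6) rec]) (rule own)
     have aj5: "adjok n ?adj" by (rule adjok_upd[OF i(5) x(2) y(2)]) (use x(3) y(3) in simp)
     have kap: "?K (hp s5 OWN a) (far s5 a) = (?kap(?h := ?q, ?t := ?q)) a" if "a \<in> ?A" for a
     proof -
      consider "a = ?h" | "a = ?t" | "a \<in> A" using \<open>a \<in> ?A\<close> by blast
      thus ?thesis
      proof cases
       case 1
       thus ?thesis unfolding own 1 tw_ids by (simp del: add_2_eq_Suc')
      next case 2
       thus ?thesis unfolding own 2 tw_ids using i(7)[of x y] by (simp del: add_2_eq_Suc')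
      next case 3
       thus ?thesis unfolding own using A[OF 3] A[OF recokD(3)[OF rec 3]] by simp
      qed
     qed
     have W5: "WFs s5 ?A (\<lambda>a. ?K (hp s5 OWN a) (far s5 a)) (degk ?adj ?K) B4 bo4 {}"
     proof -
      have "regs s5 ''nb'' = regs s4 ''nb''" "regs s5 ''nf'' = regs s4 ''nf''" using h5 by simp_all
      moreover have "WF (nodes n) (hp s5) (regs s4 ''nb'') (regs s4 ''nf'') ?A (\<lambda>a. ?K (hp s5 OWN a) (far s5 a)) (degk ?adj ?K) B4 bo4 {}"
      proof (rule WF_cong[OF W4[unfolded insert_commute[of ?t]]])
       show "degk ?adj ?K z k = (if z = y \<and> k = ?q then ?C1 z k + 1 - 2 * g else ?C1 z k)" for z k
        by (rule degk_upd[OF i(5) i(7) xy g(3,2)])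
       show "hp s5 BK a = hp s4 BK a \<and> hp s5 OWN a = hp s4 OWN a \<and> ?K (hp s5 OWN a) (far s5 a) = (?kap(?h := ?q, ?t := ?q)) a"
        if "a \<in> ?A" for a using kap[OF that] h5 by simp
      qed (simp add: h5)
      ultimately show ?thesis by simp
     qed
     have R5: "8 * regs s5 ''R'' + 8 \<le> M" "4 * regs s5 ''nb'' \<le> M" "regs s5 ''R'' = Suc R" using h5 R(2) nb4 by simp_all
     have "Inv0 ?adj ?K ?A B4 bo4 s5" unfolding Inv0_def using R5(3) i(7-9) by (intro conjI W5 R5(1,2) aj5 cov5 allI) (use rec5 in simp_all)
     moreover have sl5: "\<forall>a\<in>nodes n. hp s5 SLOT a = 0" using sl ff by simp
     moreover have lv5: "\<forall>a\<in>nodes n. hp s5 LEV a = lev a" using lv ff by simp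
     moreover have q5: "qu s5 = qu s" using ff unfolding queue_def by simp
     moreover have "wl_ok s5" using wl q5 ff h5 r4 unfolding wlok_def by simp
     ultimately have J: "Inv1 ?adj lev ?A s5" unfolding Inv1_def using net5 lL by (intro conjI exI[of _ B4] exI[of _ bo4]) simp_all
     have eq5: "eqx addset s s5" using e4' e2 h1 h3 h5 by (simp add: eqx_def addset_def)
     show ?case by (rule run_fin[OF ok4]; (unfold s5_def[symmetric])?)
       (use J q5 eq5 own h5 r4 t1 t2 t3 t4 R(2) MW in simp_all)
    qed
   qed (use r2 xM tW in simp_all)
  qed
 qed
qed

end

section \<open>Rebuilding the structure in place\<close>

definition cleanall :: com where
 "cleanall = Assign ''e'' (Const 0) ;; While (Less (rr ''e'') (rr ''R''))
  (Assign ''s'' (ld BK (Plus (Times (Const 8) (rr ''e'')) (Const 2))) ;;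
   Cond (And (Less (Const 0) (rr ''s'')) (Less (Const 0) (ld SG (Plus (Times (Const 8) (rr ''e'')) (Const 2))))) clean Skip ;;
   Assign ''e'' (Plus (rr ''e'') (Const 1)))"

text \<open>The endpoints of an edge are all that has to survive. The write index \<open>j\<close>
  never overtakes the read index \<open>e\<close>, so copying needs no second array.\<close>

definition compact :: com where
 "compact = (Assign ''e'' (Const 0) ;; Assign ''j'' (Const 0)) ;; While (Less (rr ''e'') (rr ''R''))
  (Cond (Less (Const 0) (ld BK (Plus (Times (Const 8) (rr ''e'')) (Const 2))))
    (st OWN (Plus (Times (Const 8) (rr ''j'')) (Const 2)) (ld OWN (Plus (Times (Const 8) (rr ''e'')) (Const 2))) ;;
    st OWN (Plus (Times (Const 8) (rr ''j'')) (Const 6)) (ld OWN (Plus (Times (Const 8) (rr ''e'')) (Const 6))) ;;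
    Assign ''j'' (Plus (rr ''j'') (Const 1))) Skip ;;
   Assign ''e'' (Plus (rr ''e'') (Const 1)))"

text \<open>128 is 16 cells times the 8 identifiers per node or record; the residues 9 and 3 are the
  codes of \<open>LEV\<close> and \<open>OWN\<close>. Everything is erased except the levels of the
  nodes and the endpoints of the \<open>m\<close> compacted records.\<close>

definition zero :: com where
 "zero = Assign ''a'' (Times (Const 128) (Plus (Plus (rr ''n'') (rr ''R'')) (Const 1))) ;; While (Less (Const 0) (rr ''a''))
  (Assign ''a'' (Minus (rr ''a'') (Const 1)) ;;
   Cond (And (Equal (Mod (rr ''a'') (Const 16)) (Const 9)) (Less (rr ''a'') (Times (Const 128) (rr ''n'')))) Skip
    (Cond (And (Equal (Mod (rr ''a'') (Const 16)) (Const 3)) (Less (rr ''a'') (Times (Const 128) (rr ''m'')))) Skip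
     (Store (rr ''a'') (Const 0))))"

definition refill :: com where
 "refill = While (Less (rr ''R'') (rr ''m''))
  ((Assign ''x'' (ld OWN (Plus (Times (Const 8) (rr ''R'')) (Const 2))) ;;
   Assign ''y'' (ld OWN (Plus (Times (Const 8) (rr ''R'')) (Const 6)))) ;; addrec)"

text \<open>Levels are kept, so the decomposition does not change and no node has to be moved.
  \<open>addrec\<close> number \<open>R\<close> writes back the endpoints just read from slot
  \<open>R\<close>, hence the list of edges is not destroyed while it is consumed.\<close>

definition rebuild :: com where
 "rebuild = cleanall ;; compact ;; zero ;;
  (Assign ''R'' (Const 0) ;; Assign ''nb'' (Const 0) ;; Assign ''nf'' (Const 0) ;; Assign ''g'' (Const 0)) ;; refill"

definition pairs :: "graph \<Rightarrow> (nat \<times> nat) set" where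
 "pairs adj = {(x, y). adj x y \<and> x mod 8 = 1}"

definition slot :: "heap \<Rightarrow> nat \<Rightarrow> nat \<times> nat" where
 "slot H e = (H OWN (8 * e + 2), H OWN (8 * e + 6))"

lemma pairs_slots:
 assumes r: "recok H R A" and c: "cover H A adj"
 shows "pairs adj \<subseteq> slot H ` {e. e < R \<and> 8 * e + 2 \<in> A}"
 proof
  fix p assume p: "p \<in> pairs adj"
  obtain x y where xy: "p = (x, y)" by (cases p)
  have a: "adj x y" "x mod 8 = 1" using p unfolding xy pairs_def by simp_all
  obtain g where g: "g \<in> A" "H OWN g = x" "H OWN (tw g) = y" using c a unfolding cover_def by blast
  have "g mod 8 \<noteq> 6" using r g(1,2) a(2) unfolding recok_def by fastforce
  hence g2: "g mod 8 = 2" using recokD(1)[OF r g(1)] mod4_mod8 by blast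
  hence e: "g = 8 * (g div 8) + 2" using mult_div_mod_eq[of 8 g] by simp
  have "g div 8 < R" using recokD(2)[OF r g(1)] by (simp add: less_mult_imp_div_less mult.commute)
  moreover have "slot H (g div 8) = p" using g e tw_ids[of "g div 8"] unfolding slot_def xy by metis
  ultimately show "p \<in> slot H ` {e. e < R \<and> 8 * e + 2 \<in> A}" using e g(1) by (intro image_eqI[of _ _ "g div 8"]) simp_all
 qed

text \<open>Without negative records, \<open>net\<close> admits one record per edge and none for
  other pairs; \<open>cover\<close> gives surjectivity.\<close>

lemma alive_pairs:
 assumes r: "recok H R A" and c: "cover H A adj" and N: "net H A adj" and pos: "\<And>a. a \<in> A \<Longrightarrow> H SG a = 0"
 shows "bij_betw (slot H) {e. e < R \<and> 8 * e + 2 \<in> A} (pairs adj)" unfolding bij_betw_def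
proof
 have fA: "finite A" using recok_card(2)[OF r] .
 have m: "(8 * e + 2) mod 8 = (2::nat)" for e by presburger
 show "inj_on (slot H) {e. e < R \<and> 8 * e + 2 \<in> A}"
 proof (rule inj_onI)
  fix e f assume e: "e \<in> {e. e < R \<and> 8 * e + 2 \<in> A}" and f: "f \<in> {e. e < R \<and> 8 * e + 2 \<in> A}" and s: "slot H e = slot H f"
  let ?S = "{g\<in>A. H OWN g = H OWN (8 * e + 2) \<and> H OWN (tw g) = H OWN (8 * e + 6) \<and> H SG g = 0}"
  have z: "{g\<in>A. H OWN g = H OWN (8 * e + 2) \<and> H OWN (tw g) = H OWN (8 * e + 6) \<and> 0 < H SG g} = {}" using pos by fastforce
  have "card ?S = card {g\<in>A. H OWN g = H OWN (8 * e + 2) \<and> H OWN (tw g) = H OWN (8 * e + 6) \<and> 0 < H SG g} +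
   of_bool (adj (H OWN (8 * e + 2)) (H OWN (8 * e + 6)))" using N unfolding net_def by blast
  hence c1: "card ?S \<le> Suc 0" unfolding z by simp
  have eS: "8 * e + 2 \<in> ?S" and fS: "8 * f + 2 \<in> ?S" using e f s pos tw_ids unfolding slot_def by (simp_all del: add_2_eq_Suc')
  have fin: "finite ?S" using fA by simp
  have "8 * e + 2 = 8 * f + 2" by (rule bspec[OF bspec[OF c1[unfolded card_le_Suc0_iff_eq[OF fin]] eS] fS])
  thus "e = f" by simp
 qed
 show "slot H ` {e. e < R \<and> 8 * e + 2 \<in> A} = pairs adj"
 proof
  show "slot H ` {e. e < R \<and> 8 * e + 2 \<in> A} \<subseteq> pairs adj"
  proof
   fix p assume "p \<in> slot H ` {e. e < R \<and> 8 * e + 2 \<in> A}"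
   then obtain e where e: "8 * e + 2 \<in> A" "p = slot H e" by blast
   have "adj (H OWN (8 * e + 2)) (H OWN (tw (8 * e + 2)))" by (rule net_adj[OF N fA e(1)]) (use pos in simp_all)
   moreover have "H OWN (8 * e + 2) mod 8 = 1" using r e(1) m unfolding recok_def by blast
   ultimately show "p \<in> pairs adj" unfolding e(2) slot_def pairs_def tw_ids by simp
  qed
  show "pairs adj \<subseteq> slot H ` {e. e < R \<and> 8 * e + 2 \<in> A}" by (rule pairs_slots[OF r c])
 qed
qed

lemma degk_le_bucket:
 assumes c: "cover H A adj" and f: "finite A"
 shows "degk adj K x k \<le> card {a\<in>A. H OWN a = x \<and> K x (H OWN (tw a)) = k}"
proof -
 let ?S = "{a\<in>A. H OWN a = x \<and> K x (H OWN (tw a)) = k}"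
 have "{y. adj x y \<and> K x y = k} \<subseteq> (\<lambda>g. H OWN (tw g)) ` ?S"
 proof
  fix y assume y: "y \<in> {y. adj x y \<and> K x y = k}"
  then obtain g where "g \<in> A" "H OWN g = x" "H OWN (tw g) = y" using c unfolding cover_def by blast
  thus "y \<in> (\<lambda>g. H OWN (tw g)) ` ?S" using y by (intro image_eqI[of _ _ g]) auto
 qed
 moreover have "finite ?S" using f by simp
 ultimately have "card {y. adj x y \<and> K x y = k} \<le> card ((\<lambda>g. H OWN (tw g)) ` ?S)" by (intro card_mono) simp_all
 also have "\<dots> \<le> card ?S" using \<open>finite ?S\<close> by (rule card_image_le)
 finally show ?thesis unfolding degk_def .
qed

context mach
begin

text \<open>
 The live half-edges whose bucket contains a negative record pay for cleaning that bucket, which happens only once.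
\<close>

definition bad :: "heap \<Rightarrow> (nat \<Rightarrow> nat) \<Rightarrow> nat set \<Rightarrow> nat set" where
 "bad H lev A = {a\<in>A. \<exists>b\<in>A. H OWN b = H OWN a \<and> KL lev (H OWN b) (H OWN (tw b)) = KL lev (H OWN a) (H OWN (tw a)) \<and> 0 < H SG b}"

definition clset :: "string set" where
 "clset = {''e'', ''s'', ''i'', ''j'', ''p'', ''c'', ''b'', ''nf'', ''h''}"

lemma bk_alive:
 assumes J: "Inv0 adj K A B bo s" and e: "e < regs s ''R''"
 shows "8 * e + 2 \<in> A \<longleftrightarrow> 0 < hp s BK (8 * e + 2)"
proof -
 note i = Inv0D[OF J]
 have m: "(8 * e + 2) mod 4 = (2::nat)" by presburger
 have "8 * e + 2 < 8 * regs s ''R''" using e by simp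
 hence "8 * e + 2 \<notin> A \<Longrightarrow> hp s BK (8 * e + 2) = 0" using i(4) m unfolding recok_def by blast
 moreover have "8 * e + 2 \<in> A \<Longrightarrow> hp s BK (8 * e + 2) mod 4 = 3" using WF_B_mod[OF i(1)] WFD(9)[OF i(1)] by blast
 ultimately show "8 * e + 2 \<in> A \<longleftrightarrow> 0 < hp s BK (8 * e + 2)" by (cases "8 * e + 2 \<in> A") auto
qed

lemma run_cleanall:
 assumes ok: "okst s0" and I: "Inv1 adj lev A0 s0"
 shows "run cleanall s0 (\<lambda>t s. \<exists>A. A \<subseteq> A0 \<and> Inv1 adj lev A s \<and> (\<forall>a\<in>A. hp s SG a = 0) \<and>
  (\<forall>f\<in>{OWN, WL, INW}. hp s f = hp s0 f) \<and> eqx clset s0 s \<and>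
  t \<le> 98 * regs s0 ''R'' + 22 * (card A0 - card A) + 2)"
proof -
 let ?R = "regs s0 ''R''"
 let ?I = "\<lambda>(k, A) s. A \<subseteq> A0 \<and> Inv1 adj lev A s \<and> k = regs s ''e'' \<and> k \<le> ?R \<and>
  (\<forall>e<k. 8 * e + 2 \<in> A \<longrightarrow> hp s SG (8 * e + 2) = 0) \<and>
  (\<forall>f\<in>{OWN, SG, WL, INW}. hp s f = hp s0 f) \<and> eqx clset s0 s"
 \<comment> \<open>10 pays for one turn of the loop. Cleaning a bucket takes 44 steps per live edge,
   at most 44 times its size, and its half-edges all leave \<open>bad\<close>. With at most
   \<open>2 * ?R\<close> half-edges at the start, this adds up to 98 per record.\<close>
 let ?g = "\<lambda>(k, A). 10 * (real ?R - real k) + 22 * real (card A) + 44 * real (card (bad (hp s0) lev A))"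
 have fA: "finite A" if "Inv1 adj lev A s" for A s using that recok_card(2) Inv0D(4) unfolding Inv1_def by iprover
 have fA0: "finite A0" using fA[OF I] .
 define s1 where "s1 = fin \<pi> (Assign ''e'' (Const 0)) s0"
 have h1: "hp s1 = hp s0" "regs s1 = (regs s0)(''e'' := 0)" unfolding s1_def by simp_all
 have I1: "Inv1 adj lev A0 s1"
 proof -
  obtain B bo where I0: "Inv0 adj (KL lev) A0 B bo s0" using I unfolding Inv1_def by iprover
  have "Inv0 adj (KL lev) A0 B bo s1" by (rule Inv0_cong[OF I0]) (use h1 in simp_all)
  thus ?thesis using I h1 unfolding Inv1_def by (intro conjI exI[of _ B] exI[of _ bo]) simp_all
 qed
 have loop: "run (While (Less (rr ''e'') (rr ''R''))
  (Assign ''s'' (ld BK (Plus (Times (Const 8) (rr ''e'')) (Const 2))) ;;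
   Cond (And (Less (Const 0) (rr ''s'')) (Less (Const 0) (ld SG (Plus (Times (Const 8) (rr ''e'')) (Const 2))))) clean Skip ;;
   Assign ''e'' (Plus (rr ''e'') (Const 1)))) s1
   (\<lambda>t s. \<exists>cc. ?I cc s \<and> \<not> bval \<pi> (Less (rr ''e'') (rr ''R'')) s \<and> real t + ?g cc \<le> ?g (0, A0) + 1)"
  if ok1: "okst s1"
 proof (rule run_while[where I = ?I and g = ?g], goal_cases)
  case (1 cc s)
  obtain k A where ga: "cc = (k, A)" by (cases cc)
  have AA: "A \<subseteq> A0" and J: "Inv1 adj lev A s" and k: "k = regs s ''e''" "k \<le> ?R"
   and cl: "\<forall>e<k. 8 * e + 2 \<in> A \<longrightarrow> hp s SG (8 * e + 2) = 0"
   and f0: "\<forall>f\<in>{OWN, SG, WL, INW}. hp s f = hp s0 f" and e0: "eqx clset s0 s"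
   using 1(1) unfolding ga prod.case by - (elim conjE, assumption)+
  have R: "regs s ''R'' = ?R" using e0 by (simp add: eqx_def clset_def)
  have kR: "k < ?R" using 1(3) k R by simp
  obtain B bo where I0: "Inv0 adj (KL lev) A B bo s" and N: "net (hp s) A adj"
   and sl: "\<forall>y\<in>nodes n. hp s SLOT y = 0" and lv: "\<forall>x\<in>nodes n. hp s LEV x = lev x" and lL: "\<forall>x. lev x < L"
   and wl: "wl_ok s" using J unfolding Inv1_def by iprover
  note i = Inv0D[OF I0] note D = WFD[OF i(1)]
  let ?h = "8 * k + 2"
  let ?c = "Assign ''s'' (ld BK (Plus (Times (Const 8) (rr ''e'')) (Const 2)))"
  define s2 where "s2 = fin \<pi> ?c s"
  have h2: "hp s2 = hp s" "regs s2 = (regs s)(''s'' := hp s BK ?h)" unfolding s2_def using k by (simp_all add: mem_adr)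
  let ?P = "\<lambda>t s'. \<exists>cc'. ?I cc' s' \<and> real t + 1 + ?g cc' \<le> ?g cc"
  have last: "run (Assign ''e'' (Plus (rr ''e'') (Const 1))) s3 (\<lambda>t. ?P (t1 + (Suc t2 + t)))"
   if ok3: "okst s3" and A': "A' \<subseteq> A" and J3: "Inv1 adj lev A' s3" and f3: "\<forall>f\<in>{OWN, SG, WL, INW}. hp s3 f = hp s f"
    and e3: "eqx clset s s3" and ee: "regs s3 ''e'' = k" and pos: "?h \<in> A' \<Longrightarrow> hp s SG ?h = 0" and t1: "t1 \<le> 2"
    and t2: "real t2 + 22 * real (card A') + 44 * real (card (bad (hp s0) lev A')) \<le>
     22 * real (card A) + 44 * real (card (bad (hp s0) lev A)) + 5" for s3 A' t1 t2
  proof -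
   define s4 where "s4 = fin \<pi> (Assign ''e'' (Plus (rr ''e'') (Const 1))) s3"
   have h4: "hp s4 = hp s3" "regs s4 = (regs s3)(''e'' := k + 1)" unfolding s4_def using ee by simp_all
   have J4: "Inv1 adj lev A' s4"
   proof -
    obtain B3 bo3 where I3: "Inv0 adj (KL lev) A' B3 bo3 s3" using J3 unfolding Inv1_def by iprover
    have "Inv0 adj (KL lev) A' B3 bo3 s4" by (rule Inv0_cong[OF I3]) (use h4 in simp_all)
    thus ?thesis using J3 h4 unfolding Inv1_def by (intro conjI exI[of _ B3] exI[of _ bo3]) simp_all
   qed
   have ff: "\<forall>f\<in>{OWN, SG, WL, INW}. hp s4 f = hp s0 f" using f3 f0 h4 by simp
   have cl4: "\<forall>e<k + 1. 8 * e + 2 \<in> A' \<longrightarrow> hp s4 SG (8 * e + 2) = 0"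
   proof (intro allI impI)
    fix e assume e: "e < k + 1" "8 * e + 2 \<in> A'"
    show "hp s4 SG (8 * e + 2) = 0"
    proof (cases "e = k")
     case True
     thus ?thesis using pos e(2) h4 f3 by simp
    next case False
     hence "e < k" "8 * e + 2 \<in> A" using e A' by auto
     thus ?thesis using cl h4 f3 by simp
    qed
   qed
   have e4: "eqx clset s0 s4" using e0 e3 h4 by (simp add: eqx_def clset_def)
   have kW: "k + 1 \<le> W" using kR okst_regs_le[OF 1(2), of "''R''"] R by simp
   have AA': "A' \<subseteq> A0" using A' AA by simp
   have kk: "k + 1 \<le> ?R" using kR by simp
   have re: "k + 1 = regs s4 ''e''" using h4 by simp
   show ?thesis
   proof (rule run_fin[OF ok3], goal_cases)
    case (3 t)
    hence t: "t \<le> 1" by simp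
    have pt: "real (t1 + (Suc t2 + t)) + 1 + (10 * (real ?R - real (k + 1)) + 22 * real (card A') + 44 * real (card (bad (hp s0) lev A')))
     \<le> 10 * (real ?R - real k) + 22 * real (card A) + 44 * real (card (bad (hp s0) lev A))" using t1 t2 t by simp
    show ?case unfolding s4_def[symmetric] ga prod.case
     by (rule exI[of _ "(k + 1, A')"], unfold prod.case) (intro conjI AA' J4 re kk cl4 ff e4 pt)
   qed (use ee kW in simp_all)
  qed
  show ?case
  proof (rule run_seq, rule run_fin[OF 1(2)], goal_cases)
   case (3 t1)
   hence t1: "t1 \<le> 2" by simp
   have ok2: "okst s2" unfolding s2_def using okst_reg[OF 1(2) okst_hp_le[OF 1(2)]] k by (simp add: mem_adr)
   have I2: "Inv0 adj (KL lev) A B bo s2" by (rule Inv0_cong[OF I0]) (use h2 in simp_all)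
   show ?case unfolding s2_def[symmetric]
   proof (rule run_seq, rule run_cond[OF ok2], goal_cases)
    case 1
    hence b0: "0 < hp s BK ?h" and sg: "0 < hp s SG ?h" using h2 k by (simp_all add: mem_adr)
    have hA: "?h \<in> A" using bk_alive[OF I0] kR R b0 by simp
    let ?x = "hp s OWN ?h" let ?k = "KL lev ?x (far s ?h)"
    have b: "regs s2 ''s'' \<in> B" "?x = bo (regs s2 ''s'')" "?k = hp s2 KEY (regs s2 ''s'')"
     using D(9)[OF hA] D(10)[OF hA] D(11)[OF hA] h2 by simp_all
    have N2: "net (hp s2) A adj" using N h2 by simp
    have z: "hp s2 SLOT y = 0" if "y \<in> nodes n" for y using sl that h2 by simp
    show ?case
    proof (rule run_mono[OF run_clean[OF ok2 I2 N2 b z]], goal_cases)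
     case (1 y) thus ?case .
    next case (2 t2 s3)
     from 2(1) obtain A' B' where I3: "Inv0 adj (KL lev) A' B' bo s3" and N3: "net (hp s3) A' adj" and A': "A' \<subseteq> A"
      and pos: "\<forall>g\<in>A'. hp s2 OWN g = ?x \<longrightarrow> KL lev ?x (far s2 g) = ?k \<longrightarrow> hp s2 SG g = 0"
      and sl3: "\<forall>y\<in>nodes n. hp s3 SLOT y = 0" and f3: "\<forall>f\<in>{OWN, SG, LEV, WL, INW}. hp s3 f = hp s2 f"
      and e3: "eqx cleanrs s2 s3" and t2: "t2 \<le> 44 * degk adj (KL lev) ?x ?k + 22 * (card A - card A') + 4" by iprover
     have w3: "wl_ok s3" using wl f3 h2 e3 unfolding wlok_def queue_def by (simp add: eqx_def)
     have lv3: "\<forall>y\<in>nodes n. hp s3 LEV y = lev y" using lv f3 h2 by simp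
     have J3: "Inv1 adj lev A' s3" unfolding Inv1_def by (intro conjI N3 sl3 lv3 lL w3 exI[of _ B'] exI[of _ bo] I3)
     have fA1: "finite A" using fA[OF J] .
     have cA: "card A' \<le> card A" using card_mono[OF fA1 A'] .
     have own: "hp s OWN = hp s0 OWN" "hp s SG = hp s0 SG" using f0 by simp_all
     let ?S = "{a\<in>A. hp s OWN a = ?x \<and> KL lev ?x (far s a) = ?k}"
     have S1: "?S \<subseteq> bad (hp s0) lev A" unfolding bad_def own[symmetric] using hA sg by auto
     have S2: "bad (hp s0) lev A' \<subseteq> bad (hp s0) lev A - ?S"
     proof
      fix a assume a: "a \<in> bad (hp s0) lev A'"
      then obtain c where c: "a \<in> A'" "c \<in> A'" "hp s OWN c = hp s OWN a"
       "KL lev (hp s OWN c) (far s c) = KL lev (hp s OWN a) (far s a)" "0 < hp s SG c" unfolding bad_def own by blast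
      have "a \<notin> ?S"
      proof
       assume "a \<in> ?S"
       hence "hp s OWN c = ?x" "KL lev ?x (far s c) = ?k" using c(3,4) by simp_all
       thus False using pos c(2,5) h2 by simp
      qed
      moreover have "a \<in> bad (hp s0) lev A" unfolding bad_def own[symmetric] using c A' by (intro CollectI conjI bexI[of _ c]) auto
      ultimately show "a \<in> bad (hp s0) lev A - ?S" by blast
     qed
     have fb: "finite (bad (hp s0) lev A)" unfolding bad_def using fA1 by simp
     have "card (bad (hp s0) lev A') \<le> card (bad (hp s0) lev A - ?S)" using S2 fb card_mono by blast
     also have "\<dots> = card (bad (hp s0) lev A) - card ?S" using card_Diff_subset[OF _ S1] fA1 by simp
     finally have cb: "card (bad (hp s0) lev A') + card ?S \<le> card (bad (hp s0) lev A)" using card_mono[OF fb S1] by linarith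
     have cd: "degk adj (KL lev) ?x ?k \<le> card ?S" by (rule degk_le_bucket[OF i(6) fA1])
     have "real t2 \<le> real (44 * degk adj (KL lev) ?x ?k + 22 * (card A - card A') + 4)" using t2 by (simp only: of_nat_le_iff)
     hence "real t2 \<le> 44 * real (card ?S) + 22 * (real (card A) - real (card A')) + 4" using cA cd by (simp add: of_nat_diff)
     moreover have "real (card (bad (hp s0) lev A')) + real (card ?S) \<le> real (card (bad (hp s0) lev A))" using cb by (simp flip: of_nat_add)
     ultimately have t2': "real t2 + 22 * real (card A') + 44 * real (card (bad (hp s0) lev A')) \<le>
     22 * real (card A) + 44 * real (card (bad (hp s0) lev A)) + 5" by argo
     show ?case
     proof (rule last[OF 2(2) A' J3 _ _ _ _ t1 t2'])
      show "\<forall>f\<in>{OWN, SG, WL, INW}. hp s3 f = hp s f" using f3 h2 by simp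
      show "eqx clset s s3" using e3 h2 by (simp add: eqx_def clset_def)
      show "regs s3 ''e'' = k" using e3 h2 k by (simp add: eqx_def)
      show "hp s SG ?h = 0" if "?h \<in> A'" using pos that h2 by simp
     qed
    qed
   next case 2
    hence ng: "\<not> (0 < hp s BK ?h \<and> 0 < hp s SG ?h)" using h2 k by (simp add: mem_adr)
    have J2: "Inv1 adj lev A s2" using J I2 h2 unfolding Inv1_def by (intro conjI exI[of _ B] exI[of _ bo]) simp_all
    have "run (Assign ''e'' (Plus (rr ''e'') (Const 1))) s2 (\<lambda>t. ?P (t1 + (Suc 1 + t)))"
    proof (rule last[OF ok2 subset_refl J2 _ _ _ _ t1])
     show "\<forall>f\<in>{OWN, SG, WL, INW}. hp s2 f = hp s f" using h2 by simp
     show "eqx clset s s2" using h2 by (simp add: eqx_def clset_def)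
     show "regs s2 ''e'' = k" using h2 k by simp
     show "hp s SG ?h = 0" if "?h \<in> A" using ng bk_alive[OF I0, of k] kR R that by simp
    qed simp
    thus ?case by (rule run_skip[OF ok2])
   qed
  qed simp_all
 next case (2 cc s)
  thus ?case by (cases cc) simp
 next case 3
  show ?case using I1 h1 by (simp add: eqx_def clset_def)
 next case 4
  show ?case by (rule ok1)
 qed
 show ?thesis unfolding cleanall_def
 proof (rule run_seq, rule run_fin[OF ok], goal_cases)
  case (3 t0)
  hence t0: "t0 \<le> 1" by simp
  have ok1: "okst s1" unfolding s1_def using okst_reg[OF ok, of 0] by simp
  show ?case unfolding s1_def[symmetric]
  proof (rule run_mono[OF loop[OF ok1]], goal_cases)
   case (1 t s)
   then obtain cc where a: "?I cc s" and b: "\<not> bval \<pi> (Less (rr ''e'') (rr ''R'')) s"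
    and c: "real t + ?g cc \<le> ?g (0, A0) + 1" by iprover
   obtain k A where ga: "cc = (k, A)" by (cases cc)
   have AA: "A \<subseteq> A0" and J: "Inv1 adj lev A s" and k: "k = regs s ''e''" "k \<le> ?R"
    and cl: "\<forall>e<k. 8 * e + 2 \<in> A \<longrightarrow> hp s SG (8 * e + 2) = 0"
    and f0: "\<forall>f\<in>{OWN, SG, WL, INW}. hp s f = hp s0 f" and e0: "eqx clset s0 s"
    using a unfolding ga prod.case by - (elim conjE, assumption)+
   have R: "regs s ''R'' = ?R" using e0 by (simp add: eqx_def clset_def)
   have kR: "k = ?R" using b k R by simp
   obtain B bo where I3: "Inv0 adj (KL lev) A B bo s" using J unfolding Inv1_def by iprover
   note r = Inv0D(4)[OF I3, unfolded R]
   \<comment> \<open>The loop inspects the first half of each record only; the twin has the same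
     sign.\<close>
   have pos: "\<forall>a\<in>A. hp s SG a = 0"
   proof
    fix a assume a: "a \<in> A"
    have h: "hp s SG c = 0" if "c \<in> A" "c mod 8 = 2" for c
    proof -
     have "c = 8 * (c div 8) + 2" using that(2) mult_div_mod_eq[of 8 c] by simp
     moreover have "c div 8 < k" using recokD(2)[OF r that(1)] kR by (simp add: less_mult_imp_div_less mult.commute)
     ultimately show ?thesis using cl that(1) by metis
    qed
    show "hp s SG a = 0"
    proof (cases "a mod 8 = 2")
     case True thus ?thesis using h a by simp
    next case False
     hence "tw a mod 8 = 2" using tw_props[OF recokD(1)[OF r a]] recokD(1)[OF r a] mod4_mod8 by metis
     thus ?thesis using h[OF recokD(3)[OF r a]] recokD(5)[OF r a] by simp
    qed
   qed
   have cA: "card A \<le> card A0" using card_mono[OF fA0 AA] .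
   have "card (bad (hp s0) lev A0) \<le> card A0" unfolding bad_def using fA0 by (intro card_mono) auto
   also have "\<dots> \<le> 2 * ?R" using I recok_card(1) Inv0D(4) unfolding Inv1_def by iprover
   finally have "real (card (bad (hp s0) lev A0)) \<le> 2 * real ?R" by linarith
   moreover have "real t + (10 * (real ?R - real k) + 22 * real (card A) + 44 * real (card (bad (hp s0) lev A))) \<le>
    10 * (real ?R - real 0) + 22 * real (card A0) + 44 * real (card (bad (hp s0) lev A0)) + 1" using c unfolding ga prod.case .
   ultimately have "real t \<le> 98 * real ?R + 22 * (real (card A0) - real (card A)) + 1" using kR by simp
   hence "real t \<le> real (98 * ?R + 22 * (card A0 - card A) + 1)" using cA by (simp add: of_nat_diff)
   hence "t \<le> 98 * ?R + 22 * (card A0 - card A) + 1" by (simp only: of_nat_le_iff)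
   hence tt: "t0 + t \<le> 98 * ?R + 22 * (card A0 - card A) + 2" using t0 by linarith
   have ff: "\<forall>f\<in>{OWN, WL, INW}. hp s f = hp s0 f" using f0 by simp
   show ?case by (rule exI[of _ A], intro conjI AA J pos ff e0 tt)
  qed
 qed simp_all
qed

end

text \<open>Refilling is verified in the smaller space of the compacted edges but happens within a
  run in the larger space; the final state retains the stronger bound.\<close>

lemma (in ram) run_weaken:
 assumes "ram.run \<pi> M' W c s Q" "M' \<le> M"
 shows "run c s (\<lambda>t s'. Q t s' \<and> ram.okst M' W s')"
proof -
 have w: "ram.okst M' W s \<Longrightarrow> okst s" for s using assms(2) unfolding ram.okst_def fits_space_def by auto
 show ?thesis using ram.run_okst[OF assms(1)] w unfolding ram.run_def by blast
qed

context mach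
begin

lemma run_compact:
 assumes ok: "okst s0" and al: "\<And>e. e < regs s0 ''R'' \<Longrightarrow> 8 * e + 2 \<in> A \<longleftrightarrow> 0 < hp s0 BK (8 * e + 2)"
  and RM: "8 * regs s0 ''R'' + 8 \<le> M"
 shows "run compact s0 (\<lambda>t s. slot (hp s) ` {..<regs s ''j''} = slot (hp s0) ` {e. e < regs s0 ''R'' \<and> 8 * e + 2 \<in> A} \<and>
  regs s ''j'' = card {e. e < regs s0 ''R'' \<and> 8 * e + 2 \<in> A} \<and> (\<forall>f. f \<noteq> OWN \<longrightarrow> hp s f = hp s0 f) \<and>
  eqx {''e'', ''j''} s0 s \<and> t \<le> 6 * regs s0 ''R'' + 4)"
proof -
 let ?R = "regs s0 ''R''" and ?S = "\<lambda>k. {e. e < k \<and> 8 * e + 2 \<in> A}"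
 let ?I = "\<lambda>k s. k = regs s ''e'' \<and> k \<le> ?R \<and> regs s ''j'' = card (?S k) \<and>
  slot (hp s) ` {..<regs s ''j''} = slot (hp s0) ` ?S k \<and> (\<forall>a\<ge>8 * k. hp s OWN a = hp s0 OWN a) \<and>
  (\<forall>f. f \<noteq> OWN \<longrightarrow> hp s f = hp s0 f) \<and> eqx {''e'', ''j''} s0 s"
 let ?g = "\<lambda>k. 6 * (real ?R - real k)"
 let ?c = "Cond (Less (Const 0) (ld BK (Plus (Times (Const 8) (rr ''e'')) (Const 2))))
    (st OWN (Plus (Times (Const 8) (rr ''j'')) (Const 2)) (ld OWN (Plus (Times (Const 8) (rr ''e'')) (Const 2))) ;;
    st OWN (Plus (Times (Const 8) (rr ''j'')) (Const 6)) (ld OWN (Plus (Times (Const 8) (rr ''e'')) (Const 6))) ;;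
    Assign ''j'' (Plus (rr ''j'') (Const 1))) Skip ;;
   Assign ''e'' (Plus (rr ''e'') (Const 1))"
 define s1 where "s1 = fin \<pi> (Assign ''e'' (Const 0) ;; Assign ''j'' (Const 0)) s0"
 have h1: "hp s1 = hp s0" "regs s1 = (regs s0)(''e'' := 0, ''j'' := 0)" unfolding s1_def by simp_all
 have fS: "finite (?S k)" for k by simp
 have cS: "card (?S k) \<le> k" for k
 proof -
  have "card (?S k) \<le> card {..<k}" by (rule card_mono) auto
  thus ?thesis by simp
 qed
 have loop: "run (While (Less (rr ''e'') (rr ''R'')) ?c) s1
  (\<lambda>t s. \<exists>k. ?I k s \<and> \<not> bval \<pi> (Less (rr ''e'') (rr ''R'')) s \<and> real t + ?g k \<le> ?g 0 + 1)" if ok1: "okst s1"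
 proof (rule run_while[where I = ?I and g = ?g], goal_cases)
  case (1 k s)
  hence k: "k = regs s ''e''" "k \<le> ?R" and j: "regs s ''j'' = card (?S k)"
   and sl: "slot (hp s) ` {..<regs s ''j''} = slot (hp s0) ` ?S k" and tl: "\<forall>a\<ge>8 * k. hp s OWN a = hp s0 OWN a"
   and ff: "\<forall>f. f \<noteq> OWN \<longrightarrow> hp s f = hp s0 f" and e: "eqx {''e'', ''j''} s0 s" by - (elim conjE, assumption)+
  have R: "regs s ''R'' = ?R" using e by (simp add: eqx_def)
  have kR: "k < ?R" using 1(3) k R by simp
  let ?j = "card (?S k)"
  have jk: "?j \<le> k" by (rule cS)
  have alk: "8 * k + 2 \<in> A \<longleftrightarrow> 0 < hp s BK (8 * k + 2)" using al[OF kR] ff by simp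
  define s' where "s' = fin \<pi> ?c s"
  have o: "hp s OWN (8 * k + 2) = hp s0 OWN (8 * k + 2)" "hp s OWN (8 * k + 6) = hp s0 OWN (8 * k + 6)" using tl by simp_all
  have bd: "8 * ?j + 6 < M" "8 * ?j + 2 < M" "?j + 1 \<le> W" "k + 1 \<le> W" using jk kR RM MW by linarith+
  have ne: "8 * k + 6 \<noteq> 8 * ?j + 2" by presburger
  have h: "hp s' = (if 8 * k + 2 \<in> A then (hp s)(OWN := (hp s OWN)(8 * ?j + 2 := hp s0 OWN (8 * k + 2), 8 * ?j + 6 := hp s0 OWN (8 * k + 6))) else hp s)"
   "regs s' = (if 8 * k + 2 \<in> A then (regs s)(''j'' := ?j + 1, ''e'' := k + 1) else (regs s)(''e'' := k + 1))"
   unfolding s'_def alk using k(1)[symmetric] j o ne by (simp_all add: mem_adr del: add_2_eq_Suc')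
  have ok': "ok ?c s" using alk k(1)[symmetric] j bd adr_less okst_hp_le[OF 1(2)] by (simp add: mem_adr del: add_2_eq_Suc')
  have Sk: "?S (k + 1) = (if 8 * k + 2 \<in> A then insert k (?S k) else ?S k)" by (auto simp: less_Suc_eq)
  have j': "regs s' ''j'' = card (?S (k + 1))" unfolding Sk using h j fS by simp
  have sl': "slot (hp s') ` {..<regs s' ''j''} = slot (hp s0) ` ?S (k + 1)"
  proof (cases "8 * k + 2 \<in> A")
   case True
   have "slot (hp s') i = slot (hp s) i" if "i < ?j" for i using that True unfolding slot_def h(1) by simp
   hence "slot (hp s') ` {..<?j} = slot (hp s) ` {..<?j}" by (intro image_cong) simp_all
   moreover have "slot (hp s') ?j = slot (hp s0) k" using True unfolding slot_def h(1) by simp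
   ultimately show ?thesis using sl True j unfolding Sk h(2) by (simp add: lessThan_Suc)
  next case False
   thus ?thesis using sl unfolding Sk h by simp
  qed
  have tl': "\<forall>a\<ge>8 * (k + 1). hp s' OWN a = hp s0 OWN a"
  proof (intro allI impI)
   fix a assume "8 * (k + 1) \<le> a"
   hence a8: "8 * k + 8 \<le> a" by simp
   have "8 * ?j + 8 \<le> a" "8 * k \<le> a" using le_trans[OF add_le_mono1[OF mult_le_mono2[OF jk]] a8] a8 by simp_all
   hence "a \<noteq> 8 * ?j + 2" "a \<noteq> 8 * ?j + 6" "8 * k \<le> a" by auto
   thus "hp s' OWN a = hp s0 OWN a" using tl unfolding h(1) by simp
  qed
  have ff': "\<forall>f. f \<noteq> OWN \<longrightarrow> hp s' f = hp s0 f" using ff unfolding h(1) by simp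
  have e': "eqx {''e'', ''j''} s0 s'" using e unfolding h(2) eqx_def by simp
  have k': "k + 1 = regs s' ''e''" "k + 1 \<le> ?R" using h(2) kR by simp_all
  show ?case
  proof (rule run_fin[OF 1(2)], goal_cases)
   case (3 t)
   hence t: "t \<le> 5" by simp
   have pt: "real t + 1 + ?g (k + 1) \<le> ?g k" using t by simp
   show ?case unfolding s'_def[symmetric] by (rule exI[of _ "k + 1"]) (intro conjI k' j' sl' tl' ff' e' pt)
  next case 2 show ?case by (rule ok')
  qed simp_all
 next case (2 k s) thus ?case by simp
 next case 3 show ?case using h1 by (simp add: eqx_def)
 next case 4 show ?case by (rule ok1)
 qed
 show ?thesis unfolding compact_def
 proof (rule run_seq, rule run_fin[OF ok], goal_cases)
  case (3 t0)
  hence t0: "t0 \<le> 2" by simp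
  have ok1: "okst s1" unfolding s1_def using okst_reg[OF okst_reg[OF ok, of 0 "''e''"], of 0 "''j''"] by simp
  show ?case unfolding s1_def[symmetric]
  proof (rule run_mono[OF loop[OF ok1]], goal_cases)
   case (1 t s)
   then obtain k where a: "?I k s" and b: "\<not> bval \<pi> (Less (rr ''e'') (rr ''R'')) s" and c: "real t + ?g k \<le> ?g 0 + 1" by iprover
   from a have k: "k = regs s ''e''" "k \<le> ?R" and j: "regs s ''j'' = card (?S k)"
    and sl: "slot (hp s) ` {..<regs s ''j''} = slot (hp s0) ` ?S k"
    and ff: "\<forall>f. f \<noteq> OWN \<longrightarrow> hp s f = hp s0 f" and e: "eqx {''e'', ''j''} s0 s" by - (elim conjE, assumption)+
   have kR: "k = ?R" using b k e by (simp add: eqx_def)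
   have "t \<le> 6 * ?R + 1" using c kR by simp
   hence tt: "t0 + t \<le> 6 * ?R + 4" using t0 by linarith
   show ?case by (intro conjI sl[unfolded kR] j[unfolded kR] ff e tt)
  qed
 qed simp_all
qed

definition kept :: "nat \<Rightarrow> nat \<Rightarrow> bool" where
 "kept m a \<longleftrightarrow> a mod 16 = 9 \<and> a < 128 * n \<or> a mod 16 = 3 \<and> a < 128 * m"

text \<open>The program computes the end of the memory from \<open>n\<close> and \<open>R\<close>,
  which is why \<open>M\<close> is given by an equation: \<open>128 * (n + R + 1)\<close> is
  \<open>16 * M\<close>.\<close>

lemma run_zero:
 assumes ok: "okst s0" and r: "regs s0 ''n'' = n" and M: "M = 8 * n + 8 * regs s0 ''R'' + 8"
 shows "run zero s0 (\<lambda>t s. (\<forall>a. mem s a = (if kept (regs s0 ''m'') a then mem s0 a else 0)) \<and>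
  eqx {''a''} s0 s \<and> t \<le> 80 * M + 2)"
proof -
 let ?m = "regs s0 ''m''"
 let ?I = "\<lambda>k s. k = regs s ''a'' \<and> k \<le> 16 * M \<and>
  (\<forall>a. mem s a = (if a < k \<or> kept ?m a then mem s0 a else 0)) \<and> eqx {''a''} s0 s"
 let ?g = "\<lambda>k. 5 * real k"
 let ?c = "Assign ''a'' (Minus (rr ''a'') (Const 1)) ;;
   Cond (And (Equal (Mod (rr ''a'') (Const 16)) (Const 9)) (Less (rr ''a'') (Times (Const 128) (rr ''n'')))) Skip
    (Cond (And (Equal (Mod (rr ''a'') (Const 16)) (Const 3)) (Less (rr ''a'') (Times (Const 128) (rr ''m'')))) Skip
     (Store (rr ''a'') (Const 0)))"
 let ?init = "Assign ''a'' (Times (Const 128) (Plus (Plus (rr ''n'') (rr ''R'')) (Const 1)))"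
 define s1 where "s1 = fin \<pi> ?init s0"
 have M16: "16 * M = 128 + (128 * n + 128 * regs s0 ''R'')" using M by simp
 have h1: "mem s1 = mem s0" "regs s1 = (regs s0)(''a'' := 16 * M)" unfolding s1_def M16 using r by (simp_all add: set_reg_def)
 have M0: "mem s0 a = 0" if "16 * M \<le> a" for a using ok that unfolding okst_def fits_space_def by simp
 have loop: "run (While (Less (Const 0) (rr ''a'')) ?c) s1
  (\<lambda>t s. \<exists>k. ?I k s \<and> \<not> bval \<pi> (Less (Const 0) (rr ''a'')) s \<and> real t + ?g k \<le> ?g (16 * M) + 1)" if ok1: "okst s1"
 proof (rule run_while[where I = ?I and g = ?g], goal_cases)
  case (1 k s)
  hence k: "k = regs s ''a''" "k \<le> 16 * M" and mm: "\<forall>a. mem s a = (if a < k \<or> kept ?m a then mem s0 a else 0)"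
   and e: "eqx {''a''} s0 s" by - (elim conjE, assumption)+
  have rn: "regs s ''n'' = n" "regs s ''m'' = ?m" using e r by (simp_all add: eqx_def)
  have k0: "0 < k" using 1(3) k by simp
  define s' where "s' = fin \<pi> ?c s"
  have h: "mem s' = (if kept ?m (k - 1) then mem s else (mem s)(k - 1 := 0))" "regs s' = (regs s)(''a'' := k - 1)"
   unfolding s'_def kept_def using k(1)[symmetric] rn by (simp_all add: set_reg_def set_mem_def)
  have mm': "mem s' a = (if a < k - 1 \<or> kept ?m a then mem s0 a else 0)" for a
  proof (cases "a = k - 1")
   case True
   thus ?thesis using mm k0 unfolding h(1) by simp
  next case False
   hence "a < k \<longleftrightarrow> a < k - 1" using k0 by linarith
   thus ?thesis using mm False unfolding h(1) by simp
  qed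
  have e': "eqx {''a''} s0 s'" using e unfolding h(2) eqx_def by simp
  show ?case
  proof (rule run_fin[OF 1(2)], goal_cases)
   case (3 t)
   hence t: "t \<le> 4" by simp
   hence "real t + 1 + ?g (k - 1) \<le> ?g k" using k0 by (simp add: of_nat_diff)
   thus ?case unfolding s'_def[symmetric] using h(2) k(2) mm' e' by (intro exI[of _ "k - 1"]) simp
  qed simp_all
 next case (2 k s) thus ?case by simp
 next case 3 show ?case using h1 M0 by (simp add: eqx_def)
 next case 4 show ?case by (rule ok1)
 qed
 show ?thesis unfolding zero_def
 proof (rule run_seq, rule run_fin[OF ok], goal_cases)
  case (3 t0)
  hence t0: "t0 \<le> 1" by simp
  have s1: "s1 = set_reg ''a'' (16 * M) s0" unfolding s1_def M16 using r by simp
  have "16 * M \<le> W" using MW by simp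
  hence ok1: "okst s1" unfolding s1 by (rule okst_reg[OF ok])
  show ?case unfolding s1_def[symmetric]
  proof (rule run_mono[OF loop[OF ok1]], goal_cases)
   case (1 t s)
   then obtain k where a: "?I k s" and b: "\<not> bval \<pi> (Less (Const 0) (rr ''a'')) s" and c: "real t + ?g k \<le> ?g (16 * M) + 1" by iprover
   from a have k: "k = regs s ''a''" and mm: "\<forall>a. mem s a = (if a < k \<or> kept ?m a then mem s0 a else 0)"
    and e: "eqx {''a''} s0 s" by - (elim conjE, assumption)+
   have k0: "k = 0" using b k by simp
   have "real t \<le> real (80 * M + 1)" using c k0 by simp
   hence "t \<le> 80 * M + 1" by (simp only: of_nat_le_iff)
   thus ?case using mm k0 e t0 by simp
  qed
 qed (use r M16 MW in simp_all)
qed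

text \<open>Zero memory represents the empty graph on any levels, which serves the initial state as
  well as the restart in \<open>rebuild\<close>. \<open>OWN\<close> may be nonzero because without
  records no owner is looked up; after \<open>zero\<close> it holds the compacted edges.\<close>

lemma Inv1_empty:
 assumes z: "\<And>f a. f \<noteq> LEV \<Longrightarrow> f \<noteq> OWN \<Longrightarrow> hp s f a = 0"
  and r: "regs s ''R'' = 0" "regs s ''nb'' = 0" "regs s ''nf'' = 0" "regs s ''top'' = 0"
  and lv: "\<And>x. x \<in> nodes n \<Longrightarrow> hp s LEV x = lev x" "\<And>x. lev x < L"
 shows "Inv1 (\<lambda>_ _. False) lev {} s"
proof -
 let ?K = "KL lev"
 have m: "x mod 4 = 1" if "x \<in> nodes n" for x
 proof -
  obtain j where "x = 4 * j + 1" using \<open>x \<in> nodes n\<close> unfolding nodes_def by blast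
  thus ?thesis by presburger
 qed
 have W: "WF (nodes n) (hp s) 0 0 {} (\<lambda>h. ?K (hp s OWN h) (far s h)) (degk (\<lambda>_ _. False) ?K) {} (\<lambda>_. 0) {}"
  by (rule WFI) (use z m in \<open>simp_all add: bids_def degk_def\<close>)
 have "Inv0 (\<lambda>_ _. False) ?K {} {} (\<lambda>_. 0) s" unfolding Inv0_def r using nM KL_range[OF lv(2)] z
  by (intro conjI W) (simp_all add: recok_def adjok_def cover_def)
 moreover have "net (hp s) {} (\<lambda>_ _. False)" unfolding net_def by simp
 moreover have "wl_ok s" unfolding wlok_def queue_def r using z by simp
 ultimately show ?thesis unfolding Inv1_def using z lv by (intro conjI exI[of _ "{}"] exI[of _ "\<lambda>_. 0"]) simp_all
qed

lemma pairs_adj: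
 assumes "adjok n adj" shows "adj x y \<longleftrightarrow> (x, y) \<in> pairs adj \<or> (y, x) \<in> pairs adj"
proof -
 have m: "x mod 8 = 1 \<or> x mod 8 = 5" if x: "x \<in> nodes n" for x
 proof -
  obtain j where "x = 4 * j + 1" using x unfolding nodes_def by blast
  thus ?thesis by presburger
 qed
 have "adj x y \<Longrightarrow> adj y x \<and> (x mod 8 = 1 \<or> y mod 8 = 1)"
 proof -
  assume "adj x y"
  hence "adj y x" "x \<in> nodes n" "y \<in> nodes n" "x mod 8 \<noteq> y mod 8" using assms unfolding adjok_def by blast+
  thus ?thesis using m[of x] m[of y] by linarith
 qed
 moreover have "adj y x \<Longrightarrow> adj x y" using assms unfolding adjok_def by blast
 ultimately show ?thesis unfolding pairs_def by blast
qed

lemma upd_pairs: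
 assumes "P k = (x, y)"
 shows "upd_adj (\<lambda>z w. \<exists>j<k. P j = (z, w) \<or> P j = (w, z)) x y True =
  (\<lambda>z w. \<exists>j<Suc k. P j = (z, w) \<or> P j = (w, z))"
proof (intro ext)
 fix z w
 have e: "(\<exists>j<Suc k. Q j) \<longleftrightarrow> (\<exists>j<k. Q j) \<or> Q k" for Q using less_Suc_eq by auto
 show "upd_adj (\<lambda>z w. \<exists>j<k. P j = (z, w) \<or> P j = (w, z)) x y True z w =
  (\<exists>j<Suc k. P j = (z, w) \<or> P j = (w, z))" unfolding e assms upd_adj_def by (cases "z = x \<and> w = y \<or> z = y \<and> w = x") auto
qed

lemma run_refill:
 assumes ok: "okst s0" and I: "Inv1 (\<lambda>_ _. False) lev {} s0" and r: "regs s0 ''R'' = 0" "regs s0 ''g'' = 0" "regs s0 ''m'' = m"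
  and mM: "8 * m + 8 \<le> M" and inj: "inj_on (slot (hp s0)) {..<m}" and im: "slot (hp s0) ` {..<m} = pairs adj" and aj: "adjok n adj"
 shows "run refill s0 (\<lambda>t s. \<exists>A. Inv1 adj lev A s \<and> card A \<le> 2 * m \<and> regs s ''R'' = m \<and> qu s = qu s0 \<and>
  eqx (insert ''y'' addset) s0 s \<and> t \<le> (4 * L + 104) * m + 1)"
proof -
 let ?P = "slot (hp s0)"
 let ?a = "\<lambda>k x y. \<exists>j<k. ?P j = (x, y) \<or> ?P j = (y, x)"
 let ?I = "\<lambda>k s. k = regs s ''R'' \<and> k \<le> m \<and> (\<exists>A. Inv1 (?a k) lev A s) \<and> hp s OWN = hp s0 OWN \<and>
  qu s = qu s0 \<and> eqx (insert ''y'' addset) s0 s"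
 let ?g = "\<lambda>k. (4 * real L + 104) * (real m - real k)"
 have "run refill s0 (\<lambda>t s. \<exists>k. ?I k s \<and> \<not> bval \<pi> (Less (rr ''R'') (rr ''m'')) s \<and> real t + ?g k \<le> ?g 0 + 1)"
  unfolding refill_def
 proof (rule run_while[where I = ?I and g = ?g], goal_cases)
  case (1 k s)
  hence k: "k = regs s ''R''" "k \<le> m" and J: "\<exists>A. Inv1 (?a k) lev A s" and own: "hp s OWN = hp s0 OWN"
   and Q: "qu s = qu s0" and e: "eqx (insert ''y'' addset) s0 s" by - (elim conjE, assumption)+
  obtain A where JA: "Inv1 (?a k) lev A s" using J by iprover
  have rs: "regs s ''m'' = m" "regs s ''g'' = 0" using e r by (simp_all add: eqx_def addset_def)
  have km: "k < m" using 1(3) k rs by simp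
  let ?c = "Assign ''x'' (ld OWN (Plus (Times (Const 8) (rr ''R'')) (Const 2))) ;;
   Assign ''y'' (ld OWN (Plus (Times (Const 8) (rr ''R'')) (Const 6)))"
  let ?x = "hp s0 OWN (8 * k + 2)" and ?y = "hp s0 OWN (8 * k + 6)"
  have p: "?P k = (?x, ?y)" unfolding slot_def ..
  have "?P k \<in> pairs adj" unfolding im[symmetric] using km by simp
  hence xy: "adj ?x ?y" "?x mod 8 = 1" unfolding p pairs_def by simp_all
  hence nd: "?x \<in> nodes n" "?y \<in> nodes n" "?x mod 8 \<noteq> ?y mod 8" using aj unfolding adjok_def by blast+
  have y5: "?y mod 8 = 5"
  proof -
   obtain j where "?y = 4 * j + 1" using nd(2) unfolding nodes_def by blast
   hence "?y mod 8 = 1 \<or> ?y mod 8 = 5" by presburger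
   thus ?thesis using nd(3) xy(2) by simp
  qed
  have na: "\<not> ?a k ?x ?y"
  proof
   assume "?a k ?x ?y"
   then obtain j where j: "j < k" "?P j = (?x, ?y) \<or> ?P j = (?y, ?x)" by (elim exE conjE)
   have "?P j \<in> pairs adj" unfolding im[symmetric] using j(1) km by simp
   hence "?P j \<noteq> (?y, ?x)" using y5 unfolding pairs_def by (intro notI) simp
   hence e: "?P j = ?P k" using j(2) p by simp
   have "j = k" by (rule inj_onD[OF inj e]) (use j(1) km in simp_all)
   thus False using j(1) by simp
  qed
  define s2 where "s2 = fin \<pi> ?c s"
  have h2: "hp s2 = hp s" "regs s2 = (regs s)(''x'' := ?x, ''y'' := ?y)" unfolding s2_def using k(1)[symmetric] own by (simp_all add: mem_adr)
  have J2: "Inv1 (?a k) lev A s2"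
  proof -
   obtain B bo where I0: "Inv0 (?a k) (KL lev) A B bo s" using JA unfolding Inv1_def by iprover
   have "Inv0 (?a k) (KL lev) A B bo s2" by (rule Inv0_cong[OF I0]) (use h2 in simp_all)
   thus ?thesis using JA h2 unfolding Inv1_def by (intro conjI exI[of _ B] exI[of _ bo]) simp_all
  qed
  have ad: "upd_adj (?a k) ?x ?y ((0::nat) = 0) = ?a (k + 1)" using upd_pairs[of ?P k ?x ?y, OF p] by simp
  have r2: "regs s2 ''x'' = ?x" "regs s2 ''y'' = ?y" "regs s2 ''g'' = 0" "regs s2 ''R'' = k" using h2 rs k by simp_all
  have kM: "8 * k + 16 \<le> M" using km mM by linarith
  have g0: "(0::nat) \<le> 1" "?a k ?x ?y \<longleftrightarrow> (0::nat) = 1" using na by simp_all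
  show ?case
  proof (rule run_seq, rule run_fin[OF 1(2)], goal_cases)
   case (3 t1)
   hence t1: "t1 \<le> 2" by simp
   have s2: "s2 = set_reg ''y'' ?y (set_reg ''x'' ?x s)" unfolding s2_def using k(1)[symmetric] own by (simp add: mem_adr)
   have W: "?x \<le> W" "?y \<le> W" unfolding own[symmetric] by (rule okst_hp_le[OF 1(2)])+
   have ok2: "okst s2" unfolding s2 by (rule okst_reg[OF okst_reg[OF 1(2) W(1)] W(2)])
   show ?case unfolding s2_def[symmetric]
   proof (rule run_mono[OF run_addrec[OF ok2 J2, OF r2(1) nd(1) xy(2) r2(2) nd(2) y5 r2(3) g0 r2(4) kM]], goal_cases)
    case (1 t2 s3)
    hence J3: "Inv1 (?a (k + 1)) lev (insert (8 * k + 2) (insert (8 * k + 6) A)) s3" and Q3: "qu s3 = qu s2"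
     and R3: "regs s3 ''R'' = k + 1" and O3: "hp s3 OWN = (hp s2 OWN)(8 * k + 2 := ?x, 8 * k + 6 := ?y)"
     and e3: "eqx addset s2 s3" and t2: "t2 \<le> 4 * L + 100" unfolding ad by - (elim conjE, assumption)+
    have O: "hp s3 OWN = hp s0 OWN" unfolding O3 h2 own by (simp add: fun_eq_iff)
    have QQ: "qu s3 = qu s0" using Q3 h2 Q by simp
    have E: "eqx (insert ''y'' addset) s0 s3" using e e3 h2 by (simp add: eqx_def addset_def)
    have "real (t1 + t2) + 1 \<le> 4 * real L + 104" using t1 t2 by linarith
    hence pt: "real (t1 + t2) + 1 + ?g (k + 1) \<le> ?g k" by (simp add: algebra_simps)
    have kk: "k + 1 \<le> m" using km by simp
    show ?case by (rule exI[of _ "k + 1"]) (intro conjI R3[symmetric] kk exI[of _ "insert (8 * k + 2) (insert (8 * k + 6) A)"] J3 O QQ E pt)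
   qed
  qed simp_all
 next case (2 k s) thus ?case by (intro mult_nonneg_nonneg) simp_all
 next case 3
  have z: "?a 0 = (\<lambda>_ _. False)" by (simp add: fun_eq_iff)
  show ?case unfolding z using I r by (intro conjI exI[of _ "{}"]) (simp_all add: eqx_def)
 next case 4 show ?case by (rule ok)
 qed
 thus ?thesis
 proof (rule run_mono, goal_cases)
  case (1 t s)
  from 1(1) obtain k where a: "?I k s" and b: "\<not> bval \<pi> (Less (rr ''R'') (rr ''m'')) s" and c: "real t + ?g k \<le> ?g 0 + 1" by iprover
  from a have k: "k = regs s ''R''" "k \<le> m" and J: "\<exists>A. Inv1 (?a k) lev A s"
   and Q: "qu s = qu s0" and e: "eqx (insert ''y'' addset) s0 s" by - (elim conjE, assumption)+
  obtain A where JA: "Inv1 (?a k) lev A s" using J by iprover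
  have "regs s ''m'' = m" using e r by (simp add: eqx_def addset_def)
  hence km: "k = m" using b k by simp
  have pr: "(x, y) \<in> pairs adj \<longleftrightarrow> (\<exists>j<m. ?P j = (x, y))" for x y
   unfolding im[symmetric] image_iff by (metis lessThan_iff)
  have "?a m = adj"
  proof (intro ext)
   fix x y
   show "?a m x y = adj x y" using pairs_adj[OF aj, of x y] pr[of x y] pr[of y x] by blast
  qed
  hence J': "Inv1 adj lev A s" using JA km by simp
  have cA: "card A \<le> 2 * m"
  proof -
   obtain B bo where I0: "Inv0 adj (KL lev) A B bo s" using J' unfolding Inv1_def by iprover
   show ?thesis using recok_card(1)[OF Inv0D(4)[OF I0]] k km by simp
  qed
  have "real t \<le> real ((4 * L + 104) * m + 1)" using c km by simp
  hence t: "t \<le> (4 * L + 104) * m + 1" by (simp only: of_nat_le_iff)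
  show ?case by (rule exI[of _ A]) (intro conjI J' cA k(1)[symmetric, unfolded km] Q e t)
 qed
qed

text \<open>By \<open>cover\<close> distinct edges occupy distinct records, so the excess of records
  over edges is nonnegative and can act as a credit.\<close>

lemma pairs_card:
 assumes "Inv1 adj lev A s" shows "card (pairs adj) \<le> regs s ''R''"
proof -
 obtain B bo where I: "Inv0 adj (KL lev) A B bo s" using assms unfolding Inv1_def by iprover
 let ?S = "{e. e < regs s ''R'' \<and> 8 * e + 2 \<in> A}"
 have "pairs adj \<subseteq> slot (hp s) ` ?S" using pairs_slots[OF Inv0D(4)[OF I] Inv0D(6)[OF I]] .
 hence "card (pairs adj) \<le> card (slot (hp s) ` ?S)" by (intro card_mono) simp_all
 also have "\<dots> \<le> card ?S" by (rule card_image_le) simp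
 also have "\<dots> \<le> card {..<regs s ''R''}" by (rule card_mono) auto
 finally show ?thesis by simp
qed

definition rbset :: "string set" where
 "rbset = clset \<union> addset \<union> {''y'', ''g''}"

text \<open>Per record, cleaning takes 98 steps, compaction 6 and clearing 640, the last because
  \<open>80 * M\<close> is \<open>640 * (n + R + 1)\<close>; this makes 744. Refilling takes
  \<open>4 * L + 104\<close> per edge, and 44 more is the fresh credit of its two
  half-edges.\<close>

lemma run_rebuild:
 assumes ok: "okst s0" and I: "Inv1 adj lev A0 s0" and r: "regs s0 ''n'' = n" "regs s0 ''m'' = m" "regs s0 ''top'' = 0"
  and M: "M = 8 * n + 8 * regs s0 ''R'' + 8" and m: "m = card (pairs adj)"
 shows "run rebuild s0 (\<lambda>t s. \<exists>A. mach.Inv1 (8 * n + 8 * m + 8) n L adj lev A s \<and> ram.okst (8 * n + 8 * m + 8) W s \<and>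
  regs s ''R'' = m \<and> eqx rbset s0 s \<and>
  t + 22 * card A \<le> 22 * card A0 + 744 * regs s0 ''R'' + 640 * n + (4 * L + 148) * m + 660)"
proof -
 let ?R = "regs s0 ''R''" and ?M = "8 * n + 8 * m + 8"
 have mR: "m \<le> ?R" unfolding m by (rule pairs_card[OF I])
 have MM: "?M \<le> M" using mR M by simp
 have MW': "16 * ?M + L + 3 \<le> W" using mult_le_mono2[OF MM, of 16] MW by linarith
 interpret N: mach \<pi> ?M W n L by unfold_locales (use MW' in simp_all)
 show ?thesis unfolding rebuild_def
 proof (rule run_seq, rule run_mono[OF run_cleanall[OF ok I]], goal_cases)
  case (1 t1 s1)
  from 1(1) obtain A where AA: "A \<subseteq> A0" and J: "Inv1 adj lev A s1" and pos: "\<forall>a\<in>A. hp s1 SG a = 0" and e1: "eqx clset s0 s1"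
   and t1: "t1 \<le> 98 * ?R + 22 * (card A0 - card A) + 2" by iprover
  note ok1 = 1(2)
  obtain B bo where I1: "Inv0 adj (KL lev) A B bo s1" and N1: "net (hp s1) A adj"
   and lv: "\<forall>x\<in>nodes n. hp s1 LEV x = lev x" and lL: "\<forall>x. lev x < L" using J unfolding Inv1_def by iprover
  note i = Inv0D[OF I1]
  have R1: "regs s1 ''R'' = ?R" "regs s1 ''n'' = n" "regs s1 ''m'' = m" "regs s1 ''top'' = 0" using e1 r by (simp_all add: eqx_def clset_def)
  have bij: "bij_betw (slot (hp s1)) {e. e < ?R \<and> 8 * e + 2 \<in> A} (pairs adj)" using alive_pairs[OF i(4) i(6) N1] pos R1 by simp
  have fA: "finite A0" using I recok_card(2) Inv0D(4) unfolding Inv1_def by iprover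
  have cA: "card A \<le> card A0" using card_mono[OF fA AA] .
  have al: "8 * e + 2 \<in> A \<longleftrightarrow> 0 < hp s1 BK (8 * e + 2)" if "e < regs s1 ''R''" for e by (rule bk_alive[OF I1 that])
  show ?case
  proof (rule run_seq, rule run_mono[OF run_compact[OF ok1 al i(3)]], goal_cases)
   case (1 e) thus ?case .
  next case (2 t2 s2)
   hence im: "slot (hp s2) ` {..<regs s2 ''j''} = slot (hp s1) ` {e. e < ?R \<and> 8 * e + 2 \<in> A}"
    and j: "regs s2 ''j'' = card {e. e < ?R \<and> 8 * e + 2 \<in> A}" and f2: "\<forall>f. f \<noteq> OWN \<longrightarrow> hp s2 f = hp s1 f"
    and e2: "eqx {''e'', ''j''} s1 s2" and t2: "t2 \<le> 6 * ?R + 4" and ok2: "okst s2" unfolding R1 by - (elim conjE, assumption)+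
   have jm: "regs s2 ''j'' = m" unfolding j m using bij_betw_same_card[OF bij] .
   have im2: "slot (hp s2) ` {..<m} = pairs adj" using im bij unfolding jm bij_betw_def by simp
   have inj2: "inj_on (slot (hp s2)) {..<m}" by (rule eq_card_imp_inj_on) (simp, simp only: im2 card_lessThan m[symmetric])
   have R2: "regs s2 ''R'' = ?R" "regs s2 ''n'' = n" "regs s2 ''m'' = m" "regs s2 ''top'' = 0" using e2 R1 by (simp_all add: eqx_def)
   have M2: "M = 8 * n + 8 * regs s2 ''R'' + 8" using M R2 by simp
   show ?case
   proof (rule run_seq, rule run_mono[OF run_zero[OF ok2 R2(2) M2]], goal_cases)
    case (1 t3 s3)
    hence mm: "\<forall>a. mem s3 a = (if kept m a then mem s2 a else 0)" and e3: "eqx {''a''} s2 s3" and t3: "t3 \<le> 80 * M + 2"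
     and ok3: "okst s3" unfolding R2 by - (elim conjE, assumption)+
    have R3: "regs s3 ''R'' = ?R" "regs s3 ''n'' = n" "regs s3 ''m'' = m" "regs s3 ''top'' = 0" using e3 R2 by (simp_all add: eqx_def)
    have am: "adr f a mod 16 = code f" for f a unfolding adr_def using code_less[of f] by simp
    have hz: "hp s3 f a = 0" if "f \<noteq> LEV" "f \<noteq> OWN" for f a using mm that am[of f a] unfolding hp_def kept_def by (cases f) simp_all
    have hl: "hp s3 LEV a = hp s2 LEV a" if "a \<in> nodes n" for a
    proof -
     have "adr LEV a < 128 * n" using adr_less[OF nodes_less[OF that], of LEV] by simp
     thus ?thesis using mm am[of LEV a] unfolding hp_def kept_def by simp
    qed
    have ho: "hp s3 OWN a = hp s2 OWN a" if "a < 8 * m" for a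
    proof -
     have "adr OWN a < 128 * m" using adr_less[OF that, of OWN] by simp
     thus ?thesis using mm am[of OWN a] unfolding hp_def kept_def by simp
    qed
    have sl3: "slot (hp s3) e = slot (hp s2) e" if "e < m" for e using ho[of "8 * e + 2"] ho[of "8 * e + 6"] that unfolding slot_def by simp
    define s4 where "s4 = fin \<pi> (Assign ''R'' (Const 0) ;; Assign ''nb'' (Const 0) ;; Assign ''nf'' (Const 0) ;; Assign ''g'' (Const 0)) s3"
    have h4: "hp s4 = hp s3" "regs s4 = (regs s3)(''R'' := 0, ''nb'' := 0, ''nf'' := 0, ''g'' := 0)" unfolding s4_def by simp_all
    have m4: "mem s4 = mem s3" unfolding s4_def by (simp add: set_reg_def)
    have ok4: "okst s4" unfolding s4_def fin.simps aval.simps by (intro okst_reg ok3) simp_all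
    have nk: "\<not> kept m a" if "16 * ?M \<le> a" for a using that unfolding kept_def by auto
    have okN: "N.okst s4" using ok4 nk mm m4 unfolding ram.okst_def fits_space_def by simp
    have r4: "regs s4 ''R'' = 0" "regs s4 ''nb'' = 0" "regs s4 ''nf'' = 0" "regs s4 ''top'' = 0" "regs s4 ''g'' = 0" "regs s4 ''m'' = m"
     using h4 R3 by simp_all
    have JN: "N.Inv1 (\<lambda>_ _. False) lev {} s4"
    proof (rule N.Inv1_empty[OF _ r4(1-4)])
     show "hp s4 f a = 0" if "f \<noteq> LEV" "f \<noteq> OWN" for f a using hz[OF that] h4 by simp
     show "hp s4 LEV a = lev a" if "a \<in> nodes n" for a using hl[OF that] lv f2 that h4 by simp
     show "lev a < L" for a using lL by blast
    qed
    have im4: "slot (hp s4) ` {..<m} = pairs adj" unfolding im2[symmetric] h4 by (intro image_cong) (use sl3 in simp_all)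
    have inj4: "inj_on (slot (hp s4)) {..<m}" unfolding h4 using inj2 sl3 by (simp add: inj_on_def)
    have mM: "8 * m + 8 \<le> ?M" by simp
    show ?case
    proof (rule run_seq, rule run_fin[OF ok3], goal_cases)
     case (3 t4)
     hence t4: "t4 \<le> 4" by simp
     show ?case unfolding s4_def[symmetric]
     proof (rule run_mono[OF run_weaken[OF N.run_refill[OF okN JN r4(1) r4(5,6) mM inj4 im4 i(5)] MM]], goal_cases)
      case (1 t5 s5)
      from 1(1) obtain A5 where J5: "N.Inv1 adj lev A5 s5" and c5: "card A5 \<le> 2 * m" and R5: "regs s5 ''R'' = m"
       and e5: "eqx (insert ''y'' N.addset) s4 s5" and t5: "t5 \<le> (4 * L + 104) * m + 1" and okN5: "N.okst s5" by iprover
      have e: "eqx rbset s0 s5" using e1 e2 e3 h4 e5 by (simp add: eqx_def rbset_def clset_def addset_def N.addset_def)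
      have "t1 + 22 * card A \<le> 98 * ?R + 22 * card A0 + 2" using t1 cA by simp
      moreover have "80 * M = 640 * n + 640 * ?R + 640" using M by simp
      moreover have "(4 * L + 148) * m = (4 * L + 104) * m + 44 * m" by (simp add: algebra_simps)
      ultimately have tt: "t1 + (t2 + (t3 + (t4 + t5))) + 22 * card A5 \<le> 22 * card A0 + 744 * ?R + 640 * n + (4 * L + 148) * m + 660"
       using t2 t3 t4 t5 c5 by linarith
      show ?case by (rule exI[of _ A5]) (intro conjI J5 okN5 R5 e tt)
     qed
    qed simp_all
   qed
  qed
 qed
qed

end

section \<open>One insertion or deletion\<close>

definition updc :: "nat \<Rightarrow> com" where
 "updc k = (Assign ''g'' (Const k) ;; Assign ''x'' (Plus (Times (Const 8) (rr ''u'')) (Const 1)) ;;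
   Assign ''y'' (Plus (Times (Const 8) (rr ''v'')) (Const 5))) ;;
  addrec ;; Assign ''m'' (Minus (Plus (rr ''m'') (Const 1)) (Const (2 * k))) ;; pushwl ;;
  Assign ''y'' (rr ''e'') ;; pushwl ;; fixup ;;
  Cond (Less (Plus (Times (Const 3) (rr ''m'')) (Times (Const 2) (rr ''n''))) (rr ''R'')) rebuild Skip"

lemma (in mach) Inv1_cong:
 assumes J: "Inv1 adj lev A s" and h: "\<And>f. f \<notin> {WL, INW} \<Longrightarrow> hp s' f = hp s f"
  and r: "regs s' ''nb'' = regs s ''nb''" "regs s' ''nf'' = regs s ''nf''" "regs s' ''R'' = regs s ''R''" and w: "wl_ok s'"
 shows "Inv1 adj lev A s'"
proof -
 obtain B bo where I0: "Inv0 adj (KL lev) A B bo s" and N: "net (hp s) A adj"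
  and sl: "\<forall>y\<in>nodes n. hp s SLOT y = 0" and lv: "\<forall>x\<in>nodes n. hp s LEV x = lev x" and lL: "\<forall>x. lev x < L"
  using J unfolding Inv1_def by iprover
 have "Inv0 adj (KL lev) A B bo s'" by (rule Inv0_cong[OF I0]) (use h r in simp_all)
 moreover have "net (hp s') A adj" by (rule net_recok_cong[OF N]) (use h in simp_all)
 ultimately show ?thesis unfolding Inv1_def using sl lv lL w h by (intro conjI exI[of _ B] exI[of _ bo]) simp_all
qed

lemma Inv1_mono:
 assumes m1: "mach M1 W n L" and m2: "mach M2 W n L" and le: "M1 \<le> M2" and I: "mach.Inv1 M1 n L adj lev A s"
 shows "mach.Inv1 M2 n L adj lev A s"
proof -
 obtain B bo where I0: "mach.Inv0 M1 n L adj (KL lev) A B bo s" using I unfolding mach.Inv1_def[OF m1] by iprover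
 have "mach.Inv0 M2 n L adj (KL lev) A B bo s"
  using I0 le unfolding mach.Inv0_def[OF m1] mach.Inv0_def[OF m2] by (elim conjE) (intro conjI; (assumption | linarith))
 thus ?thesis using I unfolding mach.Inv1_def[OF m1] mach.Inv1_def[OF m2] by iprover
qed

context dec
begin

text \<open>\<open>M\<close> has room for exactly one new record. The bound after the update depends
  on the final number of records, so the conclusion refers to the invariants at another value of
  \<open>M\<close>. Each record in excess of the live edges holds a credit of
  \<open>2200 * L\<close>, saved for the next rebuild.\<close>

lemma run_upd:
 assumes ok: "okst s0" and I: "Inv1 adj lev A s0" and nd: "\<And>x. \<not> dirty adj lev x"
  and r: "regs s0 ''u'' = u" "regs s0 ''v'' = v" "regs s0 ''n'' = n" "regs s0 ''L'' = L" "regs s0 ''top'' = 0"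
   "regs s0 ''m'' = m" "regs s0 ''R'' = R" and uv: "u < n" "v < n" and k: "k \<le> 1" "adj (8 * u + 1) (8 * v + 5) \<longleftrightarrow> k = 1"
  and M: "M = 8 * n + 8 * R + 16" and m: "m = card (pairs adj)" and mp: "card (pairs (upd_adj adj (8 * u + 1) (8 * v + 5) (k = 0))) = m + 1 - 2 * k"
 shows "run (updc k) s0 (\<lambda>t s. \<exists>lev' A'. let adj' = upd_adj adj (8 * u + 1) (8 * v + 5) (k = 0); m' = m + 1 - 2 * k; M' = 8 * n + 8 * regs s ''R'' + 8 in
  mach.Inv1 M' n L adj' lev' A' s \<and> ram.okst M' W s \<and> (\<forall>x. \<not> dirty adj' lev' x) \<and>
  regs s ''n'' = n \<and> regs s ''L'' = L \<and> regs s ''top'' = 0 \<and> regs s ''m'' = m' \<and> regs s ''R'' \<le> 3 * m' + 2 * n \<and>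
  real t + fxpot adj' (lev', A', 0) + 2200 * real L * (real (regs s ''R'') - real m') \<le>
   fxpot adj (lev, A, 0) + 2200 * real L * (real R - real m) + 8000 * real L / \<epsilon>)"
proof -
 define x where "x = 8 * u + 1" define y where "y = 8 * v + 5"
 let ?adj = "upd_adj adj x y (k = 0)" and ?A = "insert (8 * R + 2) (insert (8 * R + 6) A)" and ?m = "m + 1 - 2 * k"
 obtain B bo where I0: "Inv0 adj (KL lev) A B bo s0" and lL: "\<forall>x. lev x < L" and wl0: "wl_ok s0" using I unfolding Inv1_def by iprover
 note aj = Inv0D(5)[OF I0]
 have xm: "x mod 8 = 1" "y mod 8 = 5" unfolding x_def y_def by presburger+
 have xn: "x \<in> nodes n" "y \<in> nodes n"
 proof -
  show "x \<in> nodes n" unfolding nodes_def by (rule image_eqI[of _ _ "2 * u"]) (use uv x_def in simp_all)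
  show "y \<in> nodes n" unfolding nodes_def by (rule image_eqI[of _ _ "2 * v + 1"]) (use uv y_def in simp_all)
 qed
 have kx: "adj x y \<longleftrightarrow> k = 1" unfolding x_def y_def by (rule k(2))
 have xM: "x < M" "y < M" using V_less xn by simp_all
 have mR: "m \<le> R" using pairs_card[OF I] m r by simp
 have lL': "lev z \<le> L" for z using lL by (simp add: less_imp_le)
 have Q0: "qu s0 = {}" using wl0 r unfolding wlok_def by simp
 define s1 where "s1 = fin \<pi> (Assign ''g'' (Const k) ;; Assign ''x'' (Plus (Times (Const 8) (rr ''u'')) (Const 1)) ;;
   Assign ''y'' (Plus (Times (Const 8) (rr ''v'')) (Const 5))) s0"
 have h1: "hp s1 = hp s0" "regs s1 = (regs s0)(''g'' := k, ''x'' := x, ''y'' := y)" unfolding s1_def x_def y_def using r by simp_all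
 have J1: "Inv1 adj lev A s1" by (rule Inv1_cong[OF I]) (use h1 wl0 in simp_all)
 have r1: "regs s1 ''x'' = x" "regs s1 ''y'' = y" "regs s1 ''g'' = k" "regs s1 ''R'' = R" using h1 r by simp_all
 have RM: "8 * R + 16 \<le> M" using M by simp
 have W: "x \<le> W" "y \<le> W" "k \<le> W" "8 * u + 1 \<le> W" "8 * v + 5 \<le> W" "m + 1 \<le> W" using xM k(1) MW mR M uv by linarith+
 have ne: "x \<noteq> y" by (rule notI) (use xm in simp)
 have P: "Phi ?adj lev \<le> Phi adj lev + 6 * real L / \<epsilon>"
 proof (cases "k = 0")
  case True
  have "Phi ?adj lev \<le> Phi adj lev + 6 * real L" using Phi_ins[OF good_adj[OF aj] xn, of lev] ne kx lL' True by simp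
  moreover have "6 * real L \<le> 6 * real L / \<epsilon>" using eps by (simp add: le_divide_eq mult_left_le)
  ultimately show ?thesis by linarith
 next case False
  hence "Phi ?adj lev \<le> Phi adj lev + 4 * real L / \<epsilon>" using Phi_del[OF good_adj[OF aj] xn, of lev] kx k(1) lL' by simp
  moreover have "4 * real L / \<epsilon> \<le> 6 * real L / \<epsilon>" using eps by (simp add: divide_right_mono)
  ultimately show ?thesis by linarith
 qed
 have newdirty: "z = x \<or> z = y" if "dirty ?adj lev z" for z
 proof (rule ccontr)
  assume "\<not> (z = x \<or> z = y)"
  hence "Dg ?adj lev z i = Dg adj lev z i" for i unfolding Dg_def upd_adj_def by simp
  hence "dirty adj lev z" using that unfolding dirty_def by simp
  thus False using nd by blast
 qed
 show ?thesis unfolding updc_def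
 proof (rule run_seq, rule run_fin[OF ok], goal_cases)
  case (3 t1)
  hence t1: "t1 \<le> 3" by simp
  have s1: "s1 = set_reg ''y'' y (set_reg ''x'' x (set_reg ''g'' k s0))" unfolding s1_def x_def y_def using r by simp
  have ok1: "okst s1" unfolding s1 by (intro okst_reg ok W)
  show ?case unfolding s1_def[symmetric]
  proof (rule run_seq, rule run_mono[OF run_addrec[OF ok1 J1, OF r1(1) xn(1) xm(1) r1(2) xn(2) xm(2) r1(3) k(1) kx r1(4) RM]], goal_cases)
   case (1 t2 s2)
   hence J2: "Inv1 ?adj lev ?A s2" and Q2: "qu s2 = qu s1" and R2: "regs s2 ''R'' = R + 1"
    and e2r: "regs s2 ''e'' = x" and e2: "eqx addset s1 s2" and t2: "t2 \<le> 4 * L + 100" and ok2: "okst s2" by - (elim conjE, assumption)+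
   have r2: "regs s2 ''m'' = m" "regs s2 ''n'' = n" "regs s2 ''L'' = L" "regs s2 ''y'' = y" using e2 h1 r by (simp_all add: eqx_def addset_def)
   define s3 where "s3 = fin \<pi> (Assign ''m'' (Minus (Plus (rr ''m'') (Const 1)) (Const (2 * k)))) s2"
   have s3: "s3 = set_reg ''m'' ?m s2" unfolding s3_def using r2 by simp
   have h3: "hp s3 = hp s2" "regs s3 = (regs s2)(''m'' := ?m)" unfolding s3 by simp_all
   have mW: "?m \<le> W" using W(6) by linarith
   have ok3: "okst s3" unfolding s3 by (rule okst_reg[OF ok2 mW])
   have w2: "wl_ok s2" using J2 unfolding Inv1_def by iprover
   have J3: "Inv1 ?adj lev ?A s3" by (rule Inv1_cong[OF J2]) (use h3 w2 in simp_all)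
   have w3: "wl_ok s3" using w2 h3 by simp
   have y3: "regs s3 ''y'' \<in> nodes n" "regs s3 ''y'' = y" using r2 h3 xn by simp_all
   show ?case
   proof (rule run_seq, rule run_fin[OF ok2], goal_cases)
    case (3 t3)
    hence t3: "t3 \<le> 1" by simp
    show ?case unfolding s3_def[symmetric]
    proof (rule run_seq, rule run_mono[OF run_pushwl[OF ok3 w3 y3(1)]], goal_cases)
     case (1 t4 s4)
     hence w4: "wl_ok s4" and Q4: "qu s4 = insert y (qu s3)"
      and f4: "\<forall>f. f \<noteq> WL \<longrightarrow> f \<noteq> INW \<longrightarrow> hp s4 f = hp s3 f" and e4: "eqx {''top''} s3 s4" and t4: "t4 \<le> 4" and ok4: "okst s4"
      unfolding y3(2) by - (elim conjE, assumption)+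
     have J4: "Inv1 ?adj lev ?A s4" by (rule Inv1_cong[OF J3]) (use f4 e4 w4 in \<open>simp_all add: eqx_def\<close>)
     have r4: "regs s4 ''e'' = x" "regs s4 ''m'' = ?m" "regs s4 ''n'' = n" "regs s4 ''L'' = L" "regs s4 ''R'' = R + 1"
      using e4 h3 e2r r2 R2 by (simp_all add: eqx_def)
     define s5 where "s5 = fin \<pi> (Assign ''y'' (rr ''e'')) s4"
     have s5: "s5 = set_reg ''y'' x s4" unfolding s5_def using r4 by simp
     have h5: "hp s5 = hp s4" "regs s5 = (regs s4)(''y'' := x)" unfolding s5 by simp_all
     have ok5: "okst s5" unfolding s5 by (rule okst_reg[OF ok4 W(1)])
     have J5: "Inv1 ?adj lev ?A s5" by (rule Inv1_cong[OF J4]) (use h5 w4 in simp_all)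
     have w5: "wl_ok s5" using w4 h5 by simp
     have y5: "regs s5 ''y'' \<in> nodes n" "regs s5 ''y'' = x" using h5 xn by simp_all
     show ?case
     proof (rule run_seq, rule run_fin[OF ok4], goal_cases)
      case (3 t5)
      hence t5: "t5 \<le> 1" by simp
      show ?case unfolding s5_def[symmetric]
      proof (rule run_seq, rule run_mono[OF run_pushwl[OF ok5 w5 y5(1)]], goal_cases)
       case (1 t6 s6)
       hence w6: "wl_ok s6" and Q6: "qu s6 = insert x (qu s5)"
        and f6: "\<forall>f. f \<noteq> WL \<longrightarrow> f \<noteq> INW \<longrightarrow> hp s6 f = hp s5 f" and e6: "eqx {''top''} s5 s6" and t6: "t6 \<le> 4" and ok6: "okst s6"
        unfolding y5(2) by - (elim conjE, assumption)+
       have J6: "Inv1 ?adj lev ?A s6" by (rule Inv1_cong[OF J5]) (use f6 e6 w6 in \<open>simp_all add: eqx_def\<close>)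
       have r6: "regs s6 ''m'' = ?m" "regs s6 ''n'' = n" "regs s6 ''L'' = L" "regs s6 ''R'' = R + 1" using e6 h5 r4 by (simp_all add: eqx_def)
       have QQ: "qu s6 = {x, y}" using Q6 h5 Q4 h3 Q2 h1 Q0 by simp
       have cQ: "card (qu s6) = 2" unfolding QQ using ne by simp
       have dq: "z \<in> qu s6" if "dirty ?adj lev z" for z unfolding QQ using newdirty[OF that] by simp
       show ?case
       proof (rule run_seq, rule run_mono[OF run_fixup[OF ok6 J6 dq r6(3)]], goal_cases)
        case (1 z) thus ?case .
       next case (2 t7 s7)
        from 2(1) obtain lev7 A7 where A7: "A7 \<subseteq> ?A" and J7: "Inv1 ?adj lev7 A7 s7" and nd7: "\<forall>x. \<not> dirty ?adj lev7 x"
         and top7: "regs s7 ''top'' = 0" and e7: "eqx fxset s6 s7"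
         and t7: "real t7 + fxpot ?adj (lev7, A7, 0) \<le> fxpot ?adj (lev, ?A, card (qu s6)) + 1" by iprover
        note ok7 = 2(2)
        have r7: "regs s7 ''m'' = ?m" "regs s7 ''n'' = n" "regs s7 ''L'' = L" "regs s7 ''R'' = R + 1"
         using e7 r6 by (simp_all add: eqx_def fxset_def mvset_def)
        have fA: "finite A" using recok_card(2)[OF Inv0D(4)[OF I0]] .
        have "card ?A \<le> card A + 2" using fA card_insert_le_m1[of 2] by (simp add: card_insert_if)
        hence cA: "real (card ?A) \<le> real (card A) + 2" by linarith
        define X where "X = real L / \<epsilon>"
        have X1: "real L \<le> X" "1 \<le> X"
        proof -
         show a: "real L \<le> X" unfolding X_def using eps by (simp add: le_divide_eq mult_left_le)
         thus "1 \<le> X" using L1 by linarith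
        qed
        have P': "Phi ?adj lev \<le> Phi adj lev + 6 * X" using P unfolding X_def by simp
        \<comment> \<open>\<open>3000 * X\<close> is 500 times the increase of \<open>Phi\<close>;
          105 is made up of 44 for two new half-edges, 60 for two queued nodes, and 1.\<close>
        have "fxpot ?adj (lev, ?A, card (qu s6)) + 1 \<le> fxpot adj (lev, A, 0) + 3000 * X + 105" unfolding fxpot_def cQ using P' cA by simp
        moreover have "real t2 \<le> 4 * real L + 100" using t2 by linarith
        ultimately have T: "real (t1 + (t2 + (t3 + (t4 + (t5 + (t6 + t7)))))) + fxpot ?adj (lev7, A7, 0) + 3
          \<le> fxpot adj (lev, A, 0) + 3600 * X" using t7 t1 t3 t4 t5 t6 X1 by simp
        have k01: "k = 0 \<or> k = 1" using k(1) by linarith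
        have km: "1 \<le> m" if "k = 1"
        proof -
         have "(x, y) \<in> pairs adj" using kx that xm unfolding pairs_def by simp
         moreover have "finite (pairs adj)"
         proof (rule finite_subset[of _ "nodes n \<times> nodes n"])
          show "pairs adj \<subseteq> nodes n \<times> nodes n" using aj unfolding pairs_def adjok_def by blast
         qed (simp add: finite_nodes)
         ultimately show ?thesis unfolding m by (metis Suc_leI One_nat_def card_gt_0_iff empty_iff)
        qed
        have rm: "real ?m = real m + 1 - 2 * real k" using k01 km by (elim disjE) simp_all
        \<comment> \<open>An insertion adds a record and an edge and leaves the excess as it is; a
          deletion adds a record and takes an edge away, so the excess grows by 2.\<close>
        have Z: "2200 * real L * (real (R + 1) - real ?m) \<le> 2200 * real L * (real R - real m) + 4400 * X"
        proof -
         have "real (R + 1) - real ?m \<le> real R - real m + 2" using rm k01 by (elim disjE) simp_all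
         hence "2200 * real L * (real (R + 1) - real ?m) \<le> 2200 * real L * (real R - real m + 2)" by (intro mult_left_mono) simp_all
         also have "\<dots> = 2200 * real L * (real R - real m) + 4400 * real L" by (simp add: algebra_simps)
         finally show ?thesis using X1 by linarith
        qed
        have X8: "8000 * real L / \<epsilon> = 8000 * X" unfolding X_def by simp
        have mp': "?m = card (pairs ?adj)" using mp unfolding x_def y_def by simp
        let ?T = "t1 + (t2 + (t3 + (t4 + (t5 + (t6 + t7)))))"
        let ?Q = "\<lambda>t s. \<exists>lev' A'. mach.Inv1 (8 * n + 8 * regs s ''R'' + 8) n L ?adj lev' A' s \<and>
         ram.okst (8 * n + 8 * regs s ''R'' + 8) W s \<and> (\<forall>x. \<not> dirty ?adj lev' x) \<and>
         regs s ''n'' = n \<and> regs s ''L'' = L \<and> regs s ''top'' = 0 \<and> regs s ''m'' = ?m \<and> regs s ''R'' \<le> 3 * ?m + 2 * n \<and>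
         real t + fxpot ?adj (lev', A', 0) + 2200 * real L * (real (regs s ''R'') - real ?m) \<le>
         fxpot adj (lev, A, 0) + 2200 * real L * (real R - real m) + 8000 * real L / \<epsilon>"
        have fin: "run (Cond (Less (Plus (Times (Const 3) (rr ''m'')) (Times (Const 2) (rr ''n''))) (rr ''R'')) rebuild Skip) s7
         (\<lambda>t. ?Q (t1 + (t2 + (t3 + (t4 + (t5 + (t6 + (t7 + t))))))))"
        proof (rule run_cond[OF ok7], goal_cases)
         case 1
         hence big: "3 * ?m + 2 * n < R + 1" using r7 by simp
         have M7: "M = 8 * n + 8 * regs s7 ''R'' + 8" using M r7 by simp
         show ?case
         proof (rule run_mono[OF run_rebuild[OF ok7 J7 r7(2) r7(1) top7 M7 mp']], goal_cases)
          case (1 t8 s8)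
          from 1(1) obtain A8 where J8: "mach.Inv1 (8 * n + 8 * ?m + 8) n L ?adj lev7 A8 s8"
           and ok8: "ram.okst (8 * n + 8 * ?m + 8) W s8" and R8: "regs s8 ''R'' = ?m" and e8: "eqx rbset s7 s8"
           and t8: "t8 + 22 * card A8 \<le> 22 * card A7 + 744 * regs s7 ''R'' + 640 * n + (4 * L + 148) * ?m + 660" by iprover
          have r8: "regs s8 ''m'' = ?m" "regs s8 ''n'' = n" "regs s8 ''L'' = L" "regs s8 ''top'' = 0"
           using e8 r7 top7 by (simp_all add: eqx_def rbset_def clset_def addset_def)
          define z where "z = real (R + 1) - real ?m"
          define a where "a = real ?m"
          have "real (3 * ?m + 2 * n) + 1 \<le> real (R + 1)" using big by linarith
          hence z1: "2 * a + 2 * real n + 1 \<le> z" unfolding z_def a_def by simp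
          have a0: "0 \<le> a" unfolding a_def by simp
          have l1: "1 \<le> real L" using L1 by simp
          have n0: "0 \<le> real n" by simp
          have e: "real (22 * c + 744 * p + 640 * n + (4 * L + 148) * q + 660) =
           22 * real c + 744 * real p + 640 * real n + (4 * real L + 148) * real q + 660" for c p q by simp
          have ra: "real (R + 1) = z + a" unfolding z_def a_def by simp
          have "real (t8 + 22 * card A8) \<le> real (22 * card A7 + 744 * (R + 1) + 640 * n + (4 * L + 148) * ?m + 660)"
           using t8 unfolding r7 by (simp only: of_nat_le_iff)
          hence "real (t8 + 22 * card A8) \<le> 22 * real (card A7) + 744 * (z + a) + 640 * real n + (4 * real L + 148) * a + 660"
           unfolding e ra a_def[symmetric] .
          hence t8': "real t8 + 22 * real (card A8) \<le> 22 * real (card A7) + 744 * (z + a) + 640 * real n + (4 * real L + 148) * a + 660"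
           by simp
          \<comment> \<open>Past the threshold the excess \<open>z\<close> is at least
            \<open>2 * a + 2 * n + 1\<close> and dominates both edges and nodes. The slack
            \<open>4 * a\<close> on the right is set aside so that, after multiplication by
            \<open>L\<close>, it absorbs the term \<open>4 * L * a\<close>.\<close>
          have "744 * (z + a) + 640 * real n + 148 * a + 660 \<le> 2100 * z - 4 * a" using z1 a0 n0 by argo
          moreover have "0 \<le> (real L - 1) * (2100 * z - 4 * a)" using l1 z1 a0 n0 by (intro mult_nonneg_nonneg) argo+
          ultimately have "744 * (z + a) + 640 * real n + (4 * real L + 148) * a + 660 \<le> 2100 * real L * z" by (simp add: algebra_simps)
          moreover have "2100 * real L * z \<le> 2200 * real L * z" using z1 a0 by (intro mult_right_mono) simp_all
          ultimately have t9: "real t8 + 22 * real (card A8) \<le> 22 * real (card A7) + 2200 * real L * (real (R + 1) - real ?m)"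
           using t8' unfolding z_def by linarith
          have fx: "fxpot ?adj (lev7, A8, 0) = fxpot ?adj (lev7, A7, 0) + 22 * real (card A8) - 22 * real (card A7)"
           unfolding fxpot_def by simp
          have pt: "real (t1 + (t2 + (t3 + (t4 + (t5 + (t6 + (t7 + Suc t8))))))) + fxpot ?adj (lev7, A8, 0) + 2200 * real L * (real (regs s8 ''R'') - real ?m) \<le>
           fxpot adj (lev, A, 0) + 2200 * real L * (real R - real m) + 8000 * real L / \<epsilon>"
           unfolding R8 X8 fx using T Z t9 X1 by simp
          have R9: "regs s8 ''R'' \<le> 3 * ?m + 2 * n" unfolding R8 by simp
          show ?case by (rule exI[of _ lev7], rule exI[of _ A8])
            (intro conjI J8[folded R8] ok8[folded R8] nd7 r8(2,3,4,1) R9 pt)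
         qed
        next case 2
         hence small: "regs s7 ''R'' \<le> 3 * ?m + 2 * n" using r7 by simp
         have M7: "M = 8 * n + 8 * regs s7 ''R'' + 8" using M r7 by simp
         have pt: "real (t1 + (t2 + (t3 + (t4 + (t5 + (t6 + (t7 + Suc 1))))))) + fxpot ?adj (lev7, A7, 0) + 2200 * real L * (real (regs s7 ''R'') - real ?m) \<le>
           fxpot adj (lev, A, 0) + 2200 * real L * (real R - real m) + 8000 * real L / \<epsilon>" unfolding r7 X8 using T Z X1 by simp
         have "?Q (t1 + (t2 + (t3 + (t4 + (t5 + (t6 + (t7 + Suc 1))))))) s7" by (rule exI[of _ lev7], rule exI[of _ A7])
           (intro conjI J7[unfolded M7] ok7[unfolded M7] nd7 r7(2,3) top7 r7(1) small pt)
         thus ?case by (rule run_skip[OF ok7])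
        qed
        show ?case using fin unfolding Let_def x_def y_def .
       qed
      qed
     qed simp_all
    qed
   qed (use r2 mW in simp_all)
  qed
 qed (use r W in simp_all)
qed

end

section \<open>The dynamic algorithm\<close>

definition adjE :: "(nat \<times> nat) set \<Rightarrow> nat \<Rightarrow> nat \<Rightarrow> bool" where
 "adjE E x y \<longleftrightarrow> (\<exists>u v. (u, v) \<in> E \<and> (x = 8 * u + 1 \<and> y = 8 * v + 5 \<or> x = 8 * v + 5 \<and> y = 8 * u + 1))"

lemma ids_distinct: "8 * u + 1 \<noteq> 8 * v + (5::nat)" by presburger

lemma ids_distinct': "8 * v + (5::nat) = 8 * u + 1 \<longleftrightarrow> False" by presburger

lemma adjE_src: "adjE E (8 * u + 1) y \<longleftrightarrow> (\<exists>v. (u, v) \<in> E \<and> y = 8 * v + 5)"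
 unfolding adjE_def using ids_distinct by auto

lemma adjE_tgt: "adjE E (8 * v + 5) y \<longleftrightarrow> (\<exists>u. (u, v) \<in> E \<and> y = 8 * u + 1)"
 unfolding adjE_def ids_distinct' by auto

lemma adjE_ins: "upd_adj (adjE E) (8 * u + 1) (8 * v + 5) True = adjE (insert (u, v) E)" by (intro ext) (auto simp: upd_adj_def adjE_def)

lemma adjE_del: "upd_adj (adjE E) (8 * u + 1) (8 * v + 5) False = adjE (E - {(u, v)})"
proof (intro ext)
 fix x y
 show "upd_adj (adjE E) (8 * u + 1) (8 * v + 5) False x y = adjE (E - {(u, v)}) x y"
 proof (cases "x = 8 * u + 1 \<and> y = 8 * v + 5 \<or> x = 8 * v + 5 \<and> y = 8 * u + 1")
  case True
  hence "\<not> adjE (E - {(u, v)}) x y"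
  proof (elim disjE conjE)
   assume "x = 8 * u + 1" "y = 8 * v + 5"
   thus ?thesis unfolding \<open>x = 8 * u + 1\<close> adjE_src by simp
  next
   assume "x = 8 * v + 5" "y = 8 * u + 1"
   thus ?thesis unfolding \<open>x = 8 * v + 5\<close> adjE_tgt by simp
  qed
  thus ?thesis using True unfolding upd_adj_def by auto
 next case False
  hence "adjE E x y = adjE (E - {(u, v)}) x y" unfolding adjE_def by blast
  thus ?thesis using False unfolding upd_adj_def by auto
 qed
qed

lemma pairs_adjE: "card (pairs (adjE E)) = card E"
proof -
 have m: "(8 * v + 5) mod 8 = (5::nat)" "(8 * v + 1) mod 8 = (1::nat)" for v by presburger+
 have "(x, y) \<in> pairs (adjE E) \<longleftrightarrow> (x, y) \<in> (\<lambda>(u, v). (8 * u + 1, 8 * v + 5)) ` E" for x y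
 proof
  assume "(x, y) \<in> pairs (adjE E)"
  then obtain u v where uv: "(u, v) \<in> E" "x = 8 * u + 1 \<and> y = 8 * v + 5 \<or> x = 8 * v + 5 \<and> y = 8 * u + 1" "x mod 8 = 1"
   unfolding pairs_def adjE_def by blast
  hence "x = 8 * u + 1 \<and> y = 8 * v + 5" using m[of v] by (elim disjE) simp_all
  thus "(x, y) \<in> (\<lambda>(u, v). (8 * u + 1, 8 * v + 5)) ` E" using uv(1) by (intro image_eqI[of _ _ "(u, v)"]) simp_all
 next
  assume "(x, y) \<in> (\<lambda>(u, v). (8 * u + 1, 8 * v + 5)) ` E"
  then obtain u v where uv: "(u, v) \<in> E" "x = 8 * u + 1" "y = 8 * v + 5" by auto
  hence "adjE E x y" unfolding adjE_def by blast
  thus "(x, y) \<in> pairs (adjE E)" using m(2)[of u] uv unfolding pairs_def by simp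
 qed
 hence "pairs (adjE E) = (\<lambda>(u, v). (8 * u + 1, 8 * v + 5)) ` E" by auto
 moreover have "inj_on (\<lambda>(u, v). (8 * u + 1, 8 * v + (5::nat))) E" by (auto simp: inj_on_def)
 ultimately show ?thesis by (simp add: card_image)
qed

text \<open>\<open>LEV\<close> is the level minus 1 while the index i starts at 1, so i at most the
  level reads i < \<open>LEV\<close> + 2.\<close>

definition dalg :: dyn_alg where
 "dalg = \<lparr>on_insert = updc 0, on_delete = updc 1,
  test_S = Less (rr ''i'') (Plus (ld LEV (Plus (Times (Const 8) (rr ''x'')) (Const 1))) (Const 2)),
  test_T = Less (rr ''i'') (Plus (ld LEV (Plus (Times (Const 8) (rr ''x'')) (Const 5))) (Const 2))\<rparr>"

lemma fam_dalg:
 "fam_S dalg \<pi> n s i = {Src u | u. u < n \<and> i < hp s LEV (8 * u + 1) + 2}"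
 "fam_T dalg \<pi> n s i = {Tgt v | v. v < n \<and> i < hp s LEV (8 * v + 5) + 2}"
proof -
 have m: "mem (set_reg x a s) = mem s" for x a s unfolding set_reg_def by simp
 show "fam_S dalg \<pi> n s i = {Src u | u. u < n \<and> i < hp s LEV (8 * u + 1) + 2}"
  "fam_T dalg \<pi> n s i = {Tgt v | v. v < n \<and> i < hp s LEV (8 * v + 5) + 2}"
  unfolding fam_S_def fam_T_def dalg_def by (simp_all add: m mem_adr)
qed

lemma node_ids: "u < n \<Longrightarrow> 8 * u + 1 \<in> nodes n" "v < n \<Longrightarrow> 8 * v + 5 \<in> nodes n"
proof -
 show "u < n \<Longrightarrow> 8 * u + 1 \<in> nodes n" unfolding nodes_def by (rule image_eqI[of _ _ "2 * u"]) simp_all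
 show "v < n \<Longrightarrow> 8 * v + 5 \<in> nodes n" unfolding nodes_def by (rule image_eqI[of _ _ "2 * v + 1"]) simp_all
qed

lemma state_after_Cons: "state_after s (tr # trs) (Suc j) = state_after (last tr) trs j" unfolding state_after_def by (cases j) simp_all

section \<open>The invariant over a sequence of updates\<close>

locale alg =
 fixes \<pi> W n L \<alpha> \<epsilon> dS dT
 assumes base: "dec \<pi> (8 * n + 8) W n L \<alpha> \<epsilon> dS dT" and WW: "16 * (8 * n + 8 * (3 * (n * n) + 2 * n) + 16) + L + 3 \<le> W"
begin

lemma dec_at:
 assumes "8 * n + 8 \<le> M" "M \<le> 8 * n + 8 * (3 * (n * n) + 2 * n) + 16"
 shows "dec \<pi> M W n L \<alpha> \<epsilon> dS dT"
proof -
 interpret B: dec \<pi> "8 * n + 8" W n L \<alpha> \<epsilon> dS dT by (rule base)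
 have mw: "16 * M + L + 3 \<le> W" using mult_le_mono2[OF assms(2), of 16] WW by linarith
 show ?thesis by unfold_locales (use mw assms(1) B.eps B.alpha B.dpos B.L1 B.params in simp_all)
qed

text \<open>The real \<open>p\<close> is the amortised credit. The space is tied to the current
  number of records; since this is at most 3 |E| + 2 n and |E| \<le> n * n, one word size serves the
  whole sequence.\<close>

definition GI :: "(nat \<times> nat) set \<Rightarrow> state \<Rightarrow> real \<Rightarrow> bool" where
 "GI E s p \<longleftrightarrow> E \<subseteq> {..<n} \<times> {..<n} \<and> regs s ''n'' = n \<and> regs s ''L'' = L \<and> regs s ''top'' = 0 \<and>
  regs s ''m'' = card E \<and> regs s ''R'' \<le> 3 * card E + 2 * n \<and>
  (\<exists>lev A. mach.Inv1 (8 * n + 8 * regs s ''R'' + 8) n L (adjE E) lev A s \<and> ram.okst (8 * n + 8 * regs s ''R'' + 8) W s \<and>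
    (\<forall>x. \<not> dec.dirty n L \<alpha> dS dT (adjE E) lev x) \<and>
    p = dec.fxpot n L \<alpha> \<epsilon> dS dT (adjE E) (lev, A, 0) + 2200 * real L * (real (regs s ''R'') - real (card E)))"

lemma card_E: "E \<subseteq> {..<n} \<times> {..<n} \<Longrightarrow> finite E \<and> card E \<le> n * n"
 using card_mono[of "{..<n} \<times> {..<n}" E] finite_subset[of E "{..<n} \<times> {..<n}"] by (simp add: card_cartesian_product)

lemma GI_dec:
 assumes "GI E s p"
 shows "dec \<pi> (8 * n + 8 * regs s ''R'' + 8) W n L \<alpha> \<epsilon> dS dT" "dec \<pi> (8 * n + 8 * regs s ''R'' + 16) W n L \<alpha> \<epsilon> dS dT"
proof -
 have "E \<subseteq> {..<n} \<times> {..<n}" "regs s ''R'' \<le> 3 * card E + 2 * n" using assms unfolding GI_def by simp_all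
 hence "regs s ''R'' \<le> 3 * (n * n) + 2 * n" using card_E[of E] by linarith
 hence "8 * regs s ''R'' \<le> 8 * (3 * (n * n) + 2 * n)" by (rule mult_le_mono2)
 thus "dec \<pi> (8 * n + 8 * regs s ''R'' + 8) W n L \<alpha> \<epsilon> dS dT" "dec \<pi> (8 * n + 8 * regs s ''R'' + 16) W n L \<alpha> \<epsilon> dS dT"
  by (intro dec_at; linarith)+
qed

lemma GI_nonneg:
 assumes "GI E s p" shows "0 \<le> p"
proof -
 interpret D: dec \<pi> "8 * n + 8 * regs s ''R'' + 8" W n L \<alpha> \<epsilon> dS dT by (rule GI_dec[OF assms])
 obtain lev A where I: "D.Inv1 (adjE E) lev A s" and p: "p = D.fxpot (adjE E) (lev, A, 0) + 2200 * real L * (real (regs s ''R'') - real (card E))"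
  using assms unfolding GI_def by iprover
 have "\<forall>x. lev x < L" using I unfolding D.Inv1_def by iprover
 hence "0 \<le> D.Phi (adjE E) lev" by (intro D.Phi_nonneg) (simp add: less_imp_le)
 hence "0 \<le> D.fxpot (adjE E) (lev, A, 0)" unfolding D.fxpot_def by simp
 moreover have "0 \<le> 2200 * real L * (real (regs s ''R'') - real (card E))"
  using D.pairs_card[OF I] unfolding pairs_adjE by (intro mult_nonneg_nonneg) simp_all
 ultimately show ?thesis unfolding p by simp
qed

lemma GI_init: "GI {} (init_state n L) 0"
proof -
 let ?s = "init_state n L"
 interpret D: dec \<pi> "8 * n + 8" W n L \<alpha> \<epsilon> dS dT by (rule base)
 have z: "hp ?s f a = 0" for f a unfolding init_state_def hp_def by simp
 have r: "regs ?s ''R'' = 0" "regs ?s ''nb'' = 0" "regs ?s ''nf'' = 0" "regs ?s ''top'' = 0" "regs ?s ''m'' = 0"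
  "regs ?s ''n'' = n" "regs ?s ''L'' = L" unfolding init_state_def by simp_all
 have ad: "adjE {} = (\<lambda>_ _. False)" by (intro ext) (simp add: adjE_def)
 have I: "D.Inv1 (adjE {}) (\<lambda>_. 0) {} ?s" unfolding ad by (rule D.Inv1_empty[OF _ r(1-4)]) (use z D.L1 in simp_all)
 have "n \<le> W" "L \<le> W" using D.MW by simp_all
 hence ok: "D.okst ?s" unfolding D.okst_def fits_space_def fits_words_def init_state_def by simp
 have Dg0: "Dg (adjE {}) (\<lambda>_. 0) x i = 0" for x i unfolding Dg_def ad by simp
 have "0 \<le> \<alpha> * D.dd x" for x using D.alpha D.eps D.d0 by (intro mult_nonneg_nonneg) simp_all
 hence nd: "\<forall>x. \<not> D.dirty (adjE {}) (\<lambda>_. 0) x" unfolding D.dirty_def Dg0 by (auto simp: not_less)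
 have "D.Phi (adjE {}) (\<lambda>_. 0) = 0" by (rule D.Phi_zero) (simp add: ad)
 hence p: "0 = D.fxpot (adjE {}) (\<lambda>_. 0, {}, 0) + 2200 * real L * (real (regs ?s ''R'') - real (card ({} :: (nat \<times> nat) set)))"
  unfolding D.fxpot_def r by simp
 have M: "8 * n + 8 * regs ?s ''R'' + 8 = 8 * n + 8" using r by simp
 show ?thesis unfolding GI_def M using r by (intro conjI exI[of _ "\<lambda>_. 0"] exI[of _ "{}"] I ok nd p) simp_all
qed

lemma GI_step:
 assumes G: "GI E s p" and uv: "u < n" "v < n" and k: "k \<le> 1" "(u, v) \<in> E \<longleftrightarrow> k = 1"
  and E': "E' = (if k = 0 then insert (u, v) E else E - {(u, v)})"
 shows "\<exists>tr p'. exec \<pi> (updc k) (set_reg ''u'' u (set_reg ''v'' v s)) tr \<and> GI E' (last tr) p' \<and>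
  real (length tr) + p' \<le> p + 8000 * real L / \<epsilon> \<and>
  (\<forall>s'\<in>set tr. fits_space (8000 * (2 * n + card E')) s' \<and> fits_words W s')"
proof -
 let ?s = "set_reg ''u'' u (set_reg ''v'' v s)" and ?R = "regs s ''R''"
 let ?M = "8 * n + 8 * ?R + 16"
 interpret B: dec \<pi> "8 * n + 8 * ?R + 8" W n L \<alpha> \<epsilon> dS dT by (rule GI_dec[OF G])
 interpret D: dec \<pi> ?M W n L \<alpha> \<epsilon> dS dT by (rule GI_dec[OF G])
 obtain lev A where IB: "B.Inv1 (adjE E) lev A s" and okB: "B.okst s" and nd: "\<forall>x. \<not> D.dirty (adjE E) lev x"
  and p: "p = D.fxpot (adjE E) (lev, A, 0) + 2200 * real L * (real ?R - real (card E))"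
  and En: "E \<subseteq> {..<n} \<times> {..<n}" and r: "regs s ''n'' = n" "regs s ''L'' = L" "regs s ''top'' = 0" "regs s ''m'' = card E"
  and RE: "?R \<le> 3 * card E + 2 * n" using G unfolding GI_def by iprover
 have fE: "finite E" using card_E[OF En] by simp
 have E'n: "E' \<subseteq> {..<n} \<times> {..<n}" using En uv unfolding E' by auto
 have I: "D.Inv1 (adjE E) lev A s" by (rule Inv1_mono[OF B.mach_axioms D.mach_axioms _ IB]) simp
 have wl: "wlok n (hp s) (regs s ''top'')" using I unfolding D.Inv1_def by iprover
 have I': "D.Inv1 (adjE E) lev A ?s" by (rule D.Inv1_cong[OF I]) (use wl in simp_all)
 have "n \<le> W" using B.MW by simp
 hence uW: "u \<le> W" "v \<le> W" using uv by simp_all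
 have "D.okst s" using okB unfolding ram.okst_def fits_space_def by simp
 hence ok: "D.okst ?s" by (intro D.okst_reg uW)
 have rs: "regs ?s ''u'' = u" "regs ?s ''v'' = v" "regs ?s ''n'' = n" "regs ?s ''L'' = L" "regs ?s ''top'' = 0"
  "regs ?s ''m'' = card E" "regs ?s ''R'' = ?R" using r by simp_all
 have ka: "adjE E (8 * u + 1) (8 * v + 5) \<longleftrightarrow> k = 1" unfolding adjE_src using k(2) by simp
 have k01: "k = 0 \<or> k = 1" using k(1) by linarith
 have ad: "upd_adj (adjE E) (8 * u + 1) (8 * v + 5) (k = 0) = adjE E'"
  using adjE_ins[of E u v] adjE_del[of E u v] unfolding E' by (cases "k = 0") simp_all
 have cE: "card E' = card E + 1 - 2 * k"
 proof (cases "k = 0")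
  case True
  thus ?thesis using k fE unfolding E' by simp
 next case False
  hence "k = 1" using k01 by simp
  thus ?thesis using k fE unfolding E' by simp
 qed
 have mp: "card (pairs (upd_adj (adjE E) (8 * u + 1) (8 * v + 5) (k = 0))) = card E + 1 - 2 * k" unfolding ad pairs_adjE by (rule cE)
 note run = D.run_upd[OF ok I', OF spec[OF nd], OF rs uv k(1) ka refl pairs_adjE[symmetric] mp, unfolded ad Let_def cE[symmetric]]
 obtain tr where tr: "exec \<pi> (updc k) ?s tr" and okt: "\<forall>s'\<in>set tr. D.okst s'"
  and Q: "\<exists>lev' A'. mach.Inv1 (8 * n + 8 * regs (last tr) ''R'' + 8) n L (adjE E') lev' A' (last tr) \<and>
  ram.okst (8 * n + 8 * regs (last tr) ''R'' + 8) W (last tr) \<and> (\<forall>x. \<not> D.dirty (adjE E') lev' x) \<and>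
  regs (last tr) ''n'' = n \<and> regs (last tr) ''L'' = L \<and> regs (last tr) ''top'' = 0 \<and> regs (last tr) ''m'' = card E' \<and>
  regs (last tr) ''R'' \<le> 3 * card E' + 2 * n \<and>
  real (length tr) + D.fxpot (adjE E') (lev', A', 0) + 2200 * real L * (real (regs (last tr) ''R'') - real (card E')) \<le>
   D.fxpot (adjE E) (lev, A, 0) + 2200 * real L * (real ?R - real (card E)) + 8000 * real L / \<epsilon>" using run unfolding D.run_def by iprover
 from Q obtain lev' A' where J: "mach.Inv1 (8 * n + 8 * regs (last tr) ''R'' + 8) n L (adjE E') lev' A' (last tr)"
  and okl: "ram.okst (8 * n + 8 * regs (last tr) ''R'' + 8) W (last tr)" and nd': "\<forall>x. \<not> D.dirty (adjE E') lev' x"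
  and r': "regs (last tr) ''n'' = n" "regs (last tr) ''L'' = L" "regs (last tr) ''top'' = 0" "regs (last tr) ''m'' = card E'"
  "regs (last tr) ''R'' \<le> 3 * card E' + 2 * n"
  and t: "real (length tr) + D.fxpot (adjE E') (lev', A', 0) + 2200 * real L * (real (regs (last tr) ''R'') - real (card E')) \<le>
   D.fxpot (adjE E) (lev, A, 0) + 2200 * real L * (real ?R - real (card E)) + 8000 * real L / \<epsilon>" by iprover
 define q where "q = D.fxpot (adjE E') (lev', A', 0) + 2200 * real L * (real (regs (last tr) ''R'') - real (card E'))"
 have GG: "GI E' (last tr) q" unfolding GI_def q_def by (intro conjI E'n r' exI[of _ lev'] exI[of _ A'] J okl nd' refl)
 have cl: "card E \<le> card E' + 1" using cE k01 by linarith
 have n1: "1 \<le> n" using uv by simp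
 \<comment> \<open>\<open>E'\<close> may have one edge fewer than \<open>E\<close>, and
   \<open>n\<close> is at least 1 because the update names a node; the constants are thus absorbed
   by the term for the nodes.\<close>
 have sp: "16 * ?M \<le> 8000 * (2 * n + card E')" using RE cl n1 by (simp add: algebra_simps)
 have fits: "\<forall>s'\<in>set tr. fits_space (8000 * (2 * n + card E')) s' \<and> fits_words W s'"
  using okt sp unfolding D.okst_def fits_space_def by (meson order_trans)
 have tq: "real (length tr) + q \<le> p + 8000 * real L / \<epsilon>" using t unfolding q_def p by linarith
 show ?thesis by (rule exI[of _ tr], rule exI[of _ q]) (intro conjI tr GG tq fits)
qed

lemma GI_run:
 assumes "GI E s p" "\<And>k. k < length us \<Longrightarrow> legal_update n (fold apply_update (take k us) E) (us ! k)"
 shows "\<exists>trs. exec_updates dalg \<pi> s us trs \<and> real (total_time trs) \<le> p + real (length us) * (8000 * real L / \<epsilon>) \<and>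
  (\<forall>k\<le>length us. \<exists>q. GI (fold apply_update (take k us) E) (state_after s trs k) q) \<and>
  (\<forall>k<length us. \<forall>s'\<in>set (trs ! k).
   fits_space (8000 * (2 * n + card (fold apply_update (take (Suc k) us) E))) s' \<and> fits_words W s')" using assms
proof (induction us arbitrary: E s p)
 case Nil
 have "exec_updates dalg \<pi> s [] []" by (rule exec_updates.Nil)
 thus ?case using Nil(1) GI_nonneg[OF Nil(1)] by (intro exI[of _ "[]"]) (auto simp: total_time_def state_after_def)
next case (Cons x us)
 have leg: "legal_update n E x" using Cons.prems(2)[of 0] by simp
 obtain tr p' where tr: "exec_update dalg \<pi> x s tr" and G: "GI (apply_update x E) (last tr) p'"
  and t: "real (length tr) + p' \<le> p + 8000 * real L / \<epsilon>"
  and f: "\<forall>s'\<in>set tr. fits_space (8000 * (2 * n + card (apply_update x E))) s' \<and> fits_words W s'"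
 proof (cases x)
  case (Ins u v)
  have "\<exists>tr p'. exec \<pi> (updc 0) (set_reg ''u'' u (set_reg ''v'' v s)) tr \<and> GI (apply_update x E) (last tr) p' \<and>
   real (length tr) + p' \<le> p + 8000 * real L / \<epsilon> \<and>
   (\<forall>s'\<in>set tr. fits_space (8000 * (2 * n + card (apply_update x E))) s' \<and> fits_words W s')"
   by (rule GI_step[OF Cons.prems(1), of u v 0]) (use leg Ins in simp_all)
  then obtain tr p' where "exec \<pi> (updc 0) (set_reg ''u'' u (set_reg ''v'' v s)) tr" "GI (apply_update x E) (last tr) p'"
   "real (length tr) + p' \<le> p + 8000 * real L / \<epsilon>"
   "\<forall>s'\<in>set tr. fits_space (8000 * (2 * n + card (apply_update x E))) s' \<and> fits_words W s'" by iprover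
  thus ?thesis using that[of tr p'] Ins by (simp add: dalg_def)
 next case (Del u v)
  have "\<exists>tr p'. exec \<pi> (updc 1) (set_reg ''u'' u (set_reg ''v'' v s)) tr \<and> GI (apply_update x E) (last tr) p' \<and>
   real (length tr) + p' \<le> p + 8000 * real L / \<epsilon> \<and>
   (\<forall>s'\<in>set tr. fits_space (8000 * (2 * n + card (apply_update x E))) s' \<and> fits_words W s')"
   by (rule GI_step[OF Cons.prems(1), of u v 1]) (use leg Del in simp_all)
  then obtain tr p' where "exec \<pi> (updc 1) (set_reg ''u'' u (set_reg ''v'' v s)) tr" "GI (apply_update x E) (last tr) p'"
   "real (length tr) + p' \<le> p + 8000 * real L / \<epsilon>"
   "\<forall>s'\<in>set tr. fits_space (8000 * (2 * n + card (apply_update x E))) s' \<and> fits_words W s'" by iprover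
  thus ?thesis using that[of tr p'] Del by (simp add: dalg_def)
 qed
 have leg': "legal_update n (fold apply_update (take k us) (apply_update x E)) (us ! k)" if "k < length us" for k
  using Cons.prems(2)[of "Suc k"] that by simp
 obtain trs where trs: "exec_updates dalg \<pi> (last tr) us trs"
  and tt: "real (total_time trs) \<le> p' + real (length us) * (8000 * real L / \<epsilon>)"
  and inv: "\<forall>k\<le>length us. \<exists>q. GI (fold apply_update (take k us) (apply_update x E)) (state_after (last tr) trs k) q"
  and ff: "\<forall>k<length us. \<forall>s'\<in>set (trs ! k).
   fits_space (8000 * (2 * n + card (fold apply_update (take (Suc k) us) (apply_update x E)))) s' \<and> fits_words W s'"
  using Cons.IH[OF G leg'] by iprover
 have a: "exec_updates dalg \<pi> s (x # us) (tr # trs)" by (rule exec_updates.Cons[OF tr trs])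
 have b: "real (total_time (tr # trs)) \<le> p + real (length (x # us)) * (8000 * real L / \<epsilon>)"
 proof -
  define z where "z = 8000 * real L / \<epsilon>"
  have "real (total_time (tr # trs)) = real (length tr) + real (total_time trs)" unfolding total_time_def by simp
  moreover have "real (length (x # us)) * z = z + real (length us) * z" by (simp add: distrib_right)
  ultimately show ?thesis using tt t unfolding z_def[symmetric] by linarith
 qed
 have c: "\<exists>q. GI (fold apply_update (take k (x # us)) E) (state_after s (tr # trs) k) q" if "k \<le> length (x # us)" for k
 proof (cases k)
  case 0
  thus ?thesis using Cons.prems(1) by (auto simp: state_after_def)
 next case (Suc j)
  thus ?thesis using inv that unfolding Suc state_after_Cons by simp
 qed
 have d: "fits_space (8000 * (2 * n + card (fold apply_update (take (Suc k) (x # us)) E))) s' \<and> fits_words W s'"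
  if "k < length (x # us)" "s' \<in> set ((tr # trs) ! k)" for k s'
 proof (cases k)
  case 0
  thus ?thesis using f that by simp
 next case (Suc j)
  thus ?thesis using ff that by simp
 qed
 show ?case using a b c d by (intro exI[of _ "tr # trs"]) blast
qed

text \<open>With levels counted from 0, the i-th set consists of the nodes with level at least i -
  1. The upper condition concerns nodes of level exactly i - 1, where it is the absence of an upward
  violation. The lower condition concerns higher nodes; degrees only shrink as the level rises, so
  the check just below the node's own level implies the others.\<close>

lemma GI_decomposition:
 assumes G: "GI E s p"
 shows "decomposition \<alpha> dS dT L (Src ` {..<n}) (Tgt ` {..<n}) (derived_edges E) (fam_S dalg \<pi> n s) (fam_T dalg \<pi> n s)"
proof -
 interpret D: dec \<pi> "8 * n + 8 * regs s ''R'' + 8" W n L \<alpha> \<epsilon> dS dT by (rule GI_dec[OF G])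
 obtain lev A where I: "D.Inv1 (adjE E) lev A s" and nd: "\<forall>x. \<not> D.dirty (adjE E) lev x" and En: "E \<subseteq> {..<n} \<times> {..<n}"
  using G unfolding GI_def by iprover
 have lv: "\<forall>x\<in>nodes n. hp s LEV x = lev x" using I unfolding D.Inv1_def by iprover
 obtain B bo where I0: "D.Inv0 (adjE E) (KL lev) A B bo s" using I unfolding D.Inv1_def by iprover
 have S: "fam_S dalg \<pi> n s i = {Src u | u. u < n \<and> i < lev (8 * u + 1) + 2}" for i unfolding fam_dalg using lv node_ids(1) by auto
 have T: "fam_T dalg \<pi> n s i = {Tgt v | v. v < n \<and> i < lev (8 * v + 5) + 2}" for i unfolding fam_dalg using lv node_ids(2) by auto
 have outd: "deg_out (derived_edges E) (Src u) (fam_T dalg \<pi> n s i) = Dg (adjE E) lev (8 * u + 1) (i - 1)" if "1 \<le> i" for u i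
 proof -
  let ?V = "{v. (u, v) \<in> E \<and> i - 1 \<le> lev (8 * v + 5)}"
  have "{t \<in> fam_T dalg \<pi> n s i. (Src u, t) \<in> derived_edges E} = Tgt ` ?V" unfolding T derived_edges_def using that En by auto
  moreover have "{y. adjE E (8 * u + 1) y \<and> i - 1 \<le> lev y} = (\<lambda>v. 8 * v + 5) ` ?V" unfolding adjE_src by auto
  ultimately show ?thesis unfolding deg_out_def Dg_def by (simp add: card_image inj_on_def)
 qed
 have ind: "deg_in (derived_edges E) (Tgt v) (fam_S dalg \<pi> n s i) = Dg (adjE E) lev (8 * v + 5) (i - 1)" if "1 \<le> i" for v i
 proof -
  let ?U = "{u. (u, v) \<in> E \<and> i - 1 \<le> lev (8 * u + 1)}"
  have "{t \<in> fam_S dalg \<pi> n s i. (t, Tgt v) \<in> derived_edges E} = Src ` ?U" unfolding S derived_edges_def using that En by auto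
  moreover have "{y. adjE E (8 * v + 5) y \<and> i - 1 \<le> lev y} = (\<lambda>u. 8 * u + 1) ` ?U" unfolding adjE_tgt by auto
  ultimately show ?thesis unfolding deg_in_def Dg_def by (simp add: card_image inj_on_def)
 qed
 have up: "i < lev x + 1" if "x \<in> nodes n" "i < lev x + 2" "\<alpha> * D.dd x < real (Dg (adjE E) lev x (i - 1))" "1 \<le> i" "i \<le> L - 1" for x i
 proof (rule ccontr)
  assume "\<not> i < lev x + 1"
  hence "i - 1 = lev x" "lev x + 1 < L" using that(2,4,5) D.L1 by linarith+
  hence "D.dirty (adjE E) lev x" using that(1,3) unfolding D.dirty_def by simp
  thus False using nd by blast
 qed
 have down: "\<not> real (Dg (adjE E) lev x (i - 1)) < D.dd x" if "x \<in> nodes n" "i < lev x + 1" "1 \<le> i" for x i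
 proof
  assume a: "real (Dg (adjE E) lev x (i - 1)) < D.dd x"
  have "i - 1 \<le> lev x - 1" using that by linarith
  hence "Dg (adjE E) lev x (lev x - 1) \<le> Dg (adjE E) lev x (i - 1)" unfolding Dg_def by (intro card_mono adj_finite[OF D.Inv0D(5)[OF I0]]) auto
  hence "real (Dg (adjE E) lev x (lev x - 1)) < D.dd x" using a by simp
  hence "D.dirty (adjE E) lev x" using that unfolding D.dirty_def by simp
  thus False using nd by blast
 qed
 have dS: "D.dd (8 * u + 1) = dS" for u
 proof -
  have "(8 * u + 1) mod 8 = 1" by presburger
  thus ?thesis unfolding D.dd_def by simp
 qed
 have dT: "D.dd (8 * v + 5) = dT" for v
 proof -
  have "(8 * v + 5) mod 8 = 5" by presburger
  thus ?thesis unfolding D.dd_def by simp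
 qed
 show ?thesis unfolding decomposition_def
 proof (intro conjI allI impI)
  show "fam_S dalg \<pi> n s 1 = Src ` {..<n}" "fam_T dalg \<pi> n s 1 = Tgt ` {..<n}" unfolding S T by auto
 next
  fix i assume i: "1 \<le> i \<and> i \<le> L - 1"
  hence i1: "1 \<le> i" "i \<le> L - 1" by simp_all
  show "fam_S dalg \<pi> n s (i + 1) \<subseteq> fam_S dalg \<pi> n s i" "fam_T dalg \<pi> n s (i + 1) \<subseteq> fam_T dalg \<pi> n s i"
   unfolding S T by auto
  show "{x \<in> fam_S dalg \<pi> n s i. real (deg_out (derived_edges E) x (fam_T dalg \<pi> n s i)) > \<alpha> * dS} \<subseteq> fam_S dalg \<pi> n s (i + 1)"
  proof
   fix x assume x: "x \<in> {x \<in> fam_S dalg \<pi> n s i. real (deg_out (derived_edges E) x (fam_T dalg \<pi> n s i)) > \<alpha> * dS}"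
   then obtain u where u: "x = Src u" "u < n" "i < lev (8 * u + 1) + 2" unfolding S by blast
   have "i < lev (8 * u + 1) + 1"
    by (rule up[OF node_ids(1)[OF u(2)] u(3) _ i1]) (use x in \<open>simp add: u(1) outd[OF i1(1)] dS del: One_nat_def\<close>)
   thus "x \<in> fam_S dalg \<pi> n s (i + 1)" using u unfolding S by simp
  qed
  show "{x \<in> fam_T dalg \<pi> n s i. real (deg_in (derived_edges E) x (fam_S dalg \<pi> n s i)) > \<alpha> * dT} \<subseteq> fam_T dalg \<pi> n s (i + 1)"
  proof
   fix x assume x: "x \<in> {x \<in> fam_T dalg \<pi> n s i. real (deg_in (derived_edges E) x (fam_S dalg \<pi> n s i)) > \<alpha> * dT}"
   then obtain v where v: "x = Tgt v" "v < n" "i < lev (8 * v + 5) + 2" unfolding T by blast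
   have "i < lev (8 * v + 5) + 1"
    by (rule up[OF node_ids(2)[OF v(2)] v(3) _ i1]) (use x in \<open>simp add: v(1) ind[OF i1(1)] dT del: One_nat_def\<close>)
   thus "x \<in> fam_T dalg \<pi> n s (i + 1)" using v unfolding T by simp
  qed
  show "fam_S dalg \<pi> n s (i + 1) \<inter> {x \<in> fam_S dalg \<pi> n s i. real (deg_out (derived_edges E) x (fam_T dalg \<pi> n s i)) < dS} = {}"
  proof (rule equals0I)
   fix x assume x: "x \<in> fam_S dalg \<pi> n s (i + 1) \<inter> {x \<in> fam_S dalg \<pi> n s i. real (deg_out (derived_edges E) x (fam_T dalg \<pi> n s i)) < dS}"
   then obtain u where u: "x = Src u" "u < n" "i + 1 < lev (8 * u + 1) + 2" unfolding S by blast
   have "i < lev (8 * u + 1) + 1" using u(3) by simp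
   from down[OF node_ids(1)[OF u(2)] this i1(1)] show False using x by (simp add: u(1) outd[OF i1(1)] dS del: One_nat_def)
  qed
  show "fam_T dalg \<pi> n s (i + 1) \<inter> {x \<in> fam_T dalg \<pi> n s i. real (deg_in (derived_edges E) x (fam_S dalg \<pi> n s i)) < dT} = {}"
  proof (rule equals0I)
   fix x assume x: "x \<in> fam_T dalg \<pi> n s (i + 1) \<inter> {x \<in> fam_T dalg \<pi> n s i. real (deg_in (derived_edges E) x (fam_S dalg \<pi> n s i)) < dT}"
   then obtain v where v: "x = Tgt v" "v < n" "i + 1 < lev (8 * v + 5) + 2" unfolding T by blast
   have "i < lev (8 * v + 5) + 1" using v(3) by simp
   from down[OF node_ids(2)[OF v(2)] this i1(1)] show False using x by (simp add: v(1) ind[OF i1(1)] dT del: One_nat_def)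
  qed
 qed
qed

end

text \<open>The number of records is quadratic in \<open>n\<close>, which takes two factors of the
  base. The base is at least 3, and 3 ^ 7 = 2187 exceeds the sum 384 + 384 + 259 + 1 of the
  coefficients; this gives the exponent 9.\<close>

lemma word_bound:
 assumes "1 \<le> (L::nat)"
 shows "16 * (8 * n + 8 * (3 * (n * n) + 2 * n) + 16) + L + 3 \<le> (n + L + 2) ^ 9"
proof -
 define N where "N = n + L + 2"
 have N3: "3 \<le> N" "n \<le> N" "L \<le> N" using assms unfolding N_def by linarith+
 have N1: "1 \<le> N * N" "N \<le> N * N" "n * n \<le> N * N" using N3 mult_le_mono[of n N n N] by simp_all
 have "16 * (8 * n + 8 * (3 * (n * n) + 2 * n) + 16) + L + 3 = 384 * n + 384 * (n * n) + 259 + L" by simp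
 also have "\<dots> \<le> 2187 * (N * N)" using N1 N3 by linarith
 also have "\<dots> \<le> N ^ 7 * (N * N)" using power_mono[OF N3(1), of 7] by (intro mult_le_mono1) simp
 also have "\<dots> = N ^ 9" by (simp add: power_numeral_reduce)
 finally show ?thesis unfolding N_def .
qed

theorem theorem6p8:
  shows "\<exists>(A :: dyn_alg) (C :: nat). \<forall>p :: real poly. \<exists>w :: nat.
    \<forall>(n :: nat) (L :: nat) (\<epsilon> :: real) (\<alpha> :: real) (dS :: real) (dT :: real) (us :: update list).
      0 < \<epsilon> \<and> \<epsilon> < 1 \<and> 0 \<le> dS \<and> 0 \<le> dT \<and> 1 \<le> L \<and>
      2 + 3 * \<epsilon> \<le> \<alpha> \<and> \<alpha> \<le> poly p (real n) \<and> legal_updates n us \<longrightarrow>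
      (let \<pi> = (\<lambda>q. case q of Epsilon \<Rightarrow> \<epsilon> | Alpha \<Rightarrow> \<alpha> | DS \<Rightarrow> dS | DT \<Rightarrow> dT);
           S' = Src ` {..<n};
           T' = Tgt ` {..<n};
           E' = (\<lambda>k. derived_edges (edges_after (take k us)));
           s\<^sub>0 = init_state n L
       in \<exists>trs. exec_updates A \<pi> s\<^sub>0 us trs \<and>
            real (total_time trs) \<le> real C * (real (length us) * real L / \<epsilon>) \<and>
            (\<forall>k \<le> length us.
               decomposition \<alpha> dS dT L S' T' (E' k)
                 (fam_S A \<pi> n (state_after s\<^sub>0 trs k)) (fam_T A \<pi> n (state_after s\<^sub>0 trs k))) \<and>
            (\<forall>k < length us. \<forall>s \<in> set (trs ! k).
               fits_space (C * (card (S' \<union> T') + card (E' (Suc k)))) s \<and>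
               fits_words ((n + L + 2) ^ w) s))"
proof (rule exI[of _ dalg], rule exI[of _ 8000], rule allI, rule exI[of _ 9], intro allI impI)
 fix p :: "real poly" and n L :: nat and \<epsilon> \<alpha> dS dT :: real and us :: "update list"
 assume as: "0 < \<epsilon> \<and> \<epsilon> < 1 \<and> 0 \<le> dS \<and> 0 \<le> dT \<and> 1 \<le> L \<and>
   2 + 3 * \<epsilon> \<le> \<alpha> \<and> \<alpha> \<le> poly p (real n) \<and> legal_updates n us"
 define \<pi> where "\<pi> = (\<lambda>q. case q of Epsilon \<Rightarrow> \<epsilon> | Alpha \<Rightarrow> \<alpha> | DS \<Rightarrow> dS | DT \<Rightarrow> dT)"
 let ?W = "(n + L + 2) ^ 9" and ?s = "init_state n L"
 have L1: "1 \<le> L" using as by blast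
 have WW: "16 * (8 * n + 8 * (3 * (n * n) + 2 * n) + 16) + L + 3 \<le> ?W" by (rule word_bound[OF L1])
 have W0: "16 * (8 * n + 8) + L + 3 \<le> ?W" by (rule order_trans[OF _ WW], intro add_le_mono mult_le_mono2) simp_all
 have base: "dec \<pi> (8 * n + 8) ?W n L \<alpha> \<epsilon> dS dT" by unfold_locales (use as W0 in \<open>simp_all add: \<pi>_def\<close>)
 interpret alg \<pi> ?W n L \<alpha> \<epsilon> dS dT by (rule alg.intro[OF base WW])
 have leg: "legal_update n (fold apply_update (take k us) {}) (us ! k)" if "k < length us" for k
  using as that unfolding legal_updates_def edges_after_def by blast
 obtain trs where tr: "exec_updates dalg \<pi> ?s us trs" and tt: "real (total_time trs) \<le> 0 + real (length us) * (8000 * real L / \<epsilon>)"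
  and inv: "\<forall>k\<le>length us. \<exists>q. GI (fold apply_update (take k us) {}) (state_after ?s trs k) q"
  and ff: "\<forall>k<length us. \<forall>s'\<in>set (trs ! k).
   fits_space (8000 * (2 * n + card (fold apply_update (take (Suc k) us) {}))) s' \<and> fits_words ?W s'" using GI_run[OF GI_init leg] by iprover
 have cV: "card (Src ` {..<n} \<union> Tgt ` {..<n}) = 2 * n"
 proof -
  have "card (Src ` {..<n} \<union> Tgt ` {..<n}) = card (Src ` {..<n}) + card (Tgt ` {..<n})" by (rule card_Un_disjoint) auto
  thus ?thesis by (simp add: card_image inj_on_def)
 qed
 have cE: "card (derived_edges E) = card E" for E
 proof -
  have "derived_edges E = (\<lambda>(u, v). (Src u, Tgt v)) ` E" unfolding derived_edges_def by auto
  moreover have "inj_on (\<lambda>(u, v). (Src u, Tgt v)) E" by (auto simp: inj_on_def)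
  ultimately show ?thesis by (simp add: card_image)
 qed
 have t': "real (total_time trs) \<le> real 8000 * (real (length us) * real L / \<epsilon>)" using tt by (simp add: algebra_simps)
 have dc: "\<forall>k\<le>length us. decomposition \<alpha> dS dT L (Src ` {..<n}) (Tgt ` {..<n}) (derived_edges (edges_after (take k us)))
  (fam_S dalg \<pi> n (state_after ?s trs k)) (fam_T dalg \<pi> n (state_after ?s trs k))"
  using inv GI_decomposition unfolding edges_after_def by blast
 have sp: "\<forall>k<length us. \<forall>s\<in>set (trs ! k).
  fits_space (8000 * (card (Src ` {..<n} \<union> Tgt ` {..<n}) + card (derived_edges (edges_after (take (Suc k) us))))) s \<and> fits_words ?W s"
  unfolding cV cE using ff unfolding edges_after_def .
 show "let \<pi> = (\<lambda>q. case q of Epsilon \<Rightarrow> \<epsilon> | Alpha \<Rightarrow> \<alpha> | DS \<Rightarrow> dS | DT \<Rightarrow> dT);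
     S' = Src ` {..<n};
     T' = Tgt ` {..<n};
     E' = (\<lambda>k. derived_edges (edges_after (take k us)));
     s\<^sub>0 = init_state n L
   in \<exists>trs. exec_updates dalg \<pi> s\<^sub>0 us trs \<and>
      real (total_time trs) \<le> real 8000 * (real (length us) * real L / \<epsilon>) \<and>
      (\<forall>k \<le> length us.
       decomposition \<alpha> dS dT L S' T' (E' k)
        (fam_S dalg \<pi> n (state_after s\<^sub>0 trs k)) (fam_T dalg \<pi> n (state_after s\<^sub>0 trs k))) \<and>
      (\<forall>k < length us. \<forall>s \<in> set (trs ! k).
       fits_space (8000 * (card (S' \<union> T') + card (E' (Suc k)))) s \<and>
       fits_words ((n + L + 2) ^ 9) s)" unfolding Let_def \<pi>_def[symmetric] by (rule exI[of _ trs]) (intro conjI tr t' dc sp)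
qed

end
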